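(* Let $T>0$, $\sigma>0$, $x_0\in\mathbb{R}$, and let $\dot h:[0,T]\to\mathbb{R}$ be a deterministic square-integrable function. Let $f:\mathbb{R}\to\mathbb{R}$ be Lipschitz and let $\hat b:[0,T]\times\mathbb{R}\times\mathbb{R}\to\mathbb{R}$, $(t,x,m)\mapsto\hat b(t,x,m)$, be continuous in time $t$, Lipschitz in space $x$, and a bounded Lipschitz function in its third variable $m$. Let $W^{i,\mathbb{Q}}$, $i\ge1$, be independent one-dimensional Brownian motions under a probability measure $\mathbb{Q}$. For $i\ge 1$, let $(X^i,Z^i)$ be the solution on $[0,T]$ of the measure-changed McKean–Vlasov SDE $$dX^i_t=\Big(\hat b\big(t,X^i_t,\mathbb{E}_{\mathbb Q}[f(X^i_t)Z^i_t]\big)+\sigma\dot h_t\Big)dt+\sigma\,dW^{i,\mathbb Q}_t,\quad X^i_0=x_0,\qquad dZ^i_t=\dot h_tZ^i_t\,dW^{i,\mathbb Q}_t,\quad Z^i_0=1,$$ and, for $N\in\mathbb{N}$ and $1\le i\le N$, let $(X^{i,N},Z^{i,N})$ be the solution on $[0,T]$ of the corresponding interacting particle system $$dX^{i,N}_t=\Big(\hat b\Big(t,X^{i,N}_t,\frac1N\sum_{j=1}^Nf(X^{j,N}_t)Z^{j,N}_t\Big)+\sigma\dot h_t\Big)dt+\sigma\,dW^{i,\mathbb Q}_t,\quad X^{i,N}_0=x_0,\qquad dZ^{i,N}_t=\dot h_tZ^{i,N}_t\,dW^{i,\mathbb Q}_t,\quad Z^{i,N}_0=1.$$ Then $$\lim_{N\to\infty}\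 \sup_{1\le i\le N}\ \mathbb{E}_{\mathbb Q}\Big[\sup_{0\le t\le T}|X^{i,N}_t-X^i_t|^2\Big]=0.$$
   Context: All processes are real-valued. The Lipschitz constants of $\hat b$ in $x$ and in $m$, and the bound on $\hat b$ as a function of $m$, are understood to be uniform in the remaining variables. Note that $Z^{i,N}=Z^i$, since the $Z$-equations are not coupled. *)

theory Defs
  imports "HOL-Probability.Probability"
begin

section \<open>Brownian motion relative to a filtration\<close>

text \<open>The time index of a filtration is the type of all reals, so that the library notions
  of filtration and stopping time apply; only times \<open>t \<ge> 0\<close> are ever used (a filtration given on
  the nonnegative half-line extends by \<open>F t = F 0\<close> for \<open>t < 0\<close>). Neither completeness nor
  right-continuity is required.\<close>

definition filtered_prob_space :: "'a measure \<Rightarrow> (real \<Rightarrow> 'a measure) \<Rightarrow> bool" where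
  "filtered_prob_space M F \<longleftrightarrow>
     prob_space M \<and> filtration (space M) F \<and> (\<forall>t. subalgebra M (F t))"

definition brownian_motion ::
  "'a measure \<Rightarrow> (real \<Rightarrow> 'a measure) \<Rightarrow> (real \<Rightarrow> 'a \<Rightarrow> real) \<Rightarrow> bool" where
  "brownian_motion M F W \<longleftrightarrow>
     (\<forall>t\<ge>0. W t \<in> borel_measurable (F t)) \<and>
     (AE \<omega> in M. W 0 \<omega> = 0) \<and>
     (AE \<omega> in M. continuous_on {0..} (\<lambda>t. W t \<omega>)) \<and>
     (\<forall>s t. 0 \<le> s \<longrightarrow> s < t \<longrightarrow>
        distributed M lborel (\<lambda>\<omega>. W t \<omega> - W s \<omega>) (normal_density 0 (sqrt (t - s))) \<and>
        prob_space.indep_set M (sets (F s))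
          {(\<lambda>\<omega>. W t \<omega> - W s \<omega>) -` A \<inter> space M | A. A \<in> sets borel})"

section \<open>The Ito integral on a bounded time interval\<close>

definition progressive :: "(real \<Rightarrow> 'a measure) \<Rightarrow> real \<Rightarrow> (real \<Rightarrow> 'a \<Rightarrow> real) \<Rightarrow> bool" where
  "progressive F T H \<longleftrightarrow>
     (\<forall>t\<in>{0..T}. (\<lambda>(s, \<omega>). H s \<omega>)
        \<in> borel_measurable (restrict_space borel {0..t} \<Otimes>\<^sub>M F t))"

text \<open>A triple \<open>n, p, \<xi>\<close> encodes the simple process taking the value \<open>\<xi> k\<close> on the
  time interval \<open>(p k, p (k + 1)]\<close> for \<open>k < n\<close>.\<close>

definition simple_process ::
  "'a measure \<Rightarrow> (real \<Rightarrow> 'a measure) \<Rightarrow> nat \<Rightarrow> (nat \<Rightarrow> real) \<Rightarrow> (nat \<Rightarrow> 'a \<Rightarrow> real) \<Rightarrow> bool" where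
  "simple_process M F n p \<xi> \<longleftrightarrow>
     0 \<le> p 0 \<and> (\<forall>k<n. p k \<le> p (Suc k)) \<and>
     (\<forall>k<n. \<xi> k \<in> borel_measurable (F (p k)) \<and> bounded (\<xi> k ` space M))"

definition simple_value ::
  "nat \<Rightarrow> (nat \<Rightarrow> real) \<Rightarrow> (nat \<Rightarrow> 'a \<Rightarrow> real) \<Rightarrow> real \<Rightarrow> 'a \<Rightarrow> real" where
  "simple_value n p \<xi> s \<omega> = (\<Sum>k<n. \<xi> k \<omega> * indicator {p k<..p (Suc k)} s)"

definition simple_integral ::
  "(real \<Rightarrow> 'a \<Rightarrow> real) \<Rightarrow> nat \<Rightarrow> (nat \<Rightarrow> real) \<Rightarrow> (nat \<Rightarrow> 'a \<Rightarrow> real) \<Rightarrow> real \<Rightarrow> 'a \<Rightarrow> real" where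
  "simple_integral W n p \<xi> t \<omega> =
     (\<Sum>k<n. \<xi> k \<omega> * (W (min t (p (Suc k))) \<omega> - W (min t (p k)) \<omega>))"

text \<open>\<open>I\<close> is a version of the square-integrable Ito integral of \<open>H\<close>: the mean-square limit of the
  integrals of simple processes that approximate \<open>H\<close> in mean square. Measurability of \<open>I t\<close> is asked
  for the completion only, because \<open>I\<close> is instantiated below by a process with almost surely
  continuous paths, stopped at a random time.\<close>

definition ito_integral_L2 ::
  "'a measure \<Rightarrow> (real \<Rightarrow> 'a measure) \<Rightarrow> (real \<Rightarrow> 'a \<Rightarrow> real) \<Rightarrow> real \<Rightarrow>
   (real \<Rightarrow> 'a \<Rightarrow> real) \<Rightarrow> (real \<Rightarrow> 'a \<Rightarrow> real) \<Rightarrow> bool" where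
  "ito_integral_L2 M F W T H I \<longleftrightarrow>
     progressive F T H \<and>
     (\<forall>t\<in>{0..T}. I t \<in> borel_measurable (completion M)) \<and>
     (\<exists>n p \<xi>. (\<forall>j::nat. simple_process M F (n j) (p j) (\<xi> j)) \<and>
        ((\<lambda>j. \<integral>\<^sup>+\<omega>. (\<integral>\<^sup>+s\<in>{0..T}.
            ennreal ((H s \<omega> - simple_value (n j) (p j) (\<xi> j) s \<omega>)\<^sup>2) \<partial>lborel) \<partial>M)
          \<longlonglongrightarrow> 0) \<and>
        (\<forall>t\<in>{0..T}.
          (\<lambda>j. \<integral>\<^sup>+\<omega>. ennreal ((I t \<omega> - simple_integral W (n j) (p j) (\<xi> j) t \<omega>)\<^sup>2) \<partial>M)
            \<longlonglongrightarrow> 0))"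

text \<open>The general Ito integral, for integrands with almost surely square-integrable paths on
  \<open>[0, T]\<close>, by localization. It is determined up to indistinguishability, hence stated as a relation
  between the integrand \<open>H\<close> and (a version of) its integral process \<open>I\<close>.\<close>

definition ito_integral ::
  "'a measure \<Rightarrow> (real \<Rightarrow> 'a measure) \<Rightarrow> (real \<Rightarrow> 'a \<Rightarrow> real) \<Rightarrow> real \<Rightarrow>
   (real \<Rightarrow> 'a \<Rightarrow> real) \<Rightarrow> (real \<Rightarrow> 'a \<Rightarrow> real) \<Rightarrow> bool" where
  "ito_integral M F W T H I \<longleftrightarrow>
     progressive F T H \<and>
     (AE \<omega> in M. (\<integral>\<^sup>+s\<in>{0..T}. ennreal ((H s \<omega>)\<^sup>2) \<partial>lborel) < \<infinity>) \<and>
     (AE \<omega> in M. continuous_on {0..T} (\<lambda>t. I t \<omega>)) \<and>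
     (\<exists>\<tau> :: nat \<Rightarrow> 'a \<Rightarrow> real.
        (\<forall>n. stopping_time F (\<tau> n) \<and> (\<forall>\<omega>\<in>space M. 0 \<le> \<tau> n \<omega>)) \<and>
        (AE \<omega> in M. incseq (\<lambda>n. \<tau> n \<omega>) \<and> (\<forall>\<^sub>F n in sequentially. T \<le> \<tau> n \<omega>)) \<and>
        (\<forall>n. ito_integral_L2 M F W T
               (\<lambda>s \<omega>. if s \<le> \<tau> n \<omega> then H s \<omega> else 0)
               (\<lambda>t \<omega>. I (min t (\<tau> n \<omega>)) \<omega>)))"

section \<open>Solutions of the stochastic differential equations\<close>

text \<open>\<open>X\<close> is a continuous adapted process on \<open>[0, T]\<close> with
  \<open>dX = \<beta> dt + \<alpha> dW\<close> and \<open>X 0 = x0\<close>.\<close>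

definition ito_process ::
  "'a measure \<Rightarrow> (real \<Rightarrow> 'a measure) \<Rightarrow> (real \<Rightarrow> 'a \<Rightarrow> real) \<Rightarrow> real \<Rightarrow> real \<Rightarrow>
   (real \<Rightarrow> 'a \<Rightarrow> real) \<Rightarrow> (real \<Rightarrow> 'a \<Rightarrow> real) \<Rightarrow> (real \<Rightarrow> 'a \<Rightarrow> real) \<Rightarrow> bool" where
  "ito_process M F W T x0 \<beta> \<alpha> X \<longleftrightarrow>
     (\<forall>t\<in>{0..T}. X t \<in> borel_measurable (F t)) \<and>
     (AE \<omega> in M. continuous_on {0..T} (\<lambda>t. X t \<omega>)) \<and>
     (AE \<omega> in M. set_integrable lborel {0..T} (\<lambda>s. \<beta> s \<omega>)) \<and>
     (\<exists>I. ito_integral M F W T \<alpha> I \<and>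
        (AE \<omega> in M. \<forall>t\<in>{0..T}. X t \<omega> = x0 + (LBINT s:{0..t}. \<beta> s \<omega>) + I t \<omega>))"

text \<open>In both systems \<open>h\<close> is the function written as the time derivative of \<open>h\<close> in the equations,
  and \<open>M\<close> is the changed measure. Integrability makes the expectation in the
  drift a genuine one (the Bochner integral of a non-integrable function is \<open>0\<close>).\<close>

definition mckean_vlasov_solution ::
  "'a measure \<Rightarrow> (real \<Rightarrow> 'a measure) \<Rightarrow> (real \<Rightarrow> 'a \<Rightarrow> real) \<Rightarrow> real \<Rightarrow> real \<Rightarrow> real \<Rightarrow>
   (real \<Rightarrow> real) \<Rightarrow> (real \<Rightarrow> real) \<Rightarrow> (real \<Rightarrow> real \<Rightarrow> real \<Rightarrow> real) \<Rightarrow>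
   (real \<Rightarrow> 'a \<Rightarrow> real) \<Rightarrow> (real \<Rightarrow> 'a \<Rightarrow> real) \<Rightarrow> bool" where
  "mckean_vlasov_solution M F W T \<sigma> x0 h f b X Z \<longleftrightarrow>
     (\<forall>t\<in>{0..T}. integrable M (\<lambda>\<omega>. f (X t \<omega>) * Z t \<omega>)) \<and>
     ito_process M F W T x0
       (\<lambda>t \<omega>. b t (X t \<omega>) (\<integral>\<omega>'. f (X t \<omega>') * Z t \<omega>' \<partial>M) + \<sigma> * h t) (\<lambda>t \<omega>. \<sigma>) X \<and>
     ito_process M F W T 1 (\<lambda>t \<omega>. 0) (\<lambda>t \<omega>. h t * Z t \<omega>) Z"

text \<open>The particles are indexed by \<open>1, \<dots>, N\<close>.\<close>

definition particle_solution ::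
  "'a measure \<Rightarrow> (real \<Rightarrow> 'a measure) \<Rightarrow> (nat \<Rightarrow> real \<Rightarrow> 'a \<Rightarrow> real) \<Rightarrow> real \<Rightarrow> real \<Rightarrow> real \<Rightarrow>
   (real \<Rightarrow> real) \<Rightarrow> (real \<Rightarrow> real) \<Rightarrow> (real \<Rightarrow> real \<Rightarrow> real \<Rightarrow> real) \<Rightarrow> nat \<Rightarrow>
   (nat \<Rightarrow> real \<Rightarrow> 'a \<Rightarrow> real) \<Rightarrow> (nat \<Rightarrow> real \<Rightarrow> 'a \<Rightarrow> real) \<Rightarrow> bool" where
  "particle_solution M F W T \<sigma> x0 h f b N X Z \<longleftrightarrow>
     (\<forall>i\<in>{1..N}.
        ito_process M F (W i) T x0
          (\<lambda>t \<omega>. b t (X i t \<omega>) ((\<Sum>j=1..N. f (X j t \<omega>) * Z j t \<omega>) / real N) + \<sigma> * h t)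
          (\<lambda>t \<omega>. \<sigma>) (X i) \<and>
        ito_process M F (W i) T 1 (\<lambda>t \<omega>. 0) (\<lambda>t \<omega>. h t * Z i t \<omega>) (Z i))"

end

theory Submission
  imports Defs
begin

text \<open>
  The noise of \<open>X\<close> is additive, so the difference of a particle and its limit solves a random
  ordinary differential equation, and it is bounded because \<open>b\<close> is. Both equations are solved by
  explicit functionals of the driving path: \<open>Z\<close> is a mean-square limit of Euler products, by the
  bound \<open>E (I\<^sub>t - S\<^sub>t)\<^sup>2 \<le> 4 \<integral>\<^sub>0\<^sup>t E (H - S')\<^sup>2\<close> between an Ito integral of \<open>H\<close> and that of a simple
  integrand \<open>S'\<close>, together with Gronwall's inequality; \<open>X\<close> is a pathwise limit of Euler schemes. Hence
  \<open>Z\<close> agrees in both systems, the pairs \<open>(X\<^sup>i, Z\<^sup>i)\<close> are independent, and, once the mean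
  \<open>m(t) = E (f(X\<^sup>i\<^sub>t) Z\<^sup>i\<^sub>t)\<close> is shown not to depend on \<open>i\<close>, identically distributed.

  In the comparison of the drifts the errors \<open>e\<^sub>j\<close> of the particles enter through the weighted average
  \<open>1/N \<Sum> e\<^sub>j |Z\<^sup>j|\<close>. Its square is at most \<open>(1/N \<Sum> e\<^sub>j\<^sup>2) (1/N \<Sum> (Z\<^sup>j)\<^sup>2)\<close>, whose second factor is bounded
  with high probability by the law of large numbers, and on the remaining event the boundedness of
  \<open>b\<close> suffices. The other error terms are averages that the law of large numbers sends to zero, so
  Gronwall's inequality concludes.
\<close>

section \<open>Gronwall's inequality and approximation by continuous functions\<close>

text \<open>Nothing ties a solution to its own noise: it is merely adapted to a filtration shared by
  all Brownian motions, while independence is assumed for the paths of the \<open>W i\<close> alone.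
  Measurable functionals of a single path bridge this gap.

  The Ito integral is given only as some mean-square limit of simple integrals, up to localization;
  what is known about it comes from comparison with a simple integrand. The factor 4 arises from two
  uses of \<open>(x + y)^2 \<le> 2 x^2 + 2 y^2\<close> and is harmless under Gronwall.

  The mean needs an argument because each copy of the limit equation contains the expectation of its
  own solution: the functional of the first copy is evaluated on the noise of copy i, where it keeps
  the mean of the first copy, and is compared there with the solution of copy i.

  As \<open>h\<close> is only square-integrable, Gronwall carries the weight \<open>h^2\<close>; as
  the functions fed to it are often not known to be measurable in time, it is stated with extended
  nonnegative integrals. The weights \<open>Z\<close> come with second moments only, so averages are
  controlled in mean, and the bound on \<open>b\<close> makes the drift comparison linear in
  them.\<close>

lemma ennreal_le_add_half:
  fixes x D :: ennreal
  assumes "x \<le> D + x / 2" "x < \<infinity>"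
  shows "x \<le> 2 * D"
proof (cases "D = \<infinity>")
  case True then show ?thesis by (simp add: ennreal_mult_top)
next
  case False
  then obtain d where d: "D = ennreal d" "d \<ge> 0" by (cases D) auto
  obtain y where y: "x = ennreal y" "y \<ge> 0" using assms(2) by (cases x) auto
  have "x / 2 = ennreal (y / 2)" using y by (simp add: divide_ennreal[symmetric])
  then have "ennreal y \<le> ennreal (d + y / 2)" using assms(1) y d by (simp add: ennreal_plus)
  then have "y \<le> d + y / 2" using y d by (subst (asm) ennreal_le_iff) auto
  then have "y \<le> 2 * d" by simp
  then show ?thesis using y d by (metis d(1) ennreal_leI ennreal_mult ennreal_numeral y(1) zero_le_numeral)
qed

text \<open>The mass of \<open>w\<close> is cut into pieces of size 1/2, and on each piece the
  supremum of \<open>\<phi>\<close> is absorbed into the left-hand side, which the finite a priori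
  bound makes legitimate. \<open>C\<close> depends on \<open>w\<close> and \<open>T\<close> alone.
  Only monotonicity of the integral is applied to \<open>\<phi>\<close>, which may be
  non-measurable.\<close>

lemma gronwall_nn:
  fixes w :: "real \<Rightarrow> ennreal" and T :: real
  assumes w[measurable]: "w \<in> borel_measurable borel"
    and fin: "(\<integral>\<^sup>+s\<in>{0..T}. w s \<partial>lborel) < \<infinity>" and T: "0 \<le> T"
  shows "\<exists>C<\<infinity>. \<forall>A \<phi>. (\<exists>B<\<infinity>. \<forall>t\<in>{0..T}. \<phi> t \<le> B) \<longrightarrow>
      (\<forall>t\<in>{0..T}. \<phi> t \<le> A + (\<integral>\<^sup>+s\<in>{0..t}. w s * \<phi> s \<partial>lborel)) \<longrightarrow> (\<forall>t\<in>{0..T}. \<phi> t \<le> C * A)"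
proof -
  define V where "V t = (\<integral>\<^sup>+s\<in>{0..t}. w s \<partial>lborel)" for t
  define v where "v t = enn2real (V t)" for t
  have Vmono: "V s \<le> V t" if "s \<le> t" for s t
    unfolding V_def using that by (intro nn_integral_mono) (auto simp: indicator_def)
  have Vfin: "V t < \<infinity>" if "t \<le> T" for t
    using Vmono[OF that] fin unfolding V_def[of T, symmetric] by (simp add: order_le_less_trans)
  have Vv: "V t = ennreal (v t)" if "t \<le> T" for t
    using Vfin[OF that] by (simp add: v_def)
  have AEfin: "AE s in lborel. w s * indicator {0..T} s \<noteq> \<infinity>"
    by (rule nn_integral_noteq_infinite) (use fin in auto)
  have int: "set_integrable lborel {0..T} (\<lambda>s. enn2real (w s))"
  proof -
    have eq: "(\<integral>\<^sup>+s. ennreal (indicator {0..T} s * enn2real (w s)) \<partial>lborel) = V T"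
      unfolding V_def
    proof (rule nn_integral_cong_AE, use AEfin in eventually_elim)
      case (elim s)
      then show ?case by (auto simp: indicator_def less_top)
    qed
    show ?thesis unfolding set_integrable_def
      by (rule integrableI_nonneg) (use eq Vfin[of T] in auto)
  qed
  have vint: "v t = integral {0..t} (\<lambda>s. enn2real (w s))" if "t \<in> {0..T}" for t
  proof -
    have i: "set_integrable lborel {0..t} (\<lambda>s. enn2real (w s))"
      by (rule set_integrable_subset[OF int]) (use that in auto)
    have "ennreal (LBINT s:{0..t}. enn2real (w s)) = (\<integral>\<^sup>+s. ennreal (indicator {0..t} s * enn2real (w s)) \<partial>lborel)"
      using i unfolding set_lebesgue_integral_def set_integrable_def
      by (subst nn_integral_eq_integral) auto
    also have "\<dots> = V t" unfolding V_def
    proof (rule nn_integral_cong_AE, use AEfin in eventually_elim)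
      case (elim s)
      then show ?case using that by (auto simp: indicator_def less_top split: if_splits)
    qed
    finally have eq: "ennreal (LBINT s:{0..t}. enn2real (w s)) = V t" .
    have "0 \<le> (LBINT s:{0..t}. enn2real (w s))"
      unfolding set_lebesgue_integral_def by (intro integral_nonneg_AE) auto
    then have "v t = (LBINT s:{0..t}. enn2real (w s))"
      unfolding v_def eq[symmetric] by (rule enn2real_ennreal)
    also have "\<dots> = integral {0..t} (\<lambda>s. enn2real (w s))"
      by (rule set_borel_integral_eq_integral(2)[OF i])
    finally show ?thesis .
  qed
  \<comment> \<open>Continuity of the accumulated mass lets the intermediate value theorem hit each
    level \<open>m / 2\<close> exactly.\<close>
  have cont: "continuous_on {0..T} v"
  proof -
    have "continuous_on {0..T} (\<lambda>t. integral {0..t} (\<lambda>s. enn2real (w s)))"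
      by (rule indefinite_integral_continuous_1) (rule set_borel_integral_eq_integral(1)[OF int])
    then show ?thesis using vint by (subst continuous_on_cong[OF refl vint]) auto
  qed
  have v0: "v 0 = 0" using vint[of 0] T by simp
  define hyp :: "ennreal \<Rightarrow> (real \<Rightarrow> ennreal) \<Rightarrow> bool" where "hyp A \<phi> \<longleftrightarrow> (\<exists>B<\<infinity>. \<forall>t\<in>{0..T}. \<phi> t \<le> B) \<and>
      (\<forall>t\<in>{0..T}. \<phi> t \<le> A + (\<integral>\<^sup>+s\<in>{0..t}. w s * \<phi> s \<partial>lborel))" for A \<phi>
  \<comment> \<open>Induction on the number of half-units of mass: the constant for \<open>m\<close>
    serves the times at which the accumulated mass is at most \<open>m / 2\<close>.\<close>
  have ex: "\<exists>C<\<infinity>. \<forall>A \<phi>. hyp A \<phi> \<longrightarrow> (\<forall>t\<in>{0..T}. v t \<le> real m / 2 \<longrightarrow> \<phi> t \<le> C * A)" for m :: nat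
  proof (induction m)
    case 0
    have "\<phi> t \<le> 1 * A" if h: "hyp A \<phi>" and t: "t \<in> {0..T}" "v t \<le> real 0 / 2" for A \<phi> t
    proof -
      obtain B where B: "B < \<infinity>" "\<And>t. t \<in> {0..T} \<Longrightarrow> \<phi> t \<le> B" using h unfolding hyp_def by auto
      have V0: "V t = 0" using Vv[of t] t by (simp add: ennreal_eq_0_iff)
      have "(\<integral>\<^sup>+s\<in>{0..t}. w s * \<phi> s \<partial>lborel) \<le> (\<integral>\<^sup>+s. B * (w s * indicator {0..t} s) \<partial>lborel)"
        using B t by (intro nn_integral_mono) (auto simp: indicator_def mult.commute intro!: mult_mono)
      also have "\<dots> = B * V t" unfolding V_def by (rule nn_integral_cmult) simp
      finally show ?thesis using h t V0 unfolding hyp_def by fastforce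
    qed
    then show ?case by (intro exI[of _ 1]) auto
  next
    case (Suc m)
    then obtain C where C: "C < \<infinity>" "\<And>A \<phi> t. hyp A \<phi> \<Longrightarrow> t \<in> {0..T} \<Longrightarrow> v t \<le> real m / 2 \<Longrightarrow> \<phi> t \<le> C * A" by blast
    \<comment> \<open>Absorbing half of the supremum leaves \<open>2 (A + C A V(s0))\<close>, and
      \<open>V s0 = m / 2\<close> turns this into \<open>(2 + C m) A\<close>. The last
      \<open>C\<close> covers the times already reached by the induction hypothesis.\<close>
    define C' where "C' = 2 + C * of_nat m + C"
    have "\<phi> t \<le> C' * A" if h: "hyp A \<phi>" and t: "t \<in> {0..T}" "v t \<le> real (Suc m) / 2" for A \<phi> t
    proof (cases "v t \<le> real m / 2")
      case True
      then have "\<phi> t \<le> C * A" using C(2)[OF h t(1)] by simp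
      also have "\<dots> \<le> C' * A" unfolding C'_def by (intro mult_right_mono) (auto simp: add_increasing)
      finally show ?thesis .
    next
      case False
      obtain B where B: "B < \<infinity>" "\<And>t. t \<in> {0..T} \<Longrightarrow> \<phi> t \<le> B" using h unfolding hyp_def by auto
      have "\<exists>s0\<ge>0. s0 \<le> t \<and> v s0 = real m / 2"
        using t False v0 by (intro IVT') (auto intro: continuous_on_subset[OF cont])
      then obtain s0 where s0: "0 \<le> s0" "s0 \<le> t" "v s0 = real m / 2" by auto
      define Mx where "Mx = (SUP r\<in>{0..t}. \<phi> r)"
      have MxB: "Mx \<le> B" unfolding Mx_def using B t by (intro SUP_least) auto
      define D where "D = (\<integral>\<^sup>+s. w s * indicator {s0<..t} s \<partial>lborel)"
      have "V t = (\<integral>\<^sup>+s. w s * indicator {0..s0} s + w s * indicator {s0<..t} s \<partial>lborel)"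
        unfolding V_def using s0 by (intro nn_integral_cong) (auto simp: indicator_def)
      also have "\<dots> = V s0 + D" unfolding V_def D_def by (rule nn_integral_add) auto
      finally have VD: "V t = V s0 + D" .
      have Dle: "D \<le> 1 / 2"
      proof -
        have Df: "D \<noteq> \<infinity>" using VD Vfin[of t] t by auto
        then obtain d where d: "D = ennreal d" "d \<ge> 0" by (cases D) auto
        have "ennreal (v t) = ennreal (real m / 2 + d)"
          using VD Vv[of t] Vv[of s0] s0 t d by auto
        then have "v t = real m / 2 + d"
          by (metis d(2) add_nonneg_nonneg divide_nonneg_nonneg enn2real_nonneg ennreal_inj of_nat_0_le_iff v_def zero_le_numeral)
        then have "d \<le> 1 / 2" using t(2) by simp
        then have "D \<le> ennreal (1 / 2)" unfolding d(1) by (rule ennreal_leI)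
        also have "ennreal (1 / 2) = ennreal 1 / ennreal 2" by (rule divide_ennreal[symmetric]) simp_all
        finally show ?thesis by simp
      qed
      have "\<phi> r \<le> (A + C * A * V s0) + Mx / 2" if r: "r \<in> {0..t}" for r
      proof -
        have bd: "\<phi> s \<le> C * A" if "s \<in> {0..s0}" for s
        proof (rule C(2)[OF h])
          show "s \<in> {0..T}" using that s0 t by auto
          have "V s \<le> V s0" using Vmono that by auto
          then have "v s \<le> v s0" unfolding v_def using Vfin[of s0] s0 t by (intro enn2real_mono) auto
          then show "v s \<le> real m / 2" using s0 by simp
        qed
        have "(\<integral>\<^sup>+s\<in>{0..r}. w s * \<phi> s \<partial>lborel) \<le>
            (\<integral>\<^sup>+s. (C * A) * (w s * indicator {0..s0} s) + Mx * (w s * indicator {s0<..t} s) \<partial>lborel)"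
        proof (rule nn_integral_mono)
          fix s
          have "\<phi> s \<le> Mx" if "s \<in> {0..t}" unfolding Mx_def using that by (rule SUP_upper)
          then show "w s * \<phi> s * indicator {0..r} s \<le> (C * A) * (w s * indicator {0..s0} s) + Mx * (w s * indicator {s0<..t} s)"
            using bd[of s] r s0 by (auto simp: indicator_def mult.commute[of "w s"] intro!: mult_right_mono)
        qed
        also have "\<dots> = (C * A) * V s0 + Mx * D"
          unfolding V_def D_def by (simp add: nn_integral_add nn_integral_cmult)
        also have "\<dots> \<le> C * A * V s0 + Mx / 2"
          using mult_left_mono[OF Dle, of Mx] by (simp add: ennreal_times_divide)
        finally have "(\<integral>\<^sup>+s\<in>{0..r}. w s * \<phi> s \<partial>lborel) \<le> C * A * V s0 + Mx / 2" .
        moreover have "\<phi> r \<le> A + (\<integral>\<^sup>+s\<in>{0..r}. w s * \<phi> s \<partial>lborel)"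
          using h r t unfolding hyp_def by auto
        ultimately show ?thesis
          by (metis (no_types, lifting) add.assoc add_left_mono order_trans)
      qed
      then have "Mx \<le> (A + C * A * V s0) + Mx / 2" unfolding Mx_def by (rule SUP_least)
      then have "Mx \<le> 2 * (A + C * A * V s0)"
        using MxB B(1) by (intro ennreal_le_add_half) (auto simp: order_le_less_trans)
      also have "\<dots> = (2 + C * (2 * V s0)) * A" by (simp add: algebra_simps)
      also have "2 * V s0 = of_nat m"
      proof -
        have "V s0 = ennreal (real m / 2)" using Vv[of s0] s0 t by simp
        then have "2 * V s0 = ennreal (2 * (real m / 2))"
          by (subst ennreal_mult) auto
        then show ?thesis by (simp add: ennreal_of_nat_eq_real_of_nat)
      qed
      also have "(2 + C * of_nat m) * A \<le> C' * A"
        unfolding C'_def by (intro mult_right_mono) auto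
      finally have "Mx \<le> C' * A" .
      moreover have "\<phi> t \<le> Mx" unfolding Mx_def using t by (intro SUP_upper) auto
      ultimately show ?thesis by simp
    qed
    moreover have "C' < \<infinity>" using C(1) unfolding C'_def by (simp add: ennreal_mult_less_top of_nat_less_top)
    ultimately show ?case by (intro exI[of _ C']) auto
  qed
  obtain m :: nat where m: "2 * v T \<le> real m" using real_arch_simple by blast
  obtain C where C: "C < \<infinity>" "\<And>A \<phi> t. hyp A \<phi> \<Longrightarrow> t \<in> {0..T} \<Longrightarrow> v t \<le> real m / 2 \<Longrightarrow> \<phi> t \<le> C * A"
    using ex[of m] by blast
  have "v t \<le> real m / 2" if "t \<in> {0..T}" for t
  proof -
    have "v t \<le> v T" unfolding v_def using that Vfin[of T] by (intro enn2real_mono Vmono) auto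
    then show ?thesis using m by simp
  qed
  then show ?thesis using C unfolding hyp_def by (intro exI[of _ C]) auto
qed

section \<open>Truncation and mean-square density of continuous functions\<close>

definition clip :: "real \<Rightarrow> real \<Rightarrow> real" where "clip R x = max (- R) (min R x)"

lemma clip_measurable[measurable]: "clip R \<in> borel_measurable borel"
  unfolding clip_def by measurable

lemma continuous_on_clip: "continuous_on A g \<Longrightarrow> continuous_on A (\<lambda>x. clip R (g x))"
  unfolding clip_def by (intro continuous_intros)

lemma clip_bound: "R \<ge> 0 \<Longrightarrow> \<bar>clip R x\<bar> \<le> R"
  unfolding clip_def by auto

lemma clip_diff_bound: "R \<ge> 0 \<Longrightarrow> \<bar>x - clip R x\<bar> \<le> \<bar>x\<bar>"
  unfolding clip_def by auto

lemma clip_eq: "\<bar>x\<bar> \<le> R \<Longrightarrow> clip R x = x"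
  unfolding clip_def by auto

lemma tendsto_clip: "(g \<longlongrightarrow> l) A \<Longrightarrow> ((\<lambda>x. clip R (g x)) \<longlongrightarrow> clip R l) A"
  unfolding clip_def by (intro tendsto_intros)

lemma eventually_clip_eq: "\<forall>\<^sub>F n in sequentially. clip (real n) x = x"
proof -
  obtain m :: nat where "\<bar>x\<bar> \<le> real m" using real_arch_simple by blast
  then show ?thesis
    by (intro eventually_sequentiallyI[of m] clip_eq) (meson of_nat_mono order_trans)
qed

lemma square_add_le: "(x + y)\<^sup>2 \<le> 2 * x\<^sup>2 + 2 * (y::real)\<^sup>2"
  using zero_le_power2[of "x - y"] by (simp add: power2_eq_square algebra_simps)

text \<open>Truncating \<open>h\<close> costs little in mean square. The truncated function is then
  the almost everywhere limit of truncated continuous functions, and the common bound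
  \<open>R\<close> permits dominated convergence. Both errors are below
  \<open>\<epsilon> / 4\<close>, and the square of a sum doubles each.\<close>

lemma L2_dense_continuous:
  fixes h :: "real \<Rightarrow> real"
  assumes h: "set_borel_measurable lborel {0..T} h"
    and h2: "set_integrable lborel {0..T} (\<lambda>t. (h t)\<^sup>2)" and e: "\<epsilon> > 0"
  shows "\<exists>g. continuous_on UNIV g \<and> (\<integral>\<^sup>+s\<in>{0..T}. ennreal ((h s - g s)\<^sup>2) \<partial>lborel) < ennreal \<epsilon>"
proof -
  define h' where "h' s = indicator {0..T} s * h s" for s
  have [measurable]: "h' \<in> borel_measurable borel"
    using h unfolding h'_def[abs_def] set_borel_measurable_def by simp
  have h'int: "integrable lborel (\<lambda>s. (h' s)\<^sup>2)"
  proof -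
    have "(\<lambda>s. (h' s)\<^sup>2) = (\<lambda>s. indicator {0..T} s *\<^sub>R (h s)\<^sup>2)"
      by (auto simp: fun_eq_iff h'_def indicator_def)
    then show ?thesis using h2 unfolding set_integrable_def by simp
  qed
  have h'nn: "(\<integral>\<^sup>+s. ennreal ((h' s)\<^sup>2) \<partial>lborel) < \<infinity>"
    using h'int by (simp add: nn_integral_eq_integral)
  have 1: "(\<lambda>n. \<integral>\<^sup>+s. ennreal ((h' s - clip (real n) (h' s))\<^sup>2) \<partial>lborel) \<longlonglongrightarrow> (\<integral>\<^sup>+s. 0 \<partial>(lborel::real measure))"
  proof (rule nn_integral_dominated_convergence[where w = "\<lambda>s. ennreal ((h' s)\<^sup>2)" and u' = "\<lambda>s. 0"])
    show "AE s in lborel. ennreal ((h' s - clip (real j) (h' s))\<^sup>2) \<le> ennreal ((h' s)\<^sup>2)" for j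
      using clip_diff_bound[of "real j"] by (auto intro!: ennreal_leI simp: abs_le_square_iff[symmetric])
    show "AE s in lborel. (\<lambda>n. ennreal ((h' s - clip (real n) (h' s))\<^sup>2)) \<longlonglongrightarrow> 0"
    proof (rule AE_I2, rule tendsto_eventually)
      fix s show "\<forall>\<^sub>F n in sequentially. ennreal ((h' s - clip (real n) (h' s))\<^sup>2) = 0"
        using eventually_clip_eq[of "h' s"] by eventually_elim simp
    qed
  qed (use h'nn in auto)
  have "\<forall>\<^sub>F n in sequentially. (\<integral>\<^sup>+s. ennreal ((h' s - clip (real n) (h' s))\<^sup>2) \<partial>lborel) < ennreal (\<epsilon> / 4)"
    by (rule order_tendstoD(2)[OF 1]) (use e in simp)
  then obtain R :: nat where R: "(\<integral>\<^sup>+s. ennreal ((h' s - clip (real R) (h' s))\<^sup>2) \<partial>lborel) < ennreal (\<epsilon> / 4)"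
    by (auto simp: eventually_sequentially)
  have "h' \<in> borel_measurable lebesgue" by (rule measurable_completion) simp
  then have "h' measurable_on UNIV"
    using lebesgue_measurable_imp_measurable_on[of h' UNIV] by simp
  then obtain N g where N: "negligible N" and g: "\<And>n. continuous_on UNIV (g n)"
    and lim: "\<And>x. x \<notin> N \<Longrightarrow> (\<lambda>n. g n x) \<longlonglongrightarrow> h' x"
    unfolding measurable_on_def by auto
  have [measurable]: "g n \<in> borel_measurable borel" for n
    using g by (rule borel_measurable_continuous_onI)
  have "AE x in lebesgue. x \<notin> N"
    using N by (auto simp: negligible_iff_null_sets intro: AE_not_in)
  then have "AE x in lborel. x \<notin> N" by (simp add: AE_completion_iff)
  have 2: "(\<lambda>n. \<integral>\<^sup>+s. ennreal ((clip R (h' s) - clip R (g n s))\<^sup>2) * indicator {0..T} s \<partial>lborel) \<longlonglongrightarrow> (\<integral>\<^sup>+s. 0 \<partial>(lborel::real measure))"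
  proof (rule nn_integral_dominated_convergence[where w = "\<lambda>s. ennreal ((2 * real R)\<^sup>2) * indicator {0..T} s" and u' = "\<lambda>s. 0"])
    show "AE s in lborel. ennreal ((clip R (h' s) - clip R (g j s))\<^sup>2) * indicator {0..T} s \<le> ennreal ((2 * real R)\<^sup>2) * indicator {0..T} s" for j
    proof (rule AE_I2)
      fix s
      have "\<bar>clip R (h' s) - clip R (g j s)\<bar> \<le> \<bar>2 * real R\<bar>"
        using clip_bound[of "real R" "h' s"] clip_bound[of "real R" "g j s"] by linarith
      then show "ennreal ((clip R (h' s) - clip R (g j s))\<^sup>2) * indicator {0..T} s \<le> ennreal ((2 * real R)\<^sup>2) * indicator {0..T} s"
        by (intro mult_right_mono ennreal_leI) (auto simp only: abs_le_square_iff zero_le)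
    qed
    show "AE s in lborel. (\<lambda>n. ennreal ((clip R (h' s) - clip R (g n s))\<^sup>2) * indicator {0..T} s) \<longlonglongrightarrow> 0"
      using \<open>AE x in lborel. x \<notin> N\<close>
    proof eventually_elim
      case (elim s)
      have "(\<lambda>n. ennreal ((clip R (h' s) - clip R (g n s))\<^sup>2)) \<longlonglongrightarrow> ennreal ((clip R (h' s) - clip R (h' s))\<^sup>2)"
        by (intro tendsto_intros tendsto_ennrealI tendsto_clip lim elim)
      then show ?case by (auto simp: indicator_def)
    qed
    show "(\<integral>\<^sup>+ x. ennreal ((2 * real R)\<^sup>2) * indicator {0..T} x \<partial>lborel) < \<infinity>"
      by (subst nn_integral_cmult) (auto simp: ennreal_mult_less_top emeasure_lborel_Icc_eq)
  qed auto
  have "\<forall>\<^sub>F n in sequentially. (\<integral>\<^sup>+s. ennreal ((clip R (h' s) - clip R (g n s))\<^sup>2) * indicator {0..T} s \<partial>lborel) < ennreal (\<epsilon> / 4)"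
    by (rule order_tendstoD(2)[OF 2]) (use e in simp)
  then obtain n where n: "(\<integral>\<^sup>+s. ennreal ((clip R (h' s) - clip R (g n s))\<^sup>2) * indicator {0..T} s \<partial>lborel) < ennreal (\<epsilon> / 4)"
    by (auto simp: eventually_sequentially)
  have "(\<integral>\<^sup>+s\<in>{0..T}. ennreal ((h s - clip R (g n s))\<^sup>2) \<partial>lborel)
    \<le> (\<integral>\<^sup>+s. 2 * ennreal ((h' s - clip R (h' s))\<^sup>2) + 2 * (ennreal ((clip R (h' s) - clip R (g n s))\<^sup>2) * indicator {0..T} s) \<partial>lborel)"
  proof (rule nn_integral_mono)
    fix s
    have "ennreal ((h' s - clip R (g n s))\<^sup>2) \<le> ennreal (2 * (h' s - clip R (h' s))\<^sup>2 + 2 * (clip R (h' s) - clip R (g n s))\<^sup>2)"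
      using square_add_le[of "h' s - clip R (h' s)" "clip R (h' s) - clip R (g n s)"] by (intro ennreal_leI) simp
    then show "ennreal ((h s - clip R (g n s))\<^sup>2) * indicator {0..T} s \<le>
       2 * ennreal ((h' s - clip R (h' s))\<^sup>2) + 2 * (ennreal ((clip R (h' s) - clip R (g n s))\<^sup>2) * indicator {0..T} s)"
      by (auto simp: indicator_def h'_def ennreal_mult)
  qed
  also have "\<dots> = 2 * (\<integral>\<^sup>+s. ennreal ((h' s - clip R (h' s))\<^sup>2) \<partial>lborel) + 2 * (\<integral>\<^sup>+s. ennreal ((clip R (h' s) - clip R (g n s))\<^sup>2) * indicator {0..T} s \<partial>lborel)"
    by (simp add: nn_integral_add nn_integral_cmult)
  also have "\<dots> < 2 * ennreal (\<epsilon> / 4) + 2 * ennreal (\<epsilon> / 4)"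
    by (intro add_strict_mono ennreal_mult_strict_left_mono R n) auto
  also have "\<dots> = ennreal \<epsilon>"
    using e by (simp flip: ennreal_numeral ennreal_mult ennreal_plus)
  finally show ?thesis using continuous_on_clip[OF g[of n]] by blast
qed

section \<open>Increments of Brownian motion and the isometry\<close>

lemma integrable_product_square:
  fixes X Y :: "'a \<Rightarrow> real"
  assumes [measurable]: "X \<in> borel_measurable M" "Y \<in> borel_measurable M"
    and "integrable M (\<lambda>x. (X x)\<^sup>2)" "integrable M (\<lambda>x. (Y x)\<^sup>2)"
  shows "integrable M (\<lambda>x. X x * Y x)"
proof (rule Bochner_Integration.integrable_bound[of M "\<lambda>x. (X x)\<^sup>2 + (Y x)\<^sup>2"])
  have "\<bar>X x * Y x\<bar> \<le> (X x)\<^sup>2 + (Y x)\<^sup>2" for x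
  proof -
    have "2 * (\<bar>X x\<bar> * \<bar>Y x\<bar>) \<le> (X x)\<^sup>2 + (Y x)\<^sup>2"
      using sum_squares_bound[of "\<bar>X x\<bar>" "\<bar>Y x\<bar>"] by simp
    moreover have "0 \<le> \<bar>X x\<bar> * \<bar>Y x\<bar>" by simp
    ultimately show ?thesis unfolding abs_mult by linarith
  qed
  then show "AE x in M. norm (X x * Y x) \<le> norm ((X x)\<^sup>2 + (Y x)\<^sup>2)" by simp
qed (use assms in auto)

locale brownian =
  fixes M :: "'a measure" and F :: "real \<Rightarrow> 'a measure" and W :: "real \<Rightarrow> 'a \<Rightarrow> real"
  assumes filtered: "filtered_prob_space M F" and bm: "brownian_motion M F W"
begin

sublocale prob_space M
  using filtered by (simp add: filtered_prob_space_def)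

lemma space_F: "space (F t) = space M"
  using filtered by (auto simp: filtered_prob_space_def subalgebra_def)

lemma sets_F: "sets (F t) \<subseteq> sets M"
  using filtered by (auto simp: filtered_prob_space_def subalgebra_def)

lemma sets_F_mono: "s \<le> t \<Longrightarrow> sets (F s) \<subseteq> sets (F t)"
  using filtered filtration.sets_F_mono[of "space M" F s t] by (auto simp: filtered_prob_space_def)

lemma measurable_F_mono: "s \<le> t \<Longrightarrow> X \<in> measurable (F s) N \<Longrightarrow> X \<in> measurable (F t) N"
  using measurable_mono[of N N "F s" "F t"] sets_F_mono space_F by auto

lemma measurable_F_M: "X \<in> measurable (F s) N \<Longrightarrow> X \<in> measurable M N"
  using measurable_mono[of N N "F s" "M"] sets_F space_F by auto

lemma W_F: "0 \<le> s \<Longrightarrow> s \<le> t \<Longrightarrow> W s \<in> borel_measurable (F t)"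
  using bm measurable_F_mono unfolding brownian_motion_def by blast

lemma W_M[measurable (raw)]: "0 \<le> s \<Longrightarrow> W s \<in> borel_measurable M"
  using W_F[of s s] measurable_F_M by blast

lemma distributed_increment:
  "0 \<le> s \<Longrightarrow> s < t \<Longrightarrow> distributed M lborel (\<lambda>\<omega>. W t \<omega> - W s \<omega>) (normal_density 0 (sqrt (t - s)))"
  using bm unfolding brownian_motion_def by auto

text \<open>Both families in the definition of Brownian motion are closed under intersection, so
  their independence extends to the generated sigma-algebras. The target \<open>N\<close> is
  arbitrary, so that \<open>\<xi>\<close> can also be a whole vector of past values.\<close>

lemma indep_increment:
  assumes "0 \<le> s" "s < t" and \<xi>: "\<xi> \<in> measurable (F s) N"
  shows "indep_var N \<xi> borel (\<lambda>\<omega>. W t \<omega> - W s \<omega>)"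
proof -
  let ?D = "\<lambda>\<omega>. W t \<omega> - W s \<omega>"
  have D[measurable]: "?D \<in> borel_measurable M" using assms by (intro borel_measurable_diff W_M) auto
  have 1: "indep_set (sets (F s)) {?D -` A \<inter> space M | A. A \<in> sets borel}"
    using bm assms unfolding brownian_motion_def by auto
  have "Int_stable {?D -` A \<inter> space M | A. A \<in> sets borel}"
  proof (rule Int_stableI)
    fix a b assume "a \<in> {?D -` A \<inter> space M | A. A \<in> sets borel}" "b \<in> {?D -` A \<inter> space M | A. A \<in> sets borel}"
    then obtain A B where "a = ?D -` A \<inter> space M" "b = ?D -` B \<inter> space M" "A \<in> sets borel" "B \<in> sets borel"
      by auto
    then show "a \<inter> b \<in> {?D -` A \<inter> space M | A. A \<in> sets borel}"
      by (intro CollectI exI[of _ "A \<inter> B"]) auto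
  qed
  moreover have "Int_stable (sets (F s))" by (auto simp: Int_stable_def)
  ultimately have 2: "indep_set (sigma_sets (space M) (sets (F s)))
      (sigma_sets (space M) {?D -` A \<inter> space M | A. A \<in> sets borel})"
    using 1 by (intro indep_set_sigma_sets)
  have 3: "sigma_sets (space M) (sets (F s)) = sets (F s)"
    using sets.sigma_sets_eq[of "F s"] space_F by simp
  have "sigma_sets (space M) {\<xi> -` A \<inter> space M | A. A \<in> sets N} \<subseteq> sigma_sets (space M) (sets (F s))"
    using \<xi> space_F by (intro sigma_sets_mono') (auto simp: measurable_def)
  then have 4: "sigma_sets (space M) {\<xi> -` A \<inter> space M | A. A \<in> sets N} \<subseteq> sets (F s)"
    unfolding 3 .
  show ?thesis unfolding indep_var_eq
  proof (intro conjI)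
    show "indep_set (sigma_sets (space M) {\<xi> -` A \<inter> space M | A. A \<in> sets N})
      (sigma_sets (space M) {?D -` A \<inter> space M | A. A \<in> sets borel})"
      using 2 4 unfolding indep_sets2_eq 3 by blast
  qed (use \<xi> measurable_F_M D in auto)
qed

lemma increment_moments:
  assumes "0 \<le> s" "s < t"
  shows "integrable M (\<lambda>\<omega>. W t \<omega> - W s \<omega>)" "expectation (\<lambda>\<omega>. W t \<omega> - W s \<omega>) = 0"
    "integrable M (\<lambda>\<omega>. (W t \<omega> - W s \<omega>)\<^sup>2)" "expectation (\<lambda>\<omega>. (W t \<omega> - W s \<omega>)\<^sup>2) = t - s"
proof -
  let ?D = "\<lambda>\<omega>. W t \<omega> - W s \<omega>" and ?\<sigma> = "sqrt (t - s)"
  have p: "0 < ?\<sigma>" using assms by simp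
  note D = distributed_increment[OF assms]
  have i: "integrable M (\<lambda>\<omega>. ?D \<omega> ^ k) = integrable lborel (\<lambda>x. normal_density 0 ?\<sigma> x * x ^ k)" for k
    by (rule distributed_integrable[OF D, symmetric]) auto
  have e: "expectation (\<lambda>\<omega>. ?D \<omega> ^ k) = (\<integral>x. normal_density 0 ?\<sigma> x * x ^ k \<partial>lborel)" for k
    by (rule distributed_integral[OF D, symmetric]) auto
  show "integrable M ?D" using i[of 1] integrable_normal_moment[OF p, of 0 1] by simp
  show "expectation ?D = 0" using e[of 1] integral_normal_moment_odd[OF p, of 0 0] by simp
  show "integrable M (\<lambda>\<omega>. (?D \<omega>)\<^sup>2)" using i[of 2] integrable_normal_moment[OF p, of 0 2] by simp
  show "expectation (\<lambda>\<omega>. (?D \<omega>)\<^sup>2) = t - s"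
    using e[of 2] integral_normal_moment_even[OF p, of 0 1] assms by (simp add: fact_numeral)
qed

text \<open>Independence factors the expectations. The degenerate case \<open>s = t\<close> is
  included because cutting a piece at a given time can leave it empty.\<close>

lemma increment_mult:
  assumes st: "0 \<le> s" "s \<le> t" and \<xi>: "\<xi> \<in> borel_measurable (F s)" "integrable M \<xi>"
  shows "integrable M (\<lambda>\<omega>. \<xi> \<omega> * (W t \<omega> - W s \<omega>))" "expectation (\<lambda>\<omega>. \<xi> \<omega> * (W t \<omega> - W s \<omega>)) = 0"
    "integrable M (\<lambda>\<omega>. \<xi> \<omega> * (W t \<omega> - W s \<omega>)\<^sup>2)"
    "expectation (\<lambda>\<omega>. \<xi> \<omega> * (W t \<omega> - W s \<omega>)\<^sup>2) = expectation \<xi> * (t - s)"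
proof -
  have "integrable M (\<lambda>\<omega>. \<xi> \<omega> * (W t \<omega> - W s \<omega>)) \<and> expectation (\<lambda>\<omega>. \<xi> \<omega> * (W t \<omega> - W s \<omega>)) = 0 \<and>
    integrable M (\<lambda>\<omega>. \<xi> \<omega> * (W t \<omega> - W s \<omega>)\<^sup>2) \<and>
    expectation (\<lambda>\<omega>. \<xi> \<omega> * (W t \<omega> - W s \<omega>)\<^sup>2) = expectation \<xi> * (t - s)"
  proof (cases "s = t")
    case False
    then have "s < t" using st by simp
    note i = indep_increment[OF st(1) this \<xi>(1)] and m = increment_moments[OF st(1) this]
    have i2: "indep_var borel \<xi> borel (\<lambda>\<omega>. (W t \<omega> - W s \<omega>)\<^sup>2)"
      using indep_var_compose[OF i, of "\<lambda>x. x" borel "\<lambda>x. x\<^sup>2" borel] by (simp add: comp_def)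
    show ?thesis
      using indep_var_integrable[OF i \<xi>(2) m(1)] indep_var_lebesgue_integral[OF i \<xi>(2) m(1)]
        indep_var_integrable[OF i2 \<xi>(2) m(3)] indep_var_lebesgue_integral[OF i2 \<xi>(2) m(3)] m by simp
  qed simp
  then show "integrable M (\<lambda>\<omega>. \<xi> \<omega> * (W t \<omega> - W s \<omega>))" "expectation (\<lambda>\<omega>. \<xi> \<omega> * (W t \<omega> - W s \<omega>)) = 0"
    "integrable M (\<lambda>\<omega>. \<xi> \<omega> * (W t \<omega> - W s \<omega>)\<^sup>2)"
    "expectation (\<lambda>\<omega>. \<xi> \<omega> * (W t \<omega> - W s \<omega>)\<^sup>2) = expectation \<xi> * (t - s)" by auto
qed

lemma square_integrable_increment_mult:
  assumes "0 \<le> s" "s \<le> t" "\<xi> \<in> borel_measurable (F s)" "integrable M (\<lambda>\<omega>. (\<xi> \<omega>)\<^sup>2)"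
  shows "integrable M (\<lambda>\<omega>. (\<xi> \<omega> * (W t \<omega> - W s \<omega>))\<^sup>2)"
    "expectation (\<lambda>\<omega>. (\<xi> \<omega> * (W t \<omega> - W s \<omega>))\<^sup>2) = expectation (\<lambda>\<omega>. (\<xi> \<omega>)\<^sup>2) * (t - s)"
  using increment_mult(3,4)[of s t "\<lambda>\<omega>. (\<xi> \<omega>)\<^sup>2"] assms by (auto simp: power_mult_distrib)

text \<open>The polarized isometry for two elementary integrands. Measuring the overlap by Lebesgue
  measure gives one formula for disjoint, nested and partially overlapping intervals.\<close>

lemma cross_increments_ordered:
  assumes "0 \<le> a" "a \<le> b" "a \<le> c" "c \<le> d"
    and \<xi>: "\<xi> \<in> borel_measurable (F a)" "integrable M (\<lambda>\<omega>. (\<xi> \<omega>)\<^sup>2)"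
    and \<eta>: "\<eta> \<in> borel_measurable (F c)" "integrable M (\<lambda>\<omega>. (\<eta> \<omega>)\<^sup>2)"
  shows "expectation (\<lambda>\<omega>. (\<xi> \<omega> * (W b \<omega> - W a \<omega>)) * (\<eta> \<omega> * (W d \<omega> - W c \<omega>)))
     = expectation (\<lambda>\<omega>. \<xi> \<omega> * \<eta> \<omega>) * measure lborel ({a<..b} \<inter> {c<..d})"
proof -
  have c0: "0 \<le> c" using assms by simp
  note W_F[measurable (raw)]
  have \<xi>c: "\<xi> \<in> borel_measurable (F c)" by (rule measurable_F_mono[OF \<open>a \<le> c\<close> \<xi>(1)])
  have [measurable]: "\<xi> \<in> borel_measurable M" "\<eta> \<in> borel_measurable M"
    using \<xi>(1) \<eta>(1) by (auto intro: measurable_F_M)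
  define e where "e = min b c"
  have e: "a \<le> e" "e \<le> c" "e \<le> b" "0 \<le> e" using assms by (auto simp: e_def)
  define m where "m = max c (min b d)"
  have m: "c \<le> m" "m \<le> d" "0 \<le> m" using assms by (auto simp: m_def)
  define p where "p = max c b"
  \<comment> \<open>\<open>(a, b]\<close> and \<open>(c, d]\<close> overlap in \<open>(c, m]\<close>; the increments over the other pieces are
    independent of everything before them.\<close>
  have 1: "expectation (\<lambda>\<omega>. (\<xi> \<omega> * (W e \<omega> - W a \<omega>) * \<eta> \<omega>) * (W d \<omega> - W c \<omega>)) = 0"
    "integrable M (\<lambda>\<omega>. (\<xi> \<omega> * (W e \<omega> - W a \<omega>) * \<eta> \<omega>) * (W d \<omega> - W c \<omega>))"
  proof -
    have m1: "(\<lambda>\<omega>. \<xi> \<omega> * (W e \<omega> - W a \<omega>) * \<eta> \<omega>) \<in> borel_measurable (F c)"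
      using \<xi>c \<eta>(1) W_F[of e c] W_F[of a c] e assms by auto
    have i1: "integrable M (\<lambda>\<omega>. \<xi> \<omega> * (W e \<omega> - W a \<omega>) * \<eta> \<omega>)"
      using square_integrable_increment_mult(1)[OF \<open>0 \<le> a\<close> e(1) \<xi>] \<eta>(2) e assms
      by (intro integrable_product_square) auto
    show "expectation (\<lambda>\<omega>. (\<xi> \<omega> * (W e \<omega> - W a \<omega>) * \<eta> \<omega>) * (W d \<omega> - W c \<omega>)) = 0"
    "integrable M (\<lambda>\<omega>. (\<xi> \<omega> * (W e \<omega> - W a \<omega>) * \<eta> \<omega>) * (W d \<omega> - W c \<omega>))"
      using increment_mult[OF c0 \<open>c \<le> d\<close> m1 i1] by auto
  qed
  have i\<xi>\<eta>: "integrable M (\<lambda>\<omega>. \<xi> \<omega> * \<eta> \<omega>)" "(\<lambda>\<omega>. \<xi> \<omega> * \<eta> \<omega>) \<in> borel_measurable (F c)"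
    using \<xi> \<eta> \<xi>c by (auto intro!: integrable_product_square)
  have 2: "integrable M (\<lambda>\<omega>. \<xi> \<omega> * \<eta> \<omega> * (W m \<omega> - W c \<omega>)\<^sup>2)"
    "expectation (\<lambda>\<omega>. \<xi> \<omega> * \<eta> \<omega> * (W m \<omega> - W c \<omega>)\<^sup>2) = expectation (\<lambda>\<omega>. \<xi> \<omega> * \<eta> \<omega>) * (m - c)"
    using increment_mult(3,4)[OF c0 m(1) i\<xi>\<eta>(2,1)] by auto
  have sq: "integrable M (\<lambda>\<omega>. (\<xi> \<omega> * (W v \<omega> - W u \<omega>))\<^sup>2)" "integrable M (\<lambda>\<omega>. (\<eta> \<omega> * (W v \<omega> - W u \<omega>))\<^sup>2)"
    if "c \<le> u" "u \<le> v" for u v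
    using square_integrable_increment_mult(1)[of u v] that \<xi>(2) \<eta>(2) c0
      measurable_F_mono[OF that(1) \<xi>c] measurable_F_mono[OF that(1) \<eta>(1)] by auto
  have cross0: "expectation (\<lambda>\<omega>. (\<xi> \<omega> * (W v \<omega> - W u \<omega>) * \<eta> \<omega>) * (W z \<omega> - W v \<omega>)) = 0 \<and>
      integrable M (\<lambda>\<omega>. (\<xi> \<omega> * (W v \<omega> - W u \<omega>) * \<eta> \<omega>) * (W z \<omega> - W v \<omega>))"
    if "c \<le> u" "u \<le> v" "v \<le> z" for u v z
  proof -
    have m1: "(\<lambda>\<omega>. \<xi> \<omega> * (W v \<omega> - W u \<omega>) * \<eta> \<omega>) \<in> borel_measurable (F v)"
      using measurable_F_mono[OF _ \<xi>c, of v] measurable_F_mono[OF _ \<eta>(1), of v] W_F[of u v] W_F[of v v] that c0 by auto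
    have i1: "integrable M (\<lambda>\<omega>. \<xi> \<omega> * (W v \<omega> - W u \<omega>) * \<eta> \<omega>)"
      using sq(1)[OF that(1,2)] \<eta>(2) that c0 by (intro integrable_product_square) auto
    show ?thesis using increment_mult(1,2)[OF _ that(3) m1 i1] that c0 by auto
  qed
  show ?thesis
  proof (cases "b \<le> c")
    case True
    then have eb: "e = b" by (simp add: e_def)
    have e: "{a<..b} \<inter> {c<..d} = {}" using True by auto
    show ?thesis using 1(1) unfolding eb e by (simp add: ac_simps)
  next
    case False
    then have ec: "e = c" by (simp add: e_def)
    have leb: "measure lborel ({a<..b} \<inter> {c<..d}) = m - c"
    proof -
      have "{a<..b} \<inter> {c<..d} = {c<..m}" using False assms by (auto simp: m_def)
      then show ?thesis using m by simp
    qed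
    define P where "P \<omega> = (\<xi> \<omega> * (W m \<omega> - W c \<omega>) * \<eta> \<omega>) * (W d \<omega> - W m \<omega>) + (\<xi> \<omega> * (W m \<omega> - W c \<omega>) * \<eta> \<omega>) * (W b \<omega> - W m \<omega>)" for \<omega>
    have mb: "m \<le> b" using False assms by (auto simp: m_def)
    have P: "integrable M P" "expectation P = 0"
      using cross0[of c m d] cross0[of c m b] m mb unfolding P_def[abs_def] by auto
    \<comment> \<open>In this case \<open>m\<close> is the earlier of the two right end points, so
      one of the increments beyond the overlap is empty.\<close>
    have zero: "(W b \<omega> - W m \<omega>) * (W d \<omega> - W m \<omega>) = 0" for \<omega>
    proof -
      have "m = b \<or> m = d" using False assms by (auto simp: m_def min_def)
      then show ?thesis by auto
    qed
    have eq: "(\<xi> \<omega> * (W b \<omega> - W a \<omega>)) * (\<eta> \<omega> * (W d \<omega> - W c \<omega>))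
      = (\<xi> \<omega> * (W e \<omega> - W a \<omega>) * \<eta> \<omega>) * (W d \<omega> - W c \<omega>) + (\<xi> \<omega> * \<eta> \<omega> * (W m \<omega> - W c \<omega>)\<^sup>2 + P \<omega>)" for \<omega>
    proof -
      have "(\<xi> \<omega> * (W b \<omega> - W a \<omega>)) * (\<eta> \<omega> * (W d \<omega> - W c \<omega>))
        = (\<xi> \<omega> * (W e \<omega> - W a \<omega>) * \<eta> \<omega>) * (W d \<omega> - W c \<omega>) + (\<xi> \<omega> * \<eta> \<omega> * (W m \<omega> - W c \<omega>)\<^sup>2 + P \<omega>) + \<xi> \<omega> * \<eta> \<omega> * ((W b \<omega> - W m \<omega>) * (W d \<omega> - W m \<omega>))"
        unfolding P_def ec by (simp add: algebra_simps power2_eq_square)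
      then show ?thesis unfolding zero by simp
    qed
    show ?thesis unfolding eq leb using 1 2 P by simp
  qed
qed

lemma cross_increments:
  assumes "0 \<le> a" "a \<le> b" "0 \<le> c" "c \<le> d"
    and "\<xi> \<in> borel_measurable (F a)" "integrable M (\<lambda>\<omega>. (\<xi> \<omega>)\<^sup>2)"
    and "\<eta> \<in> borel_measurable (F c)" "integrable M (\<lambda>\<omega>. (\<eta> \<omega>)\<^sup>2)"
  shows "expectation (\<lambda>\<omega>. (\<xi> \<omega> * (W b \<omega> - W a \<omega>)) * (\<eta> \<omega> * (W d \<omega> - W c \<omega>)))
     = expectation (\<lambda>\<omega>. \<xi> \<omega> * \<eta> \<omega>) * measure lborel ({a<..b} \<inter> {c<..d})"
proof (cases "a \<le> c")
  case True
  then show ?thesis using cross_increments_ordered[of a b c d \<xi> \<eta>] assms by simp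
next
  case False
  then show ?thesis using cross_increments_ordered[of c d a b \<eta> \<xi>] assms by (simp add: ac_simps Int_commute)
qed

end

text \<open>A simple integrand is a finite family of pieces \<open>\<eta> k\<close> on \<open>(a k, b k]\<close>, which
  may overlap: in this form the difference of two simple integrands is again one.\<close>

locale simple_family = brownian M F W
  for M :: "'a measure" and F W +
  fixes K :: "'k set" and a b :: "'k \<Rightarrow> real" and \<eta> :: "'k \<Rightarrow> 'a \<Rightarrow> real"
  assumes finite_K: "finite K" and ab: "\<And>k. k \<in> K \<Longrightarrow> 0 \<le> a k \<and> a k \<le> b k"
    and \<eta>_F: "\<And>k. k \<in> K \<Longrightarrow> \<eta> k \<in> borel_measurable (F (a k))"
    and \<eta>_square: "\<And>k. k \<in> K \<Longrightarrow> integrable M (\<lambda>\<omega>. (\<eta> k \<omega>)\<^sup>2)"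
begin

definition S :: "real \<Rightarrow> 'a \<Rightarrow> real" where
  "S t \<omega> = (\<Sum>k\<in>K. \<eta> k \<omega> * (W (min t (b k)) \<omega> - W (min t (a k)) \<omega>))"

definition Sv :: "real \<Rightarrow> 'a \<Rightarrow> real" where
  "Sv s \<omega> = (\<Sum>k\<in>K. \<eta> k \<omega> * indicator {a k<..b k} s)"

lemma \<eta>_M[measurable]: "k \<in> K \<Longrightarrow> \<eta> k \<in> borel_measurable M"
  using \<eta>_F measurable_F_M by blast

lemma S_M[measurable]: "t \<ge> 0 \<Longrightarrow> S t \<in> borel_measurable M"
  unfolding S_def[abs_def] using ab by (intro borel_measurable_sum borel_measurable_times borel_measurable_diff W_M) (auto dest: order_trans)

lemma Sv_M[measurable]: "(\<lambda>(s, \<omega>). Sv s \<omega>) \<in> borel_measurable (borel \<Otimes>\<^sub>M M)"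
  unfolding Sv_def case_prod_beta by measurable

text \<open>Both sides expand into double sums over pairs of pieces, which
  \<open>cross_increments\<close> matches term by term; overlaps therefore do no harm. The pathwise
  double sum is nonnegative as the integral of a square, which allows the passage to
  \<open>ennreal\<close>.\<close>

lemma isometry_full:
  defines "I \<equiv> \<lambda>\<omega>. \<Sum>k\<in>K. \<eta> k \<omega> * (W (b k) \<omega> - W (a k) \<omega>)"
  shows "(\<integral>\<^sup>+\<omega>. ennreal ((I \<omega>)\<^sup>2) \<partial>M) = (\<integral>\<^sup>+\<omega>. (\<integral>\<^sup>+s. ennreal ((Sv s \<omega>)\<^sup>2) \<partial>lborel) \<partial>M)"
    "integrable M (\<lambda>\<omega>. (I \<omega>)\<^sup>2)"
proof -
  define D where "D k \<omega> = \<eta> k \<omega> * (W (b k) \<omega> - W (a k) \<omega>)" for k \<omega>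
  define l where "l k j = measure lborel ({a k<..b k} \<inter> {a j<..b j})" for k j
  have DM[measurable]: "k \<in> K \<Longrightarrow> D k \<in> borel_measurable M" for k
    unfolding D_def[abs_def] using ab by (intro borel_measurable_times borel_measurable_diff W_M \<eta>_M) force+
  have D2: "integrable M (\<lambda>\<omega>. (D k \<omega>)\<^sup>2)" if "k \<in> K" for k
    unfolding D_def using ab[OF that] \<eta>_F[OF that] \<eta>_square[OF that] by (intro square_integrable_increment_mult) auto
  have DD: "integrable M (\<lambda>\<omega>. D k \<omega> * D j \<omega>)" if "k \<in> K" "j \<in> K" for k j
    using that D2 DM by (intro integrable_product_square) auto
  have \<eta>\<eta>: "integrable M (\<lambda>\<omega>. \<eta> k \<omega> * \<eta> j \<omega>)" if "k \<in> K" "j \<in> K" for k j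
    using that \<eta>_square by (intro integrable_product_square) auto
  have ED: "expectation (\<lambda>\<omega>. D k \<omega> * D j \<omega>) = expectation (\<lambda>\<omega>. \<eta> k \<omega> * \<eta> j \<omega>) * l k j" if "k \<in> K" "j \<in> K" for k j
    unfolding D_def l_def using ab[OF that(1)] ab[OF that(2)] \<eta>_F that \<eta>_square by (intro cross_increments) auto
  have I2: "(I \<omega>)\<^sup>2 = (\<Sum>k\<in>K. \<Sum>j\<in>K. D k \<omega> * D j \<omega>)" for \<omega>
    unfolding I_def D_def power2_eq_square sum_product ..
  show int: "integrable M (\<lambda>\<omega>. (I \<omega>)\<^sup>2)" unfolding I2 using DD by (intro Bochner_Integration.integrable_sum) auto
  have EI: "expectation (\<lambda>\<omega>. (I \<omega>)\<^sup>2) = expectation (\<lambda>\<omega>. \<Sum>k\<in>K. \<Sum>j\<in>K. \<eta> k \<omega> * \<eta> j \<omega> * l k j)"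
    unfolding I2 using DD \<eta>\<eta> ED by (simp add: Bochner_Integration.integral_sum)
  have Sv2: "(Sv s \<omega>)\<^sup>2 = (\<Sum>k\<in>K. \<Sum>j\<in>K. \<eta> k \<omega> * \<eta> j \<omega> * indicator ({a k<..b k} \<inter> {a j<..b j}) s)" for s \<omega>
    unfolding Sv_def power2_eq_square sum_product
    by (simp add: indicator_inter_arith ac_simps del: Int_greaterThanAtMost)
  have fin: "emeasure lborel ({a k<..b k} \<inter> {a j<..b j}) < \<infinity>" if "k \<in> K" for k j
  proof -
    have "emeasure lborel ({a k<..b k} \<inter> {a j<..b j}) \<le> emeasure lborel {a k<..b k}"
      by (intro emeasure_mono) auto
    also have "\<dots> < \<infinity>" using ab[OF that] by simp
    finally show ?thesis .
  qed
  have inner: "(\<integral>\<^sup>+s. ennreal ((Sv s \<omega>)\<^sup>2) \<partial>lborel) = ennreal (\<Sum>k\<in>K. \<Sum>j\<in>K. \<eta> k \<omega> * \<eta> j \<omega> * l k j)"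
    and pos: "0 \<le> (\<Sum>k\<in>K. \<Sum>j\<in>K. \<eta> k \<omega> * \<eta> j \<omega> * l k j)" for \<omega>
  proof -
    have i: "integrable lborel (\<lambda>s. \<eta> k \<omega> * \<eta> j \<omega> * indicator ({a k<..b k} \<inter> {a j<..b j}) s)" if "k \<in> K" for k j
      using fin[OF that] by (intro integrable_mult_right integrable_real_indicator) auto
    have int: "integrable lborel (\<lambda>s. (Sv s \<omega>)\<^sup>2)" unfolding Sv2 using i by (intro Bochner_Integration.integrable_sum) auto
    have val: "(\<integral>s. (Sv s \<omega>)\<^sup>2 \<partial>lborel) = (\<Sum>k\<in>K. \<Sum>j\<in>K. \<eta> k \<omega> * \<eta> j \<omega> * l k j)"
      unfolding Sv2 l_def using i by (simp add: Bochner_Integration.integral_sum)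
    show "(\<integral>\<^sup>+s. ennreal ((Sv s \<omega>)\<^sup>2) \<partial>lborel) = ennreal (\<Sum>k\<in>K. \<Sum>j\<in>K. \<eta> k \<omega> * \<eta> j \<omega> * l k j)"
      unfolding val[symmetric] using int by (intro nn_integral_eq_integral) auto
    show "0 \<le> (\<Sum>k\<in>K. \<Sum>j\<in>K. \<eta> k \<omega> * \<eta> j \<omega> * l k j)"
      unfolding val[symmetric] by simp
  qed
  have "(\<integral>\<^sup>+\<omega>. ennreal ((I \<omega>)\<^sup>2) \<partial>M) = ennreal (expectation (\<lambda>\<omega>. \<Sum>k\<in>K. \<Sum>j\<in>K. \<eta> k \<omega> * \<eta> j \<omega> * l k j))"
    unfolding EI[symmetric] using int by (intro nn_integral_eq_integral) auto
  also have "\<dots> = (\<integral>\<^sup>+\<omega>. (\<integral>\<^sup>+s. ennreal ((Sv s \<omega>)\<^sup>2) \<partial>lborel) \<partial>M)"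
    unfolding inner using pos \<eta>\<eta>
    by (intro nn_integral_eq_integral[symmetric] Bochner_Integration.integrable_sum) auto
  finally show "(\<integral>\<^sup>+\<omega>. ennreal ((I \<omega>)\<^sup>2) \<partial>M) = (\<integral>\<^sup>+\<omega>. (\<integral>\<^sup>+s. ennreal ((Sv s \<omega>)\<^sup>2) \<partial>lborel) \<partial>M)" .
qed

lemma isometry:
  assumes "t \<ge> 0"
  shows "(\<integral>\<^sup>+\<omega>. ennreal ((S t \<omega>)\<^sup>2) \<partial>M) = (\<integral>\<^sup>+\<omega>. (\<integral>\<^sup>+s\<in>{..t}. ennreal ((Sv s \<omega>)\<^sup>2) \<partial>lborel) \<partial>M)"
    "integrable M (\<lambda>\<omega>. (S t \<omega>)\<^sup>2)"
proof -
  \<comment> \<open>Stopping cuts every piece at \<open>t\<close>. A piece beginning after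
    \<open>t\<close> now starts at \<open>t\<close>, where its own coefficient need not be
    measurable, so it receives the coefficient 0.\<close>
  define \<eta>' where "\<eta>' k \<omega> = (if a k \<le> t then \<eta> k \<omega> else 0)" for k \<omega>
  define a' b' where "a' k = min t (a k)" and "b' k = min t (b k)" for k
  have tr: "simple_family M F W K a' b' \<eta>'"
  proof (intro simple_family.intro simple_family_axioms.intro brownian_axioms finite_K)
    fix k assume k: "k \<in> K"
    show "\<eta>' k \<in> borel_measurable (F (a' k))"
    proof (cases "a k \<le> t")
      case True
      then have "\<eta>' k = \<eta> k" "a' k = a k" by (auto simp: a'_def \<eta>'_def fun_eq_iff)
      then show ?thesis using \<eta>_F[OF k] by simp
    next
      case False
      then have "\<eta>' k = (\<lambda>_. 0)" by (auto simp: \<eta>'_def fun_eq_iff)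
      then show ?thesis by simp
    qed
    show "integrable M (\<lambda>\<omega>. (\<eta>' k \<omega>)\<^sup>2)"
      using \<eta>_square[OF k] by (cases "a k \<le> t") (simp_all add: \<eta>'_def)
    show "0 \<le> a' k \<and> a' k \<le> b' k"
      using ab[OF k] assms by (auto simp: a'_def b'_def)
  qed
  have I: "(\<Sum>k\<in>K. \<eta>' k \<omega> * (W (b' k) \<omega> - W (a' k) \<omega>)) = S t \<omega>" for \<omega>
    unfolding S_def a'_def b'_def
  proof (rule sum.cong[OF refl])
    fix k assume "k \<in> K"
    then show "\<eta>' k \<omega> * (W (min t (b k)) \<omega> - W (min t (a k)) \<omega>) = \<eta> k \<omega> * (W (min t (b k)) \<omega> - W (min t (a k)) \<omega>)"
      using ab[of k] by (auto simp: \<eta>'_def a'_def b'_def)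
  qed
  have V: "ennreal ((simple_family.Sv K a' b' \<eta>' s \<omega>)\<^sup>2) = ennreal ((Sv s \<omega>)\<^sup>2) * indicator {..t} s" for s \<omega>
  proof -
    have "simple_family.Sv K a' b' \<eta>' s \<omega> = Sv s \<omega> * indicator {..t} s"
      unfolding Sv_def simple_family.Sv_def[OF tr] sum_distrib_right by (intro sum.cong refl) (simp add: \<eta>'_def a'_def b'_def split: split_indicator)
    then show ?thesis by (cases "s \<le> t") simp_all
  qed
  show "(\<integral>\<^sup>+\<omega>. ennreal ((S t \<omega>)\<^sup>2) \<partial>M) = (\<integral>\<^sup>+\<omega>. (\<integral>\<^sup>+s\<in>{..t}. ennreal ((Sv s \<omega>)\<^sup>2) \<partial>lborel) \<partial>M)"
    "integrable M (\<lambda>\<omega>. (S t \<omega>)\<^sup>2)"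
    using simple_family.isometry_full[OF tr] unfolding I V by this+
qed

end

section \<open>Mean-square bounds for Ito integrals\<close>

text \<open>Progressive measurability lives on a trace of the time axis and on the small
  sigma-algebra \<open>F t\<close>. Extension by 0 brings the process to the full product with
  \<open>M\<close>, where Fubini's theorem applies.\<close>

lemma (in brownian) joint_measurable_restrict:
  assumes "(\<lambda>(s, \<omega>). H s \<omega>) \<in> borel_measurable (restrict_space borel A \<Otimes>\<^sub>M F t)" and [measurable]: "A \<in> sets borel"
  shows "(\<lambda>(s, \<omega>). indicator A s * H s \<omega> :: real) \<in> borel_measurable (borel \<Otimes>\<^sub>M M)"
proof -
  let ?R = "restrict_space (borel \<Otimes>\<^sub>M M) (A \<times> space M)"
  have "fst \<in> measurable ?R (restrict_space borel A)"
    by (intro measurable_restrict_space2 measurable_restrict_space1) (auto simp: space_restrict_space)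
  moreover have "snd \<in> measurable ?R (F t)"
  proof -
    have "(\<lambda>\<omega>. \<omega>) \<in> measurable M (F t)" by (rule measurable_F_M[of _ t]) simp
    from measurable_compose[OF measurable_snd this] have "snd \<in> measurable (borel \<Otimes>\<^sub>M M) (F t)" .
    then show ?thesis by (rule measurable_restrict_space1)
  qed
  ultimately have "(\<lambda>x. (fst x, snd x)) \<in> measurable ?R (restrict_space borel A \<Otimes>\<^sub>M F t)"
    by (rule measurable_Pair)
  from measurable_compose[OF this assms(1)] have "(\<lambda>x. H (fst x) (snd x)) \<in> borel_measurable ?R"
    by (simp add: case_prod_beta)
  then have "(\<lambda>x. indicator (A \<times> space M) x *\<^sub>R H (fst x) (snd x)) \<in> borel_measurable (borel \<Otimes>\<^sub>M M)"
    by (subst (asm) borel_measurable_restrict_space_iff) (auto simp: space_pair_measure)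
  then show ?thesis
    by (rule measurable_cong[THEN iffD1, rotated]) (auto simp: space_pair_measure indicator_def)
qed

lemma (in brownian) progressive_joint:
  assumes "progressive F T H" "0 \<le> T"
  shows "(\<lambda>(s, \<omega>). indicator {0..T} s * H s \<omega>) \<in> borel_measurable (borel \<Otimes>\<^sub>M M)"
  using assms by (intro joint_measurable_restrict[of _ _ T]) (auto simp: progressive_def)

text \<open>\<open>H\<close> is measurable only after multiplication with the indicator, so every
  integrand is first rewritten with the cut-off process. The measurability statements come along
  because the integrals are later added and scaled.\<close>

lemma (in brownian) Fubini_square:
  fixes t T :: real
  assumes "(\<lambda>(s, \<omega>). indicator {0..T} s * H s \<omega>) \<in> borel_measurable (borel \<Otimes>\<^sub>M M)" "t \<le> T"
    and [measurable]: "(\<lambda>(s, \<omega>). G s \<omega>) \<in> borel_measurable (borel \<Otimes>\<^sub>M M)"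
  shows "(\<integral>\<^sup>+\<omega>. (\<integral>\<^sup>+s\<in>{0..t}. ennreal ((H s \<omega> - G s \<omega>)\<^sup>2) \<partial>lborel) \<partial>M)
      = (\<integral>\<^sup>+s\<in>{0..t}. (\<integral>\<^sup>+\<omega>. ennreal ((H s \<omega> - G s \<omega>)\<^sup>2) \<partial>M) \<partial>lborel)" (is ?Fub)
    "(\<lambda>(s, \<omega>). ennreal ((H s \<omega> - G s \<omega>)\<^sup>2) * indicator {0..t} s) \<in> borel_measurable (borel \<Otimes>\<^sub>M M)"
    "(\<lambda>\<omega>. \<integral>\<^sup>+s\<in>{0..t}. ennreal ((H s \<omega> - G s \<omega>)\<^sup>2) \<partial>lborel) \<in> borel_measurable M"
    "(\<lambda>s. (\<integral>\<^sup>+\<omega>. ennreal ((H s \<omega> - G s \<omega>)\<^sup>2) \<partial>M) * indicator {0..t} s) \<in> borel_measurable borel"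
proof -
  define H' where "H' = (\<lambda>(s, \<omega>). indicator {0..T} s * H s \<omega>)"
  have [measurable]: "H' \<in> borel_measurable (borel \<Otimes>\<^sub>M M)" using assms(1) unfolding H'_def .
  have eq: "ennreal ((H s \<omega> - G s \<omega>)\<^sup>2) * indicator {0..t} s = ennreal ((H' (s, \<omega>) - G s \<omega>)\<^sup>2) * indicator {0..t} s" for s \<omega>
    using assms(2) by (auto simp: H'_def indicator_def)
  have m: "(\<lambda>(s, \<omega>). ennreal ((H' (s, \<omega>) - G s \<omega>)\<^sup>2) * indicator {0..t} s) \<in> borel_measurable (borel \<Otimes>\<^sub>M M)"
    by measurable
  show 2: "(\<lambda>(s, \<omega>). ennreal ((H s \<omega> - G s \<omega>)\<^sup>2) * indicator {0..t} s) \<in> borel_measurable (borel \<Otimes>\<^sub>M M)"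
    unfolding eq by (rule m)
  interpret pair_sigma_finite "lborel :: real measure" M by unfold_locales
  have i: "(\<integral>\<^sup>+\<omega>. ennreal ((H s \<omega> - G s \<omega>)\<^sup>2) * indicator {0..t} s \<partial>M) = (\<integral>\<^sup>+\<omega>. ennreal ((H s \<omega> - G s \<omega>)\<^sup>2) \<partial>M) * indicator {0..t} s" for s
    by (auto simp: indicator_def)
  from m have m': "(\<lambda>(s, \<omega>). ennreal ((H' (s, \<omega>) - G s \<omega>)\<^sup>2) * indicator {0..t} s) \<in> borel_measurable (lborel \<Otimes>\<^sub>M M)"
    by simp
  from Fubini'[OF this] show ?Fub unfolding eq[symmetric] i .
  show "(\<lambda>\<omega>. \<integral>\<^sup>+s\<in>{0..t}. ennreal ((H s \<omega> - G s \<omega>)\<^sup>2) \<partial>lborel) \<in> borel_measurable M"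
    unfolding eq by measurable
  show "(\<lambda>s. (\<integral>\<^sup>+\<omega>. ennreal ((H s \<omega> - G s \<omega>)\<^sup>2) \<partial>M) * indicator {0..t} s) \<in> borel_measurable borel"
    unfolding i[symmetric] eq by measurable
qed

lemma (in brownian) simple_family_diff:
  assumes "simple_family M F W K a b \<eta>" "simple_family M F W K' a' b' \<eta>'" and t: "t \<ge> 0"
  shows "(\<integral>\<^sup>+\<omega>. ennreal ((simple_family.S W K a b \<eta> t \<omega> - simple_family.S W K' a' b' \<eta>' t \<omega>)\<^sup>2) \<partial>M)
    = (\<integral>\<^sup>+\<omega>. (\<integral>\<^sup>+s\<in>{0..t}. ennreal ((simple_family.Sv K a b \<eta> s \<omega> - simple_family.Sv K' a' b' \<eta>' s \<omega>)\<^sup>2) \<partial>lborel) \<partial>M)"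
proof -
  note f = assms(1) and f' = assms(2)
  \<comment> \<open>The two families are put side by side over the disjoint sum of their index sets,
    the second one with opposite sign.\<close>
  let ?a = "case_sum a a'" and ?b = "case_sum b b'" and ?\<eta> = "case_sum \<eta> (\<lambda>k \<omega>. - \<eta>' k \<omega>)"
  have d: "simple_family M F W (K <+> K') ?a ?b ?\<eta>"
  proof (intro simple_family.intro simple_family_axioms.intro brownian_axioms)
    show "finite (K <+> K')" using simple_family.finite_K[OF f] simple_family.finite_K[OF f'] by simp
    fix k assume k: "k \<in> K <+> K'"
    show "0 \<le> ?a k \<and> ?a k \<le> ?b k" "?\<eta> k \<in> borel_measurable (F (?a k))" "integrable M (\<lambda>\<omega>. (?\<eta> k \<omega>)\<^sup>2)"
      using k simple_family.ab[OF f] simple_family.ab[OF f'] simple_family.\<eta>_F[OF f] simple_family.\<eta>_F[OF f']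
        simple_family.\<eta>_square[OF f] simple_family.\<eta>_square[OF f'] by auto
  qed
  have fin: "finite K" "finite K'" using simple_family.finite_K[OF f] simple_family.finite_K[OF f'] by auto
  have S: "simple_family.S W (K <+> K') ?a ?b ?\<eta> t \<omega> = simple_family.S W K a b \<eta> t \<omega> - simple_family.S W K' a' b' \<eta>' t \<omega>" for \<omega>
    unfolding simple_family.S_def[OF d] simple_family.S_def[OF f] simple_family.S_def[OF f']
    using fin by (simp add: sum.Plus sum_negf)
  have V: "simple_family.Sv (K <+> K') ?a ?b ?\<eta> s \<omega> = simple_family.Sv K a b \<eta> s \<omega> - simple_family.Sv K' a' b' \<eta>' s \<omega>" for s \<omega>
    unfolding simple_family.Sv_def[OF d] simple_family.Sv_def[OF f] simple_family.Sv_def[OF f']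
    using fin by (simp add: sum.Plus sum_negf del: sum_mult_indicator)
  have neg: "simple_family.Sv (K <+> K') ?a ?b ?\<eta> s \<omega> = 0" if "s < 0" for s \<omega>
    unfolding simple_family.Sv_def[OF d] using simple_family.ab[OF d] that
    by (intro sum.neutral) (force simp: indicator_def)
  have "ennreal ((simple_family.Sv (K <+> K') ?a ?b ?\<eta> s \<omega>)\<^sup>2) * indicator {..t} s
      = ennreal ((simple_family.Sv (K <+> K') ?a ?b ?\<eta> s \<omega>)\<^sup>2) * indicator {0..t} s" for s \<omega>
    using neg[of s \<omega>] by (cases "s < 0") (auto simp: indicator_def)
  then show ?thesis
    using simple_family.isometry(1)[OF d t] unfolding S V by simp
qed

lemma (in brownian) simple_process_family:
  assumes "simple_process M F n p \<xi>"
  shows "simple_family M F W {..<n} p (\<lambda>k. p (Suc k)) \<xi>"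
proof (intro simple_family.intro simple_family_axioms.intro brownian_axioms)
  show "finite {..<n}" by simp
  have p: "0 \<le> p 0" "\<And>k. k < n \<Longrightarrow> p k \<le> p (Suc k)"
    "\<And>k. k < n \<Longrightarrow> \<xi> k \<in> borel_measurable (F (p k))" "\<And>k. k < n \<Longrightarrow> bounded (\<xi> k ` space M)"
    using assms unfolding simple_process_def by auto
  have p0: "k < n \<Longrightarrow> 0 \<le> p k" for k
  proof (induction k)
    case (Suc k)
    then show ?case using p(2)[of k] by simp
  qed (use p in simp)
  fix k assume k: "k \<in> {..<n}"
  then show "0 \<le> p k \<and> p k \<le> p (Suc k)" using p p0 by auto
  show m: "\<xi> k \<in> borel_measurable (F (p k))" using k p by auto
  have [measurable]: "\<xi> k \<in> borel_measurable M" using m by (rule measurable_F_M)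
  obtain B where B: "\<And>\<omega>. \<omega> \<in> space M \<Longrightarrow> \<bar>\<xi> k \<omega>\<bar> \<le> B"
    using p(4)[of k] k by (auto simp: bounded_iff)
  show "integrable M (\<lambda>\<omega>. (\<xi> k \<omega>)\<^sup>2)"
  proof (rule integrable_const_bound[of _ "B\<^sup>2"])
    show "AE \<omega> in M. norm ((\<xi> k \<omega>)\<^sup>2) \<le> B\<^sup>2"
    proof (rule AE_I2)
      fix \<omega> assume "\<omega> \<in> space M"
      then have "\<bar>\<xi> k \<omega>\<bar> \<le> \<bar>B\<bar>" using B[of \<omega>] by simp
      then show "norm ((\<xi> k \<omega>)\<^sup>2) \<le> B\<^sup>2" by (simp add: abs_le_square_iff)
    qed
  qed simp
qed

lemma square_diff_le: "(x - z)\<^sup>2 \<le> 2 * (x - y)\<^sup>2 + 2 * (y - z :: real)\<^sup>2"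
  using square_add_le[of "x - y" "y - z"] by simp

lemma ennreal_square_diff_le:
  "ennreal ((x - z)\<^sup>2) \<le> 2 * ennreal ((x - y)\<^sup>2) + 2 * ennreal ((y - z)\<^sup>2)"
proof -
  have "ennreal ((x - z)\<^sup>2) \<le> ennreal (2 * (x - y)\<^sup>2 + 2 * (y - z)\<^sup>2)"
    by (intro ennreal_leI square_diff_le)
  also have "\<dots> = 2 * ennreal ((x - y)\<^sup>2) + 2 * ennreal ((y - z)\<^sup>2)"
    by (simp add: ennreal_mult)
  finally show ?thesis .
qed

text \<open>Measurability in the completion is what the definition of the Ito integral offers; the
  integrals with respect to \<open>M\<close> and to its completion agree.\<close>

lemma nn_integral_square_diff_le:
  assumes [measurable]: "X \<in> borel_measurable (completion M)" "Y \<in> borel_measurable (completion M)" "Z \<in> borel_measurable (completion M)"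
  shows "(\<integral>\<^sup>+\<omega>. ennreal ((X \<omega> - Z \<omega>)\<^sup>2) \<partial>M) \<le> 2 * (\<integral>\<^sup>+\<omega>. ennreal ((X \<omega> - Y \<omega>)\<^sup>2) \<partial>M) + 2 * (\<integral>\<^sup>+\<omega>. ennreal ((Y \<omega> - Z \<omega>)\<^sup>2) \<partial>M)"
proof -
  have "(\<integral>\<^sup>+\<omega>. ennreal ((X \<omega> - Z \<omega>)\<^sup>2) \<partial>M) = (\<integral>\<^sup>+\<omega>. ennreal ((X \<omega> - Z \<omega>)\<^sup>2) \<partial>completion M)"
    by (simp only: nn_integral_completion)
  also have "\<dots> \<le> (\<integral>\<^sup>+\<omega>. 2 * ennreal ((X \<omega> - Y \<omega>)\<^sup>2) + 2 * ennreal ((Y \<omega> - Z \<omega>)\<^sup>2) \<partial>completion M)"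
    by (intro nn_integral_mono ennreal_square_diff_le)
  also have "\<dots> = 2 * (\<integral>\<^sup>+\<omega>. ennreal ((X \<omega> - Y \<omega>)\<^sup>2) \<partial>completion M) + 2 * (\<integral>\<^sup>+\<omega>. ennreal ((Y \<omega> - Z \<omega>)\<^sup>2) \<partial>completion M)"
    by (simp add: nn_integral_add nn_integral_cmult)
  finally show ?thesis by (simp only: nn_integral_completion)
qed

text \<open>Pass from \<open>I\<close> to \<open>S\<close> through the j-th approximating simple
  integral, apply the isometry to the difference of the two simple integrals, and pass through
  \<open>H\<close> in the integrand. The result is \<open>2 A j + 2 (2 B j + 2 R)\<close>, where
  \<open>A j\<close> and \<open>B j\<close> vanish in the limit. Thus any simple integrand can be
  tested against \<open>I\<close>, whichever sequence witnesses the integral.\<close>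

lemma (in simple_family) ito_L2_bound:
  assumes I: "ito_integral_L2 M F W T H I" and t: "t \<in> {0..T}"
  shows "(\<integral>\<^sup>+\<omega>. ennreal ((I t \<omega> - S t \<omega>)\<^sup>2) \<partial>M)
    \<le> 4 * (\<integral>\<^sup>+\<omega>. (\<integral>\<^sup>+s\<in>{0..t}. ennreal ((H s \<omega> - Sv s \<omega>)\<^sup>2) \<partial>lborel) \<partial>M)" (is "?L \<le> 4 * ?R")
proof -
  obtain n p \<xi> where sp: "\<And>j::nat. simple_process M F (n j) (p j) (\<xi> j)"
    and H: "(\<lambda>j. \<integral>\<^sup>+\<omega>. (\<integral>\<^sup>+s\<in>{0..T}. ennreal ((H s \<omega> - simple_value (n j) (p j) (\<xi> j) s \<omega>)\<^sup>2) \<partial>lborel) \<partial>M) \<longlonglongrightarrow> 0"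
    and lim: "(\<lambda>j. \<integral>\<^sup>+\<omega>. ennreal ((I t \<omega> - simple_integral W (n j) (p j) (\<xi> j) t \<omega>)\<^sup>2) \<partial>M) \<longlonglongrightarrow> 0"
    and Im: "I t \<in> borel_measurable (completion M)" and prog: "progressive F T H"
    using I t unfolding ito_integral_L2_def by blast
  define A where "A j = (\<integral>\<^sup>+\<omega>. ennreal ((I t \<omega> - simple_integral W (n j) (p j) (\<xi> j) t \<omega>)\<^sup>2) \<partial>M)" for j
  define B where "B j = (\<integral>\<^sup>+\<omega>. (\<integral>\<^sup>+s\<in>{0..T}. ennreal ((H s \<omega> - simple_value (n j) (p j) (\<xi> j) s \<omega>)\<^sup>2) \<partial>lborel) \<partial>M)" for j
  have t0: "0 \<le> t" "t \<le> T" using t by auto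
  note pj = progressive_joint[OF prog]
  have le: "?L \<le> 2 * A j + 4 * B j + 4 * ?R" for j
  proof -
    note f = simple_process_family[OF sp[of j]]
    have Sj: "simple_family.S W {..<n j} (p j) (\<lambda>k. p j (Suc k)) (\<xi> j) t \<omega> = simple_integral W (n j) (p j) (\<xi> j) t \<omega>" for \<omega>
      unfolding simple_family.S_def[OF f] simple_integral_def ..
    have Svj: "simple_family.Sv {..<n j} (p j) (\<lambda>k. p j (Suc k)) (\<xi> j) s \<omega> = simple_value (n j) (p j) (\<xi> j) s \<omega>" for s \<omega>
      unfolding simple_family.Sv_def[OF f] simple_value_def ..
    have Svm[measurable]: "(\<lambda>(s, \<omega>). simple_value (n j) (p j) (\<xi> j) s \<omega>) \<in> borel_measurable (borel \<Otimes>\<^sub>M M)"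
      using simple_family.Sv_M[OF f] unfolding Svj .
    have Sm[measurable]: "simple_integral W (n j) (p j) (\<xi> j) t \<in> borel_measurable M"
      using simple_family.S_M[OF f t0(1)] unfolding Sj .
    have "?L \<le> 2 * A j + 2 * (\<integral>\<^sup>+\<omega>. ennreal ((simple_integral W (n j) (p j) (\<xi> j) t \<omega> - S t \<omega>)\<^sup>2) \<partial>M)"
      unfolding A_def by (rule nn_integral_square_diff_le[OF Im measurable_completion[OF Sm] measurable_completion[OF S_M[OF t0(1)]]])
    also have "(\<integral>\<^sup>+\<omega>. ennreal ((simple_integral W (n j) (p j) (\<xi> j) t \<omega> - S t \<omega>)\<^sup>2) \<partial>M)
      = (\<integral>\<^sup>+\<omega>. (\<integral>\<^sup>+s\<in>{0..t}. ennreal ((simple_value (n j) (p j) (\<xi> j) s \<omega> - Sv s \<omega>)\<^sup>2) \<partial>lborel) \<partial>M)"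
      using simple_family_diff[OF f simple_family_axioms t0(1)] unfolding Sj Svj .
    also have "\<dots> \<le> (\<integral>\<^sup>+\<omega>. 2 * (\<integral>\<^sup>+s\<in>{0..T}. ennreal ((H s \<omega> - simple_value (n j) (p j) (\<xi> j) s \<omega>)\<^sup>2) \<partial>lborel)
        + 2 * (\<integral>\<^sup>+s\<in>{0..t}. ennreal ((H s \<omega> - Sv s \<omega>)\<^sup>2) \<partial>lborel) \<partial>M)"
    proof (rule nn_integral_mono)
      fix \<omega> assume \<omega>[measurable]: "\<omega> \<in> space M"
      have mm: "(\<lambda>s. ennreal ((H s \<omega> - simple_value (n j) (p j) (\<xi> j) s \<omega>)\<^sup>2) * indicator {0..T} s) \<in> borel_measurable lborel"
        "(\<lambda>s. ennreal ((H s \<omega> - Sv s \<omega>)\<^sup>2) * indicator {0..t} s) \<in> borel_measurable lborel"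
        using measurable_compose[OF measurable_Pair2'[OF \<omega>] Fubini_square(2)[OF pj order_refl Svm]]
          measurable_compose[OF measurable_Pair2'[OF \<omega>] Fubini_square(2)[OF pj t0(2) Sv_M]] t0 by auto
      have "(\<integral>\<^sup>+s\<in>{0..t}. ennreal ((simple_value (n j) (p j) (\<xi> j) s \<omega> - Sv s \<omega>)\<^sup>2) \<partial>lborel)
        \<le> (\<integral>\<^sup>+s. 2 * (ennreal ((H s \<omega> - simple_value (n j) (p j) (\<xi> j) s \<omega>)\<^sup>2) * indicator {0..T} s)
            + 2 * (ennreal ((H s \<omega> - Sv s \<omega>)\<^sup>2) * indicator {0..t} s) \<partial>lborel)"
      proof (rule nn_integral_mono)
        fix s
        show "ennreal ((simple_value (n j) (p j) (\<xi> j) s \<omega> - Sv s \<omega>)\<^sup>2) * indicator {0..t} s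
          \<le> 2 * (ennreal ((H s \<omega> - simple_value (n j) (p j) (\<xi> j) s \<omega>)\<^sup>2) * indicator {0..T} s)
            + 2 * (ennreal ((H s \<omega> - Sv s \<omega>)\<^sup>2) * indicator {0..t} s)"
          using ennreal_square_diff_le[of "simple_value (n j) (p j) (\<xi> j) s \<omega>" "Sv s \<omega>" "H s \<omega>"] t0
          by (auto simp: indicator_def power2_commute)
      qed
      also have "\<dots> = 2 * (\<integral>\<^sup>+s\<in>{0..T}. ennreal ((H s \<omega> - simple_value (n j) (p j) (\<xi> j) s \<omega>)\<^sup>2) \<partial>lborel)
        + 2 * (\<integral>\<^sup>+s\<in>{0..t}. ennreal ((H s \<omega> - Sv s \<omega>)\<^sup>2) \<partial>lborel)"
        using mm by (subst nn_integral_add) (auto simp: nn_integral_cmult)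
      finally show "(\<integral>\<^sup>+s\<in>{0..t}. ennreal ((simple_value (n j) (p j) (\<xi> j) s \<omega> - Sv s \<omega>)\<^sup>2) \<partial>lborel)
        \<le> 2 * (\<integral>\<^sup>+s\<in>{0..T}. ennreal ((H s \<omega> - simple_value (n j) (p j) (\<xi> j) s \<omega>)\<^sup>2) \<partial>lborel)
        + 2 * (\<integral>\<^sup>+s\<in>{0..t}. ennreal ((H s \<omega> - Sv s \<omega>)\<^sup>2) \<partial>lborel)" .
    qed
    also have "\<dots> = 2 * B j + 2 * ?R"
      unfolding B_def using Fubini_square(3)[OF pj order_refl Svm] Fubini_square(3)[OF pj t0(2) Sv_M] t0
      by (subst nn_integral_add) (auto simp: nn_integral_cmult)
    finally have "?L \<le> 2 * A j + 2 * (2 * B j + 2 * ?R)" by (simp add: add_left_mono mult_left_mono)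
    also have "\<dots> = 2 * A j + 4 * B j + 4 * ?R" by (simp add: distrib_left add.assoc flip: mult.assoc)
    finally show ?thesis .
  qed
  have "(\<lambda>j. 2 * A j + 4 * B j + 4 * ?R) \<longlonglongrightarrow> 2 * 0 + 4 * 0 + 4 * ?R"
    using H lim unfolding A_def[symmetric] B_def[symmetric]
    by (intro tendsto_intros ennreal_tendsto_cmult) auto
  then show ?thesis using le by (intro LIMSEQ_le_const[of "\<lambda>j. 2 * A j + 4 * B j + 4 * ?R"]) auto
qed

text \<open>Localization is removed by Fatou's lemma along the localizing sequence.\<close>

lemma (in simple_family) ito_bound:
  assumes I: "ito_integral M F W T H I" and t: "t \<in> {0..T}"
  shows "(\<integral>\<^sup>+\<omega>. ennreal ((I t \<omega> - S t \<omega>)\<^sup>2) \<partial>M)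
    \<le> 4 * (\<integral>\<^sup>+s\<in>{0..t}. (\<integral>\<^sup>+\<omega>. ennreal ((H s \<omega> - Sv s \<omega>)\<^sup>2) \<partial>M) \<partial>lborel)"
proof -
  obtain \<tau> where st: "\<And>n::nat. stopping_time F (\<tau> n)" and pos: "\<And>n \<omega>. \<omega> \<in> space M \<Longrightarrow> 0 \<le> \<tau> n \<omega>"
    and ev: "AE \<omega> in M. incseq (\<lambda>n. \<tau> n \<omega>) \<and> (\<forall>\<^sub>F n in sequentially. T \<le> \<tau> n \<omega>)"
    and L2: "\<And>n. ito_integral_L2 M F W T (\<lambda>s \<omega>. if s \<le> \<tau> n \<omega> then H s \<omega> else 0) (\<lambda>t \<omega>. I (min t (\<tau> n \<omega>)) \<omega>)"
    and prog: "progressive F T H"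
    using I unfolding ito_integral_def by blast
  have t0: "0 \<le> t" "t \<le> T" using t by auto
  note pj = progressive_joint[OF prog]
  have [measurable]: "\<tau> n \<in> borel_measurable M" for n
    using measurable_stopping_time[OF st sets_F space_F] .
  \<comment> \<open>\<open>H\<close> is cut at \<open>\<tau> n\<close> while the simple integrand is
    not. On the event \<open>\<tau> n < T\<close> this costs at most \<open>Q\<close>, which is
    integrable by the isometry, so the cost \<open>q n\<close> vanishes by dominated
    convergence.\<close>
  define Q where "Q \<omega> = (\<integral>\<^sup>+s\<in>{..t}. ennreal ((Sv s \<omega>)\<^sup>2) \<partial>lborel)" for \<omega>
  have Qm[measurable]: "Q \<in> borel_measurable M" unfolding Q_def[abs_def] by measurable
  have Qfin: "(\<integral>\<^sup>+\<omega>. Q \<omega> \<partial>M) < \<infinity>"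
    unfolding Q_def isometry(1)[OF t0(1), symmetric] using isometry(2)[OF t0(1)] by (simp add: nn_integral_eq_integral)
  define R where "R \<omega> = (\<integral>\<^sup>+s\<in>{0..t}. ennreal ((H s \<omega> - Sv s \<omega>)\<^sup>2) \<partial>lborel)" for \<omega>
  have Rm[measurable]: "R \<in> borel_measurable M"
    using Fubini_square(3)[OF pj t0(2) Sv_M] t0 unfolding R_def by auto
  define q where "q n = (\<integral>\<^sup>+\<omega>. Q \<omega> * indicator {\<omega>. \<tau> n \<omega> < T} \<omega> \<partial>M)" for n
  have qlim: "q \<longlonglongrightarrow> 0"
  proof -
    have "(\<lambda>n. \<integral>\<^sup>+\<omega>. Q \<omega> * indicator {\<omega>. \<tau> n \<omega> < T} \<omega> \<partial>M) \<longlonglongrightarrow> (\<integral>\<^sup>+\<omega>. 0 \<partial>M)"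
    proof (rule nn_integral_dominated_convergence[where w = Q and u' = "\<lambda>\<omega>. 0"])
      show "AE \<omega> in M. (\<lambda>n. Q \<omega> * indicator {\<omega>. \<tau> n \<omega> < T} \<omega>) \<longlonglongrightarrow> 0"
        using ev
      proof eventually_elim
        case (elim \<omega>)
        then have "\<forall>\<^sub>F n in sequentially. T \<le> \<tau> n \<omega>" by simp
        then have "\<forall>\<^sub>F n in sequentially. Q \<omega> * indicator {\<omega>. \<tau> n \<omega> < T} \<omega> = 0"
          by (rule eventually_mono) (simp add: indicator_def)
        then show ?case by (rule tendsto_eventually)
      qed
    qed (use Qfin in \<open>auto simp: indicator_def\<close>)
    then show ?thesis unfolding q_def[abs_def] by simp
  qed
  have Anle: "(\<integral>\<^sup>+\<omega>. ennreal ((I (min t (\<tau> n \<omega>)) \<omega> - S t \<omega>)\<^sup>2) \<partial>M) \<le> 4 * (\<integral>\<^sup>+\<omega>. R \<omega> \<partial>M) + 4 * q n" for n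
  proof -
    have "(\<integral>\<^sup>+\<omega>. ennreal ((I (min t (\<tau> n \<omega>)) \<omega> - S t \<omega>)\<^sup>2) \<partial>M)
      \<le> 4 * (\<integral>\<^sup>+\<omega>. (\<integral>\<^sup>+s\<in>{0..t}. ennreal (((if s \<le> \<tau> n \<omega> then H s \<omega> else 0) - Sv s \<omega>)\<^sup>2) \<partial>lborel) \<partial>M)"
      by (rule ito_L2_bound[OF L2 t])
    also have "(\<integral>\<^sup>+\<omega>. (\<integral>\<^sup>+s\<in>{0..t}. ennreal (((if s \<le> \<tau> n \<omega> then H s \<omega> else 0) - Sv s \<omega>)\<^sup>2) \<partial>lborel) \<partial>M)
      \<le> (\<integral>\<^sup>+\<omega>. R \<omega> + Q \<omega> * indicator {\<omega>. \<tau> n \<omega> < T} \<omega> \<partial>M)"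
    proof (rule nn_integral_mono)
      fix \<omega> assume \<omega>: "\<omega> \<in> space M"
      show "(\<integral>\<^sup>+s\<in>{0..t}. ennreal (((if s \<le> \<tau> n \<omega> then H s \<omega> else 0) - Sv s \<omega>)\<^sup>2) \<partial>lborel)
        \<le> R \<omega> + Q \<omega> * indicator {\<omega>. \<tau> n \<omega> < T} \<omega>"
      proof (cases "\<tau> n \<omega> < T")
        case False
        then have "(\<integral>\<^sup>+s\<in>{0..t}. ennreal (((if s \<le> \<tau> n \<omega> then H s \<omega> else 0) - Sv s \<omega>)\<^sup>2) \<partial>lborel) = R \<omega>"
          unfolding R_def using t0 by (intro nn_integral_cong) (auto simp: indicator_def)
        then show ?thesis by simp
      next
        case True
        have mm: "(\<lambda>s. ennreal ((H s \<omega> - Sv s \<omega>)\<^sup>2) * indicator {0..t} s) \<in> borel_measurable lborel"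
          using measurable_compose[OF measurable_Pair2'[OF \<omega>] Fubini_square(2)[OF pj t0(2) Sv_M]] t0 by auto
        have mm2: "(\<lambda>s. ennreal ((Sv s \<omega>)\<^sup>2) * indicator {..t} s) \<in> borel_measurable lborel"
          unfolding Sv_def by measurable
        have "(\<integral>\<^sup>+s\<in>{0..t}. ennreal (((if s \<le> \<tau> n \<omega> then H s \<omega> else 0) - Sv s \<omega>)\<^sup>2) \<partial>lborel)
          \<le> (\<integral>\<^sup>+s. ennreal ((H s \<omega> - Sv s \<omega>)\<^sup>2) * indicator {0..t} s + ennreal ((Sv s \<omega>)\<^sup>2) * indicator {..t} s \<partial>lborel)"
          by (intro nn_integral_mono) (auto simp: indicator_def)
        also have "\<dots> = R \<omega> + Q \<omega>" unfolding R_def Q_def using mm mm2 by (rule nn_integral_add)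
        finally show ?thesis using True by simp
      qed
    qed
    also have "\<dots> = (\<integral>\<^sup>+\<omega>. R \<omega> \<partial>M) + q n" unfolding q_def by (rule nn_integral_add) auto
    finally show ?thesis by (simp add: distrib_left mult_left_mono)
  qed
  have m: "(\<lambda>\<omega>. ennreal ((I (min t (\<tau> n \<omega>)) \<omega> - S t \<omega>)\<^sup>2)) \<in> borel_measurable (completion M)" for n
  proof -
    have "(\<lambda>\<omega>. I (min t (\<tau> n \<omega>)) \<omega>) \<in> borel_measurable (completion M)"
      using L2[of n] t unfolding ito_integral_L2_def by blast
    moreover have "S t \<in> borel_measurable (completion M)" using S_M[OF t0(1)] by (rule measurable_completion)
    ultimately show ?thesis by measurable
  qed
  have "(\<integral>\<^sup>+\<omega>. ennreal ((I t \<omega> - S t \<omega>)\<^sup>2) \<partial>M) = (\<integral>\<^sup>+\<omega>. liminf (\<lambda>n. ennreal ((I (min t (\<tau> n \<omega>)) \<omega> - S t \<omega>)\<^sup>2)) \<partial>M)"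
  proof (rule nn_integral_cong_AE, use ev in eventually_elim)
    case (elim \<omega>)
    then have "\<forall>\<^sub>F n in sequentially. T \<le> \<tau> n \<omega>" by simp
    then have "\<forall>\<^sub>F n in sequentially. ennreal ((I (min t (\<tau> n \<omega>)) \<omega> - S t \<omega>)\<^sup>2) = ennreal ((I t \<omega> - S t \<omega>)\<^sup>2)"
      by (rule eventually_mono) (use t0 in \<open>simp add: min_absorb1\<close>)
    then have "(\<lambda>n. ennreal ((I (min t (\<tau> n \<omega>)) \<omega> - S t \<omega>)\<^sup>2)) \<longlonglongrightarrow> ennreal ((I t \<omega> - S t \<omega>)\<^sup>2)"
      by (rule tendsto_eventually)
    then show ?case by (intro lim_imp_Liminf[symmetric]) auto
  qed
  also have "\<dots> = (\<integral>\<^sup>+\<omega>. liminf (\<lambda>n. ennreal ((I (min t (\<tau> n \<omega>)) \<omega> - S t \<omega>)\<^sup>2)) \<partial>completion M)"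
    by (simp only: nn_integral_completion)
  also have "\<dots> \<le> liminf (\<lambda>n. \<integral>\<^sup>+\<omega>. ennreal ((I (min t (\<tau> n \<omega>)) \<omega> - S t \<omega>)\<^sup>2) \<partial>completion M)"
    using m by (rule nn_integral_liminf)
  also have "\<dots> = liminf (\<lambda>n. \<integral>\<^sup>+\<omega>. ennreal ((I (min t (\<tau> n \<omega>)) \<omega> - S t \<omega>)\<^sup>2) \<partial>M)"
    by (simp only: nn_integral_completion)
  also have "\<dots> \<le> liminf (\<lambda>n. 4 * (\<integral>\<^sup>+\<omega>. R \<omega> \<partial>M) + 4 * q n)"
    using Anle by (intro Liminf_mono always_eventually) auto
  also have "\<dots> = 4 * (\<integral>\<^sup>+\<omega>. R \<omega> \<partial>M)"
  proof -
    have "(\<lambda>n. 4 * (\<integral>\<^sup>+\<omega>. R \<omega> \<partial>M) + 4 * q n) \<longlonglongrightarrow> 4 * (\<integral>\<^sup>+\<omega>. R \<omega> \<partial>M) + 4 * 0"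
      using qlim by (intro tendsto_intros ennreal_tendsto_cmult) auto
    then show ?thesis by (intro lim_imp_Liminf) auto
  qed
  finally show ?thesis unfolding R_def using Fubini_square(1)[OF pj t0(2) Sv_M] t0 by simp
qed

lemma (in brownian) simple_family_empty: "simple_family M F W {} a b \<eta>"
  by (intro simple_family.intro simple_family_axioms.intro brownian_axioms) auto

text \<open>Comparison with the empty simple family leaves a one-sided isometry with constant
  4.\<close>

lemma (in brownian) ito_L2_bound_0:
  assumes "ito_integral_L2 M F W T H I" "t \<in> {0..T}"
  shows "(\<integral>\<^sup>+\<omega>. ennreal ((I t \<omega>)\<^sup>2) \<partial>M) \<le> 4 * (\<integral>\<^sup>+s\<in>{0..t}. (\<integral>\<^sup>+\<omega>. ennreal ((H s \<omega>)\<^sup>2) \<partial>M) \<partial>lborel)"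
proof -
  note f = simple_family_empty[where 'b = nat]
  have prog: "progressive F T H" using assms(1) unfolding ito_integral_L2_def by blast
  have "t \<le> T" "0 \<le> T" using assms(2) by auto
  from simple_family.ito_L2_bound[OF f assms] Fubini_square(1)[OF progressive_joint[OF prog this(2)] this(1), of "\<lambda>_ _. 0"]
  show ?thesis unfolding simple_family.S_def[OF f] simple_family.Sv_def[OF f] by simp
qed

text \<open>Some simple integrand lies within mean-square distance 1 of \<open>H\<close> and has
  finite norm itself. This is the a priori finiteness that Gronwall's inequality asks for.\<close>

lemma (in brownian) ito_L2_finite:
  assumes I: "ito_integral_L2 M F W T H I" and T: "0 \<le> T"
  shows "(\<integral>\<^sup>+s\<in>{0..T}. (\<integral>\<^sup>+\<omega>. ennreal ((H s \<omega>)\<^sup>2) \<partial>M) \<partial>lborel) < \<infinity>"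
proof -
  obtain n p \<xi> where sp: "\<And>j::nat. simple_process M F (n j) (p j) (\<xi> j)"
    and H: "(\<lambda>j. \<integral>\<^sup>+\<omega>. (\<integral>\<^sup>+s\<in>{0..T}. ennreal ((H s \<omega> - simple_value (n j) (p j) (\<xi> j) s \<omega>)\<^sup>2) \<partial>lborel) \<partial>M) \<longlonglongrightarrow> 0"
    and prog: "progressive F T H"
    using I unfolding ito_integral_L2_def by blast
  have "\<forall>\<^sub>F j in sequentially. (\<integral>\<^sup>+\<omega>. (\<integral>\<^sup>+s\<in>{0..T}. ennreal ((H s \<omega> - simple_value (n j) (p j) (\<xi> j) s \<omega>)\<^sup>2) \<partial>lborel) \<partial>M) < 1"
    by (rule order_tendstoD(2)[OF H]) simp
  then obtain j where j: "(\<integral>\<^sup>+\<omega>. (\<integral>\<^sup>+s\<in>{0..T}. ennreal ((H s \<omega> - simple_value (n j) (p j) (\<xi> j) s \<omega>)\<^sup>2) \<partial>lborel) \<partial>M) < 1"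
    by (auto simp: eventually_sequentially)
  note f = simple_process_family[OF sp[of j]]
  have Svj: "simple_family.Sv {..<n j} (p j) (\<lambda>k. p j (Suc k)) (\<xi> j) s \<omega> = simple_value (n j) (p j) (\<xi> j) s \<omega>" for s \<omega>
    unfolding simple_family.Sv_def[OF f] simple_value_def ..
  have Svm[measurable]: "(\<lambda>(s, \<omega>). simple_value (n j) (p j) (\<xi> j) s \<omega>) \<in> borel_measurable (borel \<Otimes>\<^sub>M M)"
    using simple_family.Sv_M[OF f] unfolding Svj .
  note pj = progressive_joint[OF prog T]
  have fin: "(\<integral>\<^sup>+\<omega>. (\<integral>\<^sup>+s\<in>{..T}. ennreal ((simple_value (n j) (p j) (\<xi> j) s \<omega>)\<^sup>2) \<partial>lborel) \<partial>M) < \<infinity>"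
    unfolding Svj[symmetric] simple_family.isometry(1)[OF f T, symmetric]
    using simple_family.isometry(2)[OF f T] by (simp add: nn_integral_eq_integral)
  have "(\<integral>\<^sup>+\<omega>. (\<integral>\<^sup>+s\<in>{0..T}. ennreal ((H s \<omega> - 0)\<^sup>2) \<partial>lborel) \<partial>M)
    \<le> (\<integral>\<^sup>+\<omega>. 2 * (\<integral>\<^sup>+s\<in>{0..T}. ennreal ((H s \<omega> - simple_value (n j) (p j) (\<xi> j) s \<omega>)\<^sup>2) \<partial>lborel)
        + 2 * (\<integral>\<^sup>+s\<in>{..T}. ennreal ((simple_value (n j) (p j) (\<xi> j) s \<omega>)\<^sup>2) \<partial>lborel) \<partial>M)"
  proof (rule nn_integral_mono)
    fix \<omega> assume \<omega>[measurable]: "\<omega> \<in> space M"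
    have mm: "(\<lambda>s. ennreal ((H s \<omega> - simple_value (n j) (p j) (\<xi> j) s \<omega>)\<^sup>2) * indicator {0..T} s) \<in> borel_measurable lborel"
      using measurable_compose[OF measurable_Pair2'[OF \<omega>] Fubini_square(2)[OF pj order_refl Svm]] by auto
    have mm2: "(\<lambda>s. ennreal ((simple_value (n j) (p j) (\<xi> j) s \<omega>)\<^sup>2) * indicator {..T} s) \<in> borel_measurable lborel"
      unfolding simple_value_def by measurable
    have "(\<integral>\<^sup>+s\<in>{0..T}. ennreal ((H s \<omega> - 0)\<^sup>2) \<partial>lborel)
      \<le> (\<integral>\<^sup>+s. 2 * (ennreal ((H s \<omega> - simple_value (n j) (p j) (\<xi> j) s \<omega>)\<^sup>2) * indicator {0..T} s)
        + 2 * (ennreal ((simple_value (n j) (p j) (\<xi> j) s \<omega>)\<^sup>2) * indicator {..T} s) \<partial>lborel)"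
    proof (rule nn_integral_mono)
      fix s
      show "ennreal ((H s \<omega> - 0)\<^sup>2) * indicator {0..T} s \<le> 2 * (ennreal ((H s \<omega> - simple_value (n j) (p j) (\<xi> j) s \<omega>)\<^sup>2) * indicator {0..T} s)
        + 2 * (ennreal ((simple_value (n j) (p j) (\<xi> j) s \<omega>)\<^sup>2) * indicator {..T} s)"
        using ennreal_square_diff_le[of "H s \<omega>" 0 "simple_value (n j) (p j) (\<xi> j) s \<omega>"]
        by (auto simp: indicator_def)
    qed
    also have "\<dots> = 2 * (\<integral>\<^sup>+s\<in>{0..T}. ennreal ((H s \<omega> - simple_value (n j) (p j) (\<xi> j) s \<omega>)\<^sup>2) \<partial>lborel)
        + 2 * (\<integral>\<^sup>+s\<in>{..T}. ennreal ((simple_value (n j) (p j) (\<xi> j) s \<omega>)\<^sup>2) \<partial>lborel)"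
      using mm mm2 by (subst nn_integral_add) (auto simp: nn_integral_cmult)
    finally show "(\<integral>\<^sup>+s\<in>{0..T}. ennreal ((H s \<omega> - 0)\<^sup>2) \<partial>lborel) \<le> 2 * (\<integral>\<^sup>+s\<in>{0..T}. ennreal ((H s \<omega> - simple_value (n j) (p j) (\<xi> j) s \<omega>)\<^sup>2) \<partial>lborel)
        + 2 * (\<integral>\<^sup>+s\<in>{..T}. ennreal ((simple_value (n j) (p j) (\<xi> j) s \<omega>)\<^sup>2) \<partial>lborel)" .
  qed
  also have "\<dots> = 2 * (\<integral>\<^sup>+\<omega>. (\<integral>\<^sup>+s\<in>{0..T}. ennreal ((H s \<omega> - simple_value (n j) (p j) (\<xi> j) s \<omega>)\<^sup>2) \<partial>lborel) \<partial>M)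
     + 2 * (\<integral>\<^sup>+\<omega>. (\<integral>\<^sup>+s\<in>{..T}. ennreal ((simple_value (n j) (p j) (\<xi> j) s \<omega>)\<^sup>2) \<partial>lborel) \<partial>M)"
    using Fubini_square(3)[OF pj order_refl Svm] by (subst nn_integral_add) (auto simp: nn_integral_cmult)
  also have "\<dots> < \<infinity>"
    using fin order_less_trans[OF j ennreal_one_less_top] by (auto simp: ennreal_mult_less_top)
  finally show ?thesis using Fubini_square(1)[OF pj order_refl, of "\<lambda>_ _. 0"] by simp
qed

section \<open>The linear equation\<close>

abbreviation linear_sde :: "'a measure \<Rightarrow> (real \<Rightarrow> 'a measure) \<Rightarrow> (real \<Rightarrow> 'a \<Rightarrow> real) \<Rightarrow> real \<Rightarrow> (real \<Rightarrow> real) \<Rightarrow>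
    (real \<Rightarrow> 'a \<Rightarrow> real) \<Rightarrow> bool" where
  "linear_sde M F W T h Z \<equiv> ito_process M F W T 1 (\<lambda>t \<omega>. 0) (\<lambda>t \<omega>. h t * Z t \<omega>) Z"

text \<open>Restriction to nonnegative times places the path in the product space over
  \<open>{0..}\<close>, where the laws of different Brownian motions are compared.\<close>

abbreviation (input) path :: "(real \<Rightarrow> 'a \<Rightarrow> real) \<Rightarrow> 'a \<Rightarrow> real \<Rightarrow> real" where
  "path W \<omega> \<equiv> \<lambda>s\<in>{0..}. W s \<omega>"

locale l2_function =
  fixes T :: real and h :: "real \<Rightarrow> real"
  assumes T: "0 \<le> T" and hm: "set_borel_measurable lborel {0..T} h"
    and h2: "set_integrable lborel {0..T} (\<lambda>t. (h t)\<^sup>2)"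
begin

definition nh :: real where "nh = (LBINT t:{0..T}. (h t)\<^sup>2)"

lemma hm'[measurable]: "(\<lambda>s. indicator {0..T} s * h s) \<in> borel_measurable borel"
  using hm unfolding set_borel_measurable_def by simp

lemma h_square_measurable[measurable]: "(\<lambda>s. ennreal ((h s)\<^sup>2) * indicator {0..T} s) \<in> borel_measurable borel"
proof -
  have "(\<lambda>s. ennreal ((h s)\<^sup>2) * indicator {0..T} s) = (\<lambda>s. ennreal ((indicator {0..T} s * h s)\<^sup>2))"
    by (auto simp: indicator_def)
  then show ?thesis by simp
qed

lemma nh: "(\<integral>\<^sup>+s\<in>{0..T}. ennreal ((h s)\<^sup>2) \<partial>lborel) = ennreal nh" "0 \<le> nh"
proof -
  have "ennreal nh = (\<integral>\<^sup>+s. ennreal (indicator {0..T} s *\<^sub>R (h s)\<^sup>2) \<partial>lborel)"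
    unfolding nh_def set_lebesgue_integral_def
    using h2 unfolding set_integrable_def by (intro nn_integral_eq_integral[symmetric]) auto
  also have "\<dots> = (\<integral>\<^sup>+s\<in>{0..T}. ennreal ((h s)\<^sup>2) \<partial>lborel)"
    by (intro nn_integral_cong) (auto simp: indicator_def)
  finally show "(\<integral>\<^sup>+s\<in>{0..T}. ennreal ((h s)\<^sup>2) \<partial>lborel) = ennreal nh" by simp
  show "0 \<le> nh" unfolding nh_def set_lebesgue_integral_def by (intro integral_nonneg_AE) auto
qed

text \<open>\<open>h\<close> is controlled on \<open>{0..T}\<close> only, so the weight is cut off
  there; a function given on \<open>{0..t}\<close> is extended by 0 beyond \<open>t\<close>, where
  the inequality is trivial. The local form is needed because the Euler scheme lives on a grid of
  \<open>{0..t}\<close> that changes with \<open>t\<close>, while the constant must not.\<close>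

lemma gronwall_h:
  fixes c :: real
  assumes "0 \<le> c"
  shows "\<exists>C\<ge>0. \<forall>t\<in>{0..T}. \<forall>A \<phi>. (\<exists>B<\<infinity>. \<forall>s\<in>{0..t}. \<phi> s \<le> B) \<longrightarrow>
    (\<forall>r\<in>{0..t}. \<phi> r \<le> A + (\<integral>\<^sup>+s\<in>{0..r}. ennreal (c * (h s)\<^sup>2) * \<phi> s \<partial>lborel)) \<longrightarrow> \<phi> t \<le> ennreal C * A"
proof -
  define w where "w s = ennreal c * (ennreal ((h s)\<^sup>2) * indicator {0..T} s)" for s
  have [measurable]: "w \<in> borel_measurable borel" unfolding w_def[abs_def] by measurable
  have "(\<integral>\<^sup>+s\<in>{0..T}. w s \<partial>lborel) = (\<integral>\<^sup>+s. ennreal c * (ennreal ((h s)\<^sup>2) * indicator {0..T} s) \<partial>lborel)"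
    unfolding w_def by (intro nn_integral_cong) (auto simp: indicator_def)
  also have "\<dots> < \<infinity>" using nh(1) by (subst nn_integral_cmult) (auto simp: ennreal_mult_less_top)
  finally have fin: "(\<integral>\<^sup>+s\<in>{0..T}. w s \<partial>lborel) < \<infinity>" .
  obtain C where C: "C < \<infinity>" and gr: "\<And>A \<phi> t. \<exists>B<\<infinity>. \<forall>t\<in>{0..T}. \<phi> t \<le> B \<Longrightarrow>
      \<forall>t\<in>{0..T}. \<phi> t \<le> A + (\<integral>\<^sup>+s\<in>{0..t}. w s * \<phi> s \<partial>lborel) \<Longrightarrow> t \<in> {0..T} \<Longrightarrow> \<phi> t \<le> C * A"
    using gronwall_nn[of w T] fin T by (auto 5 5)
  obtain C' where C': "C = ennreal C'" "0 \<le> C'" using C by (cases C) auto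
  have "\<phi> t \<le> ennreal C' * A" if t: "t \<in> {0..T}" and b: "\<exists>B<\<infinity>. \<forall>s\<in>{0..t}. \<phi> s \<le> B"
    and le: "\<forall>r\<in>{0..t}. \<phi> r \<le> A + (\<integral>\<^sup>+s\<in>{0..r}. ennreal (c * (h s)\<^sup>2) * \<phi> s \<partial>lborel)" for t A \<phi>
  proof -
    define \<psi> where "\<psi> s = (if s \<le> t then \<phi> s else 0)" for s
    have "\<psi> t \<le> C * A"
    proof (rule gr)
      show "\<exists>B<\<infinity>. \<forall>s\<in>{0..T}. \<psi> s \<le> B" using b unfolding \<psi>_def by auto
      show "\<forall>r\<in>{0..T}. \<psi> r \<le> A + (\<integral>\<^sup>+s\<in>{0..r}. w s * \<psi> s \<partial>lborel)"
      proof
        fix r assume r: "r \<in> {0..T}"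
        show "\<psi> r \<le> A + (\<integral>\<^sup>+s\<in>{0..r}. w s * \<psi> s \<partial>lborel)"
        proof (cases "r \<le> t")
          case True
          have "(\<integral>\<^sup>+s\<in>{0..r}. ennreal (c * (h s)\<^sup>2) * \<phi> s \<partial>lborel) = (\<integral>\<^sup>+s\<in>{0..r}. w s * \<psi> s \<partial>lborel)"
            using True r assms unfolding w_def \<psi>_def by (intro nn_integral_cong) (auto simp: indicator_def ennreal_mult)
          moreover have "\<phi> r \<le> A + (\<integral>\<^sup>+s\<in>{0..r}. ennreal (c * (h s)\<^sup>2) * \<phi> s \<partial>lborel)"
            using le True r by simp
          ultimately show ?thesis using True by (simp add: \<psi>_def[of r])
        qed (simp add: \<psi>_def)
      qed
    qed fact
    then show ?thesis unfolding C' \<psi>_def by simp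
  qed
  then show ?thesis using C' by blast
qed

end

section \<open>Second moments of the linear equation\<close>

lemma (in brownian) linear_sde_rep:
  assumes "linear_sde M F W T h Z"
  obtains I where "ito_integral M F W T (\<lambda>t \<omega>. h t * Z t \<omega>) I" "AE \<omega> in M. \<forall>t\<in>{0..T}. Z t \<omega> = 1 + I t \<omega>"
    "\<And>t. t \<in> {0..T} \<Longrightarrow> Z t \<in> borel_measurable M"
proof -
  obtain I where I: "ito_integral M F W T (\<lambda>t \<omega>. h t * Z t \<omega>) I"
    and Z: "AE \<omega> in M. \<forall>t\<in>{0..T}. Z t \<omega> = 1 + (LBINT s:{0..t}. 0) + I t \<omega>"
    and m: "\<forall>t\<in>{0..T}. Z t \<in> borel_measurable (F t)"
    using assms unfolding ito_process_def by blast
  show thesis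
  proof (rule that[OF I])
    show "AE \<omega> in M. \<forall>t\<in>{0..T}. Z t \<omega> = 1 + I t \<omega>"
      using Z by (simp add: set_lebesgue_integral_def)
    show "Z t \<in> borel_measurable M" if "t \<in> {0..T}" for t
      using m that measurable_F_M by blast
  qed
qed

lemma ennreal_square_add_le: "ennreal ((x + y)\<^sup>2) \<le> 2 * ennreal (x\<^sup>2) + 2 * ennreal (y\<^sup>2)"
  using ennreal_square_diff_le[of x "- y" 0] by simp

text \<open>Gronwall's inequality is applied to the stopped processes \<open>1 + J n\<close>, which
  have bounded second moments by \<open>ito_L2_finite\<close>; Fatou's lemma then removes the
  stopping. The constant is chosen before \<open>M\<close>, \<open>F\<close>, \<open>W\<close> and
  \<open>Z\<close>, so that one bound serves all copies of the equation.\<close>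

lemma (in l2_function) linear_sde_second_moment:
  "\<exists>C\<ge>0. \<forall>(M :: 'a measure) F W Z. brownian M F W \<longrightarrow> linear_sde M F W T h Z \<longrightarrow>
    (\<forall>t\<in>{0..T}. (\<integral>\<^sup>+\<omega>. ennreal ((Z t \<omega>)\<^sup>2) \<partial>M) \<le> ennreal C)"
proof -
  \<comment> \<open>8 is the factor 4 of the Ito bound, doubled by
    \<open>(1 + J)^2 \<le> 2 + 2 J^2\<close>; the same inequality supplies the source term
    2.\<close>
  obtain C where C: "0 \<le> C" and gr: "\<And>t A \<phi>. t \<in> {0..T} \<Longrightarrow> \<exists>B<\<infinity>. \<forall>s\<in>{0..t}. \<phi> s \<le> B \<Longrightarrow>
    \<forall>r\<in>{0..t}. \<phi> r \<le> A + (\<integral>\<^sup>+s\<in>{0..r}. ennreal (8 * (h s)\<^sup>2) * \<phi> s \<partial>lborel) \<Longrightarrow> \<phi> t \<le> ennreal C * A"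
    using gronwall_h[of 8] by (auto 5 5)
  have "(\<integral>\<^sup>+\<omega>. ennreal ((Z t \<omega>)\<^sup>2) \<partial>M) \<le> ennreal (C * 2)"
    if "brownian M F W" and sde: "linear_sde M F W T h Z" and t: "t \<in> {0..T}"
    for M :: "'a measure" and F W Z t
  proof -
    interpret brownian M F W by fact
    obtain I where I: "ito_integral M F W T (\<lambda>t \<omega>. h t * Z t \<omega>) I" and ZI: "AE \<omega> in M. \<forall>t\<in>{0..T}. Z t \<omega> = 1 + I t \<omega>"
      using linear_sde_rep[OF sde] by blast
    obtain \<tau> where pos: "\<And>n \<omega>. \<omega> \<in> space M \<Longrightarrow> 0 \<le> \<tau> (n::nat) \<omega>"
      and ev: "AE \<omega> in M. incseq (\<lambda>n. \<tau> n \<omega>) \<and> (\<forall>\<^sub>F n in sequentially. T \<le> \<tau> n \<omega>)"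
      and L2: "\<And>n. ito_integral_L2 M F W T (\<lambda>s \<omega>. if s \<le> \<tau> n \<omega> then h s * Z s \<omega> else 0) (\<lambda>t \<omega>. I (min t (\<tau> n \<omega>)) \<omega>)"
      using I unfolding ito_integral_def by blast
    define J where "J n s \<omega> = I (min s (\<tau> n \<omega>)) \<omega>" for n s \<omega>
    have Jm[measurable]: "s \<in> {0..T} \<Longrightarrow> J n s \<in> borel_measurable (completion M)" for n s
      using L2[of n] unfolding ito_integral_L2_def J_def by blast
    have \<phi>le: "(\<integral>\<^sup>+\<omega>. ennreal ((1 + J n r \<omega>)\<^sup>2) \<partial>M) \<le> 2 + 2 * (\<integral>\<^sup>+\<omega>. ennreal ((J n r \<omega>)\<^sup>2) \<partial>M)" if r: "r \<in> {0..T}" for n r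
    proof -
      have [measurable]: "J n r \<in> borel_measurable (completion M)" using Jm r by blast
      have one: "emeasure (completion M) (space M) = 1" using emeasure_space_1 by (simp add: main_part_sets)
      have "(\<integral>\<^sup>+\<omega>. ennreal ((1 + J n r \<omega>)\<^sup>2) \<partial>completion M) \<le> (\<integral>\<^sup>+\<omega>. 2 + 2 * ennreal ((J n r \<omega>)\<^sup>2) \<partial>completion M)"
        using ennreal_square_add_le[of 1] by (intro nn_integral_mono) simp
      also have "\<dots> = 2 + 2 * (\<integral>\<^sup>+\<omega>. ennreal ((J n r \<omega>)\<^sup>2) \<partial>completion M)"
        using one by (simp add: nn_integral_add nn_integral_cmult)
      finally show ?thesis by (simp only: nn_integral_completion)
    qed
    have \<phi>bd: "(\<integral>\<^sup>+\<omega>. ennreal ((1 + J n t \<omega>)\<^sup>2) \<partial>M) \<le> ennreal C * 2" for n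
    proof (rule gr[OF t])
      define E where "E s = (\<integral>\<^sup>+\<omega>. ennreal ((if s \<le> \<tau> n \<omega> then h s * Z s \<omega> else 0)\<^sup>2) \<partial>M)" for s
      have JE: "(\<integral>\<^sup>+\<omega>. ennreal ((J n r \<omega>)\<^sup>2) \<partial>M) \<le> 4 * (\<integral>\<^sup>+s\<in>{0..r}. E s \<partial>lborel)" if "r \<in> {0..T}" for r
        using ito_L2_bound_0[OF L2 that] unfolding J_def E_def .
      have fin: "(\<integral>\<^sup>+s\<in>{0..T}. E s \<partial>lborel) < \<infinity>"
        using ito_L2_finite[OF L2] T unfolding E_def by simp
      have bd: "(\<integral>\<^sup>+\<omega>. ennreal ((1 + J n r \<omega>)\<^sup>2) \<partial>M) \<le> 2 + 8 * (\<integral>\<^sup>+s\<in>{0..r}. E s \<partial>lborel)" if r: "r \<in> {0..T}" for r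
      proof -
        have "(\<integral>\<^sup>+\<omega>. ennreal ((1 + J n r \<omega>)\<^sup>2) \<partial>M) \<le> 2 + 2 * (4 * (\<integral>\<^sup>+s\<in>{0..r}. E s \<partial>lborel))"
          using \<phi>le[OF r] JE[OF r] by (meson add_left_mono mult_left_mono order_trans zero_le)
        then show ?thesis by (simp add: mult.assoc[symmetric])
      qed
      have mono: "(\<integral>\<^sup>+s\<in>{0..r}. E s \<partial>lborel) \<le> (\<integral>\<^sup>+s\<in>{0..T}. E s \<partial>lborel)" if "r \<le> T" for r
        using that by (intro nn_integral_mono) (auto simp: indicator_def)
      show "\<exists>B<\<infinity>. \<forall>s\<in>{0..t}. (\<integral>\<^sup>+\<omega>. ennreal ((1 + J n s \<omega>)\<^sup>2) \<partial>M) \<le> B"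
      proof (intro exI[of _ "2 + 8 * (\<integral>\<^sup>+s\<in>{0..T}. E s \<partial>lborel)"] conjI ballI)
        show "2 + 8 * (\<integral>\<^sup>+s\<in>{0..T}. E s \<partial>lborel) < \<infinity>" using fin by (auto simp: ennreal_mult_less_top)
        fix s assume "s \<in> {0..t}"
        then have s: "s \<in> {0..T}" using t by auto
        then have "8 * (\<integral>\<^sup>+s\<in>{0..s}. E s \<partial>lborel) \<le> 8 * (\<integral>\<^sup>+s\<in>{0..T}. E s \<partial>lborel)"
          using mono[of s] by (intro mult_left_mono) auto
        then show "(\<integral>\<^sup>+\<omega>. ennreal ((1 + J n s \<omega>)\<^sup>2) \<partial>M) \<le> 2 + 8 * (\<integral>\<^sup>+s\<in>{0..T}. E s \<partial>lborel)"
          using bd[OF s] by (meson add_left_mono order_trans)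
      qed
      show "\<forall>r\<in>{0..t}. (\<integral>\<^sup>+\<omega>. ennreal ((1 + J n r \<omega>)\<^sup>2) \<partial>M)
         \<le> 2 + (\<integral>\<^sup>+s\<in>{0..r}. ennreal (8 * (h s)\<^sup>2) * (\<integral>\<^sup>+\<omega>. ennreal ((1 + J n s \<omega>)\<^sup>2) \<partial>M) \<partial>lborel)"
      proof
        fix r assume "r \<in> {0..t}"
        then have r: "r \<in> {0..T}" using t by auto
        \<comment> \<open>Up to the stopping time the stopped process coincides with
          \<open>Z\<close>; afterwards the integrand is 0.\<close>
        have Ele: "E s \<le> ennreal ((h s)\<^sup>2) * (\<integral>\<^sup>+\<omega>. ennreal ((1 + J n s \<omega>)\<^sup>2) \<partial>M)" if s: "s \<in> {0..T}" for s
        proof -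
          have "E s \<le> (\<integral>\<^sup>+\<omega>. ennreal ((h s)\<^sup>2) * ennreal ((1 + J n s \<omega>)\<^sup>2) \<partial>M)"
            unfolding E_def
          proof (rule nn_integral_mono_AE, use ZI in eventually_elim)
            case (elim \<omega>)
            then have "Z s \<omega> = 1 + I s \<omega>" using s by blast
            then show ?case by (auto simp: J_def min_def power_mult_distrib ennreal_mult)
          qed
          also have "\<dots> = ennreal ((h s)\<^sup>2) * (\<integral>\<^sup>+\<omega>. ennreal ((1 + J n s \<omega>)\<^sup>2) \<partial>M)"
          proof -
            have [measurable]: "J n s \<in> borel_measurable (completion M)" using Jm[OF s] .
            have "(\<lambda>\<omega>. ennreal ((1 + J n s \<omega>)\<^sup>2)) \<in> borel_measurable (completion M)" by measurable
            from nn_integral_cmult[OF this] show ?thesis by (simp only: nn_integral_completion)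
          qed
          finally show ?thesis .
        qed
        have "8 * (\<integral>\<^sup>+s\<in>{0..r}. E s \<partial>lborel) = (\<integral>\<^sup>+s. 8 * (E s * indicator {0..r} s) \<partial>lborel)"
        proof (rule nn_integral_cmult[symmetric])
          have "progressive F T (\<lambda>s \<omega>. if s \<le> \<tau> n \<omega> then h s * Z s \<omega> else 0)"
            using L2[of n] unfolding ito_integral_L2_def by blast
          from Fubini_square(4)[OF progressive_joint[OF this T], of r "\<lambda>_ _. 0"] r
          show "(\<lambda>s. E s * indicator {0..r} s) \<in> borel_measurable lborel" unfolding E_def by simp
        qed
        also have "\<dots> \<le> (\<integral>\<^sup>+s\<in>{0..r}. ennreal (8 * (h s)\<^sup>2) * (\<integral>\<^sup>+\<omega>. ennreal ((1 + J n s \<omega>)\<^sup>2) \<partial>M) \<partial>lborel)"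
        proof (rule nn_integral_mono)
          fix s
          show "8 * (E s * indicator {0..r} s) \<le> ennreal (8 * (h s)\<^sup>2) * (\<integral>\<^sup>+\<omega>. ennreal ((1 + J n s \<omega>)\<^sup>2) \<partial>M) * indicator {0..r} s"
          proof (cases "s \<in> {0..r}")
            case True
            then have "8 * E s \<le> 8 * (ennreal ((h s)\<^sup>2) * (\<integral>\<^sup>+\<omega>. ennreal ((1 + J n s \<omega>)\<^sup>2) \<partial>M))"
              using r by (intro mult_left_mono Ele) auto
            then show ?thesis using True by (simp add: ennreal_mult mult.assoc)
          qed simp
        qed
        finally show "(\<integral>\<^sup>+\<omega>. ennreal ((1 + J n r \<omega>)\<^sup>2) \<partial>M)
         \<le> 2 + (\<integral>\<^sup>+s\<in>{0..r}. ennreal (8 * (h s)\<^sup>2) * (\<integral>\<^sup>+\<omega>. ennreal ((1 + J n s \<omega>)\<^sup>2) \<partial>M) \<partial>lborel)"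
          using bd[OF r] by (meson add_left_mono order_trans)
      qed
    qed
    have "(\<integral>\<^sup>+\<omega>. ennreal ((Z t \<omega>)\<^sup>2) \<partial>M) = (\<integral>\<^sup>+\<omega>. liminf (\<lambda>n. ennreal ((1 + J n t \<omega>)\<^sup>2)) \<partial>M)"
    proof (rule nn_integral_cong_AE, use ev ZI in eventually_elim)
      case (elim \<omega>)
      then have "\<forall>\<^sub>F n in sequentially. T \<le> \<tau> n \<omega>" by simp
      then have "\<forall>\<^sub>F n in sequentially. ennreal ((1 + J n t \<omega>)\<^sup>2) = ennreal ((Z t \<omega>)\<^sup>2)"
        by (rule eventually_mono) (use t elim in \<open>simp add: J_def min_absorb1\<close>)
      then have "(\<lambda>n. ennreal ((1 + J n t \<omega>)\<^sup>2)) \<longlonglongrightarrow> ennreal ((Z t \<omega>)\<^sup>2)" by (rule tendsto_eventually)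
      then show ?case by (intro lim_imp_Liminf[symmetric]) auto
    qed
    also have "\<dots> = (\<integral>\<^sup>+\<omega>. liminf (\<lambda>n. ennreal ((1 + J n t \<omega>)\<^sup>2)) \<partial>completion M)"
      by (simp only: nn_integral_completion)
    also have "\<dots> \<le> liminf (\<lambda>n. \<integral>\<^sup>+\<omega>. ennreal ((1 + J n t \<omega>)\<^sup>2) \<partial>completion M)"
    proof (rule nn_integral_liminf)
      fix n
      have [measurable]: "J n t \<in> borel_measurable (completion M)" using Jm[OF t] .
      show "(\<lambda>\<omega>. ennreal ((1 + J n t \<omega>)\<^sup>2)) \<in> borel_measurable (completion M)" by measurable
    qed
    also have "\<dots> = liminf (\<lambda>n. \<integral>\<^sup>+\<omega>. ennreal ((1 + J n t \<omega>)\<^sup>2) \<partial>M)"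
      by (simp only: nn_integral_completion)
    also have "\<dots> \<le> liminf (\<lambda>n. ennreal C * 2)"
      using \<phi>bd by (intro Liminf_mono always_eventually) auto
    also have "\<dots> = ennreal (C * 2)"
      using C by (simp add: Liminf_const ennreal_mult)
    finally show ?thesis .
  qed
  then show ?thesis using C by (intro exI[of _ "C * 2"]) auto
qed

section \<open>The Euler scheme of the linear equation\<close>

text \<open>\<open>zE t n \<theta> w k\<close> is the Euler scheme at the time \<open>t k / n\<close> for \<open>dZ = \<theta> Z dw\<close> along a path \<open>w\<close>;
  below, \<open>xE\<close> is the Euler scheme for \<open>dx = b(t, x, m) dt + dy\<close>.\<close>

primrec zE :: "real \<Rightarrow> nat \<Rightarrow> (nat \<Rightarrow> real) \<Rightarrow> (real \<Rightarrow> real) \<Rightarrow> nat \<Rightarrow> real" where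
  "zE t n \<theta> w 0 = 1"
| "zE t n \<theta> w (Suc k) = zE t n \<theta> w k * (1 + \<theta> k * (w (t * real (Suc k) / real n) - w (t * real k / real n)))"

lemma zE_path: "t \<ge> 0 \<Longrightarrow> zE t n \<theta> (path W \<omega>) k = zE t n \<theta> (\<lambda>s. W s \<omega>) k"
  by (induction k) (simp_all del: of_nat_Suc)

lemma zE_measurable:
  assumes "t \<ge> 0"
  shows "(\<lambda>w. zE t n \<theta> w k) \<in> borel_measurable (\<Pi>\<^sub>M s\<in>{0..}. borel)"
proof (induction k)
  case (Suc k)
  have "(\<lambda>w. w (t * real j / real n)) \<in> borel_measurable (\<Pi>\<^sub>M s\<in>{0..}. borel)" for j
    using assms by (intro measurable_component_singleton) auto
  note m = this
  show ?case unfolding zE.simps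
    by (intro borel_measurable_times borel_measurable_add borel_measurable_diff borel_measurable_const m Suc.IH)
qed simp

lemma grid_le: "0 \<le> t \<Longrightarrow> j \<le> k \<Longrightarrow> t * real j / real n \<le> t * real k / real n"
  by (intro divide_right_mono mult_left_mono) auto

lemma grid_le_end: "0 \<le> t \<Longrightarrow> j \<le> n \<Longrightarrow> t * real j / real n \<le> t"
  by (cases "n = 0") (auto simp: divide_le_eq mult_left_mono)

lemma grid_diff: "t * real (Suc k) / real n - t * real k / real n = t / real n"
  by (simp add: diff_divide_distrib[symmetric] algebra_simps)

lemma cell_unique:
  assumes "s \<in> {t * real k / real n<..t * real (Suc k) / real n}" "s \<in> {t * real j / real n<..t * real (Suc j) / real n}"
    "t \<ge> 0" "n \<ge> 1"
  shows "j = k"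
proof -
  have "t * real k / real n < t * real (Suc j) / real n" "t * real j / real n < t * real (Suc k) / real n"
    using assms(1,2) by (auto simp del: of_nat_Suc)
  then have "t * real k < t * real (Suc j)" "t * real j < t * real (Suc k)"
    using assms(4) by (auto simp: divide_less_cancel simp del: of_nat_Suc)
  then have "real k < real (Suc j)" "real j < real (Suc k)"
    using assms(3) by (metis mult_less_cancel_left not_le)+
  then show ?thesis by linarith
qed

lemma cell_exists:
  assumes "s \<in> {0<..t}" "n \<ge> 1"
  shows "\<exists>k<n. s \<in> {t * real k / real n<..t * real (Suc k) / real n}"
proof -
  have t: "t > 0" using assms by auto
  define x where "x = s * real n / t"
  have x: "x > 0" "x \<le> real n" using assms t by (auto simp: x_def field_simps)
  \<comment> \<open>Cells are open on the left and closed on the right, hence the ceiling minus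
    one.\<close>
  define k where "k = nat (\<lceil>x\<rceil> - 1)"
  have c: "\<lceil>x\<rceil> \<ge> 1" "\<lceil>x\<rceil> \<le> int n" using x by (simp_all add: ceiling_le_iff)
  have k: "real k = real_of_int \<lceil>x\<rceil> - 1" using c by (simp add: k_def)
  have "real k < x" "x \<le> real (Suc k)" using k ceiling_correct[of x] by (auto simp: of_nat_Suc)
  then have "t * real k / real n < s" "s \<le> t * real (Suc k) / real n"
    using t assms(2) by (auto simp: x_def field_simps)
  moreover have "k < n" using c unfolding k_def by linarith
  ultimately show ?thesis by auto
qed

lemma cell_sum:
  assumes "s \<in> {t * real k / real n<..t * real (Suc k) / real n}" "t \<ge> 0" "n \<ge> 1" "k < n"
  shows "(\<Sum>j<n. x j * indicator {t * real j / real n<..t * real (Suc j) / real n} s) = (x k :: real)"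
proof -
  have "(\<Sum>j<n. x j * indicator {t * real j / real n<..t * real (Suc j) / real n} s) = (\<Sum>j<n. if j = k then x k else 0)"
  proof (rule sum.cong[OF refl])
    fix j
    show "x j * indicator {t * real j / real n<..t * real (Suc j) / real n} s = (if j = k then x k else 0)"
    proof (cases "j = k")
      case True
      then show ?thesis using assms(1) by (simp only: indicator_simps if_True mult_1_right simp_thms)
    next
      case False
      then have "s \<notin> {t * real j / real n<..t * real (Suc j) / real n}"
        using cell_unique[OF assms(1) _ assms(2,3)] by blast
      then show ?thesis using False by (simp only: indicator_simps if_False mult_zero_right simp_thms)
    qed
  qed
  then show ?thesis using assms(4) by simp
qed

context brownian
begin

abbreviation zB :: "real \<Rightarrow> nat \<Rightarrow> (nat \<Rightarrow> real) \<Rightarrow> nat \<Rightarrow> 'a \<Rightarrow> real" where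
  "zB t n \<theta> k \<omega> \<equiv> zE t n \<theta> (\<lambda>s. W s \<omega>) k"

lemma zB_F:
  assumes "t \<ge> 0"
  shows "zB t n \<theta> k \<in> borel_measurable (F (t * real k / real n))"
proof (induction k)
  case (Suc k)
  have le: "t * real k / real n \<le> t * real (Suc k) / real n" by (rule grid_le) (use assms in auto)
  have 0: "0 \<le> t * real k / real n" using assms by simp
  note W_F[OF 0 le] W_F[OF order_trans[OF 0 le] order_refl] measurable_F_mono[OF le Suc]
  then show ?case unfolding zE.simps
    by (intro borel_measurable_times borel_measurable_add borel_measurable_diff borel_measurable_const)
qed simp

text \<open>The increment over a cell is independent of the past and centred, so one step multiplies
  the second moment by exactly \<open>1 + (\<theta> k)^2 t / n\<close>, which the exponential
  dominates.\<close>

lemma zB_square: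
  assumes t: "t \<ge> 0"
  shows "integrable M (\<lambda>\<omega>. (zB t n \<theta> k \<omega>)\<^sup>2)"
    "expectation (\<lambda>\<omega>. (zB t n \<theta> k \<omega>)\<^sup>2) \<le> exp (\<Sum>j<k. (\<theta> j)\<^sup>2 * (t / real n))"
proof (induction k)
  case 0
  {
    case 1 then show ?case by simp
  next
    case 2 then show ?case by (simp add: prob_space)
  }
next
  case (Suc k)
  let ?a = "t * real k / real n" and ?b = "t * real (Suc k) / real n"
  define D where "D \<omega> = W ?b \<omega> - W ?a \<omega>" for \<omega>
  have le: "?a \<le> ?b" by (rule grid_le) (use t in auto)
  have 0: "0 \<le> ?a" using t by simp
  have ba: "?b - ?a = t / real n" by (rule grid_diff)
  have m: "(\<lambda>\<omega>. (zB t n \<theta> k \<omega>)\<^sup>2) \<in> borel_measurable (F ?a)" using zB_F[OF t, of n \<theta> k] by measurable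
  note im = increment_mult[OF 0 le m Suc(1), folded D_def, unfolded ba]
  have eq: "(zB t n \<theta> (Suc k) \<omega>)\<^sup>2 = (zB t n \<theta> k \<omega>)\<^sup>2 + 2 * \<theta> k * ((zB t n \<theta> k \<omega>)\<^sup>2 * D \<omega>) + (\<theta> k)\<^sup>2 * ((zB t n \<theta> k \<omega>)\<^sup>2 * (D \<omega>)\<^sup>2)" for \<omega>
    unfolding zE.simps D_def[symmetric] by (simp add: power2_eq_square algebra_simps)
  {
    case 1 show ?case unfolding eq using im Suc(1) by simp
  next
    case 2
    have "expectation (\<lambda>\<omega>. (zB t n \<theta> (Suc k) \<omega>)\<^sup>2) = expectation (\<lambda>\<omega>. (zB t n \<theta> k \<omega>)\<^sup>2) * (1 + (\<theta> k)\<^sup>2 * (t / real n))"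
    proof -
      have "expectation (\<lambda>\<omega>. (zB t n \<theta> (Suc k) \<omega>)\<^sup>2) = expectation (\<lambda>\<omega>. (zB t n \<theta> k \<omega>)\<^sup>2) + 2 * \<theta> k * 0
          + (\<theta> k)\<^sup>2 * (expectation (\<lambda>\<omega>. (zB t n \<theta> k \<omega>)\<^sup>2) * (t / real n))"
        unfolding eq using im Suc(1) by simp
      then show ?thesis by (simp add: algebra_simps)
    qed
    also have "\<dots> \<le> exp (\<Sum>j<k. (\<theta> j)\<^sup>2 * (t / real n)) * exp ((\<theta> k)\<^sup>2 * (t / real n))"
      using Suc(2) t by (intro mult_mono) auto
    also have "\<dots> = exp (\<Sum>j<Suc k. (\<theta> j)\<^sup>2 * (t / real n))" by (simp add: exp_add)
    finally show ?case .
  }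
qed

text \<open>Exhibits the scheme as a stochastic integral: the integrand on a cell is
  \<open>\<theta> k\<close> times the value at the left node, hence known at the start of the
  cell.\<close>

lemma zB_family:
  assumes t: "t \<ge> 0"
  shows "simple_family M F W {..<n} (\<lambda>k. t * real k / real n) (\<lambda>k. t * real (Suc k) / real n) (\<lambda>k \<omega>. \<theta> k * zB t n \<theta> k \<omega>)"
proof (intro simple_family.intro simple_family_axioms.intro brownian_axioms)
  fix k
  show "0 \<le> t * real k / real n \<and> t * real k / real n \<le> t * real (Suc k) / real n"
    using grid_le[OF t, of k "Suc k" n] t by auto
  show "(\<lambda>\<omega>. \<theta> k * zB t n \<theta> k \<omega>) \<in> borel_measurable (F (t * real k / real n))"
    using zB_F[OF t, of n \<theta> k] by measurable
  show "integrable M (\<lambda>\<omega>. (\<theta> k * zB t n \<theta> k \<omega>)\<^sup>2)"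
    using zB_square(1)[OF t, of n \<theta> k] by (simp add: power_mult_distrib)
qed simp

text \<open>Once a cell has been passed, its summand is one step of the recursion, so the sum
  telescopes.\<close>

lemma zB_sum_full:
  assumes t: "t \<ge> 0" and s: "t * real m / real n \<le> s"
  shows "(\<Sum>j<m. (\<theta> j * zB t n \<theta> j \<omega>) * (W (min s (t * real (Suc j) / real n)) \<omega> - W (min s (t * real j / real n)) \<omega>)) = zB t n \<theta> m \<omega> - 1"
proof -
  have "(\<Sum>j<m. (\<theta> j * zB t n \<theta> j \<omega>) * (W (min s (t * real (Suc j) / real n)) \<omega> - W (min s (t * real j / real n)) \<omega>))
    = (\<Sum>j<m. zB t n \<theta> (Suc j) \<omega> - zB t n \<theta> j \<omega>)"
  proof (rule sum.cong[OF refl])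
    fix j assume "j \<in> {..<m}"
    then have "t * real (Suc j) / real n \<le> s" "t * real j / real n \<le> s"
      using grid_le[OF t, of "Suc j" m n] grid_le[OF t, of j m n] s by auto
    then have e: "min s (t * real (Suc j) / real n) = t * real (Suc j) / real n" "min s (t * real j / real n) = t * real j / real n"
      by linarith+
    show "(\<theta> j * zB t n \<theta> j \<omega>) * (W (min s (t * real (Suc j) / real n)) \<omega> - W (min s (t * real j / real n)) \<omega>) = zB t n \<theta> (Suc j) \<omega> - zB t n \<theta> j \<omega>"
      unfolding e zE.simps by (simp add: algebra_simps)
  qed
  also have "\<dots> = zB t n \<theta> m \<omega> - zB t n \<theta> 0 \<omega>" by (rule sum_lessThan_telescope)
  finally show ?thesis by simp
qed

text \<open>Later cells contribute 0 and earlier ones telescope, which leaves the partial increment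
  of the current cell. This describes the scheme in continuous time.\<close>

lemma zB_sum_cell:
  assumes t: "t \<ge> 0" and k: "k < n" and s: "s \<in> {t * real k / real n<..t * real (Suc k) / real n}"
  shows "(\<Sum>j<n. (\<theta> j * zB t n \<theta> j \<omega>) * (W (min s (t * real (Suc j) / real n)) \<omega> - W (min s (t * real j / real n)) \<omega>))
    = zB t n \<theta> k \<omega> - 1 + \<theta> k * zB t n \<theta> k \<omega> * (W s \<omega> - W (t * real k / real n) \<omega>)" (is "sum ?g _ = _")
proof -
  have "sum ?g {..<n} = sum ?g {..<Suc k}"
  proof (rule sum.mono_neutral_right)
    show "\<forall>j\<in>{..<n} - {..<Suc k}. ?g j = 0"
    proof
      fix j assume "j \<in> {..<n} - {..<Suc k}"
      then have "s \<le> t * real j / real n" "s \<le> t * real (Suc j) / real n"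
        using grid_le[OF t, of "Suc k" j n] grid_le[OF t, of "Suc k" "Suc j" n] s by auto
      then have "min s (t * real (Suc j) / real n) = s" "min s (t * real j / real n) = s" by linarith+
      then show "?g j = 0" by simp
    qed
  qed (use k in auto)
  also have "\<dots> = sum ?g {..<k} + ?g k" by simp
  also have "sum ?g {..<k} = zB t n \<theta> k \<omega> - 1" using s by (intro zB_sum_full t) auto
  also have "?g k = \<theta> k * zB t n \<theta> k \<omega> * (W s \<omega> - W (t * real k / real n) \<omega>)"
  proof -
    have "min s (t * real (Suc k) / real n) = s" "min s (t * real k / real n) = t * real k / real n"
      using s unfolding greaterThanAtMost_iff by linarith+
    then show ?thesis by simp
  qed
  finally show ?thesis .
qed

end

lemma ennreal_square_add3_le:
  "ennreal ((x + y + z)\<^sup>2) \<le> ennreal (3 * x\<^sup>2) + ennreal (3 * y\<^sup>2) + ennreal (3 * z\<^sup>2)"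
proof -
  have "(x + y + z)\<^sup>2 \<le> 3 * x\<^sup>2 + 3 * y\<^sup>2 + 3 * z\<^sup>2"
    using zero_le_power2[of "x - y"] zero_le_power2[of "y - z"] zero_le_power2[of "x - z"]
    by (simp add: power2_eq_square algebra_simps)
  then show ?thesis by (simp flip: ennreal_plus add: ennreal_leI)
qed

text \<open>The nonnegative integral of a non-measurable function is a supremum over simple
  functions below it: monotone, but not additive. Moving \<open>g\<close> to the other side leaves
  the measurable function \<open>a - g\<close> below \<open>f\<close>, and monotonicity suffices. In
  the applications \<open>f\<close> is the weight times the unknown function of a Gronwall
  argument.\<close>

lemma nn_integral_le_add:
  assumes [measurable]: "a \<in> borel_measurable M" "g \<in> borel_measurable M"
    and le: "AE s in M. a s \<le> f s + g s" and fin: "\<And>s. g s < \<infinity>"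
  shows "(\<integral>\<^sup>+s. a s \<partial>M) \<le> (\<integral>\<^sup>+s. f s \<partial>M) + (\<integral>\<^sup>+s. g s \<partial>M)"
proof -
  have "(\<integral>\<^sup>+s. a s \<partial>M) \<le> (\<integral>\<^sup>+s. (a s - g s) + g s \<partial>M)"
  proof (rule nn_integral_mono)
    fix s
    show "a s \<le> (a s - g s) + g s"
      by (cases "g s \<le> a s") (auto simp: diff_add_cancel_ennreal intro: add_increasing)
  qed
  also have "\<dots> = (\<integral>\<^sup>+s. a s - g s \<partial>M) + (\<integral>\<^sup>+s. g s \<partial>M)" by (rule nn_integral_add) auto
  also have "\<dots> \<le> (\<integral>\<^sup>+s. f s \<partial>M) + (\<integral>\<^sup>+s. g s \<partial>M)"
  proof (rule add_right_mono, rule nn_integral_mono_AE, use le in eventually_elim)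
    case (elim s)
    then show ?case using fin[of s] by (auto simp: ennreal_minus_le_iff add.commute)
  qed
  finally show ?thesis .
qed

section \<open>Convergence of the scheme and the solution functional\<close>

context l2_function
begin

definition step :: "real \<Rightarrow> nat \<Rightarrow> (nat \<Rightarrow> real) \<Rightarrow> real \<Rightarrow> real" where
  "step t n \<theta> s = (\<Sum>j<n. \<theta> j * indicator {t * real j / real n<..t * real (Suc j) / real n} s)"

lemma step_measurable[measurable]: "step t n \<theta> \<in> borel_measurable borel"
  unfolding step_def[abs_def] by measurable

lemma step_error_measurable:
  assumes "t \<le> T"
  shows "(\<lambda>s. ennreal ((h s - step t n \<theta> s)\<^sup>2) * indicator {0..t} s) \<in> borel_measurable borel"
proof -
  have "(\<lambda>s. ennreal ((h s - step t n \<theta> s)\<^sup>2) * indicator {0..t} s)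
    = (\<lambda>s. ennreal ((indicator {0..T} s * h s - step t n \<theta> s)\<^sup>2) * indicator {0..t} s)"
    using assms by (auto simp: indicator_def)
  then show ?thesis by simp
qed

text \<open>The left-hand side is the integral of the squared step function, which is close to
  \<open>h\<close> in mean square. It is the exponent occurring in \<open>zB_square\<close>.\<close>

lemma step_square_sum:
  assumes t: "t \<in> {0..T}" and n: "n \<ge> 1"
    and D: "(\<integral>\<^sup>+s\<in>{0..t}. ennreal ((h s - step t n \<theta> s)\<^sup>2) \<partial>lborel) \<le> ennreal D" "0 \<le> D"
  shows "(\<Sum>j<n. (\<theta> j)\<^sup>2 * (t / real n)) \<le> 2 * nh + 2 * D"
proof -
  have t0: "0 \<le> t" "t \<le> T" using t by auto
  let ?c = "\<lambda>j. {t * real j / real n<..t * real (Suc j) / real n}"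
  have le: "t * real j / real n \<le> t * real (Suc j) / real n" for j
    using t0 by (intro divide_right_mono mult_left_mono) auto
  have "ennreal (\<Sum>j<n. (\<theta> j)\<^sup>2 * (t / real n)) = (\<Sum>j<n. ennreal ((\<theta> j)\<^sup>2) * ennreal (t / real n))"
  proof -
    have "ennreal ((\<theta> j)\<^sup>2) * ennreal (t / real n) = ennreal ((\<theta> j)\<^sup>2 * (t / real n))" for j
      using t0 by (intro ennreal_mult[symmetric]) auto
    then show ?thesis using t0 by (simp only: sum_ennreal mult_nonneg_nonneg zero_le_power2 divide_nonneg_nonneg of_nat_0_le_iff)
  qed
  also have "\<dots> = (\<Sum>j<n. ennreal ((\<theta> j)\<^sup>2) * emeasure lborel (?c j))"
  proof (rule sum.cong[OF refl])
    fix j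
    have "t * real (Suc j) / real n - t * real j / real n = t / real n" by (rule grid_diff)
    then show "ennreal ((\<theta> j)\<^sup>2) * ennreal (t / real n) = ennreal ((\<theta> j)\<^sup>2) * emeasure lborel (?c j)"
      using emeasure_lborel_Ioc[OF le[of j]] by simp
  qed
  also have "\<dots> = (\<integral>\<^sup>+s. (\<Sum>j<n. ennreal ((\<theta> j)\<^sup>2) * indicator (?c j) s) \<partial>lborel)"
    by (subst nn_integral_sum) (auto simp: nn_integral_cmult_indicator simp del: of_nat_Suc)
  also have "\<dots> \<le> (\<integral>\<^sup>+s. 2 * (ennreal ((h s)\<^sup>2) * indicator {0..T} s) + 2 * (ennreal ((h s - step t n \<theta> s)\<^sup>2) * indicator {0..t} s) \<partial>lborel)"
  proof (rule nn_integral_mono)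
    fix s
    show "(\<Sum>j<n. ennreal ((\<theta> j)\<^sup>2) * indicator (?c j) s) \<le> 2 * (ennreal ((h s)\<^sup>2) * indicator {0..T} s) + 2 * (ennreal ((h s - step t n \<theta> s)\<^sup>2) * indicator {0..t} s)"
    proof (cases "s \<in> {0<..t}")
      case True
      obtain k where k: "k < n" "s \<in> ?c k" using cell_exists[OF True n] by blast
      have "(\<Sum>j<n. ennreal ((\<theta> j)\<^sup>2) * indicator (?c j) s) = ennreal (\<Sum>j<n. (\<theta> j)\<^sup>2 * indicator (?c j) s)"
        by (subst sum_ennreal[symmetric]) (auto simp: ennreal_mult ennreal_indicator simp del: of_nat_Suc)
      also have "(\<Sum>j<n. (\<theta> j)\<^sup>2 * indicator (?c j) s) = (\<theta> k)\<^sup>2" by (rule cell_sum[OF k(2) t0(1) n k(1)])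
      also have "\<theta> k = step t n \<theta> s" unfolding step_def by (rule cell_sum[OF k(2) t0(1) n k(1), symmetric])
      also have "ennreal ((step t n \<theta> s)\<^sup>2) \<le> 2 * ennreal ((h s)\<^sup>2) + 2 * ennreal ((h s - step t n \<theta> s)\<^sup>2)"
        using ennreal_square_diff_le[of "step t n \<theta> s" 0 "h s"] by (simp add: power2_commute add.commute)
      finally show ?thesis using True t0 by (auto simp: indicator_def)
    next
      case False
      have "s \<notin> ?c j" if "j < n" for j
      proof
        assume a: "s \<in> ?c j"
        have "0 \<le> t * real j / real n" using t0 by simp
        then have "0 < s" using a by auto
        have "t * real (Suc j) / real n \<le> t * real n / real n" using that t0 by (intro divide_right_mono mult_left_mono) auto
        then have "s \<le> t" using a n by (auto simp del: of_nat_Suc)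
        then show False using False \<open>0 < s\<close> by auto
      qed
      then have "(\<Sum>j<n. ennreal ((\<theta> j)\<^sup>2) * indicator (?c j) s) = 0" by (intro sum.neutral) (auto simp del: of_nat_Suc)
      then show ?thesis by (metis zero_le)
    qed
  qed
  also have "\<dots> = 2 * (\<integral>\<^sup>+s\<in>{0..T}. ennreal ((h s)\<^sup>2) \<partial>lborel) + 2 * (\<integral>\<^sup>+s\<in>{0..t}. ennreal ((h s - step t n \<theta> s)\<^sup>2) \<partial>lborel)"
    using step_error_measurable[OF t0(2), of n \<theta>] by (subst nn_integral_add) (auto simp: nn_integral_cmult)
  also have "\<dots> \<le> 2 * ennreal nh + 2 * ennreal D"
    using D(1) nh(1) by (intro add_mono mult_left_mono) auto
  also have "\<dots> = ennreal (2 * nh + 2 * D)" using nh(2) D(2) by (simp add: ennreal_mult)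
  finally show ?thesis using nh(2) D(2) by (subst (asm) ennreal_le_iff) auto
qed

text \<open>The difference of the integrands of \<open>Z\<close> and of the interpolated scheme
  \<open>1 + S\<close> splits into \<open>h\<close> times the current error, \<open>h\<close> times
  the increment since the last node, and \<open>h - \<theta> k\<close> times the node value.
  Gronwall's inequality absorbs the first; the second is of order \<open>G t / n\<close> and the
  third of order \<open>D\<close>. The coefficient bound \<open>G\<close> comes with the mesh
  \<open>t / n\<close>, so a large \<open>G\<close> can be beaten by the choice of
  \<open>n\<close>.\<close>

lemma linear_sde_euler_error:
  "\<exists>C\<ge>0. \<forall>(M :: 'a measure) F W Z t n \<theta> D G.
    brownian M F W \<longrightarrow> linear_sde M F W T h Z \<longrightarrow> t \<in> {0..T} \<longrightarrow> n \<ge> (1::nat) \<longrightarrow>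
    (\<integral>\<^sup>+s\<in>{0..t}. ennreal ((h s - step t n \<theta> s)\<^sup>2) \<partial>lborel) \<le> ennreal D \<longrightarrow> 0 \<le> D \<longrightarrow> D \<le> 1 \<longrightarrow>
    (\<forall>k<n. (\<theta> k)\<^sup>2 \<le> G) \<longrightarrow>
    (\<integral>\<^sup>+\<omega>. ennreal ((Z t \<omega> - zE t n \<theta> (\<lambda>s. W s \<omega>) n)\<^sup>2) \<partial>M) \<le> ennreal (C * (G * t / real n + D))"
proof -
  \<comment> \<open>Bound for the second moments of the scheme: the exponent is the right-hand side
    of \<open>step_square_sum\<close> for \<open>D\<close> at most 1.\<close>
  define B where "B = exp (2 * nh + 2)"
  have B: "1 \<le> B" unfolding B_def using nh(2) by simp
  obtain CZ where CZ: "0 \<le> CZ" and Z2: "\<And>(M :: 'a measure) F W Z t. brownian M F W \<Longrightarrow> linear_sde M F W T h Z \<Longrightarrow> t \<in> {0..T} \<Longrightarrow>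
      (\<integral>\<^sup>+\<omega>. ennreal ((Z t \<omega>)\<^sup>2) \<partial>M) \<le> ennreal CZ"
    using linear_sde_second_moment by blast
  \<comment> \<open>12 is the factor 4 of the Ito bound times the 3 from the square of a sum of
    three terms.\<close>
  obtain C where C: "0 \<le> C" and gr: "\<And>t A \<phi>. t \<in> {0..T} \<Longrightarrow> \<exists>B<\<infinity>. \<forall>s\<in>{0..t}. \<phi> s \<le> B \<Longrightarrow>
    \<forall>r\<in>{0..t}. \<phi> r \<le> A + (\<integral>\<^sup>+s\<in>{0..r}. ennreal (12 * (h s)\<^sup>2) * \<phi> s \<partial>lborel) \<Longrightarrow> \<phi> t \<le> ennreal C * A"
    using gronwall_h[of 12] by (auto 5 5)
  have main: "(\<integral>\<^sup>+\<omega>. ennreal ((Z t \<omega> - zE t n \<theta> (\<lambda>s. W s \<omega>) n)\<^sup>2) \<partial>M) \<le> ennreal (C * (12 * B * (G * t / real n * nh + D)))"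
    if bm': "brownian M F W" and sde: "linear_sde M F W T h Z" and t: "t \<in> {0..T}" and n: "n \<ge> (1::nat)"
      and D: "(\<integral>\<^sup>+s\<in>{0..t}. ennreal ((h s - step t n \<theta> s)\<^sup>2) \<partial>lborel) \<le> ennreal D" "0 \<le> D" "D \<le> 1"
      and G: "\<forall>k<n. (\<theta> k)\<^sup>2 \<le> G" for M :: "'a measure" and F W Z t n \<theta> D G
  proof -
    interpret brownian M F W by fact
    have t0: "0 \<le> t" "t \<le> T" using t by auto
    let ?c = "\<lambda>j. {t * real j / real n<..t * real (Suc j) / real n}"
    have G0: "0 \<le> G" using G n by (meson less_le_trans order_trans zero_le_power2 zero_less_one)
    obtain I where I: "ito_integral M F W T (\<lambda>t \<omega>. h t * Z t \<omega>) I" and ZI: "AE \<omega> in M. \<forall>t\<in>{0..T}. Z t \<omega> = 1 + I t \<omega>"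
      and Zm: "\<And>t. t \<in> {0..T} \<Longrightarrow> Z t \<in> borel_measurable M"
      using linear_sde_rep[OF sde] by blast
    note f = zB_family[OF t0(1), of n \<theta>]
    define S where "S = simple_family.S W {..<n} (\<lambda>k. t * real k / real n) (\<lambda>k. t * real (Suc k) / real n) (\<lambda>k \<omega>. \<theta> k * zB t n \<theta> k \<omega>)"
    define Sv where "Sv = simple_family.Sv {..<n} (\<lambda>k. t * real k / real n) (\<lambda>k. t * real (Suc k) / real n) (\<lambda>k \<omega>. \<theta> k * zB t n \<theta> k \<omega>)"
    have Sm: "s \<ge> 0 \<Longrightarrow> S s \<in> borel_measurable M" for s
      unfolding S_def by (rule simple_family.S_M[OF f])
    define \<phi> where "\<phi> s = (\<integral>\<^sup>+\<omega>. ennreal ((Z s \<omega> - (1 + S s \<omega>))\<^sup>2) \<partial>M)" for s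
    have zm[measurable]: "zB t n \<theta> k \<in> borel_measurable M" for k using zB_F[OF t0(1)] by (rule measurable_F_M)
    have z2: "(\<integral>\<^sup>+\<omega>. ennreal ((zB t n \<theta> k \<omega>)\<^sup>2) \<partial>M) \<le> ennreal B" if "k \<le> n" for k
    proof -
      have "(\<integral>\<^sup>+\<omega>. ennreal ((zB t n \<theta> k \<omega>)\<^sup>2) \<partial>M) = ennreal (expectation (\<lambda>\<omega>. (zB t n \<theta> k \<omega>)\<^sup>2))"
        using zB_square(1)[OF t0(1)] by (intro nn_integral_eq_integral) auto
      also have "\<dots> \<le> ennreal B"
      proof (rule ennreal_leI)
        have "(\<Sum>j<k. (\<theta> j)\<^sup>2 * (t / real n)) \<le> (\<Sum>j<n. (\<theta> j)\<^sup>2 * (t / real n))"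
          using that t0 by (intro sum_mono2) auto
        also have "\<dots> \<le> 2 * nh + 2" using step_square_sum[OF t n D(1,2)] D(3) by simp
        finally show "expectation (\<lambda>\<omega>. (zB t n \<theta> k \<omega>)\<^sup>2) \<le> B"
          unfolding B_def using zB_square(2)[OF t0(1), of n \<theta> k] by (meson exp_le_cancel_iff order_trans)
      qed
      finally show ?thesis .
    qed
    have inc2: "(\<integral>\<^sup>+\<omega>. ennreal ((\<theta> k * zB t n \<theta> k \<omega> * (W s \<omega> - W (t * real k / real n) \<omega>))\<^sup>2) \<partial>M) \<le> ennreal (G * B * (t / real n))"
      if k: "k < n" and s: "s \<in> ?c k" for k s
    proof -
      have 1: "0 \<le> t * real k / real n" "t * real k / real n \<le> s" using t0 s by auto
      have m: "(\<lambda>\<omega>. \<theta> k * zB t n \<theta> k \<omega>) \<in> borel_measurable (F (t * real k / real n))"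
        using zB_F[OF t0(1), of n \<theta> k] by measurable
      have i: "integrable M (\<lambda>\<omega>. (\<theta> k * zB t n \<theta> k \<omega>)\<^sup>2)"
        using zB_square(1)[OF t0(1), of n \<theta> k] by (simp add: power_mult_distrib)
      note sq = square_integrable_increment_mult[OF 1 m i]
      have "(\<integral>\<^sup>+\<omega>. ennreal ((\<theta> k * zB t n \<theta> k \<omega> * (W s \<omega> - W (t * real k / real n) \<omega>))\<^sup>2) \<partial>M)
        = ennreal (expectation (\<lambda>\<omega>. (\<theta> k * zB t n \<theta> k \<omega>)\<^sup>2) * (s - t * real k / real n))"
        using sq by (simp add: nn_integral_eq_integral)
      also have "\<dots> \<le> ennreal (G * B * (t / real n))"
      proof (intro ennreal_leI mult_mono)
        have "expectation (\<lambda>\<omega>. (zB t n \<theta> k \<omega>)\<^sup>2) \<le> B"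
          using z2[of k] k zB_square(1)[OF t0(1), of n \<theta> k] B by (simp add: nn_integral_eq_integral ennreal_le_iff)
        then show "expectation (\<lambda>\<omega>. (\<theta> k * zB t n \<theta> k \<omega>)\<^sup>2) \<le> G * B"
          using G k G0 by (simp add: power_mult_distrib mult_mono)
        have "t * real (Suc k) / real n - t * real k / real n = t / real n" by (rule grid_diff)
        then show "s - t * real k / real n \<le> t / real n" using s unfolding greaterThanAtMost_iff by linarith
      qed (use G0 B s in auto)
      finally show ?thesis .
    qed
    have S1: "1 + S s \<omega> = zB t n \<theta> k \<omega> + \<theta> k * zB t n \<theta> k \<omega> * (W s \<omega> - W (t * real k / real n) \<omega>)"
      if "k < n" "s \<in> ?c k" for k s \<omega>
      unfolding S_def simple_family.S_def[OF f] using zB_sum_cell[OF t0(1) that, of \<theta> \<omega>] by simp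
    have Sv1: "Sv s \<omega> = \<theta> k * zB t n \<theta> k \<omega>" if "k < n" "s \<in> ?c k" for k s \<omega>
      unfolding Sv_def simple_family.Sv_def[OF f] by (rule cell_sum[OF that(2) t0(1) n that(1)])
    have St: "1 + S t \<omega> = zB t n \<theta> n \<omega>" for \<omega>
      unfolding S_def simple_family.S_def[OF f] using zB_sum_full[OF t0(1), of n n t \<theta> \<omega>] n by simp
    have "\<phi> t \<le> ennreal C * ennreal (12 * B * (G * t / real n * nh + D))"
    proof (rule gr[OF t])
      \<comment> \<open>By the isometry the second moment of \<open>S\<close> grows with time, so
        its value at \<open>t\<close> serves for all earlier times.\<close>
      show "\<exists>B<\<infinity>. \<forall>s\<in>{0..t}. \<phi> s \<le> B"
      proof (intro exI[of _ "2 * ennreal CZ + 2 * (2 + 2 * (\<integral>\<^sup>+\<omega>. ennreal ((S t \<omega>)\<^sup>2) \<partial>M))"] conjI ballI)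
        have "(\<integral>\<^sup>+\<omega>. ennreal ((S t \<omega>)\<^sup>2) \<partial>M) < \<infinity>"
          using simple_family.isometry(2)[OF f t0(1)] unfolding S_def by (simp add: nn_integral_eq_integral)
        then show "2 * ennreal CZ + 2 * (2 + 2 * (\<integral>\<^sup>+\<omega>. ennreal ((S t \<omega>)\<^sup>2) \<partial>M)) < \<infinity>"
          by (auto simp: ennreal_mult_less_top)
        fix s assume s: "s \<in> {0..t}"
        then have s0: "0 \<le> s" "s \<in> {0..T}" using t0 by auto
        have [measurable]: "S s \<in> borel_measurable M" "Z s \<in> borel_measurable M" using Sm Zm s0 by auto
        have "(\<integral>\<^sup>+\<omega>. ennreal ((S s \<omega>)\<^sup>2) \<partial>M) \<le> (\<integral>\<^sup>+\<omega>. ennreal ((S t \<omega>)\<^sup>2) \<partial>M)"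
          unfolding S_def simple_family.isometry(1)[OF f s0(1)] simple_family.isometry(1)[OF f t0(1)]
          using s by (intro nn_integral_mono) (auto simp: indicator_def)
        moreover have "(\<integral>\<^sup>+\<omega>. ennreal ((1 + S s \<omega>)\<^sup>2) \<partial>M) \<le> 2 + 2 * (\<integral>\<^sup>+\<omega>. ennreal ((S s \<omega>)\<^sup>2) \<partial>M)"
        proof -
          have "(\<integral>\<^sup>+\<omega>. ennreal ((1 + S s \<omega>)\<^sup>2) \<partial>M) \<le> (\<integral>\<^sup>+\<omega>. 2 + 2 * ennreal ((S s \<omega>)\<^sup>2) \<partial>M)"
            using ennreal_square_add_le[of 1] by (intro nn_integral_mono) simp
          also have "\<dots> = 2 + 2 * (\<integral>\<^sup>+\<omega>. ennreal ((S s \<omega>)\<^sup>2) \<partial>M)"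
            by (simp add: nn_integral_add nn_integral_cmult emeasure_space_1)
          finally show ?thesis .
        qed
        moreover have "\<phi> s \<le> 2 * (\<integral>\<^sup>+\<omega>. ennreal ((Z s \<omega>)\<^sup>2) \<partial>M) + 2 * (\<integral>\<^sup>+\<omega>. ennreal ((1 + S s \<omega>)\<^sup>2) \<partial>M)"
        proof -
          have "\<phi> s \<le> (\<integral>\<^sup>+\<omega>. 2 * ennreal ((Z s \<omega>)\<^sup>2) + 2 * ennreal ((1 + S s \<omega>)\<^sup>2) \<partial>M)"
            unfolding \<phi>_def using ennreal_square_diff_le[where y=0] by (intro nn_integral_mono) (simp add: power2_commute)
          also have "\<dots> = 2 * (\<integral>\<^sup>+\<omega>. ennreal ((Z s \<omega>)\<^sup>2) \<partial>M) + 2 * (\<integral>\<^sup>+\<omega>. ennreal ((1 + S s \<omega>)\<^sup>2) \<partial>M)"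
            by (simp add: nn_integral_add nn_integral_cmult)
          finally show ?thesis .
        qed
        moreover have "(\<integral>\<^sup>+\<omega>. ennreal ((Z s \<omega>)\<^sup>2) \<partial>M) \<le> ennreal CZ" using Z2[OF bm' sde s0(2)] .
        ultimately show "\<phi> s \<le> 2 * ennreal CZ + 2 * (2 + 2 * (\<integral>\<^sup>+\<omega>. ennreal ((S t \<omega>)\<^sup>2) \<partial>M))"
          by (meson add_mono add_left_mono mult_left_mono order_trans zero_le)
      qed
      show "\<forall>r\<in>{0..t}. \<phi> r \<le> ennreal (12 * B * (G * t / real n * nh + D)) + (\<integral>\<^sup>+s\<in>{0..r}. ennreal (12 * (h s)\<^sup>2) * \<phi> s \<partial>lborel)"
      proof
        fix r assume r: "r \<in> {0..t}"
        then have rT: "r \<in> {0..T}" "r \<le> T" using t0 by auto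
        define E where "E s = (\<integral>\<^sup>+\<omega>. ennreal ((h s * Z s \<omega> - Sv s \<omega>)\<^sup>2) \<partial>M)" for s
        have Em: "(\<lambda>s. E s * indicator {0..r} s) \<in> borel_measurable lborel"
        proof -
          have "progressive F T (\<lambda>s \<omega>. h s * Z s \<omega>)" using I unfolding ito_integral_def by blast
          from Fubini_square(4)[OF progressive_joint[OF this T] rT(2) simple_family.Sv_M[OF f]]
          show ?thesis unfolding E_def Sv_def by simp
        qed
        have "\<phi> r = (\<integral>\<^sup>+\<omega>. ennreal ((I r \<omega> - S r \<omega>)\<^sup>2) \<partial>M)"
          unfolding \<phi>_def
        proof (rule nn_integral_cong_AE, use ZI in eventually_elim)
          case (elim \<omega>)
          then have "Z r \<omega> = 1 + I r \<omega>" using rT by blast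
          then show ?case by simp
        qed
        also have "\<dots> \<le> 4 * (\<integral>\<^sup>+s\<in>{0..r}. E s \<partial>lborel)"
          unfolding S_def E_def Sv_def by (rule simple_family.ito_bound[OF f I rT(1)])
        also have "\<dots> = (\<integral>\<^sup>+s. 4 * (E s * indicator {0..r} s) \<partial>lborel)"
          using Em by (rule nn_integral_cmult[symmetric])
        also have "\<dots> \<le> (\<integral>\<^sup>+s\<in>{0..r}. ennreal (12 * (h s)\<^sup>2) * \<phi> s \<partial>lborel) + (\<integral>\<^sup>+s.
             ennreal (12 * G * B * (t / real n)) * (ennreal ((h s)\<^sup>2) * indicator {0..T} s)
             + ennreal (12 * B) * (ennreal ((h s - step t n \<theta> s)\<^sup>2) * indicator {0..t} s) \<partial>lborel)"
        proof (rule nn_integral_le_add)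
          show "(\<lambda>s. 4 * (E s * indicator {0..r} s)) \<in> borel_measurable lborel" using Em by simp
          show "(\<lambda>s. ennreal (12 * G * B * (t / real n)) * (ennreal ((h s)\<^sup>2) * indicator {0..T} s)
             + ennreal (12 * B) * (ennreal ((h s - step t n \<theta> s)\<^sup>2) * indicator {0..t} s)) \<in> borel_measurable lborel"
            using step_error_measurable[OF t0(2), of n \<theta>] by simp
          show "ennreal (12 * G * B * (t / real n)) * (ennreal ((h s)\<^sup>2) * indicator {0..T} s)
             + ennreal (12 * B) * (ennreal ((h s - step t n \<theta> s)\<^sup>2) * indicator {0..t} s) < \<infinity>" for s
            by (auto simp: indicator_def ennreal_mult_less_top)
          \<comment> \<open>The cells cover \<open>{0<..t}\<close> and leave out the single time
            0.\<close>
          have "AE s in lborel. s \<noteq> (0::real)" by (rule AE_lborel_singleton)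
          then show "AE s in lborel. 4 * (E s * indicator {0..r} s) \<le> ennreal (12 * (h s)\<^sup>2) * \<phi> s * indicator {0..r} s
             + (ennreal (12 * G * B * (t / real n)) * (ennreal ((h s)\<^sup>2) * indicator {0..T} s)
             + ennreal (12 * B) * (ennreal ((h s - step t n \<theta> s)\<^sup>2) * indicator {0..t} s))"
          proof eventually_elim
            case (elim s)
            show ?case
            proof (cases "s \<in> {0..r}")
              case True
              then have s: "s \<in> {0<..t}" "s \<in> {0..t}" "s \<in> {0..T}" "0 \<le> s" using elim r t0 by auto
              obtain k where k: "k < n" "s \<in> ?c k" using cell_exists[OF s(1) n] by blast
              have st: "step t n \<theta> s = \<theta> k" unfolding step_def by (rule cell_sum[OF k(2) t0(1) n k(1)])
              define inc where "inc \<omega> = \<theta> k * zB t n \<theta> k \<omega> * (W s \<omega> - W (t * real k / real n) \<omega>)" for \<omega>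
              have [measurable]: "S s \<in> borel_measurable M" "Z s \<in> borel_measurable M" using Sm Zm s by auto
              have [measurable]: "inc \<in> borel_measurable M"
              proof -
                have "inc = (\<lambda>\<omega>. 1 + S s \<omega> - zB t n \<theta> k \<omega>)" using S1[OF k] by (simp add: inc_def fun_eq_iff)
                then show ?thesis by simp
              qed
              have "E s = (\<integral>\<^sup>+\<omega>. ennreal ((h s * (Z s \<omega> - (1 + S s \<omega>)) + h s * inc \<omega> + (h s - \<theta> k) * zB t n \<theta> k \<omega>)\<^sup>2) \<partial>M)"
                unfolding E_def Sv1[OF k] S1[OF k] inc_def by (intro nn_integral_cong) (simp add: algebra_simps)
              also have "\<dots> \<le> (\<integral>\<^sup>+\<omega>. ennreal (3 * (h s)\<^sup>2) * ennreal ((Z s \<omega> - (1 + S s \<omega>))\<^sup>2)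
                 + ennreal (3 * (h s)\<^sup>2) * ennreal ((inc \<omega>)\<^sup>2) + ennreal (3 * (h s - \<theta> k)\<^sup>2) * ennreal ((zB t n \<theta> k \<omega>)\<^sup>2) \<partial>M)"
              proof (rule nn_integral_mono)
                fix \<omega>
                show "ennreal ((h s * (Z s \<omega> - (1 + S s \<omega>)) + h s * inc \<omega> + (h s - \<theta> k) * zB t n \<theta> k \<omega>)\<^sup>2)
                   \<le> ennreal (3 * (h s)\<^sup>2) * ennreal ((Z s \<omega> - (1 + S s \<omega>))\<^sup>2)
                 + ennreal (3 * (h s)\<^sup>2) * ennreal ((inc \<omega>)\<^sup>2) + ennreal (3 * (h s - \<theta> k)\<^sup>2) * ennreal ((zB t n \<theta> k \<omega>)\<^sup>2)"
                  using ennreal_square_add3_le[of "h s * (Z s \<omega> - (1 + S s \<omega>))" "h s * inc \<omega>" "(h s - \<theta> k) * zB t n \<theta> k \<omega>"]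
                  by (simp add: power_mult_distrib ennreal_mult[symmetric] mult.assoc)
              qed
              also have "\<dots> = ennreal (3 * (h s)\<^sup>2) * \<phi> s + ennreal (3 * (h s)\<^sup>2) * (\<integral>\<^sup>+\<omega>. ennreal ((inc \<omega>)\<^sup>2) \<partial>M)
                 + ennreal (3 * (h s - \<theta> k)\<^sup>2) * (\<integral>\<^sup>+\<omega>. ennreal ((zB t n \<theta> k \<omega>)\<^sup>2) \<partial>M)"
                unfolding \<phi>_def by (simp add: nn_integral_add nn_integral_cmult)
              also have "\<dots> \<le> ennreal (3 * (h s)\<^sup>2) * \<phi> s + ennreal (3 * (h s)\<^sup>2) * ennreal (G * B * (t / real n))
                 + ennreal (3 * (h s - \<theta> k)\<^sup>2) * ennreal B"
                using inc2[OF k] z2[of k] k unfolding inc_def by (intro add_mono mult_left_mono) auto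
              finally have Es: "E s \<le> ennreal (3 * (h s)\<^sup>2) * \<phi> s + ennreal (3 * (h s)\<^sup>2) * ennreal (G * B * (t / real n))
                 + ennreal (3 * (h s - \<theta> k)\<^sup>2) * ennreal B" .
              have "4 * E s \<le> 4 * (ennreal (3 * (h s)\<^sup>2) * \<phi> s + ennreal (3 * (h s)\<^sup>2) * ennreal (G * B * (t / real n))
                 + ennreal (3 * (h s - \<theta> k)\<^sup>2) * ennreal B)"
                by (rule mult_left_mono[OF Es]) simp
              also have "\<dots> = ennreal (12 * (h s)\<^sup>2) * \<phi> s + (ennreal (12 * G * B * (t / real n)) * ennreal ((h s)\<^sup>2)
                  + ennreal (12 * B) * ennreal ((h s - \<theta> k)\<^sup>2))"
              proof -
                have 1: "4 * (ennreal (3 * (h s)\<^sup>2) * \<phi> s) = ennreal (12 * (h s)\<^sup>2) * \<phi> s"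
                  by (simp add: ennreal_mult mult.assoc[symmetric])
                have 2: "4 * (ennreal (3 * (h s)\<^sup>2) * ennreal (G * B * (t / real n))) = ennreal (12 * G * B * (t / real n)) * ennreal ((h s)\<^sup>2)"
                  using G0 B t0 by (simp flip: ennreal_mult ennreal_numeral add: algebra_simps)
                have 3: "4 * (ennreal (3 * (h s - \<theta> k)\<^sup>2) * ennreal B) = ennreal (12 * B) * ennreal ((h s - \<theta> k)\<^sup>2)"
                  using B by (simp flip: ennreal_mult ennreal_numeral add: algebra_simps)
                show ?thesis unfolding distrib_left 1 2 3 by (simp add: add.assoc)
              qed
              finally show ?thesis using True s unfolding st by simp
            qed simp
          qed
        qed
        also have "(\<integral>\<^sup>+s. ennreal (12 * G * B * (t / real n)) * (ennreal ((h s)\<^sup>2) * indicator {0..T} s)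
             + ennreal (12 * B) * (ennreal ((h s - step t n \<theta> s)\<^sup>2) * indicator {0..t} s) \<partial>lborel)
           = ennreal (12 * G * B * (t / real n)) * ennreal nh
             + ennreal (12 * B) * (\<integral>\<^sup>+s\<in>{0..t}. ennreal ((h s - step t n \<theta> s)\<^sup>2) \<partial>lborel)"
          using step_error_measurable[OF t0(2), of n \<theta>] by (simp add: nn_integral_add nn_integral_cmult nh(1))
        also have "(\<integral>\<^sup>+s\<in>{0..r}. ennreal (12 * (h s)\<^sup>2) * \<phi> s \<partial>lborel) + (ennreal (12 * G * B * (t / real n)) * ennreal nh
             + ennreal (12 * B) * (\<integral>\<^sup>+s\<in>{0..t}. ennreal ((h s - step t n \<theta> s)\<^sup>2) \<partial>lborel))
           \<le> (\<integral>\<^sup>+s\<in>{0..r}. ennreal (12 * (h s)\<^sup>2) * \<phi> s \<partial>lborel)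
           + (ennreal (12 * G * B * (t / real n)) * ennreal nh + ennreal (12 * B) * ennreal D)"
          using D(1) by (intro add_left_mono mult_left_mono) auto
        also have "ennreal (12 * G * B * (t / real n)) * ennreal nh + ennreal (12 * B) * ennreal D = ennreal (12 * B * (G * t / real n * nh + D))"
          using G0 B t0 D nh(2) by (simp flip: ennreal_mult ennreal_plus add: algebra_simps)
        also have "(\<integral>\<^sup>+s\<in>{0..r}. ennreal (12 * (h s)\<^sup>2) * \<phi> s \<partial>lborel) + ennreal (12 * B * (G * t / real n * nh + D))
            = ennreal (12 * B * (G * t / real n * nh + D)) + (\<integral>\<^sup>+s\<in>{0..r}. ennreal (12 * (h s)\<^sup>2) * \<phi> s \<partial>lborel)"
          by (rule add.commute)
        finally show "\<phi> r \<le> ennreal (12 * B * (G * t / real n * nh + D)) + (\<integral>\<^sup>+s\<in>{0..r}. ennreal (12 * (h s)\<^sup>2) * \<phi> s \<partial>lborel)" .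
      qed
    qed
    then show ?thesis using C unfolding \<phi>_def St by (simp add: ennreal_mult')
  qed
  define C' where "C' = C * (12 * B * (nh + 1))"
  have "C * (12 * B * (G * t / real n * nh + D)) \<le> C' * (G * t / real n + D)" if "0 \<le> G" "0 \<le> t" "0 \<le> D" for G t D and n :: nat
  proof -
    define q where "q = G * t / real n"
    have "0 \<le> q" using that by (simp add: q_def)
    then have "q * nh + D \<le> (nh + 1) * (q + D)"
      using that nh(2) by (simp add: algebra_simps)
    then have "G * t / real n * nh + D \<le> (nh + 1) * (G * t / real n + D)" unfolding q_def .
    then have "C * (12 * B) * (G * t / real n * nh + D) \<le> C * (12 * B) * ((nh + 1) * (G * t / real n + D))"
      using C B by (intro mult_left_mono) auto
    then show ?thesis unfolding C'_def by (simp add: mult.assoc)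
  qed
  note le = this
  show ?thesis
  proof (intro exI[of _ C'] conjI allI impI)
    show "0 \<le> C'" unfolding C'_def using C B nh(2) by simp
    fix M :: "'a measure" and F W Z t n \<theta> D G
    assume a: "brownian M F W" "linear_sde M F W T h Z" "t \<in> {0..T}" "(1::nat) \<le> n"
      "(\<integral>\<^sup>+s\<in>{0..t}. ennreal ((h s - step t n \<theta> s)\<^sup>2) \<partial>lborel) \<le> ennreal D" "0 \<le> D" "D \<le> 1" "\<forall>k<n. (\<theta> k)\<^sup>2 \<le> G"
    have "0 \<le> (\<theta> 0)\<^sup>2" "(\<theta> 0)\<^sup>2 \<le> G" using a by auto
    then have "0 \<le> G" by (rule order_trans)
    then show "(\<integral>\<^sup>+\<omega>. ennreal ((Z t \<omega> - zE t n \<theta> (\<lambda>s. W s \<omega>) n)\<^sup>2) \<partial>M) \<le> ennreal (C' * (G * t / real n + D))"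
      using main[OF a] le[of G t D n] a by (meson atLeastAtMost_iff ennreal_leI order_trans)
  qed
qed

text \<open>The order of the choices matters. A continuous \<open>g\<close> close to
  \<open>h\<close> comes first, and its bound on \<open>{0..T}\<close> controls the coefficients on
  every grid; only then is the mesh chosen, so fine that \<open>g\<close> oscillates by less than
  \<open>w\<close> on a cell and that the term with \<open>G / n\<close> is at most
  \<open>\<epsilon> / 2\<close>.\<close>

lemma linear_sde_euler_approx:
  assumes t: "t \<in> {0..T}" and \<epsilon>: "\<epsilon> > 0"
  shows "\<exists>n \<theta>. \<forall>(M :: 'a measure) F W Z. brownian M F W \<longrightarrow> linear_sde M F W T h Z \<longrightarrow>
    (\<integral>\<^sup>+\<omega>. ennreal ((Z t \<omega> - zE t n \<theta> (\<lambda>s. W s \<omega>) n)\<^sup>2) \<partial>M) \<le> ennreal \<epsilon>"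
proof -
  have t0: "0 \<le> t" "t \<le> T" using t by auto
  obtain C where C: "0 \<le> C" and err: "\<And>(M :: 'a measure) F W Z t n \<theta> D G.
    brownian M F W \<Longrightarrow> linear_sde M F W T h Z \<Longrightarrow> t \<in> {0..T} \<Longrightarrow> n \<ge> (1::nat) \<Longrightarrow>
    (\<integral>\<^sup>+s\<in>{0..t}. ennreal ((h s - step t n \<theta> s)\<^sup>2) \<partial>lborel) \<le> ennreal D \<Longrightarrow> 0 \<le> D \<Longrightarrow> D \<le> 1 \<Longrightarrow>
    (\<forall>k<n. (\<theta> k)\<^sup>2 \<le> G) \<Longrightarrow>
    (\<integral>\<^sup>+\<omega>. ennreal ((Z t \<omega> - zE t n \<theta> (\<lambda>s. W s \<omega>) n)\<^sup>2) \<partial>M) \<le> ennreal (C * (G * t / real n + D))"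
    using linear_sde_euler_error by blast
  \<comment> \<open>The error estimate is applied with \<open>D = 4 \<delta>\<close>: the bound 1/4
    secures \<open>D \<le> 1\<close>, and the second bound makes the contribution of
    \<open>D\<close> at most \<open>\<epsilon> / 2\<close>. The summand 1 excludes division by
    0.\<close>
  define \<delta> where "\<delta> = min (1 / 4) (\<epsilon> / (8 * (C + 1)))"
  have \<delta>: "\<delta> > 0" "4 * \<delta> \<le> 1" "\<delta> \<le> \<epsilon> / (8 * (C + 1))" using \<epsilon> C by (auto simp: \<delta>_def)
  have C\<delta>: "C * (4 * \<delta>) \<le> \<epsilon> / 2"
  proof -
    have "C * (4 * \<delta>) \<le> (C + 1) * (4 * \<delta>)" using \<delta> by (intro mult_right_mono) auto
    also have "\<dots> \<le> (C + 1) * (4 * (\<epsilon> / (8 * (C + 1))))" using \<delta> C by (intro mult_left_mono) auto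
    also have "\<dots> = \<epsilon> / 2" using C by (simp add: field_simps)
    finally show ?thesis .
  qed
  obtain g where g: "continuous_on UNIV g" "(\<integral>\<^sup>+s\<in>{0..T}. ennreal ((h s - g s)\<^sup>2) \<partial>lborel) < ennreal \<delta>"
    using L2_dense_continuous[OF hm h2 \<delta>(1)] by blast
  have [measurable]: "g \<in> borel_measurable borel" using g(1) by (rule borel_measurable_continuous_onI)
  have gT: "continuous_on {0..T} g" using g(1) by (rule continuous_on_subset) simp
  obtain B where "\<forall>x\<in>g ` {0..T}. norm x \<le> B"
    using compact_imp_bounded[OF compact_continuous_image[OF gT compact_Icc]] unfolding bounded_iff by blast
  then have B: "\<And>s. s \<in> {0..T} \<Longrightarrow> \<bar>g s\<bar> \<le> B" by auto
  \<comment> \<open>The oscillation allowed on a cell. Its square integrates to at most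
    \<open>\<delta>\<close>, as does the squared distance of \<open>h\<close> and \<open>g\<close>,
    and doubling both gives \<open>4 \<delta>\<close>.\<close>
  define w where "w = sqrt (\<delta> / (T + 1))"
  have w: "w > 0" "w\<^sup>2 * T \<le> \<delta>" using \<delta> T by (auto simp: w_def field_simps)
  obtain \<eta> where \<eta>: "\<eta> > 0" "\<And>s r. s \<in> {0..T} \<Longrightarrow> r \<in> {0..T} \<Longrightarrow> \<bar>r - s\<bar> < \<eta> \<Longrightarrow> \<bar>g r - g s\<bar> < w"
    using compact_uniformly_continuous[OF gT compact_Icc] w(1) unfolding uniformly_continuous_on_def dist_real_def by meson
  obtain n :: nat where n': "max (T / \<eta>) (2 * C * B\<^sup>2 * T / \<epsilon>) < real n" using reals_Archimedean2 by blast
  have "0 \<le> T / \<eta>" using T \<eta>(1) by simp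
  then have n0: "0 < real n" using n' by linarith
  then have n: "n \<ge> 1" "T / real n < \<eta>" "C * B\<^sup>2 * T / real n \<le> \<epsilon> / 2"
    using n' \<eta>(1) \<epsilon> by (auto simp: field_simps)
  define \<theta> where "\<theta> k = g (t * real k / real n)" for k
  have node: "t * real k / real n \<in> {0..T}" if "k \<le> n" for k
  proof -
    have "t * real k / real n \<le> t * real n / real n" using that t0 by (intro divide_right_mono mult_left_mono) auto
    then show ?thesis using n t0 by auto
  qed
  have err_g: "ennreal ((g s - step t n \<theta> s)\<^sup>2) \<le> ennreal (w\<^sup>2)" if s: "s \<in> {0<..t}" for s
  proof -
    obtain k where k: "k < n" "s \<in> {t * real k / real n<..t * real (Suc k) / real n}"
      using cell_exists[OF s n(1)] by blast
    have "step t n \<theta> s = g (t * real k / real n)"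
      unfolding step_def cell_sum[OF k(2) t0(1) n(1) k(1)] by (simp add: \<theta>_def)
    moreover have "\<bar>s - t * real k / real n\<bar> < \<eta>"
    proof -
      have "t * real (Suc k) / real n - t * real k / real n = t / real n" by (rule grid_diff)
      moreover have "t / real n \<le> T / real n" using t0 by (intro divide_right_mono) auto
      ultimately show ?thesis using k(2) n(2) unfolding greaterThanAtMost_iff by linarith
    qed
    ultimately have "\<bar>g s - step t n \<theta> s\<bar> < w" using \<eta>(2)[of "t * real k / real n" s] node[of k] k s t0 by auto
    then show ?thesis using w by (intro ennreal_leI) (simp add: abs_le_square_iff[symmetric])
  qed
  have D: "(\<integral>\<^sup>+s\<in>{0..t}. ennreal ((h s - step t n \<theta> s)\<^sup>2) \<partial>lborel) \<le> ennreal (4 * \<delta>)"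
  proof -
    have hg[measurable]: "(\<lambda>s. ennreal ((h s - g s)\<^sup>2) * indicator {0..T} s) \<in> borel_measurable borel"
    proof -
      have "(\<lambda>s. ennreal ((h s - g s)\<^sup>2) * indicator {0..T} s) = (\<lambda>s. ennreal ((indicator {0..T} s * h s - g s)\<^sup>2) * indicator {0..T} s)"
        by (auto simp: indicator_def)
      then show ?thesis by simp
    qed
    have "(\<integral>\<^sup>+s\<in>{0..t}. ennreal ((h s - step t n \<theta> s)\<^sup>2) \<partial>lborel)
      \<le> (\<integral>\<^sup>+s. 2 * (ennreal ((h s - g s)\<^sup>2) * indicator {0..T} s) + 2 * (ennreal (w\<^sup>2) * indicator {0..t} s) \<partial>lborel)"
    proof (rule nn_integral_mono_AE)
      have "AE s in lborel. s \<noteq> (0::real)" by (rule AE_lborel_singleton)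
      then show "AE s in lborel. ennreal ((h s - step t n \<theta> s)\<^sup>2) * indicator {0..t} s
        \<le> 2 * (ennreal ((h s - g s)\<^sup>2) * indicator {0..T} s) + 2 * (ennreal (w\<^sup>2) * indicator {0..t} s)"
      proof eventually_elim
        case (elim s)
        show ?case
        proof (cases "s \<in> {0..t}")
          case True
          then have s: "s \<in> {0<..t}" "s \<in> {0..T}" using elim t0 by auto
          have "ennreal ((h s - step t n \<theta> s)\<^sup>2) \<le> 2 * ennreal ((h s - g s)\<^sup>2) + 2 * ennreal ((g s - step t n \<theta> s)\<^sup>2)"
            by (rule ennreal_square_diff_le)
          also have "\<dots> \<le> 2 * ennreal ((h s - g s)\<^sup>2) + 2 * ennreal (w\<^sup>2)"
            using err_g[OF s(1)] by (intro add_left_mono mult_left_mono) auto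
          finally show ?thesis using True s by simp
        qed simp
      qed
    qed
    also have "\<dots> = 2 * (\<integral>\<^sup>+s\<in>{0..T}. ennreal ((h s - g s)\<^sup>2) \<partial>lborel) + 2 * (ennreal (w\<^sup>2) * ennreal t)"
      using t0 by (simp add: nn_integral_add nn_integral_cmult)
    also have "\<dots> \<le> 2 * ennreal \<delta> + 2 * ennreal \<delta>"
    proof -
      have "w\<^sup>2 * t \<le> w\<^sup>2 * T" using t0 by (intro mult_left_mono) auto
      then have "w\<^sup>2 * t \<le> \<delta>" using w by linarith
      then have "ennreal (w\<^sup>2) * ennreal t \<le> ennreal \<delta>" using t0 by (simp flip: ennreal_mult add: ennreal_leI)
      then show ?thesis using g(2) by (intro add_mono mult_left_mono) auto
    qed
    also have "\<dots> = ennreal (4 * \<delta>)" using \<delta> by (simp flip: ennreal_numeral ennreal_mult ennreal_plus)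
    finally show ?thesis .
  qed
  have G: "\<forall>k<n. (\<theta> k)\<^sup>2 \<le> B\<^sup>2"
  proof (intro allI impI)
    fix k assume "k < n"
    then have "\<bar>\<theta> k\<bar> \<le> B" unfolding \<theta>_def using node[of k] by (intro B) auto
    then show "(\<theta> k)\<^sup>2 \<le> B\<^sup>2" by (metis abs_le_square_iff abs_of_nonneg abs_ge_zero order_trans)
  qed
  have fin: "C * (B\<^sup>2 * t / real n + 4 * \<delta>) \<le> \<epsilon>"
  proof -
    have "C * B\<^sup>2 * t / real n \<le> C * B\<^sup>2 * T / real n" using C t0 by (intro divide_right_mono mult_left_mono) auto
    then have "C * B\<^sup>2 * t / real n \<le> \<epsilon> / 2" using n(3) by linarith
    moreover have "C * (B\<^sup>2 * t / real n + 4 * \<delta>) = C * B\<^sup>2 * t / real n + C * (4 * \<delta>)"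
      by (simp add: distrib_left mult.assoc)
    ultimately show ?thesis using C\<delta> by linarith
  qed
  have "\<forall>(M :: 'a measure) F W Z. brownian M F W \<longrightarrow> linear_sde M F W T h Z \<longrightarrow>
    (\<integral>\<^sup>+\<omega>. ennreal ((Z t \<omega> - zE t n \<theta> (\<lambda>s. W s \<omega>) n)\<^sup>2) \<partial>M) \<le> ennreal \<epsilon>"
  proof (intro allI impI)
    fix M :: "'a measure" and F W Z
    assume "brownian M F W" "linear_sde M F W T h Z"
    from err[OF this t n(1) D _ \<delta>(2) G] \<delta>(1)
    have "(\<integral>\<^sup>+\<omega>. ennreal ((Z t \<omega> - zE t n \<theta> (\<lambda>s. W s \<omega>) n)\<^sup>2) \<partial>M) \<le> ennreal (C * (B\<^sup>2 * t / real n + 4 * \<delta>))"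
      by simp
    also have "\<dots> \<le> ennreal \<epsilon>" by (rule ennreal_leI[OF fin])
    finally show "(\<integral>\<^sup>+\<omega>. ennreal ((Z t \<omega> - zE t n \<theta> (\<lambda>s. W s \<omega>) n)\<^sup>2) \<partial>M) \<le> ennreal \<epsilon>" .
  qed
  then show ?thesis by blast
qed

text \<open>The functional does not depend on the solution: this yields pathwise uniqueness,
  independence and equality of laws at once.\<close>

lemma linear_sde_functional:
  assumes t: "t \<in> {0..T}"
  shows "\<exists>\<zeta>\<in>borel_measurable (\<Pi>\<^sub>M s\<in>{0..}. borel). \<forall>(M :: 'a measure) F W Z.
    brownian M F W \<longrightarrow> linear_sde M F W T h Z \<longrightarrow> (AE \<omega> in M. Z t \<omega> = \<zeta> (path W \<omega>))"
proof -
  have t0: "0 \<le> t" using t by auto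
  \<comment> \<open>The errors \<open>(1/2)^j\<close> are summable, so the whole sequence converges
    almost surely. Grids and coefficients are fixed once for all solutions.\<close>
  define P where "P j n \<theta> \<longleftrightarrow> (\<forall>(M :: 'a measure) F W Z. brownian M F W \<longrightarrow> linear_sde M F W T h Z \<longrightarrow>
    (\<integral>\<^sup>+\<omega>. ennreal ((Z t \<omega> - zE t n \<theta> (\<lambda>s. W s \<omega>) n)\<^sup>2) \<partial>M) \<le> ennreal ((1/2)^j))" for j n \<theta>
  have "\<forall>j. \<exists>n \<theta>. P j n \<theta>"
    unfolding P_def by (rule allI, rule linear_sde_euler_approx[OF t]) simp
  then obtain n \<theta> where "\<And>j. P j (n j) (\<theta> j)" by metis
  then have n: "\<And>j (M :: 'a measure) F W Z. brownian M F W \<Longrightarrow> linear_sde M F W T h Z \<Longrightarrow>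
    (\<integral>\<^sup>+\<omega>. ennreal ((Z t \<omega> - zE t (n j) (\<theta> j) (\<lambda>s. W s \<omega>) (n j))\<^sup>2) \<partial>M) \<le> ennreal ((1/2)^j)"
    unfolding P_def by blast
  \<comment> \<open>Where the schemes diverge, \<open>lim\<close> takes one fixed unspecified value,
    so measurability is not lost.\<close>
  define \<zeta> where "\<zeta> w = lim (\<lambda>j. zE t (n j) (\<theta> j) w (n j))" for w
  have m: "\<zeta> \<in> borel_measurable (\<Pi>\<^sub>M s\<in>{0..}. borel)"
    unfolding \<zeta>_def by (intro borel_measurable_lim_metric zE_measurable t0)
  have "AE \<omega> in M. Z t \<omega> = \<zeta> (path W \<omega>)"
    if bm': "brownian M F W" and sde: "linear_sde M F W T h Z" for M :: "'a measure" and F W Z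
  proof -
    interpret brownian M F W by fact
    define d where "d j \<omega> = (Z t \<omega> - zB t (n j) (\<theta> j) (n j) \<omega>)\<^sup>2" for j \<omega>
    have [measurable]: "Z t \<in> borel_measurable M" using linear_sde_rep[OF sde] t by blast
    have [measurable]: "zB t (n j) (\<theta> j) (n j) \<in> borel_measurable M" for j
      using zB_F[OF t0] by (rule measurable_F_M)
    have [measurable]: "d j \<in> borel_measurable M" for j unfolding d_def[abs_def] by measurable
    have "(\<integral>\<^sup>+\<omega>. (\<Sum>j. ennreal (d j \<omega>)) \<partial>M) = (\<Sum>j. \<integral>\<^sup>+\<omega>. ennreal (d j \<omega>) \<partial>M)"
      by (rule nn_integral_suminf) simp
    also have "\<dots> \<le> (\<Sum>j. ennreal ((1/2)^j))"
      using n[OF bm' sde] unfolding d_def by (intro suminf_le) auto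
    also have "\<dots> < \<infinity>" by (subst suminf_ennreal2) auto
    finally have "AE \<omega> in M. (\<Sum>j. ennreal (d j \<omega>)) \<noteq> \<infinity>" by (intro nn_integral_noteq_infinite) auto
    then show ?thesis
    proof eventually_elim
      case (elim \<omega>)
      then have "summable (\<lambda>j. d j \<omega>)" by (intro summable_suminf_not_top) (auto simp: d_def)
      then have "(\<lambda>j. d j \<omega>) \<longlonglongrightarrow> 0" by (rule summable_LIMSEQ_zero)
      then have "(\<lambda>j. sqrt (d j \<omega>)) \<longlonglongrightarrow> sqrt 0" by (rule tendsto_real_sqrt)
      then have "(\<lambda>j. \<bar>Z t \<omega> - zB t (n j) (\<theta> j) (n j) \<omega>\<bar>) \<longlonglongrightarrow> 0" by (simp add: d_def)
      then have "(\<lambda>j. Z t \<omega> - zB t (n j) (\<theta> j) (n j) \<omega>) \<longlonglongrightarrow> 0" by (simp only: tendsto_rabs_zero_iff)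
      then have "(\<lambda>j. Z t \<omega> - (Z t \<omega> - zB t (n j) (\<theta> j) (n j) \<omega>)) \<longlonglongrightarrow> Z t \<omega> - 0" by (intro tendsto_intros)
      then have "(\<lambda>j. zB t (n j) (\<theta> j) (n j) \<omega>) \<longlonglongrightarrow> Z t \<omega>" by simp
      then show ?case unfolding \<zeta>_def zE_path[OF t0] by (rule limI[symmetric])
    qed
  qed
  then show ?thesis using m by blast
qed

end

section \<open>The equation with additive noise\<close>

locale drift =
  fixes T K L :: real and b :: "real \<Rightarrow> real \<Rightarrow> real \<Rightarrow> real"
  assumes T: "0 \<le> T" and L: "0 \<le> L"
    and cont: "\<And>x m. continuous_on {0..T} (\<lambda>t. b t x m)"
    and lip_x: "\<And>t x y m. t \<in> {0..T} \<Longrightarrow> \<bar>b t x m - b t y m\<bar> \<le> L * \<bar>x - y\<bar>"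
    and lip_m: "\<And>t x m m'. t \<in> {0..T} \<Longrightarrow> \<bar>b t x m - b t x m'\<bar> \<le> L * \<bar>m - m'\<bar>"
    and bound: "\<And>t x m. t \<in> {0..T} \<Longrightarrow> \<bar>b t x m\<bar> \<le> K"
begin

lemma K: "0 \<le> K" using bound[of 0 0 0] T by auto

text \<open>The Lipschitz bounds in \<open>x\<close> and \<open>m\<close> are uniform in time, which
  upgrades continuity in \<open>t\<close> at fixed arguments to joint continuity. It is wanted for
  the Borel measurability of the drift along a path.\<close>

lemma joint_continuous: "continuous_on ({0..T} \<times> UNIV) (\<lambda>(s, x, m). b s x m)"
proof -
  have "((\<lambda>p. b (fst p) (fst (snd p)) (snd (snd p))) \<longlongrightarrow> b s x m) (at (s, x, m) within {0..T} \<times> UNIV)"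
    if s: "s \<in> {0..T}" for s x m
  proof -
    let ?F = "at (s, x, m) within {0..T} \<times> UNIV"
    have id: "((\<lambda>p. p) \<longlongrightarrow> (s, x, m)) ?F" by (rule tendsto_ident_at)
    note f = tendsto_fst[OF id] tendsto_fst[OF tendsto_snd[OF id]] tendsto_snd[OF tendsto_snd[OF id]]
    have c: "((\<lambda>p. b (fst p) x m) \<longlongrightarrow> b s x m) ?F"
    proof -
      have "continuous_on ({0..T} \<times> UNIV) (\<lambda>p. b (fst p) x m)"
        by (rule continuous_on_compose2[OF cont]) (auto intro: continuous_intros)
      then show ?thesis using s unfolding continuous_on_def by force
    qed
    have "((\<lambda>p. L * \<bar>fst (snd p) - x\<bar> + L * \<bar>snd (snd p) - m\<bar> + \<bar>b (fst p) x m - b s x m\<bar>) \<longlongrightarrow>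
        L * \<bar>x - x\<bar> + L * \<bar>m - m\<bar> + \<bar>b s x m - b s x m\<bar>) ?F"
      using f c by (intro tendsto_intros) (simp_all add: fst_conv snd_conv)
    then have lim: "((\<lambda>p. L * \<bar>fst (snd p) - x\<bar> + L * \<bar>snd (snd p) - m\<bar> + \<bar>b (fst p) x m - b s x m\<bar>) \<longlongrightarrow> 0) ?F"
      by simp
    have "((\<lambda>p. b (fst p) (fst (snd p)) (snd (snd p)) - b s x m) \<longlongrightarrow> 0) ?F"
    proof (rule Lim_null_comparison[OF _ lim])
      show "\<forall>\<^sub>F p in ?F. norm (b (fst p) (fst (snd p)) (snd (snd p)) - b s x m)
          \<le> L * \<bar>fst (snd p) - x\<bar> + L * \<bar>snd (snd p) - m\<bar> + \<bar>b (fst p) x m - b s x m\<bar>"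
        unfolding eventually_at_filter
      proof (intro always_eventually allI impI)
        fix p :: "real \<times> real \<times> real" assume "p \<in> {0..T} \<times> UNIV"
        then have "fst p \<in> {0..T}" by auto
        from lip_x[OF this, of "fst (snd p)" "snd (snd p)" x] lip_m[OF this, of x "snd (snd p)" m]
        show "norm (b (fst p) (fst (snd p)) (snd (snd p)) - b s x m)
          \<le> L * \<bar>fst (snd p) - x\<bar> + L * \<bar>snd (snd p) - m\<bar> + \<bar>b (fst p) x m - b s x m\<bar>"
          by (simp add: abs_if split: if_splits)
      qed
    qed
    then show ?thesis by (rule Lim_null[THEN iffD2])
  qed
  then show ?thesis unfolding continuous_on_def case_prod_beta by auto
qed

lemma joint_measurable: "(\<lambda>(s, x, m). indicator {0..T} s * b s x m) \<in> borel_measurable (borel \<Otimes>\<^sub>M borel \<Otimes>\<^sub>M borel)"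
proof -
  have "(\<lambda>p. indicator ({0..T} \<times> UNIV) p *\<^sub>R (\<lambda>(s, x, m). b s x m) p) \<in> borel_measurable borel"
    by (rule borel_measurable_continuous_on_indicator[OF _ joint_continuous]) (intro borel_closed closed_Times closed_atLeastAtMost closed_UNIV)
  then show ?thesis unfolding borel_prod by (rule measurable_cong[THEN iffD1, rotated]) (auto simp: indicator_def)
qed

lemma drift_measurable:
  assumes "S \<in> borel_measurable N" "U \<in> borel_measurable N" "Q \<in> borel_measurable N"
  shows "(\<lambda>x. indicator {0..T} (S x) * b (S x) (U x) (Q x)) \<in> borel_measurable N"
  using measurable_compose[OF measurable_Pair[OF assms(1) measurable_Pair[OF assms(2,3)]] joint_measurable] by simp

lemma drift_integrable:
  assumes [measurable]: "u \<in> borel_measurable borel" "m \<in> borel_measurable borel" and A: "A \<in> sets borel" "A \<subseteq> {0..T}"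
  shows "set_integrable lborel A (\<lambda>s. b s (u s) (m s))"
proof -
  have "integrable lborel (\<lambda>s. indicator {0..T} s * b s (u s) (m s))"
  proof (rule Bochner_Integration.integrable_bound[of lborel "\<lambda>s. K * indicator {0..T} s"])
    show "(\<lambda>s. indicator {0..T} s * b s (u s) (m s)) \<in> borel_measurable lborel"
      using drift_measurable[of "\<lambda>s. s" lborel u m] by simp
    show "AE s in lborel. norm (indicator {0..T} s * b s (u s) (m s)) \<le> norm (K * indicator {0..T} s)"
      using bound K by (auto simp: indicator_def)
    show "integrable lborel (\<lambda>s. K * indicator {0..T} s)"
      by (intro integrable_mult_right integrable_real_indicator) (auto simp: emeasure_lborel_Icc_eq)
  qed
  then have "set_integrable lborel {0..T} (\<lambda>s. b s (u s) (m s))" unfolding set_integrable_def by simp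
  then show ?thesis by (rule set_integrable_subset) (use A in auto)
qed

end

lemma set_integral_diff_bound:
  fixes f g c :: "real \<Rightarrow> real"
  assumes "set_integrable lborel A f" "set_integrable lborel A g" "set_integrable lborel A c"
    and "\<And>s. s \<in> A \<Longrightarrow> \<bar>f s - g s\<bar> \<le> c s"
  shows "\<bar>(LBINT s:A. f s) - (LBINT s:A. g s)\<bar> \<le> (LBINT s:A. c s)"
proof -
  have "(LBINT s:A. f s) - (LBINT s:A. g s) = (LBINT s:A. f s - g s)"
    using assms by (simp add: set_integral_diff)
  also have "\<bar>\<dots>\<bar> \<le> (LBINT s:A. c s)"
    unfolding set_lebesgue_integral_def real_norm_def[symmetric]
  proof (rule order_trans[OF integral_norm_bound], rule integral_mono)
    show "integrable lborel (\<lambda>s. norm (indicator A s *\<^sub>R (f s - g s)))"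
      using set_integral_diff(1)[OF assms(1,2)] unfolding set_integrable_def by (rule integrable_norm)
    show "integrable lborel (\<lambda>s. indicator A s *\<^sub>R c s)" using assms(3) unfolding set_integrable_def .
    show "norm (indicator A s *\<^sub>R (f s - g s)) \<le> indicator A s *\<^sub>R c s" for s
      using assms(4)[of s] by (auto simp: indicator_def)
  qed
  finally show ?thesis .
qed

lemma set_integral_const_Ioc: "a \<le> c \<Longrightarrow> (LBINT s:{a<..c}. (k::real)) = k * (c - a)"
  unfolding set_lebesgue_integral_def by simp

lemma set_integrable_const_Ioc: "set_integrable lborel {a<..c::real} (\<lambda>s. k::real)"
  unfolding set_integrable_def by (cases "a \<le> c") (auto intro!: integrable_mult_left integrable_real_indicator)

lemma one_plus_power_le_exp:
  assumes "0 \<le> (x::real)"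
  shows "(1 + x / real n) ^ n \<le> exp x"
proof (cases "n = 0")
  case False
  have "(1 + x / real n) ^ n \<le> exp (x / real n) ^ n"
    using assms by (intro power_mono exp_ge_add_one_self) (auto intro!: add_nonneg_nonneg)
  also have "\<dots> = exp x" using False by (simp add: exp_of_nat_mult[symmetric])
  finally show ?thesis .
qed (use assms in simp)

section \<open>The Euler scheme with an additive driver\<close>

primrec xE :: "(real \<Rightarrow> real \<Rightarrow> real \<Rightarrow> real) \<Rightarrow> (real \<Rightarrow> real) \<Rightarrow> real \<Rightarrow> (real \<Rightarrow> real) \<Rightarrow> real \<Rightarrow> nat \<Rightarrow> nat \<Rightarrow> real" where
  "xE b m x0 y t n 0 = x0"
| "xE b m x0 y t n (Suc k) = xE b m x0 y t n k
    + (LBINT s:{t * real k / real n<..t * real (Suc k) / real n}. b s (xE b m x0 y t n k) (m s))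
    + (y (t * real (Suc k) / real n) - y (t * real k / real n))"

context drift
begin

lemma drift_integral_measurable:
  assumes [measurable]: "m \<in> borel_measurable borel" "A \<in> sets borel" and A: "A \<subseteq> {0..T}"
  shows "(\<lambda>x. LBINT s:A. b s x (m s)) \<in> borel_measurable borel"
proof -
  have "(\<lambda>p. indicator {0..T} (snd p) * b (snd p) (fst p) (m (snd p))) \<in> borel_measurable (borel \<Otimes>\<^sub>M lborel)"
    by (rule drift_measurable) measurable
  then have 1: "(\<lambda>p. indicator A (snd p) *\<^sub>R (indicator {0..T} (snd p) * b (snd p) (fst p) (m (snd p)))) \<in> borel_measurable (borel \<Otimes>\<^sub>M lborel)"
    by measurable
  have "(\<lambda>(x, s). indicator A s *\<^sub>R b s x (m s)) \<in> borel_measurable (borel \<Otimes>\<^sub>M lborel)"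
    using A by (intro measurable_cong[THEN iffD1, OF _ 1]) (auto simp: indicator_def)
  then show ?thesis unfolding set_lebesgue_integral_def
    by (rule lborel.borel_measurable_lebesgue_integral)
qed

lemma xE_measurable:
  assumes m: "m \<in> borel_measurable borel" and t: "t \<in> {0..T}" and k: "k \<le> n"
  shows "(\<lambda>w. xE b m x0 (\<lambda>s. c s + \<sigma> * w s) t n k) \<in> borel_measurable (\<Pi>\<^sub>M s\<in>{0..}. borel)"
  using k
proof (induction k)
  case (Suc k)
  have t0: "0 \<le> t" "t \<le> T" using t by auto
  have w: "(\<lambda>w. c (t * real j / real n) + \<sigma> * w (t * real j / real n)) \<in> borel_measurable (\<Pi>\<^sub>M s\<in>{0..}. borel)" for j
    using t0 by (intro borel_measurable_add borel_measurable_times borel_measurable_const measurable_component_singleton) auto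
  have "{t * real k / real n<..t * real (Suc k) / real n} \<subseteq> {0..T}"
  proof
    fix x assume x: "x \<in> {t * real k / real n<..t * real (Suc k) / real n}"
    have "0 \<le> t * real k / real n" using t0 by simp
    then show "x \<in> {0..T}" using x grid_le_end[OF t0(1) Suc.prems] t0 unfolding greaterThanAtMost_iff atLeastAtMost_iff by linarith
  qed
  then have "(\<lambda>x. LBINT s:{t * real k / real n<..t * real (Suc k) / real n}. b s x (m s)) \<in> borel_measurable borel"
    by (intro drift_integral_measurable m) simp
  note i = measurable_compose[OF Suc.IH this]
  show ?case unfolding xE.simps using Suc.prems
    by (intro borel_measurable_add borel_measurable_diff w i Suc.IH) auto
qed simp

lemma drift_integral_diff_bound:
  assumes "u \<in> borel_measurable borel" "m \<in> borel_measurable borel" "v \<in> borel_measurable borel" "m' \<in> borel_measurable borel"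
    and "A \<in> sets borel" "A \<subseteq> {0..T}" "set_integrable lborel A c"
    and "\<And>s. s \<in> A \<Longrightarrow> L * \<bar>u s - v s\<bar> + L * \<bar>m s - m' s\<bar> \<le> c s"
  shows "\<bar>(LBINT s:A. b s (u s) (m s)) - (LBINT s:A. b s (v s) (m' s))\<bar> \<le> (LBINT s:A. c s)"
proof (rule set_integral_diff_bound)
  show "\<bar>b s (u s) (m s) - b s (v s) (m' s)\<bar> \<le> c s" if "s \<in> A" for s
  proof -
    have "s \<in> {0..T}" using that assms(6) by auto
    from lip_x[OF this, of "u s" "m s" "v s"] lip_m[OF this, of "v s" "m s" "m' s"] assms(8)[OF that]
    show ?thesis by linarith
  qed
qed (use assms in \<open>auto intro!: drift_integrable\<close>)

text \<open>On a cell the scheme freezes the space variable only, so the merely measurable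
  \<open>m\<close> causes no error; the local error is \<open>L (t / n)\<close> times the
  oscillation \<open>w\<close> of the solution, and the driver \<open>y\<close> cancels. The product
  \<open>k (q w) (1 + q)^k\<close> with \<open>q = L (t / n)\<close> is a closed upper bound for the
  recursion that sends \<open>d\<close> to \<open>d (1 + q) + q w\<close>.\<close>

lemma xE_error:
  assumes m: "m \<in> borel_measurable borel" and u: "continuous_on UNIV u"
    and eq: "\<And>s. s \<in> {0..T} \<Longrightarrow> u s = x0 + (LBINT r:{0..s}. b r (u r) (m r)) + (y s - y 0)"
    and t: "t \<in> {0..T}" and osc: "\<And>s r. s \<in> {0..T} \<Longrightarrow> r \<in> {0..T} \<Longrightarrow> \<bar>s - r\<bar> \<le> t / real n \<Longrightarrow> \<bar>u s - u r\<bar> \<le> w"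
    and w: "0 \<le> w" and k: "k \<le> n"
  shows "\<bar>u (t * real k / real n) - xE b m x0 y t n k\<bar> \<le> real k * (L * (t / real n) * w) * (1 + L * (t / real n)) ^ k"
  using k
proof (induction k)
  case 0
  have "(LBINT r:{0..0}. b r (u r) (m r)) = 0"
    unfolding set_lebesgue_integral_def by (intro integral_eq_zero_AE) (auto intro: AE_mp[OF AE_lborel_singleton[of 0]])
  then show ?case using eq[of 0] T by simp
next
  case (Suc k)
  have t0: "0 \<le> t" "t \<le> T" using t by auto
  let ?a = "t * real k / real n" and ?b = "t * real (Suc k) / real n" and ?x = "xE b m x0 y t n k"
  let ?q = "L * (t / real n)" and ?d = "\<bar>u (t * real k / real n) - xE b m x0 y t n k\<bar>"
  have [measurable]: "u \<in> borel_measurable borel" using u by (rule borel_measurable_continuous_onI)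
  have ab: "0 \<le> ?a" "?a \<le> ?b" "?b \<le> T"
    using t0 grid_le[OF t0(1), of k "Suc k" n] grid_le_end[OF t0(1) Suc.prems] by (auto simp del: of_nat_Suc)
  have un: "{0..?b} = {0..?a} \<union> {?a<..?b}" using ab by auto
  have "(LBINT r:{0..?b}. b r (u r) (m r)) = (LBINT r:{0..?a}. b r (u r) (m r)) + (LBINT r:{?a<..?b}. b r (u r) (m r))"
    unfolding un using ab m by (intro set_integral_Un drift_integrable) auto
  then have "u ?b - xE b m x0 y t n (Suc k) = (u ?a - ?x) + ((LBINT r:{?a<..?b}. b r (u r) (m r)) - (LBINT r:{?a<..?b}. b r ?x (m r)))"
    using eq[of ?a] eq[of ?b] ab unfolding xE.simps by auto
  moreover have "\<bar>(LBINT r:{?a<..?b}. b r (u r) (m r)) - (LBINT r:{?a<..?b}. b r ?x (m r))\<bar> \<le> (LBINT r:{?a<..?b}. L * (w + ?d))"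
  proof (rule drift_integral_diff_bound[where u = u and v = "\<lambda>_. ?x" and m = m and m' = m])
    fix s assume s: "s \<in> {?a<..?b}"
    have "\<bar>s - ?a\<bar> \<le> t / real n" using s grid_diff[of t k n] unfolding greaterThanAtMost_iff by linarith
    then have "\<bar>u s - u ?a\<bar> \<le> w" using s ab by (intro osc) auto
    then have "\<bar>u s - ?x\<bar> \<le> w + ?d" by linarith
    then show "L * \<bar>u s - ?x\<bar> + L * \<bar>m s - m s\<bar> \<le> L * (w + ?d)" using L by (simp add: mult_left_mono)
  qed (use ab m in \<open>auto intro: set_integrable_const_Ioc\<close>)
  moreover have "(LBINT r:{?a<..?b}. L * (w + ?d)) = L * (w + ?d) * (t / real n)"
    using set_integral_const_Ioc[OF ab(2)] unfolding grid_diff by simp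
  ultimately have "\<bar>u ?b - xE b m x0 y t n (Suc k)\<bar> \<le> ?d + L * (w + ?d) * (t / real n)" by linarith
  also have "\<dots> = ?d * (1 + ?q) + ?q * w"
    by (simp add: algebra_simps add_divide_distrib)
  also have "\<dots> \<le> real k * (?q * w) * (1 + ?q) ^ k * (1 + ?q) + ?q * w * (1 + ?q) ^ Suc k"
  proof (rule add_mono)
    have q: "0 \<le> ?q" using L t0 by simp
    show "?d * (1 + ?q) \<le> real k * (?q * w) * (1 + ?q) ^ k * (1 + ?q)"
      using Suc q by (intro mult_right_mono) auto
    have "1 \<le> (1 + ?q) ^ Suc k" using q by (intro one_le_power) simp
    then show "?q * w \<le> ?q * w * (1 + ?q) ^ Suc k" using q w by (metis mult_left_mono mult.right_neutral mult_nonneg_nonneg)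
  qed
  also have "\<dots> = real (Suc k) * (?q * w) * (1 + ?q) ^ Suc k"
  proof -
    have "real k * v * P * r + v * (r * P) = (real k + 1) * v * (r * P)" for v P r :: real by (simp add: algebra_simps)
    then show ?thesis unfolding power_Suc of_nat_Suc by (simp only: add.commute[of 1])
  qed
  finally show ?case .
qed

lemma xE_converges:
  assumes m: "m \<in> borel_measurable borel" and u: "continuous_on UNIV u"
    and eq: "\<And>s. s \<in> {0..T} \<Longrightarrow> u s = x0 + (LBINT r:{0..s}. b r (u r) (m r)) + (y s - y 0)"
    and t: "t \<in> {0..T}"
  shows "(\<lambda>n. xE b m x0 y t n n) \<longlonglongrightarrow> u t"
proof (rule LIMSEQ_I)
  fix e :: real assume e: "0 < e"
  have t0: "0 \<le> t" "t \<le> T" using t by auto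
  \<comment> \<open>Makes the bound \<open>L t exp (L t) w\<close> at most \<open>e / 2\<close>; the
    summand 1 keeps the denominator positive.\<close>
  define w where "w = e / (2 * (L * t * exp (L * t) + 1))"
  have p: "0 < L * t * exp (L * t) + 1" using L t0 by (intro add_nonneg_pos mult_nonneg_nonneg) auto
  have w: "0 < w" using e p by (simp add: w_def)
  have uT: "continuous_on {0..T} u" using u by (rule continuous_on_subset) simp
  obtain d where d: "d > 0" "\<And>s r. s \<in> {0..T} \<Longrightarrow> r \<in> {0..T} \<Longrightarrow> \<bar>r - s\<bar> < d \<Longrightarrow> \<bar>u r - u s\<bar> < w"
    using compact_uniformly_continuous[OF uT compact_Icc] w unfolding uniformly_continuous_on_def dist_real_def by meson
  obtain N :: nat where N: "T / d < real N" using reals_Archimedean2 by blast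
  show "\<exists>N. \<forall>n\<ge>N. norm (xE b m x0 y t n n - u t) < e"
  proof (intro exI allI impI)
    fix n assume "Suc N \<le> n"
    then have n: "0 < real n" "real N < real n" by auto
    have "t / real n < d"
    proof -
      have "T / d < real n" using N n by simp
      then have "T < real n * d" using d(1) by (simp add: divide_less_eq)
      then show ?thesis using n t0 by (simp add: divide_less_eq mult.commute)
    qed
    then have osc: "\<bar>u s - u r\<bar> \<le> w" if "s \<in> {0..T}" "r \<in> {0..T}" "\<bar>s - r\<bar> \<le> t / real n" for s r
      using d(2)[OF that(2,1)] that(3) by simp
    have "\<bar>u (t * real n / real n) - xE b m x0 y t n n\<bar> \<le> real n * (L * (t / real n) * w) * (1 + L * (t / real n)) ^ n"
      by (rule xE_error[OF m u eq t osc less_imp_le[OF w] order_refl])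
    moreover have "t * real n / real n = t" using n by simp
    ultimately have "\<bar>u t - xE b m x0 y t n n\<bar> \<le> real n * (L * (t / real n) * w) * (1 + L * (t / real n)) ^ n" by simp
    also have "\<dots> = L * t * w * (1 + L * t / real n) ^ n" using n by simp
    also have "\<dots> \<le> L * t * w * exp (L * t)"
      using L t0 w by (intro mult_left_mono one_plus_power_le_exp) auto
    also have "\<dots> = (L * t * exp (L * t)) * w" by simp
    also have "\<dots> \<le> (L * t * exp (L * t) + 1) * w" using w by (intro mult_right_mono) auto
    also have "\<dots> = e / 2"
    proof -
      have "q * (e / (2 * q)) = e / 2" if "0 < q" for q using that by simp
      then show ?thesis unfolding w_def using p by blast
    qed
    also have "\<dots> < e" using e by simp
    finally show "norm (xE b m x0 y t n n - u t) < e" by (simp add: abs_minus_commute)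
  qed
qed

text \<open>The drivers cancel, which leaves a discrete Gronwall estimate. The bound depends neither
  on \<open>n\<close> nor on \<open>y\<close>: it survives the limit, and it is deterministic even
  when the driver is a random path.\<close>

lemma xE_stable:
  assumes m: "m \<in> borel_measurable borel" "m' \<in> borel_measurable borel"
    and i: "set_integrable lborel {0..T} (\<lambda>s. \<bar>m s - m' s\<bar>)" and t: "t \<in> {0..T}"
  shows "\<bar>xE b m x0 y t n n - xE b m' x0 y t n n\<bar> \<le> exp (L * t) * L * (LBINT s:{0<..t}. \<bar>m s - m' s\<bar>)"
proof (cases "n = 0")
  case True
  have "0 \<le> (LBINT s:{0<..t}. \<bar>m s - m' s\<bar>)" unfolding set_lebesgue_integral_def by (intro integral_nonneg_AE) auto
  then show ?thesis using True L by simp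
next
  case False
  have t0: "0 \<le> t" "t \<le> T" using t by auto
  let ?q = "L * (t / real n)"
  have q: "0 \<le> ?q" using L t0 by simp
  define \<mu> where "\<mu> A = (LBINT s:A. \<bar>m s - m' s\<bar>)" for A
  have \<mu>0: "0 \<le> \<mu> A" for A unfolding \<mu>_def set_lebesgue_integral_def by (intro integral_nonneg_AE) auto
  have main: "\<bar>xE b m x0 y t n k - xE b m' x0 y t n k\<bar> \<le> (1 + ?q) ^ k * (L * \<mu> {0<..t * real k / real n})" if "k \<le> n" for k
    using that
  proof (induction k)
    case 0
    then show ?case using L \<mu>0 by simp
  next
    case (Suc k)
    let ?a = "t * real k / real n" and ?b = "t * real (Suc k) / real n"
    let ?x = "xE b m x0 y t n k" and ?x' = "xE b m' x0 y t n k"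
    let ?d = "\<bar>?x - ?x'\<bar>"
    have ab: "0 \<le> ?a" "?a \<le> ?b" "?b \<le> T"
      using t0 grid_le[OF t0(1), of k "Suc k" n] grid_le_end[OF t0(1) Suc.prems] by (auto simp del: of_nat_Suc)
    have si: "set_integrable lborel A (\<lambda>s. \<bar>m s - m' s\<bar>)" if "A \<in> sets borel" "A \<subseteq> {0..T}" for A
      using i that by (intro set_integrable_subset[OF i]) auto
    have cell: "{?a<..?b} \<subseteq> {0..T}" "{0<..?a} \<subseteq> {0..T}" using ab by auto
    have sc: "set_integrable lborel {?a<..?b} (\<lambda>s. L * ?d + L * \<bar>m s - m' s\<bar>)"
      using si[OF _ cell(1)] by (intro set_integral_add set_integrable_const_Ioc set_integrable_mult_right) auto
    have "\<bar>(LBINT r:{?a<..?b}. b r ?x (m r)) - (LBINT r:{?a<..?b}. b r ?x' (m' r))\<bar> \<le> (LBINT s:{?a<..?b}. L * ?d + L * \<bar>m s - m' s\<bar>)"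
      by (rule drift_integral_diff_bound[where u = "\<lambda>_. ?x" and v = "\<lambda>_. ?x'" and m = m and m' = m']) (use m sc cell in auto)
    also have "\<dots> = L * ?d * (t / real n) + L * \<mu> {?a<..?b}"
      unfolding \<mu>_def using si[OF _ cell(1)] set_integral_const_Ioc[OF ab(2), of "L * ?d"] unfolding grid_diff
      by (subst set_integral_add) (auto intro!: set_integrable_const_Ioc set_integrable_mult_right)
    finally have "\<bar>xE b m x0 y t n (Suc k) - xE b m' x0 y t n (Suc k)\<bar> \<le> ?d + (L * ?d * (t / real n) + L * \<mu> {?a<..?b})"
      unfolding xE.simps by linarith
    also have "\<dots> = (1 + ?q) * ?d + L * \<mu> {?a<..?b}" by (simp add: algebra_simps)
    also have "\<dots> \<le> (1 + ?q) * ((1 + ?q) ^ k * (L * \<mu> {0<..?a})) + (1 + ?q) ^ Suc k * (L * \<mu> {?a<..?b})"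
    proof (rule add_mono)
      show "(1 + ?q) * ?d \<le> (1 + ?q) * ((1 + ?q) ^ k * (L * \<mu> {0<..?a}))"
        using Suc q by (intro mult_left_mono) auto
      have "1 \<le> (1 + ?q) ^ Suc k" using q by (intro one_le_power) simp
      moreover have "0 \<le> L * \<mu> {?a<..?b}" using L \<mu>0 by simp
      ultimately show "L * \<mu> {?a<..?b} \<le> (1 + ?q) ^ Suc k * (L * \<mu> {?a<..?b})"
        by (metis mult_right_mono mult_1)
    qed
    also have "\<dots> = (1 + ?q) ^ Suc k * (L * (\<mu> {0<..?a} + \<mu> {?a<..?b}))" by (simp add: algebra_simps)
    also have "\<mu> {0<..?a} + \<mu> {?a<..?b} = \<mu> {0<..?b}"
    proof -
      have un: "{0<..?b} = {0<..?a} \<union> {?a<..?b}" using ab by auto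
      show ?thesis unfolding \<mu>_def un using cell by (intro set_integral_Un[symmetric] si) auto
    qed
    finally show ?case .
  qed
  have "\<bar>xE b m x0 y t n n - xE b m' x0 y t n n\<bar> \<le> (1 + ?q) ^ n * (L * \<mu> {0<..t})"
    using main[of n] False by simp
  also have "\<dots> \<le> exp (L * t) * (L * \<mu> {0<..t})"
    using one_plus_power_le_exp[of "L * t" n] L t0 \<mu>0 by (intro mult_right_mono) auto
  finally show ?thesis unfolding \<mu>_def by (simp add: mult.assoc)
qed

end

section \<open>Continuous versions and joint measurability\<close>

lemma floor_grid_tendsto: "(\<lambda>n. real_of_int \<lfloor>real (Suc n) * s\<rfloor> / real (Suc n)) \<longlonglongrightarrow> s"
proof (rule LIMSEQ_I)
  fix e :: real assume "0 < e"
  then obtain N :: nat where N: "1 / e < real N" using reals_Archimedean2 by blast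
  show "\<exists>N. \<forall>n\<ge>N. norm (real_of_int \<lfloor>real (Suc n) * s\<rfloor> / real (Suc n) - s) < e"
  proof (intro exI allI impI)
    fix n assume "N \<le> n"
    then have "1 / e < real (Suc n)" using N by simp
    then have n: "1 < e * real (Suc n)" using \<open>0 < e\<close> by (simp add: divide_less_eq mult.commute)
    have "\<bar>real_of_int \<lfloor>real (Suc n) * s\<rfloor> - real (Suc n) * s\<bar> \<le> 1" by linarith
    then have "\<bar>real_of_int \<lfloor>real (Suc n) * s\<rfloor> - real (Suc n) * s\<bar> < e * real (Suc n)" using n by linarith
    then have "\<bar>real_of_int \<lfloor>real (Suc n) * s\<rfloor> - real (Suc n) * s\<bar> / real (Suc n) < e"
      by (subst divide_less_eq) auto
    moreover have "real_of_int \<lfloor>real (Suc n) * s\<rfloor> / real (Suc n) - s = (real_of_int \<lfloor>real (Suc n) * s\<rfloor> - real (Suc n) * s) / real (Suc n)"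
      by (simp add: field_simps)
    ultimately show "norm (real_of_int \<lfloor>real (Suc n) * s\<rfloor> / real (Suc n) - s) < e" by (simp del: of_nat_Suc)
  qed
qed

text \<open>Rounding time down to a grid leaves countably many measurable pieces; continuity of the
  paths passes to the limit as the mesh shrinks.\<close>

lemma continuous_process_joint_measurable:
  fixes X :: "real \<Rightarrow> 'a \<Rightarrow> real"
  assumes m: "\<And>t. X t \<in> borel_measurable M" and c: "\<And>\<omega>. \<omega> \<in> space M \<Longrightarrow> continuous_on UNIV (\<lambda>t. X t \<omega>)"
  shows "(\<lambda>(s, \<omega>). X s \<omega>) \<in> borel_measurable (borel \<Otimes>\<^sub>M M)"
proof (rule borel_measurable_LIMSEQ_real)
  show "(\<lambda>(s, \<omega>). X (real_of_int \<lfloor>real (Suc n) * s\<rfloor> / real (Suc n)) \<omega>) \<in> borel_measurable (borel \<Otimes>\<^sub>M M)" for n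
  proof -
    have "(\<lambda>p. X (real_of_int \<lfloor>real (Suc n) * fst p\<rfloor> / real (Suc n)) (snd p)) \<in> borel_measurable (borel \<Otimes>\<^sub>M M)"
    proof (rule measurable_compose_countable[where f = "\<lambda>i p. X (real_of_int i / real (Suc n)) (snd p)"
          and g = "\<lambda>p. \<lfloor>real (Suc n) * fst p\<rfloor>"])
      show "(\<lambda>p. X (real_of_int i / real (Suc n)) (snd p)) \<in> borel_measurable (borel \<Otimes>\<^sub>M M)" for i
        by (rule measurable_compose[OF measurable_snd m])
    qed measurable
    then show ?thesis by (simp add: case_prod_beta)
  qed
  fix p assume "p \<in> space (borel \<Otimes>\<^sub>M M :: (real \<times> 'a) measure)"
  then have "snd p \<in> space M" by (auto simp: space_pair_measure)
  from c[OF this] have "isCont (\<lambda>t. X t (snd p)) (fst p)" by (simp add: continuous_on_eq_continuous_at)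
  from isCont_tendsto_compose[OF this floor_grid_tendsto]
  show "(\<lambda>n. (\<lambda>(s, \<omega>). X (real_of_int \<lfloor>real (Suc n) * s\<rfloor> / real (Suc n)) \<omega>) p) \<longlonglongrightarrow> (\<lambda>(s, \<omega>). X s \<omega>) p"
    by (simp add: case_prod_beta)
qed

lemma continuous_modification:
  fixes X :: "real \<Rightarrow> 'a \<Rightarrow> real"
  assumes T: "0 \<le> T" and m: "\<And>t. t \<in> {0..T} \<Longrightarrow> X t \<in> borel_measurable M"
    and c: "AE \<omega> in M. continuous_on {0..T} (\<lambda>t. X t \<omega>)"
  obtains Y where "\<And>\<omega>. continuous_on UNIV (\<lambda>t. Y t \<omega>)" "(\<lambda>(s, \<omega>). Y s \<omega>) \<in> borel_measurable (borel \<Otimes>\<^sub>M M)"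
    "AE \<omega> in M. \<forall>t\<in>{0..T}. Y t \<omega> = X t \<omega>" "\<And>t. Y t \<in> borel_measurable M"
proof -
  obtain N where N: "{\<omega> \<in> space M. \<not> continuous_on {0..T} (\<lambda>t. X t \<omega>)} \<subseteq> N" "N \<in> null_sets M"
    using c by (auto simp: eventually_ae_filter)
  \<comment> \<open>Exceptional paths are replaced by 0 and time is clamped to
    \<open>{0..T}\<close>, so that continuity holds for every path and on the whole real
    line.\<close>
  define Y where "Y t \<omega> = (if \<omega> \<in> space M - N then X (max 0 (min t T)) \<omega> else 0)" for t \<omega>
  have cont: "continuous_on UNIV (\<lambda>t. Y t \<omega>)" for \<omega>
  proof (cases "\<omega> \<in> space M - N")
    case True
    then have "continuous_on {0..T} (\<lambda>t. X t \<omega>)" using N by auto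
    then have "continuous_on UNIV (\<lambda>t. X (max 0 (min t T)) \<omega>)"
      by (rule continuous_on_compose2) (use T in \<open>auto intro!: continuous_intros\<close>)
    then show ?thesis using True by (simp add: Y_def)
  next
    case False
    then have eq: "(\<lambda>t. Y t \<omega>) = (\<lambda>t. 0)" by (auto simp: Y_def)
    show ?thesis unfolding eq by (rule continuous_on_const)
  qed
  have meas: "Y t \<in> borel_measurable M" for t
  proof -
    have [measurable]: "X (max 0 (min t T)) \<in> borel_measurable M" using T by (intro m) auto
    have [measurable]: "space M - N \<in> sets M" using N by auto
    show ?thesis unfolding Y_def[abs_def] by measurable
  qed
  have "AE \<omega> in M. \<forall>t\<in>{0..T}. Y t \<omega> = X t \<omega>"
    using AE_not_in[OF N(2)] AE_space
  proof eventually_elim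
    case (elim \<omega>)
    then show ?case by (auto simp: Y_def min_absorb1 max_absorb2)
  qed
  with cont continuous_process_joint_measurable[OF meas cont] meas show thesis by (intro that)
qed

text \<open>Turns identities that hold almost surely at each fixed time into identities off one null
  set for all times: only countably many grid points are involved.\<close>

lemma continuous_eq_on_grid:
  fixes f g :: "real \<Rightarrow> real"
  assumes T: "0 \<le> T" and f: "continuous_on {0..T} f" and g: "continuous_on {0..T} g"
    and eq: "\<And>i n. i \<le> Suc n \<Longrightarrow> f (T * real i / real (Suc n)) = g (T * real i / real (Suc n))" and t: "t \<in> {0..T}"
  shows "f t = g t"
proof (cases "T = 0")
  case True
  then show ?thesis using eq[of 0 0] t by simp
next
  case False
  define x where "x = t / T"
  have x: "0 \<le> x" "x \<le> 1" "t = T * x" using t False T by (auto simp: x_def)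
  define i where "i n = nat \<lfloor>real (Suc n) * x\<rfloor>" for n
  have i: "real (i n) = real_of_int \<lfloor>real (Suc n) * x\<rfloor>" for n using x by (simp add: i_def)
  have le: "i n \<le> Suc n" for n
  proof -
    have "real (Suc n) * x \<le> real (Suc n) * 1" using x by (intro mult_left_mono) auto
    then have "\<lfloor>real (Suc n) * x\<rfloor> \<le> int (Suc n)" by (metis floor_mono floor_of_nat mult.right_neutral)
    then show ?thesis by (simp add: i_def)
  qed
  define r where "r n = T * real (i n) / real (Suc n)" for n
  have "(\<lambda>n. T * (real (i n) / real (Suc n))) \<longlonglongrightarrow> T * x"
    unfolding i by (intro tendsto_intros floor_grid_tendsto)
  then have r: "r \<longlonglongrightarrow> t" unfolding r_def[abs_def] x(3) by simp
  have rin: "r n \<in> {0..T}" for n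
    unfolding r_def using grid_le_end[OF T le[of n]] T by auto
  have "(\<lambda>n. f (r n)) \<longlonglongrightarrow> f t" "(\<lambda>n. g (r n)) \<longlonglongrightarrow> g t"
    using continuous_on_tendsto_compose[OF f r t always_eventually]
      continuous_on_tendsto_compose[OF g r t always_eventually] rin by blast+
  moreover have "f (r n) = g (r n)" for n unfolding r_def by (rule eq[OF le])
  ultimately show ?thesis by (simp add: LIMSEQ_unique)
qed

text \<open>A constant is itself a simple integrand, with the single piece \<open>(0, T]\<close>, so
  \<open>ito_bound\<close> yields mean-square distance 0 at each time. Continuity of both sides
  makes the null set independent of time.\<close>

lemma (in brownian) constant_ito_integral:
  assumes I: "ito_integral M F W T (\<lambda>t \<omega>. \<sigma>) I" and T: "0 \<le> T"
  shows "AE \<omega> in M. \<forall>t\<in>{0..T}. I t \<omega> = \<sigma> * W t \<omega>"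
proof -
  have f: "simple_family M F W {()} (\<lambda>_. 0) (\<lambda>_. T) (\<lambda>_ _. \<sigma>)"
    by (intro simple_family.intro simple_family_axioms.intro brownian_axioms) (use T in auto)
  have "AE \<omega> in M. continuous_on {0..} (\<lambda>t. W t \<omega>)" and W0: "AE \<omega> in M. W 0 \<omega> = 0"
    using bm unfolding brownian_motion_def by blast+
  then have Wc: "AE \<omega> in M. continuous_on {0..T} (\<lambda>t. W t \<omega>)"
    by (elim eventually_mono) (auto intro: continuous_on_subset)
  have Ic: "AE \<omega> in M. continuous_on {0..T} (\<lambda>t. I t \<omega>)"
    using I unfolding ito_integral_def by blast
  obtain \<tau> where ev: "AE \<omega> in M. incseq (\<lambda>n. \<tau> n \<omega>) \<and> (\<forall>\<^sub>F n in sequentially. T \<le> \<tau> (n::nat) \<omega>)"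
    and L2: "\<And>n. ito_integral_L2 M F W T (\<lambda>s \<omega>. if s \<le> \<tau> n \<omega> then \<sigma> else 0) (\<lambda>t \<omega>. I (min t (\<tau> n \<omega>)) \<omega>)"
    using I unfolding ito_integral_def by blast
  have pt: "AE \<omega> in M. I t \<omega> = \<sigma> * W t \<omega>" if t: "t \<in> {0..T}" for t
  proof -
    have t0: "0 \<le> t" "t \<le> T" using t by auto
    \<comment> \<open>Measurability is known for the stopped versions of \<open>I t\<close>, not for
      \<open>I t\<close> itself. Their limit is measurable in the completion and agrees with
      \<open>I t\<close> almost surely.\<close>
    define J where "J \<omega> = lim (\<lambda>n. I (min t (\<tau> n \<omega>)) \<omega>)" for \<omega>
    have [measurable]: "J \<in> borel_measurable (completion M)"
      unfolding J_def
    proof (rule borel_measurable_lim_metric)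
      show "(\<lambda>\<omega>. I (min t (\<tau> n \<omega>)) \<omega>) \<in> borel_measurable (completion M)" for n
        using L2[of n] t unfolding ito_integral_L2_def by blast
    qed
    have JI: "AE \<omega> in M. J \<omega> = I t \<omega>"
      using ev
    proof eventually_elim
      case (elim \<omega>)
      then have "\<forall>\<^sub>F n in sequentially. T \<le> \<tau> n \<omega>" by simp
      then have "\<forall>\<^sub>F n in sequentially. I (min t (\<tau> n \<omega>)) \<omega> = I t \<omega>"
        by (rule eventually_mono) (use t0 in \<open>simp add: min_absorb1\<close>)
      then show ?case unfolding J_def by (intro limI tendsto_eventually)
    qed
    define D where "D \<omega> = \<sigma> * (W t \<omega> - W 0 \<omega>)" for \<omega>
    have [measurable]: "D \<in> borel_measurable (completion M)"
      unfolding D_def[abs_def] by (intro measurable_completion borel_measurable_times borel_measurable_diff W_M t0) auto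
    have S: "simple_family.S W {()} (\<lambda>_. 0) (\<lambda>_. T) (\<lambda>_ _. \<sigma>) t \<omega> = D \<omega>" for \<omega>
      unfolding simple_family.S_def[OF f] D_def using t0 by (simp add: min_absorb1 min_absorb2)
    have "(\<integral>\<^sup>+\<omega>. ennreal ((J \<omega> - D \<omega>)\<^sup>2) \<partial>M) = (\<integral>\<^sup>+\<omega>. ennreal ((I t \<omega> - D \<omega>)\<^sup>2) \<partial>M)"
      by (rule nn_integral_cong_AE) (use JI in eventually_elim, simp)
    also have "\<dots> \<le> 4 * (\<integral>\<^sup>+s\<in>{0..t}. (\<integral>\<^sup>+\<omega>. ennreal ((\<sigma> - simple_family.Sv {()} (\<lambda>_. 0) (\<lambda>_. T) (\<lambda>_ _. \<sigma>) s \<omega>)\<^sup>2) \<partial>M) \<partial>lborel)"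
      using simple_family.ito_bound[OF f I t] unfolding S .
    also have "(\<integral>\<^sup>+s\<in>{0..t}. (\<integral>\<^sup>+\<omega>. ennreal ((\<sigma> - simple_family.Sv {()} (\<lambda>_. 0) (\<lambda>_. T) (\<lambda>_ _. \<sigma>) s \<omega>)\<^sup>2) \<partial>M) \<partial>lborel)
      = (\<integral>\<^sup>+s. 0 \<partial>(lborel :: real measure))"
    proof (rule nn_integral_cong_AE)
      have "AE s in lborel. s \<noteq> (0::real)" by (rule AE_lborel_singleton)
      then show "AE s in lborel. (\<integral>\<^sup>+\<omega>. ennreal ((\<sigma> - simple_family.Sv {()} (\<lambda>_. 0) (\<lambda>_. T) (\<lambda>_ _. \<sigma>) s \<omega>)\<^sup>2) \<partial>M) * indicator {0..t} s = 0"
        unfolding simple_family.Sv_def[OF f] by eventually_elim (use t0 in \<open>auto simp: indicator_def\<close>)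
    qed
    finally have "(\<integral>\<^sup>+\<omega>. ennreal ((J \<omega> - D \<omega>)\<^sup>2) \<partial>completion M) = 0" by (simp add: nn_integral_completion)
    then have "AE \<omega> in completion M. ennreal ((J \<omega> - D \<omega>)\<^sup>2) = 0"
      by (subst (asm) nn_integral_0_iff_AE) measurable
    then have "AE \<omega> in M. ennreal ((J \<omega> - D \<omega>)\<^sup>2) = 0" by (simp add: AE_completion_iff)
    then show ?thesis using JI W0
      by eventually_elim (simp add: D_def ennreal_eq_0_iff)
  qed
  have "AE \<omega> in M. \<forall>i n. i \<le> Suc n \<longrightarrow> I (T * real i / real (Suc n)) \<omega> = \<sigma> * W (T * real i / real (Suc n)) \<omega>"
  proof (subst AE_all_countable, intro allI, subst AE_all_countable, intro allI)
    fix i n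
    show "AE \<omega> in M. i \<le> Suc n \<longrightarrow> I (T * real i / real (Suc n)) \<omega> = \<sigma> * W (T * real i / real (Suc n)) \<omega>"
    proof (cases "i \<le> Suc n")
      case True
      then show ?thesis using pt[of "T * real i / real (Suc n)"] grid_le_end[OF T True] T by auto
    qed simp
  qed
  then show ?thesis using Ic Wc
  proof eventually_elim
    case (elim \<omega>)
    show ?case
    proof
      fix t assume t: "t \<in> {0..T}"
      show "I t \<omega> = \<sigma> * W t \<omega>"
        by (rule continuous_eq_on_grid[OF T elim(2) _ _ t]) (use elim in \<open>auto intro!: continuous_intros\<close>)
    qed
  qed
qed

lemma (in brownian) additive_noise_rep:
  assumes "ito_process M F W T x0 \<beta> (\<lambda>t \<omega>. \<sigma>) X" "0 \<le> T"
  shows "AE \<omega> in M. \<forall>t\<in>{0..T}. X t \<omega> = x0 + (LBINT s:{0..t}. \<beta> s \<omega>) + \<sigma> * W t \<omega>"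
proof -
  obtain I where "ito_integral M F W T (\<lambda>t \<omega>. \<sigma>) I"
    and X: "AE \<omega> in M. \<forall>t\<in>{0..T}. X t \<omega> = x0 + (LBINT s:{0..t}. \<beta> s \<omega>) + I t \<omega>"
    using assms(1) unfolding ito_process_def by blast
  from constant_ito_integral[OF this(1) assms(2)] X show ?thesis
    by eventually_elim simp
qed

section \<open>Laws of Brownian paths and averages\<close>

text \<open>The joint law of the past and the increment agrees with the product law on rectangles,
  hence everywhere. The right-hand side integrates out the increment against a density that is the
  same for all Brownian motions.\<close>

lemma (in brownian) nn_integral_increment:
  assumes st: "0 \<le> s" "s < t" and \<xi>: "\<xi> \<in> measurable (F s) N" and G: "G \<in> borel_measurable (N \<Otimes>\<^sub>M borel)"
  shows "(\<integral>\<^sup>+\<omega>. G (\<xi> \<omega>, W t \<omega> - W s \<omega>) \<partial>M)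
    = (\<integral>\<^sup>+\<omega>. (\<integral>\<^sup>+y. G (\<xi> \<omega>, y) \<partial>density lborel (normal_density 0 (sqrt (t - s)))) \<partial>M)"
proof -
  let ?D = "\<lambda>\<omega>. W t \<omega> - W s \<omega>" and ?n = "density lborel (normal_density 0 (sqrt (t - s)))"
  have Dm: "?D \<in> borel_measurable M" using st by (intro borel_measurable_diff W_M) auto
  have \<xi>m: "\<xi> \<in> measurable M N" using \<xi> by (rule measurable_F_M)
  have "distr M borel ?D = distr M lborel ?D" by (rule distr_cong) auto
  also have "\<dots> = ?n" by (rule distributed_distr_eq_density[OF distributed_increment[OF st]])
  finally have d: "distr M borel ?D = ?n" .
  interpret n: prob_space ?n unfolding d[symmetric] by (rule prob_space_distr[OF Dm])
  interpret x: prob_space "distr M N \<xi>" by (rule prob_space_distr[OF \<xi>m])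
  have eq: "distr M N \<xi> \<Otimes>\<^sub>M ?n = distr M (N \<Otimes>\<^sub>M borel) (\<lambda>\<omega>. (\<xi> \<omega>, ?D \<omega>))"
  proof (rule pair_measure_eqI)
    show "sigma_finite_measure (distr M N \<xi>)" "sigma_finite_measure ?n" by unfold_locales
    show "sets (distr M N \<xi> \<Otimes>\<^sub>M ?n) = sets (distr M (N \<Otimes>\<^sub>M borel) (\<lambda>\<omega>. (\<xi> \<omega>, ?D \<omega>)))"
      by (simp cong: sets_pair_measure_cong)
    fix A B assume "A \<in> sets (distr M N \<xi>)" "B \<in> sets ?n"
    then have A: "A \<in> sets N" and B: "B \<in> sets borel" by auto
    have "indep_set (sets (F s)) {?D -` B \<inter> space M | B. B \<in> sets borel}"
      using bm st unfolding brownian_motion_def by auto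
    moreover have "\<xi> -` A \<inter> space M \<in> sets (F s)" using measurable_sets[OF \<xi> A] by (simp add: space_F)
    ultimately have p: "prob ((\<xi> -` A \<inter> space M) \<inter> (?D -` B \<inter> space M)) = prob (\<xi> -` A \<inter> space M) * prob (?D -` B \<inter> space M)"
      using B by (intro indep_setD) auto
    have "(\<lambda>\<omega>. (\<xi> \<omega>, ?D \<omega>)) -` (A \<times> B) \<inter> space M = (\<xi> -` A \<inter> space M) \<inter> (?D -` B \<inter> space M)" by auto
    then show "emeasure (distr M N \<xi>) A * emeasure ?n B = emeasure (distr M (N \<Otimes>\<^sub>M borel) (\<lambda>\<omega>. (\<xi> \<omega>, ?D \<omega>))) (A \<times> B)"
      unfolding d[symmetric] using A B p
      by (simp add: emeasure_distr[OF \<xi>m A] emeasure_distr[OF Dm B] emeasure_distr[OF measurable_Pair[OF \<xi>m Dm]] emeasure_eq_measure ennreal_mult)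
  qed
  have Gn: "G \<in> borel_measurable (N \<Otimes>\<^sub>M ?n)"
    using G by (simp cong: measurable_cong_sets sets_pair_measure_cong)
  have Gd: "G \<in> borel_measurable (distr M N \<xi> \<Otimes>\<^sub>M ?n)"
    using G by (simp cong: measurable_cong_sets sets_pair_measure_cong)
  have "(\<integral>\<^sup>+\<omega>. G (\<xi> \<omega>, ?D \<omega>) \<partial>M) = (\<integral>\<^sup>+p. G p \<partial>distr M (N \<Otimes>\<^sub>M borel) (\<lambda>\<omega>. (\<xi> \<omega>, ?D \<omega>)))"
    using G by (intro nn_integral_distr[symmetric] measurable_Pair \<xi>m Dm) simp
  also have "\<dots> = (\<integral>\<^sup>+p. G p \<partial>(distr M N \<xi> \<Otimes>\<^sub>M ?n))" unfolding eq ..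
  also have "\<dots> = (\<integral>\<^sup>+u. (\<integral>\<^sup>+y. G (u, y) \<partial>?n) \<partial>distr M N \<xi>)"
    by (rule n.nn_integral_fst[symmetric, OF Gd])
  also have "\<dots> = (\<integral>\<^sup>+\<omega>. (\<integral>\<^sup>+y. G (\<xi> \<omega>, y) \<partial>?n) \<partial>M)"
    using n.borel_measurable_nn_integral_fst[OF Gn] by (intro nn_integral_distr \<xi>m) simp
  finally show ?thesis .
qed

text \<open>Induction adding the latest time. The new value is the last earlier one plus a Gaussian
  increment of known variance; integrating it out leaves a functional of the earlier times that no
  longer refers to the Brownian motion at hand. The two motions may live on different
  spaces.\<close>

lemma brownian_finite_law:
  assumes B: "brownian M F W" and B': "brownian M' F' W'" and J: "finite J" "J \<subseteq> {0..}"
    and g: "g \<in> borel_measurable (\<Pi>\<^sub>M s\<in>J. borel)"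
  shows "(\<integral>\<^sup>+\<omega>. g (\<lambda>s\<in>J. W s \<omega>) \<partial>M) = (\<integral>\<^sup>+\<omega>. g (\<lambda>s\<in>J. W' s \<omega>) \<partial>M')"
  using J g
proof (induction J arbitrary: g rule: finite_linorder_max_induct)
  case empty
  interpret b: brownian M F W by fact
  interpret b': brownian M' F' W' by fact
  show ?case by (simp add: b.emeasure_space_1 b'.emeasure_space_1)
next
  case (insert c A)
  \<comment> \<open>The last earlier time. If there is none, both \<open>s\<close> and
    \<open>base\<close> default to 0, in accordance with the start of the motion at 0.\<close>
  define s where "s = (if A = {} then 0 else Max A)"
  define base where "base u = (if A = {} then 0 else u s :: real)" for u
  have sA1: "A \<noteq> {} \<Longrightarrow> s \<in> A" using insert.hyps(1) Max_in[of A] by (simp add: s_def)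
  have sA2: "0 \<le> s" using sA1 insert.prems(1) by (cases "A = {}") (auto simp: s_def)
  have sA3: "\<And>a. a \<in> A \<Longrightarrow> a \<le> s" using insert.hyps(1) by (auto simp: s_def)
  note sA = sA1 sA3 sA2
  have cA: "c \<notin> A" using insert.hyps(2) by auto
  define G where "G p = g ((fst p)(c := base (fst p) + snd p))" for p
  have base: "base \<in> borel_measurable (\<Pi>\<^sub>M s\<in>A. borel)"
    unfolding base_def[abs_def] using sA(1) by (cases "A = {}") (auto intro: measurable_component_singleton)
  have Gm: "G \<in> borel_measurable ((\<Pi>\<^sub>M s\<in>A. borel) \<Otimes>\<^sub>M borel)"
  proof -
    have "(\<lambda>p. (fst p, base (fst p) + snd p)) \<in> measurable ((\<Pi>\<^sub>M s\<in>A. borel) \<Otimes>\<^sub>M borel) ((\<Pi>\<^sub>M s\<in>A. borel) \<Otimes>\<^sub>M borel)"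
      by (intro measurable_Pair measurable_fst borel_measurable_add measurable_snd measurable_compose[OF measurable_fst base])
    from measurable_compose[OF measurable_compose[OF this measurable_add_dim[of c A "\<lambda>_. borel"]] insert.prems(2)]
    show ?thesis unfolding G_def[abs_def] by (simp add: fun_upd_def)
  qed
  have main: "(\<integral>\<^sup>+\<omega>. g (\<lambda>s\<in>insert c A. V s \<omega>) \<partial>N) = (if c = 0 then g (\<lambda>s\<in>{0}. 0) else
     (\<integral>\<^sup>+\<omega>. (\<integral>\<^sup>+y. G ((\<lambda>s\<in>A. V s \<omega>), y) \<partial>density lborel (normal_density 0 (sqrt (c - s)))) \<partial>N))"
    if br: "brownian N H V" for N :: "'z measure" and H V
  proof -
    interpret brownian N H V by fact
    have V0: "AE \<omega> in N. V 0 \<omega> = 0" using bm unfolding brownian_motion_def by blast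
    show ?thesis
    proof (cases "c = 0")
      case True
      then have "A = {}" using insert.hyps(2) insert.prems(1) by fastforce
      then have "(\<integral>\<^sup>+\<omega>. g (\<lambda>s\<in>insert c A. V s \<omega>) \<partial>N) = (\<integral>\<^sup>+\<omega>. g (\<lambda>s\<in>{0}. 0) \<partial>N)"
        using V0 True by (intro nn_integral_cong_AE) (elim eventually_mono, auto intro!: arg_cong[where f = g])
      then show ?thesis using True by (simp add: emeasure_space_1)
    next
      case False
      have sc: "s < c" using insert.hyps(2) insert.prems(1) False sA(1) by (cases "A = {}") (auto simp: s_def)
      have \<xi>: "(\<lambda>\<omega>. \<lambda>a\<in>A. V a \<omega>) \<in> measurable (H s) (\<Pi>\<^sub>M s\<in>A. borel)"
        using sA insert.prems(1) by (intro measurable_restrict W_F) auto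
      have "(\<integral>\<^sup>+\<omega>. g (\<lambda>s\<in>insert c A. V s \<omega>) \<partial>N) = (\<integral>\<^sup>+\<omega>. G ((\<lambda>a\<in>A. V a \<omega>), V c \<omega> - V s \<omega>) \<partial>N)"
      proof (rule nn_integral_cong_AE, use V0 in eventually_elim)
        case (elim \<omega>)
        have "base (\<lambda>a\<in>A. V a \<omega>) = V s \<omega>" using elim sA(1) by (auto simp: base_def s_def)
        then have "(\<lambda>a\<in>A. V a \<omega>)(c := base (\<lambda>a\<in>A. V a \<omega>) + (V c \<omega> - V s \<omega>)) = (\<lambda>s\<in>insert c A. V s \<omega>)"
          by (auto simp: fun_eq_iff)
        then show ?case by (simp add: G_def)
      qed
      also have "\<dots> = (\<integral>\<^sup>+\<omega>. (\<integral>\<^sup>+y. G ((\<lambda>s\<in>A. V s \<omega>), y) \<partial>density lborel (normal_density 0 (sqrt (c - s)))) \<partial>N)"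
        by (rule nn_integral_increment[OF sA(3) sc \<xi> Gm])
      finally show ?thesis using False by simp
    qed
  qed
  define Q where "Q u = (\<integral>\<^sup>+y. G (u, y) \<partial>density lborel (normal_density 0 (sqrt (c - s))))" for u
  have Q: "Q \<in> borel_measurable (\<Pi>\<^sub>M s\<in>A. borel)" if "c \<noteq> 0"
  proof -
    have sc: "s < c" using insert.hyps(2) insert.prems(1) that sA(1) by (cases "A = {}") (auto simp: s_def)
    interpret prob_space "density lborel (normal_density 0 (sqrt (c - s)))"
      using sc by (intro prob_space_normal_density) simp
    show ?thesis unfolding Q_def
      by (rule borel_measurable_nn_integral_fst) (use Gm in \<open>simp cong: measurable_cong_sets sets_pair_measure_cong\<close>)
  qed
  show ?case
  proof (cases "c = 0")
    case True
    then show ?thesis unfolding main[OF B] main[OF B'] by simp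
  next
    case False
    have "(\<integral>\<^sup>+\<omega>. Q (\<lambda>s\<in>A. W s \<omega>) \<partial>M) = (\<integral>\<^sup>+\<omega>. Q (\<lambda>s\<in>A. W' s \<omega>) \<partial>M')"
      using insert.prems(1) by (intro insert.IH Q[OF False]) auto
    then show ?thesis using False unfolding main[OF B] main[OF B'] Q_def by (simp only: if_False)
  qed
qed

lemma (in brownian) path_measurable: "path W \<in> measurable M (\<Pi>\<^sub>M s\<in>{0..}. borel)"
  by (intro measurable_restrict W_M) auto

text \<open>A finite measure on the product space is determined by cylinder sets over finitely many
  times.\<close>

lemma brownian_path_law:
  assumes B: "brownian M F W" and B': "brownian M' F' W'"
  shows "distr M (\<Pi>\<^sub>M s\<in>{0..}. borel) (path W) = distr M' (\<Pi>\<^sub>M s\<in>{0..}. borel) (path W')"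
proof (rule measure_eqI_PiM_infinite)
  note pm = brownian.path_measurable
  show "finite_measure (distr M (\<Pi>\<^sub>M s\<in>{0..}. borel) (path W))"
  proof -
    interpret brownian M F W by fact
    show ?thesis by (rule finite_measure_distr[OF path_measurable])
  qed
  fix A :: "real \<Rightarrow> real set" and J :: "real set"
  assume J: "finite J" "J \<subseteq> {0..}" and A: "\<And>i. i \<in> J \<Longrightarrow> A i \<in> sets borel"
  let ?E = "prod_emb {0..} (\<lambda>_. borel) J (Pi\<^sub>E J A) :: (real \<Rightarrow> real) set"
  have E: "?E \<in> sets (\<Pi>\<^sub>M s\<in>{0..}. borel)"
    using J A by (intro sets_PiM_I) auto
  have PE: "Pi\<^sub>E J A \<in> sets (\<Pi>\<^sub>M s\<in>J. borel)" using J A by (intro sets_PiM_I_finite) auto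
  have main: "emeasure (distr N (\<Pi>\<^sub>M s\<in>{0..}. borel) (path V)) ?E = (\<integral>\<^sup>+\<omega>. indicator (Pi\<^sub>E J A) (\<lambda>s\<in>J. V s \<omega>) \<partial>N)"
    if br: "brownian N H V" for N :: "'z measure" and H V
  proof -
    have "emeasure (distr N (\<Pi>\<^sub>M s\<in>{0..}. borel) (path V)) ?E = (\<integral>\<^sup>+p. indicator ?E p \<partial>distr N (\<Pi>\<^sub>M s\<in>{0..}. borel) (path V))"
      using E by simp
    also have "\<dots> = (\<integral>\<^sup>+\<omega>. indicator ?E (path V \<omega>) \<partial>N)"
      using E by (intro nn_integral_distr pm[OF br]) auto
    also have "\<dots> = (\<integral>\<^sup>+\<omega>. indicator (Pi\<^sub>E J A) (\<lambda>s\<in>J. V s \<omega>) \<partial>N)"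
    proof (rule nn_integral_cong)
      fix \<omega>
      have "restrict (path V \<omega>) J = (\<lambda>s\<in>J. V s \<omega>)" using J(2) by (auto simp: fun_eq_iff)
      then have "path V \<omega> \<in> ?E \<longleftrightarrow> (\<lambda>s\<in>J. V s \<omega>) \<in> Pi\<^sub>E J A"
        by (simp add: prod_emb_def)
      then show "indicator ?E (path V \<omega>) = (indicator (Pi\<^sub>E J A) (\<lambda>s\<in>J. V s \<omega>) :: ennreal)"
        by (simp add: indicator_def)
    qed
    finally show ?thesis .
  qed
  show "emeasure (distr M (\<Pi>\<^sub>M s\<in>{0..}. borel) (path W)) ?E = emeasure (distr M' (\<Pi>\<^sub>M s\<in>{0..}. borel) (path W')) ?E"
    unfolding main[OF B] main[OF B'] using PE by (intro brownian_finite_law[OF B B' J]) auto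
qed auto

section \<open>A law of large numbers in mean\<close>

lemma (in prob_space) average_bounded_deviation:
  fixes U :: "nat \<Rightarrow> 'a \<Rightarrow> real"
  assumes ind: "indep_vars (\<lambda>_. borel) U {1..}" and bd: "\<And>i \<omega>. i \<ge> 1 \<Longrightarrow> \<bar>U i \<omega>\<bar> \<le> R"
    and mean: "\<And>i. i \<ge> 1 \<Longrightarrow> expectation (U i) = 0" and N: "N \<ge> 1" and d: "d > 0"
  shows "expectation (\<lambda>\<omega>. \<bar>(\<Sum>i=1..N. U i \<omega>) / real N\<bar>) \<le> d + R\<^sup>2 / (d * real N)"
proof -
  have m[measurable]: "U i \<in> borel_measurable M" if "i \<ge> 1" for i
    using ind that by (auto simp: indep_vars_def)
  have prod: "integrable M (\<lambda>\<omega>. U i \<omega> * U j \<omega>)" if "i \<ge> 1" "j \<ge> 1" for i j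
  proof (rule integrable_const_bound[of _ "R * R"])
    show "AE \<omega> in M. norm (U i \<omega> * U j \<omega>) \<le> R * R"
      using bd[OF that(1)] bd[OF that(2)] by (intro AE_I2) (auto simp: abs_mult intro!: mult_mono intro: order_trans[OF abs_ge_zero])
  qed (use that in measurable)
  have int: "integrable M (U i)" if "i \<ge> 1" for i
    using that bd by (intro integrable_const_bound[of _ R]) auto
  have cross: "expectation (\<lambda>\<omega>. U i \<omega> * U j \<omega>) = 0" if "i \<ge> 1" "j \<ge> 1" "i \<noteq> j" for i j
  proof -
    have "indep_vars (\<lambda>_. borel) U {i, j}" by (rule indep_vars_subset[OF ind]) (use that in auto)
    from indep_vars_lebesgue_integral[OF _ this] int that
    have "expectation (\<lambda>\<omega>. \<Prod>k\<in>{i, j}. U k \<omega>) = (\<Prod>k\<in>{i, j}. expectation (U k))" by auto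
    then show ?thesis using that mean by simp
  qed
  have diag: "expectation (\<lambda>\<omega>. U i \<omega> * U i \<omega>) \<le> R\<^sup>2" if "i \<ge> 1" for i
  proof (rule integral_le_const)
    show "AE \<omega> in M. U i \<omega> * U i \<omega> \<le> R\<^sup>2"
    proof (rule AE_I2)
      fix \<omega>
      have "\<bar>U i \<omega>\<bar> \<le> \<bar>R\<bar>" using bd[OF that, of \<omega>] by linarith
      then show "U i \<omega> * U i \<omega> \<le> R\<^sup>2" by (simp add: abs_le_square_iff power2_eq_square)
    qed
  qed (use prod that in auto)
  define S where "S \<omega> = (\<Sum>i=1..N. U i \<omega>)" for \<omega>
  have S2: "(S \<omega>)\<^sup>2 = (\<Sum>i=1..N. \<Sum>j=1..N. U i \<omega> * U j \<omega>)" for \<omega>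
    unfolding S_def power2_eq_square sum_product ..
  have S2i: "integrable M (\<lambda>\<omega>. (S \<omega>)\<^sup>2)" unfolding S2 using prod by (intro Bochner_Integration.integrable_sum) auto
  have Si: "integrable M S" unfolding S_def[abs_def] using int by (intro Bochner_Integration.integrable_sum) auto
  have "expectation (\<lambda>\<omega>. (S \<omega>)\<^sup>2) = (\<Sum>i=1..N. \<Sum>j=1..N. expectation (\<lambda>\<omega>. U i \<omega> * U j \<omega>))"
  proof -
    have "expectation (\<lambda>\<omega>. (S \<omega>)\<^sup>2) = (\<Sum>i=1..N. expectation (\<lambda>\<omega>. \<Sum>j=1..N. U i \<omega> * U j \<omega>))"
      unfolding S2 using prod by (intro Bochner_Integration.integral_sum Bochner_Integration.integrable_sum) auto
    also have "\<dots> = (\<Sum>i=1..N. \<Sum>j=1..N. expectation (\<lambda>\<omega>. U i \<omega> * U j \<omega>))"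
      using prod by (intro sum.cong refl Bochner_Integration.integral_sum) auto
    finally show ?thesis .
  qed
  also have "\<dots> = (\<Sum>i=1..N. \<Sum>j=1..N. if j = i then expectation (\<lambda>\<omega>. U i \<omega> * U i \<omega>) else 0)"
    using cross by (intro sum.cong refl) auto
  also have "\<dots> = (\<Sum>i=1..N. expectation (\<lambda>\<omega>. U i \<omega> * U i \<omega>))" by simp
  also have "\<dots> \<le> (\<Sum>i=1..N. R\<^sup>2)" using diag by (intro sum_mono) auto
  finally have ES: "expectation (\<lambda>\<omega>. (S \<omega>)\<^sup>2) \<le> real N * R\<^sup>2" by simp
  \<comment> \<open>The elementary inequality \<open>v \<le> d + v^2 / d\<close> passes from the
    first to the second absolute moment; orthogonality has made the latter of order
    \<open>N\<close>.\<close>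
  have "expectation (\<lambda>\<omega>. \<bar>S \<omega> / real N\<bar>) \<le> expectation (\<lambda>\<omega>. d + (S \<omega>)\<^sup>2 / (d * (real N)\<^sup>2))"
  proof (rule integral_mono)
    show "integrable M (\<lambda>\<omega>. \<bar>S \<omega> / real N\<bar>)" using Si by simp
    show "integrable M (\<lambda>\<omega>. d + (S \<omega>)\<^sup>2 / (d * (real N)\<^sup>2))" using S2i by simp
    fix \<omega>
    define v where "v = \<bar>S \<omega> / real N\<bar>"
    have "v * d \<le> d\<^sup>2 + v\<^sup>2"
    proof -
      have "0 \<le> v * d" using d by (simp add: v_def)
      then show ?thesis using sum_squares_bound[of v d] by linarith
    qed
    then have "v \<le> (d\<^sup>2 + v\<^sup>2) / d" using d by (simp add: le_divide_eq)
    also have "\<dots> = d + v\<^sup>2 / d" using d by (simp add: add_divide_distrib power2_eq_square)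
    also have "v\<^sup>2 / d = (S \<omega>)\<^sup>2 / (d * (real N)\<^sup>2)" by (simp add: v_def power_divide mult.commute)
    finally show "\<bar>S \<omega> / real N\<bar> \<le> d + (S \<omega>)\<^sup>2 / (d * (real N)\<^sup>2)" unfolding v_def .
  qed
  also have "\<dots> = d + expectation (\<lambda>\<omega>. (S \<omega>)\<^sup>2) / (d * (real N)\<^sup>2)" using S2i by (simp add: prob_space)
  also have "\<dots> \<le> d + real N * R\<^sup>2 / (d * (real N)\<^sup>2)" using ES d by (intro add_left_mono divide_right_mono) auto
  also have "\<dots> = d + R\<^sup>2 / (d * real N)" using N by (simp add: power2_eq_square)
  finally show ?thesis unfolding S_def .
qed

text \<open>The summands below are products with one moment only, hence the truncation.\<close>

lemma (in prob_space) L1_law_of_large_numbers: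
  fixes V :: "nat \<Rightarrow> 'a \<Rightarrow> 'b" and \<psi> :: "'b \<Rightarrow> real"
  assumes ind: "indep_vars (\<lambda>_. S) V {1..}"
    and law: "\<And>i. i \<ge> 1 \<Longrightarrow> distr M S (V i) = distr M S (V 1)"
    and \<psi>[measurable]: "\<psi> \<in> borel_measurable S" and int: "integrable M (\<lambda>\<omega>. \<psi> (V 1 \<omega>))"
  shows "(\<lambda>N. expectation (\<lambda>\<omega>. \<bar>(\<Sum>i=1..N. \<psi> (V i \<omega>)) / real N - expectation (\<lambda>\<omega>. \<psi> (V 1 \<omega>))\<bar>)) \<longlonglongrightarrow> 0"
proof (rule LIMSEQ_I)
  fix e :: real assume e: "0 < e"
  have Vm[measurable]: "V i \<in> measurable M S" if "i \<ge> 1" for i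
    using ind that by (auto simp: indep_vars_def)
  have tr: "integrable M (\<lambda>\<omega>. \<phi> (V i \<omega>)) \<and> expectation (\<lambda>\<omega>. \<phi> (V i \<omega>)) = expectation (\<lambda>\<omega>. \<phi> (V 1 \<omega>))"
    if i: "i \<ge> 1" and \<phi>: "\<phi> \<in> borel_measurable S" "integrable M (\<lambda>\<omega>. \<phi> (V 1 \<omega>))" for i and \<phi> :: "'b \<Rightarrow> real"
    using integrable_distr_eq[OF Vm[OF i] \<phi>(1)] integrable_distr_eq[OF Vm[of 1] \<phi>(1)]
      integral_distr[OF Vm[OF i] \<phi>(1)] integral_distr[OF Vm[of 1] \<phi>(1)] law[OF i] \<phi>(2) by simp
  have "(\<lambda>R. expectation (\<lambda>\<omega>. \<bar>\<psi> (V 1 \<omega>) - clip (real R) (\<psi> (V 1 \<omega>))\<bar>)) \<longlonglongrightarrow> expectation (\<lambda>\<omega>. 0)"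
  proof (rule integral_dominated_convergence[where w = "\<lambda>\<omega>. \<bar>\<psi> (V 1 \<omega>)\<bar>"])
    show "AE \<omega> in M. (\<lambda>R. \<bar>\<psi> (V 1 \<omega>) - clip (real R) (\<psi> (V 1 \<omega>))\<bar>) \<longlonglongrightarrow> 0"
    proof (rule AE_I2, rule tendsto_eventually)
      fix \<omega>
      show "\<forall>\<^sub>F R in sequentially. \<bar>\<psi> (V 1 \<omega>) - clip (real R) (\<psi> (V 1 \<omega>))\<bar> = 0"
        using eventually_clip_eq[of "\<psi> (V 1 \<omega>)"] by eventually_elim simp
    qed
  qed (use int clip_diff_bound in auto)
  then have "\<forall>\<^sub>F R in sequentially. expectation (\<lambda>\<omega>. \<bar>\<psi> (V 1 \<omega>) - clip (real R) (\<psi> (V 1 \<omega>))\<bar>) < e / 8"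
    by (intro order_tendstoD(2)[where y = 0]) (use e in auto)
  then obtain R :: nat where R: "expectation (\<lambda>\<omega>. \<bar>\<psi> (V 1 \<omega>) - clip (real R) (\<psi> (V 1 \<omega>))\<bar>) < e / 8"
    by (auto simp: eventually_sequentially)
  define \<phi> where "\<phi> x = clip (real R) (\<psi> x)" for x
  have \<phi>[measurable]: "\<phi> \<in> borel_measurable S" unfolding \<phi>_def[abs_def] by measurable
  have \<phi>b: "\<bar>\<phi> x\<bar> \<le> real R" for x unfolding \<phi>_def by (rule clip_bound) simp
  have \<phi>i: "integrable M (\<lambda>\<omega>. \<phi> (V 1 \<omega>))"
    using \<phi>b by (intro integrable_const_bound[of _ "real R"]) auto
  define \<mu> \<nu> where "\<mu> = expectation (\<lambda>\<omega>. \<psi> (V 1 \<omega>))" and "\<nu> = expectation (\<lambda>\<omega>. \<phi> (V 1 \<omega>))"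
  have \<nu>b: "\<bar>\<nu>\<bar> \<le> real R"
  proof -
    have "\<bar>\<nu>\<bar> \<le> expectation (\<lambda>\<omega>. \<bar>\<phi> (V 1 \<omega>)\<bar>)" unfolding \<nu>_def by (rule integral_abs_bound)
    also have "\<dots> \<le> real R" using \<phi>i \<phi>b by (intro integral_le_const) auto
    finally show ?thesis .
  qed
  \<comment> \<open>The truncation error enters twice, through the summands and through the mean.
    Together with the two parts of the deviation bound this makes four terms of at most
    \<open>e / 8\<close>.\<close>
  define a where "a = expectation (\<lambda>\<omega>. \<bar>\<psi> (V 1 \<omega>) - \<phi> (V 1 \<omega>)\<bar>)"
  have a: "a < e / 8" using R unfolding a_def \<phi>_def .
  have \<mu>\<nu>: "\<bar>\<mu> - \<nu>\<bar> \<le> a"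
  proof -
    have "\<mu> - \<nu> = expectation (\<lambda>\<omega>. \<psi> (V 1 \<omega>) - \<phi> (V 1 \<omega>))" unfolding \<mu>_def \<nu>_def using int \<phi>i by simp
    then show ?thesis unfolding a_def using integral_abs_bound by metis
  qed
  define U where "U i \<omega> = \<phi> (V i \<omega>) - \<nu>" for i \<omega>
  have Uind: "indep_vars (\<lambda>_. borel) U {1..}"
    unfolding U_def using indep_vars_compose2[OF ind, of "\<lambda>_ x. \<phi> x - \<nu>" "\<lambda>_. borel"] by simp
  have Ub: "\<bar>U i \<omega>\<bar> \<le> 2 * real R" for i \<omega> unfolding U_def using \<phi>b[of "V i \<omega>"] \<nu>b by linarith
  have Um: "expectation (U i) = 0" if "i \<ge> 1" for i
    unfolding U_def using tr[OF that \<phi> \<phi>i] by (simp add: \<nu>_def prob_space)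
  obtain N0 :: nat where N0: "(2 * real R)\<^sup>2 / (e / 8 * (e / 8)) < real N0" using reals_Archimedean2 by blast
  show "\<exists>no. \<forall>N\<ge>no. norm (expectation (\<lambda>\<omega>. \<bar>(\<Sum>i=1..N. \<psi> (V i \<omega>)) / real N - expectation (\<lambda>\<omega>. \<psi> (V 1 \<omega>))\<bar>) - 0) < e"
  proof (intro exI allI impI)
    fix N assume NN: "max 1 N0 \<le> N"
    then have N: "N \<ge> 1" "real N0 \<le> real N" by auto
    define D where "D i \<omega> = \<bar>\<psi> (V i \<omega>) - \<phi> (V i \<omega>)\<bar>" for i \<omega>
    have Di: "integrable M (D i)" "expectation (D i) = a" if "i \<ge> 1" for i
      using tr[OF that, of "\<lambda>x. \<bar>\<psi> x - \<phi> x\<bar>"] int \<phi>i unfolding D_def a_def by auto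
    have Ui: "integrable M (U i)" if "i \<ge> 1" for i unfolding U_def using tr[OF that \<phi> \<phi>i] by simp
    have "expectation (\<lambda>\<omega>. \<bar>(\<Sum>i=1..N. \<psi> (V i \<omega>)) / real N - \<mu>\<bar>)
      \<le> expectation (\<lambda>\<omega>. (\<Sum>i=1..N. D i \<omega>) / real N + (\<bar>(\<Sum>i=1..N. U i \<omega>) / real N\<bar> + a))"
    proof (rule integral_mono)
      show "integrable M (\<lambda>\<omega>. \<bar>(\<Sum>i=1..N. \<psi> (V i \<omega>)) / real N - \<mu>\<bar>)"
        using tr[OF _ \<psi> int] by (auto intro!: Bochner_Integration.integrable_diff Bochner_Integration.integrable_sum integrable_divide)
      show "integrable M (\<lambda>\<omega>. (\<Sum>i=1..N. D i \<omega>) / real N + (\<bar>(\<Sum>i=1..N. U i \<omega>) / real N\<bar> + a))"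
        using Di(1) Ui by (auto intro!: Bochner_Integration.integrable_add integrable_abs Bochner_Integration.integrable_sum integrable_divide)
      fix \<omega>
      have "(\<Sum>i=1..N. \<psi> (V i \<omega>)) = (\<Sum>i=1..N. (\<psi> (V i \<omega>) - \<phi> (V i \<omega>)) + U i \<omega> + \<nu>)" by (simp add: U_def)
      also have "\<dots> = (\<Sum>i=1..N. \<psi> (V i \<omega>) - \<phi> (V i \<omega>)) + (\<Sum>i=1..N. U i \<omega>) + real N * \<nu>"
        by (simp add: sum.distrib)
      finally have "(\<Sum>i=1..N. \<psi> (V i \<omega>)) / real N - \<mu> = (\<Sum>i=1..N. \<psi> (V i \<omega>) - \<phi> (V i \<omega>)) / real N + (\<Sum>i=1..N. U i \<omega>) / real N + (\<nu> - \<mu>)"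
        using N by (simp add: add_divide_distrib)
      moreover have "\<bar>(\<Sum>i=1..N. \<psi> (V i \<omega>) - \<phi> (V i \<omega>)) / real N\<bar> \<le> (\<Sum>i=1..N. D i \<omega>) / real N"
        unfolding D_def by (simp add: abs_divide divide_right_mono sum_abs)
      ultimately show "\<bar>(\<Sum>i=1..N. \<psi> (V i \<omega>)) / real N - \<mu>\<bar> \<le> (\<Sum>i=1..N. D i \<omega>) / real N + (\<bar>(\<Sum>i=1..N. U i \<omega>) / real N\<bar> + a)"
        using \<mu>\<nu> by linarith
    qed
    also have "\<dots> = (\<Sum>i=1..N. expectation (D i)) / real N + (expectation (\<lambda>\<omega>. \<bar>(\<Sum>i=1..N. U i \<omega>) / real N\<bar>) + a)"
    proof -
      have 1: "integrable M (\<lambda>\<omega>. \<bar>(\<Sum>i=1..N. U i \<omega>) / real N\<bar>)" "integrable M (\<lambda>\<omega>. (\<Sum>i=1..N. D i \<omega>) / real N)"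
        using Di(1) Ui by (auto intro!: integrable_abs Bochner_Integration.integrable_sum integrable_divide)
      have 2: "expectation (\<lambda>\<omega>. (\<Sum>i=1..N. D i \<omega>) / real N) = (\<Sum>i=1..N. expectation (D i)) / real N"
        using Di(1) by (simp add: Bochner_Integration.integral_sum)
      show ?thesis unfolding 2[symmetric] using 1
        by (subst Bochner_Integration.integral_add) (auto simp: prob_space)
    qed
    also have "(\<Sum>i=1..N. expectation (D i)) / real N = a" using Di(2) N by simp
    also have "a + (expectation (\<lambda>\<omega>. \<bar>(\<Sum>i=1..N. U i \<omega>) / real N\<bar>) + a) \<le> a + ((e / 8 + (2 * real R)\<^sup>2 / (e / 8 * real N)) + a)"
      using average_bounded_deviation[OF Uind Ub Um N(1), of "e / 8"] e by simp
    also have "\<dots> < e"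
    proof -
      have "(2 * real R)\<^sup>2 / (e / 8 * (e / 8)) < real N" using N0 N(2) by linarith
      then have "(2 * real R)\<^sup>2 < real N * (e / 8 * (e / 8))" using e by (subst (asm) divide_less_eq) auto
      then have "(2 * real R)\<^sup>2 / (e / 8 * real N) < e / 8"
        using e N by (subst divide_less_eq) (auto simp: ac_simps)
      then show ?thesis using a e by linarith
    qed
    finally have "expectation (\<lambda>\<omega>. \<bar>(\<Sum>i=1..N. \<psi> (V i \<omega>)) / real N - \<mu>\<bar>) < e" .
    then show "norm (expectation (\<lambda>\<omega>. \<bar>(\<Sum>i=1..N. \<psi> (V i \<omega>)) / real N - expectation (\<lambda>\<omega>. \<psi> (V 1 \<omega>))\<bar>) - 0) < e"
      unfolding \<mu>_def by (simp add: integral_nonneg_AE)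
  qed
qed

section \<open>The mean-field equation\<close>

locale mckean_vlasov = drift T K L b + l2_function T h
  for T K L :: real and b :: "real \<Rightarrow> real \<Rightarrow> real \<Rightarrow> real" and h :: "real \<Rightarrow> real" +
  fixes M :: "'a measure" and F :: "real \<Rightarrow> 'a measure" and W X Z :: "nat \<Rightarrow> real \<Rightarrow> 'a \<Rightarrow> real"
    and \<sigma> x0 Lf :: real and f :: "real \<Rightarrow> real"
  assumes Lf: "0 \<le> Lf" and lip_f: "\<And>x y. \<bar>f x - f y\<bar> \<le> Lf * \<bar>x - y\<bar>"
    and br: "\<And>i. i \<ge> 1 \<Longrightarrow> brownian M F (W i)"
    and ind: "prob_space.indep_vars M (\<lambda>i. \<Pi>\<^sub>M t\<in>{0..}. borel) (\<lambda>i \<omega>. path (W i) \<omega>) {1..}"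
    and sol: "\<And>i. i \<ge> 1 \<Longrightarrow> mckean_vlasov_solution M F (W i) T \<sigma> x0 h f b (X i) (Z i)"
begin

sublocale prob_space M
proof -
  interpret brownian M F "W 1" by (rule br) simp
  show "prob_space M" by unfold_locales
qed

lemma f_measurable[measurable]: "f \<in> borel_measurable borel"
proof (rule borel_measurable_continuous_onI)
  have "Lf-lipschitz_on UNIV f" using lip_f Lf by (intro lipschitz_onI) (auto simp: dist_real_def)
  then show "continuous_on UNIV f" by (rule lipschitz_on_continuous_on)
qed

text \<open>The deterministic part of the driver: \<open>c s + \<sigma> * W s\<close> takes the role
  of \<open>y\<close> in the Euler scheme.\<close>

definition c :: "real \<Rightarrow> real" where "c s = (LBINT r:{0..s}. \<sigma> * h r)"

lemma h_integrable: "set_integrable lborel {0..T} h"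
proof -
  have "integrable lborel (\<lambda>s. indicator {0..T} s *\<^sub>R h s)"
  proof (rule Bochner_Integration.integrable_bound[of lborel "\<lambda>s. indicator {0..T} s *\<^sub>R (1 + (h s)\<^sup>2)"])
    show "integrable lborel (\<lambda>s. indicator {0..T} s *\<^sub>R (1 + (h s)\<^sup>2))"
      using h2 unfolding set_integrable_def by (auto simp: distrib_left emeasure_lborel_Icc_eq intro!: Bochner_Integration.integrable_add integrable_real_indicator)
    show "(\<lambda>s. indicator {0..T} s *\<^sub>R h s) \<in> borel_measurable lborel" by simp
    have "\<bar>h s\<bar> \<le> 1 + (h s)\<^sup>2" for s
      using sum_squares_bound[of "\<bar>h s\<bar>" 1] zero_le_power2[of "h s"] by simp
    then show "AE s in lborel. norm (indicator {0..T} s *\<^sub>R h s) \<le> norm (indicator {0..T} s *\<^sub>R (1 + (h s)\<^sup>2))"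
      by (auto simp: indicator_def intro!: AE_I2)
  qed
  then show ?thesis unfolding set_integrable_def .
qed

lemma c_0: "c 0 = 0"
  unfolding c_def set_lebesgue_integral_def
  by (intro integral_eq_zero_AE) (auto intro: AE_mp[OF AE_lborel_singleton[of 0]])

lemma c_bound: "s \<in> {0..T} \<Longrightarrow> \<bar>c s\<bar> \<le> (LBINT r:{0..T}. \<bar>\<sigma> * h r\<bar>)"
proof -
  assume s: "s \<in> {0..T}"
  have i: "integrable lborel (\<lambda>r. indicator {0..u} r *\<^sub>R \<bar>\<sigma> * h r\<bar>)" if "u \<le> T" for u
  proof -
    have "set_integrable lborel {0..u} h" by (rule set_integrable_subset[OF h_integrable]) (use that in auto)
    then have "set_integrable lborel {0..u} (\<lambda>r. \<bar>\<sigma> * h r\<bar>)"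
      by (intro set_integrable_abs set_integrable_mult_right) auto
    then show ?thesis unfolding set_integrable_def .
  qed
  have "\<bar>c s\<bar> \<le> (\<integral>r. \<bar>indicator {0..s} r *\<^sub>R (\<sigma> * h r)\<bar> \<partial>lborel)"
    unfolding c_def set_lebesgue_integral_def by (rule integral_abs_bound)
  also have "\<dots> = (\<integral>r. indicator {0..s} r *\<^sub>R \<bar>\<sigma> * h r\<bar> \<partial>lborel)"
    by (intro Bochner_Integration.integral_cong) (auto simp: indicator_def)
  also have "\<dots> \<le> (\<integral>r. indicator {0..T} r *\<^sub>R \<bar>\<sigma> * h r\<bar> \<partial>lborel)"
    using s i by (intro integral_mono) (auto simp: indicator_def)
  finally show "\<bar>c s\<bar> \<le> (LBINT r:{0..T}. \<bar>\<sigma> * h r\<bar>)" unfolding set_lebesgue_integral_def .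
qed

text \<open>Serves both systems: \<open>\<mu>\<close> is the mean in one and the empirical average
  in the other. The primed processes are versions with measurable paths, which permits splitting the
  drift integral.\<close>

lemma drift_noise_rep:
  assumes B: "brownian M F V" and P: "ito_process M F V T x0 (\<lambda>t \<omega>. b t (U t \<omega>) (\<mu> t \<omega>) + \<sigma> * h t) (\<lambda>t \<omega>. \<sigma>) U"
    and eq: "AE \<omega> in M. \<forall>t\<in>{0..T}. U' t \<omega> = U t \<omega> \<and> \<mu>' t \<omega> = \<mu> t \<omega>"
    and m: "\<And>\<omega>. (\<lambda>t. U' t \<omega>) \<in> borel_measurable borel" "\<And>\<omega>. \<omega> \<in> space M \<Longrightarrow> (\<lambda>t. \<mu>' t \<omega>) \<in> borel_measurable borel"
  shows "AE \<omega> in M. \<forall>s\<in>{0..T}. U' s \<omega> = x0 + (LBINT r:{0..s}. b r (U' r \<omega>) (\<mu>' r \<omega>)) + (c s + \<sigma> * V s \<omega>)"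
  using brownian.additive_noise_rep[OF B P T] eq AE_space
proof eventually_elim
  case (elim \<omega>)
  show ?case
  proof
    fix s assume s: "s \<in> {0..T}"
    have sub: "{0..s} \<subseteq> {0..T}" using s by auto
    have "(LBINT r:{0..s}. b r (U r \<omega>) (\<mu> r \<omega>) + \<sigma> * h r) = (LBINT r:{0..s}. b r (U' r \<omega>) (\<mu>' r \<omega>) + \<sigma> * h r)"
      using elim(2) sub by (intro set_lebesgue_integral_cong) auto
    also have "\<dots> = (LBINT r:{0..s}. b r (U' r \<omega>) (\<mu>' r \<omega>)) + c s"
      unfolding c_def
    proof (rule set_integral_add)
      show "set_integrable lborel {0..s} (\<lambda>r. b r (U' r \<omega>) (\<mu>' r \<omega>))"
        using m elim(3) sub by (intro drift_integrable) auto
      show "set_integrable lborel {0..s} (\<lambda>r. \<sigma> * h r)"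
        using set_integrable_subset[OF h_integrable _ sub] by (intro set_integrable_mult_right) auto
    qed
    finally show "U' s \<omega> = x0 + (LBINT r:{0..s}. b r (U' r \<omega>) (\<mu>' r \<omega>)) + (c s + \<sigma> * V s \<omega>)"
      using elim(1,2) s by auto
  qed
qed

lemma brownian_second_moment:
  assumes "brownian M F V" "0 \<le> s"
  shows "(\<integral>\<^sup>+\<omega>. ennreal ((V s \<omega>)\<^sup>2) \<partial>M) \<le> ennreal s"
proof -
  interpret B: brownian M F V by fact
  have V0: "AE \<omega> in M. V 0 \<omega> = 0" using B.bm unfolding brownian_motion_def by blast
  have "(\<integral>\<^sup>+\<omega>. ennreal ((V s \<omega>)\<^sup>2) \<partial>M) = (\<integral>\<^sup>+\<omega>. ennreal ((V s \<omega> - V 0 \<omega>)\<^sup>2) \<partial>M)"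
    by (rule nn_integral_cong_AE) (use V0 in eventually_elim, simp)
  also have "\<dots> = ennreal s"
  proof (cases "s = 0")
    case False
    then have s: "0 < s" using assms(2) by simp
    from B.increment_moments(3,4)[OF order_refl s] show ?thesis by (simp add: nn_integral_eq_integral)
  qed simp
  finally show ?thesis by simp
qed

definition CX :: real where
  "CX = 2 * (\<bar>x0\<bar> + K * T + (LBINT r:{0..T}. \<bar>\<sigma> * h r\<bar>))\<^sup>2 + 2 * (\<sigma>\<^sup>2 * T)"

text \<open>Since \<open>b\<close> is bounded, \<open>U - \<sigma> V\<close> is bounded by a
  deterministic constant, and the variance of \<open>V\<close> does the rest. Hence one constant
  \<open>CX\<close> holds for every driver and every \<open>\<mu>\<close>.\<close>

lemma second_moment_bound:
  assumes B: "brownian M F V"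
    and eq: "AE \<omega> in M. \<forall>s\<in>{0..T}. U s \<omega> = x0 + (LBINT r:{0..s}. b r (U r \<omega>) (\<mu> r \<omega>)) + (c s + \<sigma> * V s \<omega>)"
    and m: "\<And>\<omega>. (\<lambda>t. U t \<omega>) \<in> borel_measurable borel" "\<And>\<omega>. \<omega> \<in> space M \<Longrightarrow> (\<lambda>t. \<mu> t \<omega>) \<in> borel_measurable borel"
    and s: "s \<in> {0..T}"
  shows "(\<integral>\<^sup>+\<omega>. ennreal ((U s \<omega>)\<^sup>2) \<partial>M) \<le> ennreal CX"
proof -
  interpret B: brownian M F V by fact
  let ?a = "\<bar>x0\<bar> + K * T + (LBINT r:{0..T}. \<bar>\<sigma> * h r\<bar>)"
  have [measurable]: "V s \<in> borel_measurable M" using s by (intro B.W_M) auto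
  have "(\<integral>\<^sup>+\<omega>. ennreal ((U s \<omega>)\<^sup>2) \<partial>M) \<le> (\<integral>\<^sup>+\<omega>. ennreal (2 * ?a\<^sup>2) + ennreal (2 * \<sigma>\<^sup>2) * ennreal ((V s \<omega>)\<^sup>2) \<partial>M)"
  proof (rule nn_integral_mono_AE, use eq AE_space in eventually_elim)
    case (elim \<omega>)
    have sub: "{0..s} \<subseteq> {0..T}" using s by auto
    have "\<bar>(LBINT r:{0..s}. b r (U r \<omega>) (\<mu> r \<omega>)) - (LBINT r:{0..s}. 0)\<bar> \<le> (LBINT r:{0..s}. K)"
    proof (rule set_integral_diff_bound)
      show "set_integrable lborel {0..s} (\<lambda>r. b r (U r \<omega>) (\<mu> r \<omega>))"
        using m elim(2) sub by (intro drift_integrable) auto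
      show "set_integrable lborel {0..s} (\<lambda>r. K)"
        unfolding set_integrable_def by (intro integrable_mult_left integrable_real_indicator integrable_scaleR_left) (auto simp: emeasure_lborel_Icc_eq)
      show "\<bar>b r (U r \<omega>) (\<mu> r \<omega>) - 0\<bar> \<le> K" if "r \<in> {0..s}" for r using bound that sub by auto
    qed (simp add: set_integrable_def)
    moreover have "(LBINT r:{0..s}. K) = K * s" using s unfolding set_lebesgue_integral_def by simp
    moreover have "K * s \<le> K * T" using s K by (intro mult_left_mono) auto
    moreover have "(LBINT r:{0..s}. 0) = (0::real)" by (simp add: set_lebesgue_integral_def)
    ultimately have "\<bar>LBINT r:{0..s}. b r (U r \<omega>) (\<mu> r \<omega>)\<bar> \<le> K * T" by linarith
    moreover have "U s \<omega> = x0 + (LBINT r:{0..s}. b r (U r \<omega>) (\<mu> r \<omega>)) + (c s + \<sigma> * V s \<omega>)" using elim(1) s by blast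
    ultimately have le: "\<bar>U s \<omega> - \<sigma> * V s \<omega>\<bar> \<le> ?a" using c_bound[OF s] by linarith
    have "\<bar>U s \<omega> - \<sigma> * V s \<omega>\<bar> \<le> \<bar>?a\<bar>" using le by linarith
    then have "(U s \<omega> - \<sigma> * V s \<omega>)\<^sup>2 \<le> ?a\<^sup>2" by (simp only: abs_le_square_iff)
    then have "(U s \<omega>)\<^sup>2 \<le> 2 * ?a\<^sup>2 + 2 * \<sigma>\<^sup>2 * (V s \<omega>)\<^sup>2"
      using square_add_le[of "U s \<omega> - \<sigma> * V s \<omega>" "\<sigma> * V s \<omega>"] by (simp add: power_mult_distrib)
    then have "ennreal ((U s \<omega>)\<^sup>2) \<le> ennreal (2 * ?a\<^sup>2 + 2 * \<sigma>\<^sup>2 * (V s \<omega>)\<^sup>2)" by (rule ennreal_leI)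
    then show ?case by (simp add: ennreal_mult)
  qed
  also have "\<dots> = ennreal (2 * ?a\<^sup>2) + ennreal (2 * \<sigma>\<^sup>2) * (\<integral>\<^sup>+\<omega>. ennreal ((V s \<omega>)\<^sup>2) \<partial>M)"
    by (simp add: nn_integral_add nn_integral_cmult emeasure_space_1)
  also have "\<dots> \<le> ennreal (2 * ?a\<^sup>2) + ennreal (2 * \<sigma>\<^sup>2) * ennreal T"
    using brownian_second_moment[OF B, of s] s by (intro add_left_mono mult_left_mono) (auto intro: order_trans ennreal_leI)
  also have "\<dots> = ennreal CX" unfolding CX_def using T by (simp flip: ennreal_mult ennreal_plus add: mult.assoc)
  finally show ?thesis .
qed

lemma continuous_version:
  assumes i1: "i \<ge> 1" and ip: "ito_process M F (W i) T x \<beta> \<alpha> U"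
  shows "\<exists>Y. (\<forall>\<omega>. continuous_on UNIV (\<lambda>t. Y t \<omega>)) \<and> (\<lambda>(s, \<omega>). Y s \<omega>) \<in> borel_measurable (borel \<Otimes>\<^sub>M M)
     \<and> (AE \<omega> in M. \<forall>t\<in>{0..T}. Y t \<omega> = U t \<omega>)"
proof -
  interpret B: brownian M F "W i" by (rule br[OF i1])
  have "U t \<in> borel_measurable M" if "t \<in> {0..T}" for t
    using ip that B.measurable_F_M unfolding ito_process_def by blast
  moreover have "AE \<omega> in M. continuous_on {0..T} (\<lambda>t. U t \<omega>)"
    using ip unfolding ito_process_def by blast
  ultimately show ?thesis
  proof (rule continuous_modification[OF T])
    fix Y :: "real \<Rightarrow> 'a \<Rightarrow> real"
    assume "\<And>\<omega>. continuous_on UNIV (\<lambda>t. Y t \<omega>)" "(\<lambda>(s, \<omega>). Y s \<omega>) \<in> borel_measurable (borel \<Otimes>\<^sub>M M)"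
      "AE \<omega> in M. \<forall>t\<in>{0..T}. Y t \<omega> = U t \<omega>"
    then show ?thesis by (intro exI[of _ Y] conjI allI)
  qed
qed

lemma continuous_versions:
  "\<exists>X' Z'. (\<forall>i\<ge>1. (\<forall>\<omega>. continuous_on UNIV (\<lambda>t. X' i t \<omega>)) \<and> (\<forall>\<omega>. continuous_on UNIV (\<lambda>t. Z' i t \<omega>))
     \<and> (\<lambda>(s, \<omega>). X' i s \<omega>) \<in> borel_measurable (borel \<Otimes>\<^sub>M M) \<and> (\<lambda>(s, \<omega>). Z' i s \<omega>) \<in> borel_measurable (borel \<Otimes>\<^sub>M M)
     \<and> (AE \<omega> in M. \<forall>t\<in>{0..T}. X' i t \<omega> = X i t \<omega>) \<and> (AE \<omega> in M. \<forall>t\<in>{0..T}. Z' i t \<omega> = Z i t \<omega>))"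
proof -
  have "\<forall>i\<in>{1..}. \<exists>Y. (\<forall>\<omega>. continuous_on UNIV (\<lambda>t. Y t \<omega>)) \<and> (\<lambda>(s, \<omega>). Y s \<omega>) \<in> borel_measurable (borel \<Otimes>\<^sub>M M)
     \<and> (AE \<omega> in M. \<forall>t\<in>{0..T}. Y t \<omega> = X i t \<omega>)"
  proof
    fix i :: nat assume "i \<in> {1..}"
    then have i: "i \<ge> 1" by simp
    show "\<exists>Y. (\<forall>\<omega>. continuous_on UNIV (\<lambda>t. Y t \<omega>)) \<and> (\<lambda>(s, \<omega>). Y s \<omega>) \<in> borel_measurable (borel \<Otimes>\<^sub>M M)
     \<and> (AE \<omega> in M. \<forall>t\<in>{0..T}. Y t \<omega> = X i t \<omega>)"
      using sol[OF i] unfolding mckean_vlasov_solution_def by (elim conjE) (rule continuous_version[OF i])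
  qed
  then obtain X' where X': "\<forall>i\<in>{1..}. (\<forall>\<omega>. continuous_on UNIV (\<lambda>t. X' i t \<omega>)) \<and> (\<lambda>(s, \<omega>). X' i s \<omega>) \<in> borel_measurable (borel \<Otimes>\<^sub>M M)
     \<and> (AE \<omega> in M. \<forall>t\<in>{0..T}. X' i t \<omega> = X i t \<omega>)" by (rule bchoice[THEN exE])
  have "\<forall>i\<in>{1..}. \<exists>Y. (\<forall>\<omega>. continuous_on UNIV (\<lambda>t. Y t \<omega>)) \<and> (\<lambda>(s, \<omega>). Y s \<omega>) \<in> borel_measurable (borel \<Otimes>\<^sub>M M)
     \<and> (AE \<omega> in M. \<forall>t\<in>{0..T}. Y t \<omega> = Z i t \<omega>)"
  proof
    fix i :: nat assume "i \<in> {1..}"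
    then have i: "i \<ge> 1" by simp
    show "\<exists>Y. (\<forall>\<omega>. continuous_on UNIV (\<lambda>t. Y t \<omega>)) \<and> (\<lambda>(s, \<omega>). Y s \<omega>) \<in> borel_measurable (borel \<Otimes>\<^sub>M M)
     \<and> (AE \<omega> in M. \<forall>t\<in>{0..T}. Y t \<omega> = Z i t \<omega>)"
      using sol[OF i] unfolding mckean_vlasov_solution_def by (elim conjE) (rule continuous_version[OF i])
  qed
  then obtain Z' where Z': "\<forall>i\<in>{1..}. (\<forall>\<omega>. continuous_on UNIV (\<lambda>t. Z' i t \<omega>)) \<and> (\<lambda>(s, \<omega>). Z' i s \<omega>) \<in> borel_measurable (borel \<Otimes>\<^sub>M M)
     \<and> (AE \<omega> in M. \<forall>t\<in>{0..T}. Z' i t \<omega> = Z i t \<omega>)" by (rule bchoice[THEN exE])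
  show ?thesis using X' Z' by (intro exI[of _ X'] exI[of _ Z']) simp
qed

end

text \<open>\<open>X'\<close> and \<open>Z'\<close> are versions of the solutions for which paths can be integrated in time and
  Fubini's theorem applies; adaptedness of the original processes does not provide this.\<close>

locale mckean_vlasov_continuous = mckean_vlasov T K L b h M F W X Z \<sigma> x0 Lf f
  for T K L :: real and b :: "real \<Rightarrow> real \<Rightarrow> real \<Rightarrow> real" and h :: "real \<Rightarrow> real"
    and M :: "'a measure" and F :: "real \<Rightarrow> 'a measure" and W X Z :: "nat \<Rightarrow> real \<Rightarrow> 'a \<Rightarrow> real"
    and \<sigma> x0 Lf :: real and f :: "real \<Rightarrow> real" +
  fixes X' Z' :: "nat \<Rightarrow> real \<Rightarrow> 'a \<Rightarrow> real"
  assumes X'_cont: "\<And>i \<omega>. i \<ge> 1 \<Longrightarrow> continuous_on UNIV (\<lambda>t. X' i t \<omega>)"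
    and Z'_cont: "\<And>i \<omega>. i \<ge> 1 \<Longrightarrow> continuous_on UNIV (\<lambda>t. Z' i t \<omega>)"
    and X'_joint: "\<And>i. i \<ge> 1 \<Longrightarrow> (\<lambda>(s, \<omega>). X' i s \<omega>) \<in> borel_measurable (borel \<Otimes>\<^sub>M M)"
    and Z'_joint: "\<And>i. i \<ge> 1 \<Longrightarrow> (\<lambda>(s, \<omega>). Z' i s \<omega>) \<in> borel_measurable (borel \<Otimes>\<^sub>M M)"
    and X'_eq: "\<And>i. i \<ge> 1 \<Longrightarrow> AE \<omega> in M. \<forall>t\<in>{0..T}. X' i t \<omega> = X i t \<omega>"
    and Z'_eq: "\<And>i. i \<ge> 1 \<Longrightarrow> AE \<omega> in M. \<forall>t\<in>{0..T}. Z' i t \<omega> = Z i t \<omega>"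
begin

lemma X'_M[measurable]: "i \<ge> 1 \<Longrightarrow> X' i t \<in> borel_measurable M"
  using measurable_compose[OF measurable_Pair1'[of t borel M] X'_joint[of i]] by simp

lemma Z'_M[measurable]: "i \<ge> 1 \<Longrightarrow> Z' i t \<in> borel_measurable M"
  using measurable_compose[OF measurable_Pair1'[of t borel M] Z'_joint[of i]] by simp

text \<open>The index stays because each copy carries the expectation of its own solution; that all
  \<open>m i\<close> agree on \<open>{0..T}\<close> has to be proved. The continuous versions make
  the function Borel in time.\<close>

definition m :: "nat \<Rightarrow> real \<Rightarrow> real" where "m i t = (\<integral>\<omega>. f (X' i t \<omega>) * Z' i t \<omega> \<partial>M)"

lemma m_measurable: "i \<ge> 1 \<Longrightarrow> m i \<in> borel_measurable borel"
  unfolding m_def[abs_def]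
proof (rule borel_measurable_lebesgue_integral)
  assume i: "i \<ge> 1"
  have [measurable]: "(\<lambda>p. X' i (fst p) (snd p)) \<in> borel_measurable (borel \<Otimes>\<^sub>M M)"
     "(\<lambda>p. Z' i (fst p) (snd p)) \<in> borel_measurable (borel \<Otimes>\<^sub>M M)"
    using X'_joint[OF i] Z'_joint[OF i] by (simp_all add: case_prod_beta)
  show "(\<lambda>(t, \<omega>). f (X' i t \<omega>) * Z' i t \<omega>) \<in> borel_measurable (borel \<Otimes>\<^sub>M M)"
    unfolding case_prod_beta by measurable
qed

lemma m_eq:
  assumes i: "i \<ge> 1" and t: "t \<in> {0..T}"
  shows "m i t = (\<integral>\<omega>. f (X i t \<omega>) * Z i t \<omega> \<partial>M)" "integrable M (\<lambda>\<omega>. f (X' i t \<omega>) * Z' i t \<omega>)"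
proof -
  interpret B: brownian M F "W i" by (rule br[OF i])
  have [measurable]: "X i t \<in> borel_measurable M" "Z i t \<in> borel_measurable M"
    using sol[OF i] t B.measurable_F_M unfolding mckean_vlasov_solution_def ito_process_def by blast+
  have [measurable]: "X' i t \<in> borel_measurable M" "Z' i t \<in> borel_measurable M" using i by auto
  have eq: "AE \<omega> in M. f (X' i t \<omega>) * Z' i t \<omega> = f (X i t \<omega>) * Z i t \<omega>"
    using X'_eq[OF i] Z'_eq[OF i] by eventually_elim (use t in simp)
  show "m i t = (\<integral>\<omega>. f (X i t \<omega>) * Z i t \<omega> \<partial>M)" unfolding m_def by (rule integral_cong_AE[OF _ _ eq]) measurable
  have "integrable M (\<lambda>\<omega>. f (X i t \<omega>) * Z i t \<omega>)" using sol[OF i] t unfolding mckean_vlasov_solution_def by blast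
  then show "integrable M (\<lambda>\<omega>. f (X' i t \<omega>) * Z' i t \<omega>)"
    by (subst integrable_cong_AE[OF _ _ eq]) measurable
qed

lemma path_cont_measurable:
  assumes "i \<ge> 1"
  shows "(\<lambda>t. X' i t \<omega>) \<in> borel_measurable borel" "(\<lambda>t. Z' i t \<omega>) \<in> borel_measurable borel"
  using X'_cont[OF assms] Z'_cont[OF assms] by (auto intro: borel_measurable_continuous_onI)

lemma X'_equation:
  assumes i: "i \<ge> 1"
  shows "AE \<omega> in M. \<forall>s\<in>{0..T}. X' i s \<omega> = x0 + (LBINT r:{0..s}. b r (X' i r \<omega>) (m i r)) + (c s + \<sigma> * W i s \<omega>)"
proof (rule drift_noise_rep[OF br[OF i]])
  show "ito_process M F (W i) T x0 (\<lambda>t \<omega>. b t (X i t \<omega>) (\<integral>\<omega>'. f (X i t \<omega>') * Z i t \<omega>' \<partial>M) + \<sigma> * h t) (\<lambda>t \<omega>. \<sigma>) (X i)"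
    using sol[OF i] unfolding mckean_vlasov_solution_def by blast
  show "AE \<omega> in M. \<forall>t\<in>{0..T}. X' i t \<omega> = X i t \<omega> \<and> m i t = (\<integral>\<omega>'. f (X i t \<omega>') * Z i t \<omega>' \<partial>M)"
    using X'_eq[OF i] by eventually_elim (use m_eq(1)[OF i] in simp)
qed (use path_cont_measurable[OF i] m_measurable[OF i] in auto)

lemma X'_second_moment: "i \<ge> 1 \<Longrightarrow> s \<in> {0..T} \<Longrightarrow> (\<integral>\<^sup>+\<omega>. ennreal ((X' i s \<omega>)\<^sup>2) \<partial>M) \<le> ennreal CX"
  using second_moment_bound[OF br X'_equation] path_cont_measurable m_measurable by blast

lemma Z_sde: "i \<ge> 1 \<Longrightarrow> linear_sde M F (W i) T h (Z i)"
  using sol unfolding mckean_vlasov_solution_def by blast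

lemma Z'_second_moment: "\<exists>C\<ge>0. \<forall>i\<ge>1. \<forall>s\<in>{0..T}. (\<integral>\<^sup>+\<omega>. ennreal ((Z' i s \<omega>)\<^sup>2) \<partial>M) \<le> ennreal C"
proof -
  obtain C where C: "0 \<le> C" and b: "\<And>i s. i \<ge> 1 \<Longrightarrow> s \<in> {0..T} \<Longrightarrow> (\<integral>\<^sup>+\<omega>. ennreal ((Z i s \<omega>)\<^sup>2) \<partial>M) \<le> ennreal C"
    using linear_sde_second_moment[where 'a = 'a] br Z_sde by meson
  have "(\<integral>\<^sup>+\<omega>. ennreal ((Z' i s \<omega>)\<^sup>2) \<partial>M) = (\<integral>\<^sup>+\<omega>. ennreal ((Z i s \<omega>)\<^sup>2) \<partial>M)" if "i \<ge> 1" "s \<in> {0..T}" for i s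
    by (rule nn_integral_cong_AE) (use Z'_eq[OF that(1)] in eventually_elim, use that in simp)
  then show ?thesis using C b by (intro exI[of _ C]) simp
qed

text \<open>The moment bound is existential; the choice fixes one constant for all copies and times,
  on which further constants are built.\<close>

definition CZ :: real where "CZ = (SOME C. C \<ge> 0 \<and> (\<forall>i\<ge>1. \<forall>s\<in>{0..T}. (\<integral>\<^sup>+\<omega>. ennreal ((Z' i s \<omega>)\<^sup>2) \<partial>M) \<le> ennreal C))"

lemma CZ: "0 \<le> CZ" "i \<ge> 1 \<Longrightarrow> s \<in> {0..T} \<Longrightarrow> (\<integral>\<^sup>+\<omega>. ennreal ((Z' i s \<omega>)\<^sup>2) \<partial>M) \<le> ennreal CZ"
  using someI_ex[OF Z'_second_moment] unfolding CZ_def[symmetric] by auto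

lemma Z'_square_integrable:
  assumes "i \<ge> 1" "s \<in> {0..T}"
  shows "integrable M (\<lambda>\<omega>. (Z' i s \<omega>)\<^sup>2)" "expectation (\<lambda>\<omega>. (Z' i s \<omega>)\<^sup>2) \<le> CZ"
proof -
  have [measurable]: "Z' i s \<in> borel_measurable M" using assms by simp
  have le: "(\<integral>\<^sup>+\<omega>. ennreal ((Z' i s \<omega>)\<^sup>2) \<partial>M) \<le> ennreal CZ" by (rule CZ(2)[OF assms])
  show int: "integrable M (\<lambda>\<omega>. (Z' i s \<omega>)\<^sup>2)"
    using le by (intro integrableI_nonneg) (auto simp: order_le_less_trans[OF _ ennreal_less_top])
  then have "ennreal (expectation (\<lambda>\<omega>. (Z' i s \<omega>)\<^sup>2)) \<le> ennreal CZ" using le by (simp add: nn_integral_eq_integral)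
  then show "expectation (\<lambda>\<omega>. (Z' i s \<omega>)\<^sup>2) \<le> CZ" using CZ(1) by (simp only: ennreal_le_iff)
qed

text \<open>Bound for the first absolute moment of \<open>f (X) Z\<close>, from
  \<open>|f z| \<le> f^2 + z^2\<close> and the linear growth of \<open>f\<close>.\<close>

definition CY :: real where "CY = (2 * (f 0)\<^sup>2 + 2 * Lf\<^sup>2 * CX) + CZ"

lemma CX: "0 \<le> CX" unfolding CX_def using T by simp

lemma CY: "0 \<le> CY" unfolding CY_def using CX CZ(1) by simp

lemma Y_moment:
  assumes i: "i \<ge> 1" and s: "s \<in> {0..T}"
  shows "(\<integral>\<^sup>+\<omega>. ennreal \<bar>f (X' i s \<omega>) * Z' i s \<omega>\<bar> \<partial>M) \<le> ennreal CY"
proof -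
  have [measurable]: "X' i s \<in> borel_measurable M" "Z' i s \<in> borel_measurable M" using i by auto
  have "(\<integral>\<^sup>+\<omega>. ennreal \<bar>f (X' i s \<omega>) * Z' i s \<omega>\<bar> \<partial>M)
    \<le> (\<integral>\<^sup>+\<omega>. (ennreal (2 * (f 0)\<^sup>2) + ennreal (2 * Lf\<^sup>2) * ennreal ((X' i s \<omega>)\<^sup>2)) + ennreal ((Z' i s \<omega>)\<^sup>2) \<partial>M)"
  proof (rule nn_integral_mono)
    fix \<omega>
    let ?x = "X' i s \<omega>" and ?z = "Z' i s \<omega>"
    have "2 * (\<bar>f ?x\<bar> * \<bar>?z\<bar>) \<le> (f ?x)\<^sup>2 + ?z\<^sup>2" using sum_squares_bound[of "\<bar>f ?x\<bar>" "\<bar>?z\<bar>"] by simp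
    moreover have "0 \<le> \<bar>f ?x\<bar> * \<bar>?z\<bar>" by simp
    ultimately have 1: "\<bar>f ?x * ?z\<bar> \<le> (f ?x)\<^sup>2 + ?z\<^sup>2" unfolding abs_mult by linarith
    have "\<bar>f ?x - f 0\<bar> \<le> \<bar>Lf * ?x\<bar>" using lip_f[of ?x 0] Lf by (simp add: abs_mult)
    then have "(f ?x - f 0)\<^sup>2 \<le> Lf\<^sup>2 * ?x\<^sup>2" by (simp add: abs_le_square_iff power_mult_distrib)
    then have "(f ?x)\<^sup>2 \<le> 2 * (f 0)\<^sup>2 + 2 * Lf\<^sup>2 * ?x\<^sup>2" using square_add_le[of "f ?x - f 0" "f 0"] by simp
    then have "ennreal \<bar>f ?x * ?z\<bar> \<le> ennreal (2 * (f 0)\<^sup>2 + 2 * Lf\<^sup>2 * ?x\<^sup>2 + ?z\<^sup>2)" using 1 by (intro ennreal_leI) linarith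
    then show "ennreal \<bar>f ?x * ?z\<bar> \<le> (ennreal (2 * (f 0)\<^sup>2) + ennreal (2 * Lf\<^sup>2) * ennreal (?x\<^sup>2)) + ennreal (?z\<^sup>2)"
      by (simp add: ennreal_mult)
  qed
  also have "\<dots> = (ennreal (2 * (f 0)\<^sup>2) + ennreal (2 * Lf\<^sup>2) * (\<integral>\<^sup>+\<omega>. ennreal ((X' i s \<omega>)\<^sup>2) \<partial>M)) + (\<integral>\<^sup>+\<omega>. ennreal ((Z' i s \<omega>)\<^sup>2) \<partial>M)"
    by (simp add: nn_integral_add nn_integral_cmult emeasure_space_1)
  also have "\<dots> \<le> (ennreal (2 * (f 0)\<^sup>2) + ennreal (2 * Lf\<^sup>2) * ennreal CX) + ennreal CZ"
    using X'_second_moment[OF i s] CZ(2)[OF i s] by (intro add_mono add_left_mono mult_left_mono) auto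
  also have "\<dots> = ennreal CY" unfolding CY_def using CX CZ(1) by (simp flip: ennreal_mult ennreal_plus)
  finally show ?thesis .
qed

lemma m_bound:
  assumes i: "i \<ge> 1" and s: "s \<in> {0..T}"
  shows "\<bar>m i s\<bar> \<le> CY"
proof -
  have "\<bar>m i s\<bar> \<le> (\<integral>\<omega>. \<bar>f (X' i s \<omega>) * Z' i s \<omega>\<bar> \<partial>M)" unfolding m_def by (rule integral_abs_bound)
  moreover have "ennreal (\<integral>\<omega>. \<bar>f (X' i s \<omega>) * Z' i s \<omega>\<bar> \<partial>M) = (\<integral>\<^sup>+\<omega>. ennreal \<bar>f (X' i s \<omega>) * Z' i s \<omega>\<bar> \<partial>M)"
    using m_eq(2)[OF i s] by (intro nn_integral_eq_integral[symmetric]) auto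
  then have "ennreal (\<integral>\<omega>. \<bar>f (X' i s \<omega>) * Z' i s \<omega>\<bar> \<partial>M) \<le> ennreal CY" using Y_moment[OF i s] by simp
  then have "(\<integral>\<omega>. \<bar>f (X' i s \<omega>) * Z' i s \<omega>\<bar> \<partial>M) \<le> CY" using CY by (simp only: ennreal_le_iff)
  ultimately show ?thesis by linarith
qed

text \<open>The solution map of the equation with a prescribed mean. With \<open>\<mu>\<close> as a
  parameter, the mean of one copy can be combined with the noise of another.\<close>

definition \<xi> :: "(real \<Rightarrow> real) \<Rightarrow> real \<Rightarrow> (real \<Rightarrow> real) \<Rightarrow> real" where
  "\<xi> \<mu> t w = lim (\<lambda>n. xE b \<mu> x0 (\<lambda>s. c s + \<sigma> * w s) t n n)"

lemma \<xi>_measurable: "\<mu> \<in> borel_measurable borel \<Longrightarrow> t \<in> {0..T} \<Longrightarrow> \<xi> \<mu> t \<in> borel_measurable (\<Pi>\<^sub>M s\<in>{0..}. borel)"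
  unfolding \<xi>_def[abs_def] by (intro borel_measurable_lim_metric xE_measurable) auto

text \<open>\<open>\<mu>\<close> has to agree with \<open>m i\<close> on \<open>{0..T}\<close> only,
  so that \<open>m 1\<close> can replace \<open>m i\<close> once uniqueness of the mean is known
  there.\<close>

lemma xE_converges_X':
  assumes i: "i \<ge> 1" and t: "t \<in> {0..T}" and \<mu>: "\<mu> \<in> borel_measurable borel" "\<And>s. s \<in> {0..T} \<Longrightarrow> \<mu> s = m i s"
  shows "AE \<omega> in M. (\<lambda>n. xE b \<mu> x0 (\<lambda>s. c s + \<sigma> * path (W i) \<omega> s) t n n) \<longlonglongrightarrow> X' i t \<omega>"
proof -
  interpret B: brownian M F "W i" by (rule br[OF i])
  have W0: "AE \<omega> in M. W i 0 \<omega> = 0" using B.bm unfolding brownian_motion_def by blast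
  show ?thesis
    using X'_equation[OF i] W0
  proof eventually_elim
    case (elim \<omega>)
    show ?case
    proof (rule xE_converges[OF \<mu>(1) X'_cont[OF i] _ t])
      fix s assume s: "s \<in> {0..T}"
      have "(LBINT r:{0..s}. b r (X' i r \<omega>) (\<mu> r)) = (LBINT r:{0..s}. b r (X' i r \<omega>) (m i r))"
        using \<mu>(2) s by (intro set_lebesgue_integral_cong) auto
      then show "X' i s \<omega> = x0 + (LBINT r:{0..s}. b r (X' i r \<omega>) (\<mu> r)) + ((c s + \<sigma> * path (W i) \<omega> s) - (c 0 + \<sigma> * path (W i) \<omega> 0))"
        using elim s c_0 by simp
    qed
  qed
qed

lemma X'_functional:
  assumes "i \<ge> 1" "t \<in> {0..T}" "\<mu> \<in> borel_measurable borel" "\<And>s. s \<in> {0..T} \<Longrightarrow> \<mu> s = m i s"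
  shows "AE \<omega> in M. X' i t \<omega> = \<xi> \<mu> t (path (W i) \<omega>)"
proof -
  have "AE \<omega> in M. (\<lambda>n. xE b \<mu> x0 (\<lambda>s. c s + \<sigma> * path (W i) \<omega> s) t n n) \<longlonglongrightarrow> X' i t \<omega>"
    by (rule xE_converges_X'[OF assms])
  then show ?thesis unfolding \<xi>_def by (rule eventually_mono) (rule limI[symmetric])
qed

text \<open>One functional for all noises and all solutions. The second clause will identify the
  weights of the particle system with those of the limit.\<close>

lemma Z'_functional:
  assumes t: "t \<in> {0..T}"
  shows "\<exists>\<zeta>\<in>borel_measurable (\<Pi>\<^sub>M s\<in>{0..}. borel). (\<forall>i\<ge>1. AE \<omega> in M. Z' i t \<omega> = \<zeta> (path (W i) \<omega>)) \<and>
    (\<forall>i\<ge>1. \<forall>U. linear_sde M F (W i) T h U \<longrightarrow> (AE \<omega> in M. U t \<omega> = \<zeta> (path (W i) \<omega>)))"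
proof -
  obtain \<zeta> where \<zeta>: "\<zeta> \<in> borel_measurable (\<Pi>\<^sub>M s\<in>{0..}. borel)"
    and eq: "\<And>(M :: 'a measure) F W Z. brownian M F W \<Longrightarrow> linear_sde M F W T h Z \<Longrightarrow> (AE \<omega> in M. Z t \<omega> = \<zeta> (path W \<omega>))"
    using linear_sde_functional[OF t, where 'a = 'a] by blast
  have "AE \<omega> in M. Z' i t \<omega> = \<zeta> (path (W i) \<omega>)" if i: "i \<ge> 1" for i
    using eq[OF br[OF i] Z_sde[OF i]] Z'_eq[OF i] by eventually_elim (use t in simp)
  then show ?thesis using \<zeta> eq[OF br] by blast
qed

section \<open>Equality of laws and uniqueness of the mean\<close>

abbreviation PS :: "(real \<Rightarrow> real) measure" where "PS \<equiv> \<Pi>\<^sub>M s\<in>{0..}. borel"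

lemma path_law: "i \<ge> 1 \<Longrightarrow> distr M PS (path (W i)) = distr M PS (path (W 1))"
  by (rule brownian_path_law[OF br br]) simp_all

lemma path_W_measurable[measurable]: "i \<ge> 1 \<Longrightarrow> path (W i) \<in> measurable M PS"
  by (rule brownian.path_measurable[OF br])

lemma same_law_integral:
  fixes \<psi> :: "(real \<Rightarrow> real) \<Rightarrow> real"
  assumes i: "i \<ge> 1" and \<psi>: "\<psi> \<in> borel_measurable PS"
  shows "integrable M (\<lambda>\<omega>. \<psi> (path (W i) \<omega>)) \<longleftrightarrow> integrable M (\<lambda>\<omega>. \<psi> (path (W 1) \<omega>))"
    "expectation (\<lambda>\<omega>. \<psi> (path (W i) \<omega>)) = expectation (\<lambda>\<omega>. \<psi> (path (W 1) \<omega>))"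
proof -
  have a: "integrable (distr M PS (path (W j))) \<psi> \<longleftrightarrow> integrable M (\<lambda>\<omega>. \<psi> (path (W j) \<omega>))" if "j \<ge> 1" for j
    by (rule integrable_distr_eq[OF path_W_measurable[OF that] \<psi>])
  have b: "integral\<^sup>L (distr M PS (path (W j))) \<psi> = expectation (\<lambda>\<omega>. \<psi> (path (W j) \<omega>))" if "j \<ge> 1" for j
    by (rule integral_distr[OF path_W_measurable[OF that] \<psi>])
  show "integrable M (\<lambda>\<omega>. \<psi> (path (W i) \<omega>)) \<longleftrightarrow> integrable M (\<lambda>\<omega>. \<psi> (path (W 1) \<omega>))"
    using a[OF i] a[OF order_refl] unfolding path_law[OF i] by blast
  show "expectation (\<lambda>\<omega>. \<psi> (path (W i) \<omega>)) = expectation (\<lambda>\<omega>. \<psi> (path (W 1) \<omega>))"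
    using b[OF i] b[OF order_refl] unfolding path_law[OF i] by (rule trans[OF sym])
qed

text \<open>Meant for the scheme with mean \<open>m 1\<close> along the path of \<open>W i\<close>:
  its convergence is known along \<open>W 1\<close>, where a solution exists, and is transferred by
  equality of laws.\<close>

lemma same_law_AE:
  assumes i: "i \<ge> 1" and P: "{w \<in> space PS. P w} \<in> sets PS" and AE: "AE \<omega> in M. P (path (W 1) \<omega>)"
  shows "AE \<omega> in M. P (path (W i) \<omega>)"
proof -
  have a: "(AE w in distr M PS (path (W j)). P w) \<longleftrightarrow> (AE \<omega> in M. P (path (W j) \<omega>))" if "j \<ge> 1" for j
    by (rule AE_distr_iff[OF path_W_measurable[OF that] P])
  show ?thesis using a[OF i] a[OF order_refl] AE unfolding path_law[OF i] by blast
qed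

text \<open>\<open>\<xi> (m 1)\<close> along the path of \<open>W i\<close> has weighted mean
  \<open>m 1\<close>, by equality of laws, and is driven by the same noise as \<open>X' i\<close>.
  The two processes differ only through their means, so \<open>xE_stable\<close> bounds their
  distance by the deterministic \<open>D\<close>; the weight then costs a factor
  \<open>E |Z| \<le> 1 + CZ\<close>.\<close>

lemma mean_difference:
  assumes i: "i \<ge> 1" and t: "t \<in> {0..T}"
  shows "\<bar>m i t - m 1 t\<bar> \<le> Lf * (1 + CZ) * (exp (L * t) * L * (LBINT s:{0<..t}. \<bar>m i s - m 1 s\<bar>))"
proof -
  define D where "D = exp (L * t) * L * (LBINT s:{0<..t}. \<bar>m i s - m 1 s\<bar>)"
  have mm: "m i \<in> borel_measurable borel" "m 1 \<in> borel_measurable borel" using m_measurable i by auto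
  note [measurable] = \<xi>_measurable[OF mm(2) t]
  obtain \<zeta> where \<zeta>[measurable]: "\<zeta> \<in> borel_measurable PS" and Z\<zeta>: "\<And>j. j \<ge> 1 \<Longrightarrow> AE \<omega> in M. Z' j t \<omega> = \<zeta> (path (W j) \<omega>)"
    using Z'_functional[OF t] by blast
  define \<psi> where "\<psi> w = f (\<xi> (m 1) t w) * \<zeta> w" for w
  have \<psi>m[measurable]: "\<psi> \<in> borel_measurable PS" unfolding \<psi>_def[abs_def] by measurable
  have [measurable]: "X' j t \<in> borel_measurable M" "Z' j t \<in> borel_measurable M" "path (W j) \<in> measurable M PS" if "j \<ge> 1" for j
    using that by auto
  have one: "AE \<omega> in M. f (X' 1 t \<omega>) * Z' 1 t \<omega> = \<psi> (path (W 1) \<omega>)"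
    using X'_functional[OF order_refl t mm(2) refl] Z\<zeta>[OF order_refl] unfolding \<psi>_def by eventually_elim simp
  have m1: "m 1 t = expectation (\<lambda>\<omega>. \<psi> (path (W 1) \<omega>))" "integrable M (\<lambda>\<omega>. \<psi> (path (W 1) \<omega>))"
  proof -
    show "m 1 t = expectation (\<lambda>\<omega>. \<psi> (path (W 1) \<omega>))" unfolding m_def by (rule integral_cong_AE[OF _ _ one]) auto
    show "integrable M (\<lambda>\<omega>. \<psi> (path (W 1) \<omega>))"
      using m_eq(2)[OF order_refl t] by (subst (asm) integrable_cong_AE[OF _ _ one]) auto
  qed
  have mi: "integrable M (\<lambda>\<omega>. \<psi> (path (W i) \<omega>))" "m 1 t = expectation (\<lambda>\<omega>. \<psi> (path (W i) \<omega>))"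
    using same_law_integral[OF i \<psi>m] m1 by auto
  define E1 where "E1 n w = xE b (m 1) x0 (\<lambda>s. c s + \<sigma> * w s) t n n" for n w
  have E1[measurable]: "E1 n \<in> borel_measurable PS" for n
    unfolding E1_def[abs_def] by (rule xE_measurable[OF mm(2) t order_refl])
  \<comment> \<open>Convergence is put as the Cauchy property because the set of such paths is
    measurable, as \<open>same_law_AE\<close> demands.\<close>
  have "AE \<omega> in M. Cauchy (\<lambda>n. E1 n (path (W 1) \<omega>))"
    using xE_converges_X'[OF order_refl t mm(2) refl] unfolding E1_def by (rule eventually_mono) (rule LIMSEQ_imp_Cauchy)
  then have "AE \<omega> in M. Cauchy (\<lambda>n. E1 n (path (W i) \<omega>))"
    by (rule same_law_AE[OF i, rotated]) (intro sets_Collect_Cauchy E1)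
  then have conv: "AE \<omega> in M. (\<lambda>n. E1 n (path (W i) \<omega>)) \<longlonglongrightarrow> \<xi> (m 1) t (path (W i) \<omega>)"
    unfolding \<xi>_def E1_def by (rule eventually_mono) (simp add: Cauchy_convergent_iff convergent_LIMSEQ_iff)
  have int: "set_integrable lborel {0..T} (\<lambda>s. \<bar>m i s - m 1 s\<bar>)"
    unfolding set_integrable_def
  proof (rule Bochner_Integration.integrable_bound[of lborel "\<lambda>s. (2 * CY) * indicator {0..T} s"])
    show "integrable lborel (\<lambda>s. 2 * CY * indicator {0..T} s)"
      by (intro integrable_mult_right integrable_real_indicator) (auto simp: emeasure_lborel_Icc_eq)
    show "(\<lambda>s. indicator {0..T} s *\<^sub>R \<bar>m i s - m 1 s\<bar>) \<in> borel_measurable lborel" using mm by measurable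
    have "\<bar>m i s - m 1 s\<bar> \<le> 2 * CY" if "s \<in> {0..T}" for s
      using m_bound[OF i that] m_bound[OF order_refl that] by linarith
    then show "AE s in lborel. norm (indicator {0..T} s *\<^sub>R \<bar>m i s - m 1 s\<bar>) \<le> norm (2 * CY * indicator {0..T} s)"
      using CY by (auto simp: indicator_def)
  qed
  have diff: "AE \<omega> in M. \<bar>X' i t \<omega> - \<xi> (m 1) t (path (W i) \<omega>)\<bar> \<le> D"
    using xE_converges_X'[OF i t mm(1) refl] conv
  proof eventually_elim
    case (elim \<omega>)
    have "(\<lambda>n. \<bar>xE b (m i) x0 (\<lambda>s. c s + \<sigma> * path (W i) \<omega> s) t n n - E1 n (path (W i) \<omega>)\<bar>) \<longlonglongrightarrow> \<bar>X' i t \<omega> - \<xi> (m 1) t (path (W i) \<omega>)\<bar>"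
      using elim by (intro tendsto_intros)
    moreover have "\<bar>xE b (m i) x0 (\<lambda>s. c s + \<sigma> * path (W i) \<omega> s) t n n - E1 n (path (W i) \<omega>)\<bar> \<le> D" for n
      unfolding E1_def D_def by (rule xE_stable[OF mm int t])
    ultimately show ?case by (intro LIMSEQ_le_const2) auto
  qed
  have D0: "0 \<le> D" unfolding D_def set_lebesgue_integral_def using L by (intro mult_nonneg_nonneg integral_nonneg_AE) auto
  note Z2 = Z'_square_integrable[OF i t]
  have "m i t - m 1 t = expectation (\<lambda>\<omega>. f (X' i t \<omega>) * Z' i t \<omega> - \<psi> (path (W i) \<omega>))"
    unfolding mi(2) using m_eq(2)[OF i t] mi(1) by (simp add: m_def)
  then have "\<bar>m i t - m 1 t\<bar> \<le> expectation (\<lambda>\<omega>. \<bar>f (X' i t \<omega>) * Z' i t \<omega> - \<psi> (path (W i) \<omega>)\<bar>)"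
    by (simp only: integral_abs_bound)
  also have "\<dots> \<le> expectation (\<lambda>\<omega>. Lf * D * (1 + (Z' i t \<omega>)\<^sup>2))"
  proof (rule integral_mono_AE)
    show "integrable M (\<lambda>\<omega>. \<bar>f (X' i t \<omega>) * Z' i t \<omega> - \<psi> (path (W i) \<omega>)\<bar>)" using m_eq(2)[OF i t] mi(1) by simp
    show "integrable M (\<lambda>\<omega>. Lf * D * (1 + (Z' i t \<omega>)\<^sup>2))" using Z2(1) by simp
    show "AE \<omega> in M. \<bar>f (X' i t \<omega>) * Z' i t \<omega> - \<psi> (path (W i) \<omega>)\<bar> \<le> Lf * D * (1 + (Z' i t \<omega>)\<^sup>2)"
      using diff Z\<zeta>[OF i]
    proof eventually_elim
      case (elim \<omega>)
      have "\<bar>f (X' i t \<omega>) * Z' i t \<omega> - \<psi> (path (W i) \<omega>)\<bar> = \<bar>f (X' i t \<omega>) - f (\<xi> (m 1) t (path (W i) \<omega>))\<bar> * \<bar>Z' i t \<omega>\<bar>"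
        unfolding \<psi>_def elim(2)[symmetric] by (simp add: abs_mult[symmetric] algebra_simps)
      also have "\<dots> \<le> (Lf * D) * (1 + (Z' i t \<omega>)\<^sup>2)"
      proof (rule mult_mono)
        have "\<bar>f (X' i t \<omega>) - f (\<xi> (m 1) t (path (W i) \<omega>))\<bar> \<le> Lf * \<bar>X' i t \<omega> - \<xi> (m 1) t (path (W i) \<omega>)\<bar>" by (rule lip_f)
        also have "\<dots> \<le> Lf * D" using elim(1) Lf by (intro mult_left_mono) auto
        finally show "\<bar>f (X' i t \<omega>) - f (\<xi> (m 1) t (path (W i) \<omega>))\<bar> \<le> Lf * D" .
        show "\<bar>Z' i t \<omega>\<bar> \<le> 1 + (Z' i t \<omega>)\<^sup>2"
          using sum_squares_bound[of "\<bar>Z' i t \<omega>\<bar>" 1] zero_le_power2[of "Z' i t \<omega>"] by simp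
      qed (use Lf D0 in auto)
      finally show ?case .
    qed
  qed
  also have "\<dots> = Lf * D * (1 + expectation (\<lambda>\<omega>. (Z' i t \<omega>)\<^sup>2))" using Z2(1) by (simp add: prob_space)
  also have "\<dots> \<le> Lf * D * (1 + CZ)" using Z2(2) Lf D0 by (intro mult_left_mono) auto
  finally show ?thesis unfolding D_def by (simp add: ac_simps)
qed

text \<open>Gronwall's inequality with source term 0; \<open>m_bound\<close> supplies the a priori
  bound. In substance this is uniqueness in law for the mean-field equation.\<close>

lemma mean_unique:
  assumes i: "i \<ge> 1" and t: "t \<in> {0..T}"
  shows "m i t = m 1 t"
proof -
  define k where "k = Lf * (1 + CZ) * (exp (L * T) * L)"
  have k: "0 \<le> k" unfolding k_def using Lf L CZ(1) by simp
  have mm: "m i \<in> borel_measurable borel" "m 1 \<in> borel_measurable borel" using m_measurable i by auto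
  define \<phi> where "\<phi> s = ennreal \<bar>m i s - m 1 s\<bar>" for s
  have fin: "(\<integral>\<^sup>+s\<in>{0..T}. ennreal k \<partial>lborel) < \<infinity>"
    by (subst nn_integral_cmult) (auto simp: ennreal_mult_less_top emeasure_lborel_Icc_eq)
  obtain C where "\<forall>A \<phi>. (\<exists>B<\<infinity>. \<forall>t\<in>{0..T}. \<phi> t \<le> B) \<longrightarrow>
      (\<forall>t\<in>{0..T}. \<phi> t \<le> A + (\<integral>\<^sup>+s\<in>{0..t}. ennreal k * \<phi> s \<partial>lborel)) \<longrightarrow> (\<forall>t\<in>{0..T}. \<phi> t \<le> C * A)"
    using gronwall_nn[OF borel_measurable_const fin T] by blast
  then have gr: "\<And>A \<phi> t. \<exists>B<\<infinity>. \<forall>t\<in>{0..T}. \<phi> t \<le> B \<Longrightarrow>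
      \<forall>t\<in>{0..T}. \<phi> t \<le> A + (\<integral>\<^sup>+s\<in>{0..t}. ennreal k * \<phi> s \<partial>lborel) \<Longrightarrow> t \<in> {0..T} \<Longrightarrow> \<phi> t \<le> C * A"
    by blast
  have "\<phi> t \<le> C * 0"
  proof (rule gr[OF _ _ t])
    have bd: "\<bar>m i s - m 1 s\<bar> \<le> 2 * CY" if "s \<in> {0..T}" for s
      using m_bound[OF i that] m_bound[OF order_refl that] by linarith
    then show "\<exists>B<\<infinity>. \<forall>t\<in>{0..T}. \<phi> t \<le> B"
      unfolding \<phi>_def by (intro exI[of _ "ennreal (2 * CY)"]) (auto intro: ennreal_leI)
    show "\<forall>t\<in>{0..T}. \<phi> t \<le> 0 + (\<integral>\<^sup>+s\<in>{0..t}. ennreal k * \<phi> s \<partial>lborel)"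
    proof
      fix t assume t: "t \<in> {0..T}"
      define I where "I = (LBINT s:{0<..t}. \<bar>m i s - m 1 s\<bar>)"
      have I0: "0 \<le> I" unfolding I_def set_lebesgue_integral_def by (intro integral_nonneg_AE) auto
      have Iint: "integrable lborel (\<lambda>s. indicator {0<..t} s *\<^sub>R \<bar>m i s - m 1 s\<bar>)"
      proof (rule Bochner_Integration.integrable_bound[of lborel "\<lambda>s. (2 * CY) * indicator {0..T} s"])
        show "integrable lborel (\<lambda>s. 2 * CY * indicator {0..T} s)"
          by (intro integrable_mult_right integrable_real_indicator) (auto simp: emeasure_lborel_Icc_eq)
        show "(\<lambda>s. indicator {0<..t} s *\<^sub>R \<bar>m i s - m 1 s\<bar>) \<in> borel_measurable lborel" using mm by measurable
        show "AE s in lborel. norm (indicator {0<..t} s *\<^sub>R \<bar>m i s - m 1 s\<bar>) \<le> norm (2 * CY * indicator {0..T} s)"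
          using CY bd t by (auto simp: indicator_def)
      qed
      have "\<bar>m i t - m 1 t\<bar> \<le> Lf * (1 + CZ) * (exp (L * t) * L * I)" unfolding I_def by (rule mean_difference[OF i t])
      also have "\<dots> \<le> Lf * (1 + CZ) * (exp (L * T) * L * I)"
        using Lf CZ(1) L I0 t by (intro mult_left_mono mult_right_mono) (auto intro: mult_left_mono)
      also have "\<dots> = k * I" by (simp add: k_def)
      finally have "\<phi> t \<le> ennreal (k * I)" unfolding \<phi>_def by (rule ennreal_leI)
      also have "\<dots> = ennreal k * ennreal I" using k I0 by (rule ennreal_mult)
      also have "ennreal I = (\<integral>\<^sup>+s. ennreal (indicator {0<..t} s *\<^sub>R \<bar>m i s - m 1 s\<bar>) \<partial>lborel)"
        unfolding I_def set_lebesgue_integral_def using Iint by (intro nn_integral_eq_integral[symmetric]) auto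
      also have "ennreal k * \<dots> = (\<integral>\<^sup>+s. ennreal k * ennreal (indicator {0<..t} s *\<^sub>R \<bar>m i s - m 1 s\<bar>) \<partial>lborel)"
      proof (rule nn_integral_cmult[symmetric])
        show "(\<lambda>s. ennreal (indicator {0<..t} s *\<^sub>R \<bar>m i s - m 1 s\<bar>)) \<in> borel_measurable lborel"
          using Iint by (intro measurable_compose[OF borel_measurable_integrable measurable_ennreal])
      qed
      also have "\<dots> \<le> (\<integral>\<^sup>+s\<in>{0..t}. ennreal k * \<phi> s \<partial>lborel)"
        unfolding \<phi>_def by (intro nn_integral_mono) (auto simp: indicator_def)
      finally show "\<phi> t \<le> 0 + (\<integral>\<^sup>+s\<in>{0..t}. ennreal k * \<phi> s \<partial>lborel)" by simp
    qed
  qed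
  then show ?thesis unfolding \<phi>_def by (simp add: ennreal_eq_0_iff)
qed

section \<open>Averages over the independent copies\<close>

lemma average_converges:
  assumes s: "s \<in> {0..T}"
    and \<psi>: "\<psi> \<in> borel_measurable PS" and Y: "\<And>i. i \<ge> 1 \<Longrightarrow> Y i \<in> borel_measurable M"
      "\<And>i. i \<ge> 1 \<Longrightarrow> AE \<omega> in M. Y i \<omega> = \<psi> (path (W i) \<omega>)" and int: "integrable M (Y 1)"
  shows "(\<lambda>N. \<integral>\<^sup>+\<omega>. ennreal \<bar>(\<Sum>j=1..N. Y j \<omega>) / real N - expectation (Y 1)\<bar> \<partial>M) \<longlonglongrightarrow> 0"
proof -
  note [measurable] = \<psi> Y(1)
  have e1: "AE \<omega> in M. Y 1 \<omega> = \<psi> (path (W 1) \<omega>)" using Y(2) by simp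
  have [measurable]: "Y 1 \<in> borel_measurable M" "path (W 1) \<in> measurable M PS" by simp_all
  have i1: "integrable M (\<lambda>\<omega>. \<psi> (path (W 1) \<omega>))"
    using int by (subst (asm) integrable_cong_AE[OF _ _ e1]) measurable
  have ex: "expectation (Y 1) = expectation (\<lambda>\<omega>. \<psi> (path (W 1) \<omega>))"
    by (rule integral_cong_AE[OF _ _ e1]) measurable
  have lln: "(\<lambda>N. expectation (\<lambda>\<omega>. \<bar>(\<Sum>i=1..N. \<psi> (path (W i) \<omega>)) / real N - expectation (Y 1)\<bar>)) \<longlonglongrightarrow> 0"
    unfolding ex
    by (rule L1_law_of_large_numbers[where V = "\<lambda>i \<omega>. path (W i) \<omega>" and S = PS and \<psi> = \<psi>, OF ind path_law \<psi> i1])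
  have ii: "integrable M (\<lambda>\<omega>. \<psi> (path (W i) \<omega>))" if "i \<ge> 1" for i
    using same_law_integral(1)[OF that \<psi>] i1 by simp
  have eq: "(\<integral>\<^sup>+\<omega>. ennreal \<bar>(\<Sum>j=1..N. Y j \<omega>) / real N - expectation (Y 1)\<bar> \<partial>M)
    = ennreal (expectation (\<lambda>\<omega>. \<bar>(\<Sum>i=1..N. \<psi> (path (W i) \<omega>)) / real N - expectation (Y 1)\<bar>))" for N
  proof -
    have "AE \<omega> in M. \<forall>j\<in>{1..N}. Y j \<omega> = \<psi> (path (W j) \<omega>)"
      using Y(2) by (intro AE_finite_allI) auto
    then have "(\<integral>\<^sup>+\<omega>. ennreal \<bar>(\<Sum>j=1..N. Y j \<omega>) / real N - expectation (Y 1)\<bar> \<partial>M)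
      = (\<integral>\<^sup>+\<omega>. ennreal \<bar>(\<Sum>j=1..N. \<psi> (path (W j) \<omega>)) / real N - expectation (Y 1)\<bar> \<partial>M)"
      by (intro nn_integral_cong_AE) (elim eventually_mono, simp)
    also have "\<dots> = ennreal (expectation (\<lambda>\<omega>. \<bar>(\<Sum>i=1..N. \<psi> (path (W i) \<omega>)) / real N - expectation (Y 1)\<bar>))"
      using ii by (intro nn_integral_eq_integral integrable_abs Bochner_Integration.integrable_diff integrable_divide Bochner_Integration.integrable_sum) auto
    finally show ?thesis .
  qed
  show ?thesis unfolding eq using tendsto_ennrealI[OF lln] by simp
qed

text \<open>The expected sizes of the two fluctuations occurring in \<open>drift_gap\<close>: that
  of the weighted average and that of the empirical second moment of the weights.\<close>

definition rN :: "nat \<Rightarrow> real \<Rightarrow> ennreal" where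
  "rN N s = (\<integral>\<^sup>+\<omega>. ennreal \<bar>(\<Sum>j=1..N. f (X' j s \<omega>) * Z' j s \<omega>) / real N - m 1 s\<bar> \<partial>M)
    + (\<integral>\<^sup>+\<omega>. ennreal \<bar>(\<Sum>j=1..N. (Z' j s \<omega>)\<^sup>2) / real N - expectation (\<lambda>\<omega>. (Z' 1 s \<omega>)\<^sup>2)\<bar> \<partial>M)"

lemma rN_converges:
  assumes s: "s \<in> {0..T}"
  shows "(\<lambda>N. rN N s) \<longlonglongrightarrow> 0"
proof -
  obtain \<zeta> where \<zeta>[measurable]: "\<zeta> \<in> borel_measurable PS" and Z\<zeta>: "\<And>j. j \<ge> 1 \<Longrightarrow> AE \<omega> in M. Z' j s \<omega> = \<zeta> (path (W j) \<omega>)"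
    using Z'_functional[OF s] by blast
  have m1: "m 1 \<in> borel_measurable borel" by (rule m_measurable) simp
  note [measurable] = \<xi>_measurable[OF m1 s]
  \<comment> \<open>This is where uniqueness of the mean enters: with the common mean
    \<open>m 1\<close> all \<open>X' j\<close> are the same functional of their noises.\<close>
  have X\<xi>: "AE \<omega> in M. X' j s \<omega> = \<xi> (m 1) s (path (W j) \<omega>)" if "j \<ge> 1" for j
    using that mean_unique[OF that] by (intro X'_functional[OF _ s m1]) auto
  have "(\<lambda>N. \<integral>\<^sup>+\<omega>. ennreal \<bar>(\<Sum>j=1..N. f (X' j s \<omega>) * Z' j s \<omega>) / real N - expectation (\<lambda>\<omega>. f (X' 1 s \<omega>) * Z' 1 s \<omega>)\<bar> \<partial>M) \<longlonglongrightarrow> 0"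
  proof (rule average_converges[OF s, of "\<lambda>w. f (\<xi> (m 1) s w) * \<zeta> w" "\<lambda>j \<omega>. f (X' j s \<omega>) * Z' j s \<omega>"])
    show "AE \<omega> in M. f (X' i s \<omega>) * Z' i s \<omega> = f (\<xi> (m 1) s (path (W i) \<omega>)) * \<zeta> (path (W i) \<omega>)" if "i \<ge> 1" for i
      using X\<xi>[OF that] Z\<zeta>[OF that] by eventually_elim simp
    show "(\<lambda>\<omega>. f (X' i s \<omega>) * Z' i s \<omega>) \<in> borel_measurable M" if "i \<ge> 1" for i
      using that by (intro borel_measurable_times measurable_compose[OF X'_M f_measurable] Z'_M)
  qed (use m_eq(2)[OF order_refl s] in measurable)
  moreover have "(\<lambda>N. \<integral>\<^sup>+\<omega>. ennreal \<bar>(\<Sum>j=1..N. (Z' j s \<omega>)\<^sup>2) / real N - expectation (\<lambda>\<omega>. (Z' 1 s \<omega>)\<^sup>2)\<bar> \<partial>M) \<longlonglongrightarrow> 0"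
  proof (rule average_converges[OF s, of "\<lambda>w. (\<zeta> w)\<^sup>2" "\<lambda>j \<omega>. (Z' j s \<omega>)\<^sup>2"])
    show "AE \<omega> in M. (Z' i s \<omega>)\<^sup>2 = (\<zeta> (path (W i) \<omega>))\<^sup>2" if "i \<ge> 1" for i
      using Z\<zeta>[OF that] by eventually_elim simp
    show "(\<lambda>\<omega>. (Z' i s \<omega>)\<^sup>2) \<in> borel_measurable M" if "i \<ge> 1" for i
      using that by (intro borel_measurable_power Z'_M)
    show "integrable M (\<lambda>\<omega>. (Z' 1 s \<omega>)\<^sup>2)" using Z'_square_integrable[OF _ s] by simp
  qed measurable
  ultimately have "(\<lambda>N. rN N s) \<longlonglongrightarrow> 0 + 0" unfolding rN_def m_def by (intro tendsto_add)
  then show ?thesis by simp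
qed

lemma joint_pairs[measurable]:
  assumes "i \<ge> 1"
  shows "(\<lambda>p. X' i (fst p) (snd p)) \<in> borel_measurable (borel \<Otimes>\<^sub>M M)" "(\<lambda>p. Z' i (fst p) (snd p)) \<in> borel_measurable (borel \<Otimes>\<^sub>M M)"
  using X'_joint[OF assms] Z'_joint[OF assms] by (simp_all add: case_prod_beta)

lemma rN_measurable[measurable]: "rN N \<in> borel_measurable borel"
proof -
  have [measurable]: "m 1 \<in> borel_measurable borel" by (rule m_measurable) simp
  have [measurable]: "(\<lambda>s. expectation (\<lambda>\<omega>. (Z' 1 s \<omega>)\<^sup>2)) \<in> borel_measurable borel"
    by (rule borel_measurable_lebesgue_integral) (use joint_pairs(2)[of 1] in \<open>simp add: case_prod_beta\<close>)
  have 1: "(\<lambda>p. ennreal \<bar>(\<Sum>j=1..N. f (X' j (fst p) (snd p)) * Z' j (fst p) (snd p)) / real N - m 1 (fst p)\<bar>) \<in> borel_measurable (borel \<Otimes>\<^sub>M M)"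
    by measurable
  have 2: "(\<lambda>p. ennreal \<bar>(\<Sum>j=1..N. (Z' j (fst p) (snd p))\<^sup>2) / real N - expectation (\<lambda>\<omega>. (Z' 1 (fst p) \<omega>)\<^sup>2)\<bar>) \<in> borel_measurable (borel \<Otimes>\<^sub>M M)"
    by measurable
  show ?thesis unfolding rN_def[abs_def]
    by (intro borel_measurable_add borel_measurable_nn_integral) (use 1 2 in \<open>simp_all add: case_prod_beta\<close>)
qed

lemma average_deviation_bound:
  assumes m: "\<And>j. j \<ge> 1 \<Longrightarrow> Y j \<in> borel_measurable M" and b: "\<And>j. j \<ge> 1 \<Longrightarrow> (\<integral>\<^sup>+\<omega>. ennreal \<bar>Y j \<omega>\<bar> \<partial>M) \<le> ennreal B"
    and a: "\<bar>a\<bar> \<le> B"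
  shows "(\<integral>\<^sup>+\<omega>. ennreal \<bar>(\<Sum>j=1..N. Y j \<omega>) / real N - a\<bar> \<partial>M) \<le> ennreal (2 * B)"
proof -
  note [measurable] = m
  have B: "0 \<le> B" using a by linarith
  have "(\<integral>\<^sup>+\<omega>. ennreal \<bar>(\<Sum>j=1..N. Y j \<omega>) / real N - a\<bar> \<partial>M)
    \<le> (\<integral>\<^sup>+\<omega>. (\<Sum>j=1..N. ennreal (1 / real N) * ennreal \<bar>Y j \<omega>\<bar>) + ennreal B \<partial>M)"
  proof (rule nn_integral_mono)
    fix \<omega>
    have "\<bar>(\<Sum>j=1..N. Y j \<omega>) / real N\<bar> \<le> (\<Sum>j=1..N. \<bar>Y j \<omega>\<bar>) / real N"
      by (simp add: abs_divide divide_right_mono sum_abs)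
    then have "\<bar>(\<Sum>j=1..N. Y j \<omega>) / real N - a\<bar> \<le> (\<Sum>j=1..N. 1 / real N * \<bar>Y j \<omega>\<bar>) + B"
      using a by (simp add: sum_divide_distrib)
    then have "ennreal \<bar>(\<Sum>j=1..N. Y j \<omega>) / real N - a\<bar> \<le> ennreal ((\<Sum>j=1..N. 1 / real N * \<bar>Y j \<omega>\<bar>) + B)" by (rule ennreal_leI)
    also have "\<dots> = ennreal (\<Sum>j=1..N. 1 / real N * \<bar>Y j \<omega>\<bar>) + ennreal B" using B by (intro ennreal_plus sum_nonneg) auto
    also have "ennreal (\<Sum>j=1..N. 1 / real N * \<bar>Y j \<omega>\<bar>) = (\<Sum>j=1..N. ennreal (1 / real N * \<bar>Y j \<omega>\<bar>))" by (intro sum_ennreal[symmetric]) auto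
    also have "\<dots> = (\<Sum>j=1..N. ennreal (1 / real N) * ennreal \<bar>Y j \<omega>\<bar>)" by (intro sum.cong refl ennreal_mult) auto
    finally show "ennreal \<bar>(\<Sum>j=1..N. Y j \<omega>) / real N - a\<bar> \<le> (\<Sum>j=1..N. ennreal (1 / real N) * ennreal \<bar>Y j \<omega>\<bar>) + ennreal B" .
  qed
  also have "\<dots> = (\<Sum>j=1..N. ennreal (1 / real N) * (\<integral>\<^sup>+\<omega>. ennreal \<bar>Y j \<omega>\<bar> \<partial>M)) + ennreal B"
  proof -
    have "(\<integral>\<^sup>+\<omega>. (\<Sum>j=1..N. ennreal (1 / real N) * ennreal \<bar>Y j \<omega>\<bar>) \<partial>M) = (\<Sum>j=1..N. \<integral>\<^sup>+\<omega>. ennreal (1 / real N) * ennreal \<bar>Y j \<omega>\<bar> \<partial>M)"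
      by (rule nn_integral_sum) measurable
    also have "\<dots> = (\<Sum>j=1..N. ennreal (1 / real N) * (\<integral>\<^sup>+\<omega>. ennreal \<bar>Y j \<omega>\<bar> \<partial>M))"
      by (intro sum.cong refl nn_integral_cmult) measurable
    finally show ?thesis by (subst nn_integral_add) (simp_all add: emeasure_space_1)
  qed
  also have "\<dots> \<le> (\<Sum>j=1..N. ennreal (1 / real N) * ennreal B) + ennreal B"
    using b by (intro add_right_mono sum_mono mult_left_mono) auto
  also have "\<dots> \<le> ennreal B + ennreal B"
  proof (rule add_right_mono)
    have "(\<Sum>j=1..N. ennreal (1 / real N) * ennreal B) = (\<Sum>j=1..N. ennreal (1 / real N * B))"
      using B by (intro sum.cong refl ennreal_mult[symmetric]) auto
    also have "\<dots> = ennreal (\<Sum>j=1..N. 1 / real N * B)" using B by (intro sum_ennreal) auto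
    also have "\<dots> \<le> ennreal B" using B by (intro ennreal_leI) auto
    finally show "(\<Sum>j=1..N. ennreal (1 / real N) * ennreal B) \<le> ennreal B" .
  qed
  also have "\<dots> = ennreal (2 * B)" using B by (simp flip: ennreal_plus)
  finally show ?thesis .
qed

text \<open>Being uniform in \<open>N\<close> and \<open>s\<close>, this is the dominating constant
  that carries the pointwise convergence over to the time integral.\<close>

lemma rN_bound:
  assumes s: "s \<in> {0..T}"
  shows "rN N s \<le> ennreal (2 * CY + 2 * CZ)"
proof -
  have "rN N s \<le> ennreal (2 * CY) + ennreal (2 * CZ)"
    unfolding rN_def
  proof (rule add_mono)
    show "(\<integral>\<^sup>+\<omega>. ennreal \<bar>(\<Sum>j=1..N. f (X' j s \<omega>) * Z' j s \<omega>) / real N - m 1 s\<bar> \<partial>M) \<le> ennreal (2 * CY)"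
      using Y_moment[OF _ s] m_bound[OF _ s]
      by (intro average_deviation_bound borel_measurable_times measurable_compose[OF X'_M f_measurable] Z'_M) auto
    have "\<bar>expectation (\<lambda>\<omega>. (Z' 1 s \<omega>)\<^sup>2)\<bar> \<le> CZ" using Z'_square_integrable(2)[OF order_refl s] by simp
    then show "(\<integral>\<^sup>+\<omega>. ennreal \<bar>(\<Sum>j=1..N. (Z' j s \<omega>)\<^sup>2) / real N - expectation (\<lambda>\<omega>. (Z' 1 s \<omega>)\<^sup>2)\<bar> \<partial>M) \<le> ennreal (2 * CZ)"
      using CZ(2)[OF _ s] by (intro average_deviation_bound borel_measurable_power Z'_M) auto
  qed
  then show ?thesis using CY CZ(1) by (simp flip: ennreal_plus)
qed

lemma rN_integral_converges: "(\<lambda>N. \<integral>\<^sup>+s\<in>{0..T}. rN N s \<partial>lborel) \<longlonglongrightarrow> 0"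
proof -
  have "(\<lambda>N. \<integral>\<^sup>+s. rN N s * indicator {0..T} s \<partial>lborel) \<longlonglongrightarrow> (\<integral>\<^sup>+s. 0 \<partial>(lborel :: real measure))"
  proof (rule nn_integral_dominated_convergence[where w = "\<lambda>s. ennreal (2 * CY + 2 * CZ) * indicator {0..T} s" and u' = "\<lambda>s. 0"])
    show "AE s in lborel. rN j s * indicator {0..T} s \<le> ennreal (2 * CY + 2 * CZ) * indicator {0..T} s" for j
      using rN_bound by (auto simp: indicator_def)
    show "(\<integral>\<^sup>+s. ennreal (2 * CY + 2 * CZ) * indicator {0..T} s \<partial>lborel) < \<infinity>"
      by (subst nn_integral_cmult) (auto simp: ennreal_mult_less_top emeasure_lborel_Icc_eq)
    show "AE s in lborel. (\<lambda>N. rN N s * indicator {0..T} s) \<longlonglongrightarrow> 0"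
      using rN_converges by (auto simp: indicator_def)
  qed auto
  then show ?thesis by simp
qed

text \<open>At each time both processes are the same functional of the path, and continuity gives a
  null set common to all times. It allows replacing the particle weights by those of the
  limit.\<close>

lemma Z_unique:
  assumes i: "i \<ge> 1" and V: "linear_sde M F (W i) T h V"
  shows "AE \<omega> in M. \<forall>t\<in>{0..T}. V t \<omega> = Z' i t \<omega>"
proof -
  have pt: "AE \<omega> in M. V t \<omega> = Z' i t \<omega>" if t: "t \<in> {0..T}" for t
  proof -
    obtain \<zeta> where "AE \<omega> in M. Z' i t \<omega> = \<zeta> (path (W i) \<omega>)" "AE \<omega> in M. V t \<omega> = \<zeta> (path (W i) \<omega>)"
      using Z'_functional[OF t] i V by blast
    then show ?thesis by eventually_elim simp
  qed
  have cV: "AE \<omega> in M. continuous_on {0..T} (\<lambda>t. V t \<omega>)" using V unfolding ito_process_def by blast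
  have "AE \<omega> in M. \<forall>k n. k \<le> Suc n \<longrightarrow> V (T * real k / real (Suc n)) \<omega> = Z' i (T * real k / real (Suc n)) \<omega>"
  proof (subst AE_all_countable, intro allI, subst AE_all_countable, intro allI)
    fix k n
    show "AE \<omega> in M. k \<le> Suc n \<longrightarrow> V (T * real k / real (Suc n)) \<omega> = Z' i (T * real k / real (Suc n)) \<omega>"
    proof (cases "k \<le> Suc n")
      case True
      then show ?thesis using pt[of "T * real k / real (Suc n)"] grid_le_end[OF T True] T by auto
    qed simp
  qed
  then show ?thesis using cV
  proof eventually_elim
    case (elim \<omega>)
    have c: "continuous_on {0..T} (\<lambda>t. Z' i t \<omega>)" using Z'_cont[OF i] by (rule continuous_on_subset) simp
    show ?case
      using continuous_eq_on_grid[OF T elim(2) c] elim(1) by blast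
  qed
qed

section \<open>Comparison of the drifts and the final estimate\<close>

text \<open>On the event that the empirical second moment of the weights is at most \<open>CZ + 1\<close>, the
  Cauchy--Schwarz inequality controls the weighted error; off this event only boundedness of \<open>b\<close>
  is used, and its probability vanishes.\<close>

lemma drift_gap:
  fixes x y z :: "nat \<Rightarrow> real"
  assumes r: "r \<in> {0..T}" and v: "v \<le> CZ"
  shows "(b r (x i) ((\<Sum>j=1..N. f (x j) * z j) / real N) - b r (y i) \<mu>)\<^sup>2
    \<le> 2 * L\<^sup>2 * (x i - y i)\<^sup>2 + 4 * L\<^sup>2 * Lf\<^sup>2 * (CZ + 1) * ((\<Sum>j=1..N. (x j - y j)\<^sup>2) / real N)
      + (8 * K\<^sup>2 + 8 * K * L) * (\<bar>(\<Sum>j=1..N. f (y j) * z j) / real N - \<mu>\<bar> + \<bar>(\<Sum>j=1..N. (z j)\<^sup>2) / real N - v\<bar>)"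
proof -
  define A where "A = (\<Sum>j=1..N. \<bar>f (x j) - f (y j)\<bar> * \<bar>z j\<bar>) / real N"
  define B where "B = \<bar>(\<Sum>j=1..N. f (y j) * z j) / real N - \<mu>\<bar>"
  define E where "E = (\<Sum>j=1..N. (x j - y j)\<^sup>2) / real N"
  define Q where "Q = (\<Sum>j=1..N. (z j)\<^sup>2) / real N"
  define mN where "mN = (\<Sum>j=1..N. f (x j) * z j) / real N"
  define p where "p = \<bar>b r (y i) mN - b r (y i) \<mu>\<bar>"
  have nn: "0 \<le> A" "0 \<le> B" "0 \<le> E" "0 \<le> Q" "0 \<le> p"
    unfolding A_def B_def E_def Q_def p_def by (auto intro!: divide_nonneg_nonneg sum_nonneg)
  have "mN - \<mu> = (\<Sum>j=1..N. (f (x j) - f (y j)) * z j) / real N + ((\<Sum>j=1..N. f (y j) * z j) / real N - \<mu>)"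
    unfolding mN_def by (simp add: left_diff_distrib sum_subtractf diff_divide_distrib)
  moreover have "\<bar>(\<Sum>j=1..N. (f (x j) - f (y j)) * z j) / real N\<bar> \<le> A"
    unfolding A_def abs_divide using sum_abs[of "\<lambda>j. (f (x j) - f (y j)) * z j" "{1..N}"]
    by (simp add: abs_mult divide_right_mono)
  ultimately have mAB: "\<bar>mN - \<mu>\<bar> \<le> A + B" unfolding B_def by linarith
  have p1: "p \<le> L * (A + B)"
    unfolding p_def using lip_m[OF r, of "y i" mN \<mu>] mult_left_mono[OF mAB L] by linarith
  have p2: "p \<le> 2 * K"
    unfolding p_def using bound[OF r, of "y i" mN] bound[OF r, of "y i" \<mu>] by linarith
  have A2: "A\<^sup>2 \<le> Lf\<^sup>2 * E * Q"
  proof -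
    have "(\<Sum>j=1..N. \<bar>f (x j) - f (y j)\<bar> * \<bar>z j\<bar>)\<^sup>2 \<le> (\<Sum>j=1..N. \<bar>f (x j) - f (y j)\<bar>\<^sup>2) * (\<Sum>j=1..N. \<bar>z j\<bar>\<^sup>2)"
      by (rule Cauchy_Schwarz_ineq_sum)
    also have "\<dots> \<le> (\<Sum>j=1..N. Lf\<^sup>2 * (x j - y j)\<^sup>2) * (\<Sum>j=1..N. (z j)\<^sup>2)"
    proof (rule mult_mono)
      show "(\<Sum>j=1..N. \<bar>f (x j) - f (y j)\<bar>\<^sup>2) \<le> (\<Sum>j=1..N. Lf\<^sup>2 * (x j - y j)\<^sup>2)"
      proof (rule sum_mono)
        fix j
        have "\<bar>f (x j) - f (y j)\<bar>\<^sup>2 \<le> (Lf * \<bar>x j - y j\<bar>)\<^sup>2" by (intro power_mono lip_f) simp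
        then show "\<bar>f (x j) - f (y j)\<bar>\<^sup>2 \<le> Lf\<^sup>2 * (x j - y j)\<^sup>2" by (simp add: power_mult_distrib)
      qed
    qed (auto intro!: sum_nonneg)
    finally have "(\<Sum>j=1..N. \<bar>f (x j) - f (y j)\<bar> * \<bar>z j\<bar>)\<^sup>2 / (real N)\<^sup>2
        \<le> (\<Sum>j=1..N. Lf\<^sup>2 * (x j - y j)\<^sup>2) * (\<Sum>j=1..N. (z j)\<^sup>2) / (real N)\<^sup>2"
      by (rule divide_right_mono) simp
    then show ?thesis unfolding A_def E_def Q_def by (simp add: power_divide sum_distrib_left[symmetric] power2_eq_square mult.assoc)
  qed
  have p_sq: "p\<^sup>2 \<le> 2 * L\<^sup>2 * Lf\<^sup>2 * (CZ + 1) * E + (4 * K\<^sup>2 + 4 * K * L) * (B + \<bar>Q - v\<bar>)"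
  proof (cases "Q \<le> CZ + 1")
    case True
    \<comment> \<open>Of \<open>B\<close> only the mean is known to vanish, not the mean square, so
      \<open>B\<close> has to enter linearly: truncation at \<open>2 K\<close> gives
      \<open>w^2 \<le> 2 K L B\<close>. For \<open>u\<close> the quadratic bound is kept, since
      Gronwall's inequality works with squared errors.\<close>
    define u w where "u = min (2 * K) (L * A)" and "w = min (2 * K) (L * B)"
    have uw: "0 \<le> u" "0 \<le> w" unfolding u_def w_def using K L nn by auto
    have "0 \<le> L * A" "0 \<le> L * B" using L nn by auto
    moreover have "p \<le> L * A + L * B" using p1 by (simp add: distrib_left)
    ultimately have "p \<le> u + w" using p2 K unfolding u_def w_def
      by (cases "2 * K \<le> L * A"; cases "2 * K \<le> L * B") auto
    then have "p\<^sup>2 \<le> (u + w)\<^sup>2" using nn by (intro power_mono) auto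
    also have "\<dots> \<le> 2 * u\<^sup>2 + 2 * w\<^sup>2" by (rule square_add_le)
    also have "u\<^sup>2 \<le> (L * A)\<^sup>2" using uw(1) unfolding u_def by (intro power_mono) auto
    also have "(L * A)\<^sup>2 = L\<^sup>2 * A\<^sup>2" by (simp add: power_mult_distrib)
    also have "L\<^sup>2 * A\<^sup>2 \<le> L\<^sup>2 * (Lf\<^sup>2 * E * (CZ + 1))"
    proof (rule mult_left_mono)
      have "Lf\<^sup>2 * E * Q \<le> Lf\<^sup>2 * E * (CZ + 1)" using True nn by (intro mult_left_mono) auto
      then show "A\<^sup>2 \<le> Lf\<^sup>2 * E * (CZ + 1)" using A2 by linarith
    qed simp
    also have "w\<^sup>2 \<le> (2 * K) * (L * B)"
      unfolding power2_eq_square using uw(2) K unfolding w_def by (intro mult_mono) auto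
    finally have "p\<^sup>2 \<le> 2 * (L\<^sup>2 * (Lf\<^sup>2 * E * (CZ + 1))) + 2 * ((2 * K) * (L * B))" by simp
    also have "\<dots> = 2 * L\<^sup>2 * Lf\<^sup>2 * (CZ + 1) * E + 4 * K * L * B" by simp
    also have "4 * K * L * B \<le> (4 * K\<^sup>2 + 4 * K * L) * (B + \<bar>Q - v\<bar>)"
      using K L nn by (intro mult_mono) auto
    finally show ?thesis by simp
  next
    case False
    \<comment> \<open>Here \<open>Q\<close> exceeds \<open>v\<close> by at least 1, so multiplying
      the crude bound \<open>(2 K)^2\<close> by the deviation costs nothing: a pointwise form of
      Markov's inequality.\<close>
    then have "1 \<le> B + \<bar>Q - v\<bar>" using v nn by linarith
    have "p\<^sup>2 \<le> (2 * K)\<^sup>2" using p2 nn by (intro power_mono) auto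
    also have "\<dots> = 4 * K\<^sup>2 * 1" by simp
    also have "\<dots> \<le> (4 * K\<^sup>2 + 4 * K * L) * (B + \<bar>Q - v\<bar>)"
      using K L \<open>1 \<le> B + \<bar>Q - v\<bar>\<close> by (intro mult_mono) auto
    also have "\<dots> \<le> 2 * L\<^sup>2 * Lf\<^sup>2 * (CZ + 1) * E + (4 * K\<^sup>2 + 4 * K * L) * (B + \<bar>Q - v\<bar>)"
      using CZ(1) nn by simp
    finally show ?thesis .
  qed
  have "\<bar>b r (x i) mN - b r (y i) \<mu>\<bar> \<le> L * \<bar>x i - y i\<bar> + p"
    unfolding p_def using lip_x[OF r, of "x i" mN "y i"] by linarith
  then have "(b r (x i) mN - b r (y i) \<mu>)\<^sup>2 \<le> (L * \<bar>x i - y i\<bar> + p)\<^sup>2"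
    using L nn by (subst abs_le_square_iff[symmetric]) auto
  also have "\<dots> \<le> 2 * (L * \<bar>x i - y i\<bar>)\<^sup>2 + 2 * p\<^sup>2" by (rule square_add_le)
  also have "\<dots> \<le> 2 * L\<^sup>2 * (x i - y i)\<^sup>2 + 2 * (2 * L\<^sup>2 * Lf\<^sup>2 * (CZ + 1) * E + (4 * K\<^sup>2 + 4 * K * L) * (B + \<bar>Q - v\<bar>))"
    using p_sq by (simp add: power_mult_distrib)
  also have "\<dots> = 2 * L\<^sup>2 * (x i - y i)\<^sup>2 + 4 * L\<^sup>2 * Lf\<^sup>2 * (CZ + 1) * E + (8 * K\<^sup>2 + 8 * K * L) * (B + \<bar>Q - v\<bar>)"
    by (simp add: algebra_simps)
  finally show ?thesis unfolding mN_def E_def B_def Q_def .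
qed

text \<open>The Cauchy-Schwarz inequality against the indicator of \<open>{0..t}\<close>, whose mass
  \<open>t\<close> is at most \<open>T\<close>.\<close>

lemma square_integral_bound:
  fixes q :: "real \<Rightarrow> real" and e :: real
  assumes q[measurable]: "(\<lambda>r. indicator {0..t} r * q r) \<in> borel_measurable borel" and t: "0 \<le> t" "t \<le> T"
    and e: "ennreal \<bar>e\<bar> \<le> (\<integral>\<^sup>+r\<in>{0..t}. ennreal \<bar>q r\<bar> \<partial>lborel)"
  shows "ennreal (e\<^sup>2) \<le> ennreal T * (\<integral>\<^sup>+r\<in>{0..t}. ennreal ((q r)\<^sup>2) \<partial>lborel)"
proof -
  let ?g = "\<lambda>r. ennreal \<bar>indicator {0..t} r * q r\<bar>" and ?i = "indicator {0..t} :: real \<Rightarrow> ennreal"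
  have "ennreal (e\<^sup>2) = (ennreal \<bar>e\<bar>)\<^sup>2" by (simp add: ennreal_power)
  also have "\<dots> \<le> (\<integral>\<^sup>+r. ?g r * ?i r \<partial>lborel)\<^sup>2"
  proof (rule power_mono)
    have "(\<integral>\<^sup>+r\<in>{0..t}. ennreal \<bar>q r\<bar> \<partial>lborel) = (\<integral>\<^sup>+r. ?g r * ?i r \<partial>lborel)"
      by (intro nn_integral_cong) (auto simp: indicator_def)
    then show "ennreal \<bar>e\<bar> \<le> (\<integral>\<^sup>+r. ?g r * ?i r \<partial>lborel)" using e by simp
  qed simp
  also have "\<dots> \<le> (\<integral>\<^sup>+r. (?g r)\<^sup>2 \<partial>lborel) * (\<integral>\<^sup>+r. (?i r)\<^sup>2 \<partial>lborel)"
    by (rule Cauchy_Schwarz_nn_integral) measurable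
  also have "(\<integral>\<^sup>+r. (?i r)\<^sup>2 \<partial>lborel) = (\<integral>\<^sup>+r. ?i r \<partial>lborel)" by (intro nn_integral_cong) (auto simp: indicator_def)
  also have "\<dots> = ennreal t" using t by simp
  also have "(\<integral>\<^sup>+r. (?g r)\<^sup>2 \<partial>lborel) = (\<integral>\<^sup>+r\<in>{0..t}. ennreal ((q r)\<^sup>2) \<partial>lborel)"
    by (intro nn_integral_cong) (auto simp: indicator_def ennreal_power)
  also have "(\<integral>\<^sup>+r\<in>{0..t}. ennreal ((q r)\<^sup>2) \<partial>lborel) * ennreal t \<le> (\<integral>\<^sup>+r\<in>{0..t}. ennreal ((q r)\<^sup>2) \<partial>lborel) * ennreal T"
    using t by (intro mult_left_mono ennreal_leI) auto
  finally show ?thesis by (simp add: mult.commute)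
qed

text \<open>The coefficients of a particle's own error and of the averaged error in
  \<open>drift_gap\<close> are added, because both errors will be bounded by the same supremum over
  the particles.\<close>

definition k1 :: real where "k1 = 2 * L\<^sup>2 + 4 * L\<^sup>2 * Lf\<^sup>2 * (CZ + 1)"
definition k2 :: real where "k2 = 8 * K\<^sup>2 + 8 * K * L"

lemma k1: "0 \<le> k1" and k2: "0 \<le> k2"
  unfolding k1_def k2_def using CZ(1) K L by auto

text \<open>Both equations have the same driver, which cancels. The particle weights are replaced by
  \<open>Z'\<close> through \<open>Z_unique\<close>, and the own mean \<open>m i\<close> by
  \<open>m 1\<close> through \<open>mean_unique\<close>, which leaves the drift difference treated
  in \<open>drift_gap\<close>.\<close>

lemma particle_gap_integral:
  assumes N: "N \<ge> 1" and P: "particle_solution M F W T \<sigma> x0 h f b N U V"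
    and U'c: "\<And>j \<omega>. j \<in> {1..N} \<Longrightarrow> continuous_on UNIV (\<lambda>t. U' j t \<omega>)"
    and U'e: "\<And>j. j \<in> {1..N} \<Longrightarrow> AE \<omega> in M. \<forall>t\<in>{0..T}. U' j t \<omega> = U j t \<omega>"
    and i: "i \<in> {1..N}"
  defines "\<mu> \<equiv> \<lambda>r \<omega>. (\<Sum>j=1..N. f (U' j r \<omega>) * Z' j r \<omega>) / real N"
  shows "AE \<omega> in M. \<forall>s\<in>{0..T}. ennreal \<bar>U' i s \<omega> - X' i s \<omega>\<bar>
    \<le> (\<integral>\<^sup>+r\<in>{0..s}. ennreal \<bar>b r (U' i r \<omega>) (\<mu> r \<omega>) - b r (X' i r \<omega>) (m 1 r)\<bar> \<partial>lborel)"
proof -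
  have i1: "i \<ge> 1" using i by simp
  have U'b: "(\<lambda>t. U' j t \<omega>) \<in> borel_measurable borel" if "j \<in> {1..N}" for j \<omega>
    using U'c[OF that] by (rule borel_measurable_continuous_onI)
  have \<mu>b: "(\<lambda>t. \<mu> t \<omega>) \<in> borel_measurable borel" for \<omega>
    unfolding \<mu>_def using U'b path_cont_measurable
    by (intro borel_measurable_divide borel_measurable_sum borel_measurable_times measurable_compose[OF U'b f_measurable]) auto
  have ZV: "AE \<omega> in M. \<forall>j\<in>{1..N}. \<forall>t\<in>{0..T}. V j t \<omega> = Z' j t \<omega>"
  proof (rule AE_finite_allI)
    fix j assume "j \<in> {1..N}"
    then show "AE \<omega> in M. \<forall>t\<in>{0..T}. V j t \<omega> = Z' j t \<omega>"
      using P unfolding particle_solution_def by (intro Z_unique) auto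
  qed simp
  have UU: "AE \<omega> in M. \<forall>j\<in>{1..N}. \<forall>t\<in>{0..T}. U' j t \<omega> = U j t \<omega>"
    by (rule AE_finite_allI[OF _ U'e]) auto
  have eqU: "AE \<omega> in M. \<forall>s\<in>{0..T}. U' i s \<omega> = x0 + (LBINT r:{0..s}. b r (U' i r \<omega>) (\<mu> r \<omega>)) + (c s + \<sigma> * W i s \<omega>)"
  proof (rule drift_noise_rep[OF br[OF i1]])
    show "ito_process M F (W i) T x0 (\<lambda>t \<omega>. b t (U i t \<omega>) ((\<Sum>j=1..N. f (U j t \<omega>) * V j t \<omega>) / real N) + \<sigma> * h t) (\<lambda>t \<omega>. \<sigma>) (U i)"
      using P i unfolding particle_solution_def by blast
    show "AE \<omega> in M. \<forall>t\<in>{0..T}. U' i t \<omega> = U i t \<omega> \<and> \<mu> t \<omega> = (\<Sum>j=1..N. f (U j t \<omega>) * V j t \<omega>) / real N"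
      using ZV UU
    proof eventually_elim
      case (elim \<omega>)
      show ?case
      proof (intro ballI conjI)
        fix t assume t: "t \<in> {0..T}"
        show "U' i t \<omega> = U i t \<omega>" using elim(2) i t by blast
        have "(\<Sum>j=1..N. f (U' j t \<omega>) * Z' j t \<omega>) = (\<Sum>j=1..N. f (U j t \<omega>) * V j t \<omega>)"
          using elim t by (intro sum.cong refl) simp
        then show "\<mu> t \<omega> = (\<Sum>j=1..N. f (U j t \<omega>) * V j t \<omega>) / real N" unfolding \<mu>_def by simp
      qed
    qed
  qed (use U'b[OF i] \<mu>b in auto)
  show ?thesis
    using eqU X'_equation[OF i1]
  proof eventually_elim
    case (elim \<omega>)
    show ?case
    proof
      fix s assume s: "s \<in> {0..T}"
      then have sub: "{0..s} \<subseteq> {0..T}" by auto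
      let ?q = "\<lambda>r. \<bar>b r (U' i r \<omega>) (\<mu> r \<omega>) - b r (X' i r \<omega>) (m 1 r)\<bar>"
      have mi: "(LBINT r:{0..s}. b r (X' i r \<omega>) (m i r)) = (LBINT r:{0..s}. b r (X' i r \<omega>) (m 1 r))"
        using mean_unique[OF i1] sub by (intro set_lebesgue_integral_cong) auto
      have i12: "set_integrable lborel {0..s} (\<lambda>r. b r (U' i r \<omega>) (\<mu> r \<omega>))" "set_integrable lborel {0..s} (\<lambda>r. b r (X' i r \<omega>) (m 1 r))"
        using U'b[OF i] \<mu>b path_cont_measurable(1)[OF i1] m_measurable[of 1] sub by (auto intro!: drift_integrable)
      have qi: "set_integrable lborel {0..s} ?q" by (intro set_integrable_abs set_integral_diff i12)
      have "\<bar>U' i s \<omega> - X' i s \<omega>\<bar> = \<bar>(LBINT r:{0..s}. b r (U' i r \<omega>) (\<mu> r \<omega>)) - (LBINT r:{0..s}. b r (X' i r \<omega>) (m 1 r))\<bar>"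
        using elim s by (simp add: mi del: One_nat_def)
      also have "\<dots> \<le> (LBINT r:{0..s}. ?q r)"
        by (rule set_integral_diff_bound[OF i12 qi]) simp
      finally have "ennreal \<bar>U' i s \<omega> - X' i s \<omega>\<bar> \<le> ennreal (LBINT r:{0..s}. ?q r)" by (rule ennreal_leI)
      also have "\<dots> = (\<integral>\<^sup>+r. ennreal (indicator {0..s} r *\<^sub>R ?q r) \<partial>lborel)"
        unfolding set_lebesgue_integral_def using qi unfolding set_integrable_def
        by (intro nn_integral_eq_integral[symmetric]) auto
      also have "\<dots> = (\<integral>\<^sup>+r\<in>{0..s}. ennreal (?q r) \<partial>lborel)"
        by (intro nn_integral_cong) (auto simp: indicator_def)
      finally show "ennreal \<bar>U' i s \<omega> - X' i s \<omega>\<bar> \<le> (\<integral>\<^sup>+r\<in>{0..s}. ennreal (?q r) \<partial>lborel)" .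
    qed
  qed
qed

text \<open>Integrates \<open>drift_gap\<close>. The bound \<open>v\<close> on every single particle
  error also bounds their average, so the estimate closes although the particles of a given solution
  are not known to be exchangeable.\<close>

lemma particle_gap_expectation:
  assumes N: "N \<ge> 1" and r: "r \<in> {0..T}" and i: "i \<in> {1..N}"
    and m': "\<And>j. j \<in> {1..N} \<Longrightarrow> U' j r \<in> borel_measurable M"
    and V: "\<And>j. j \<in> {1..N} \<Longrightarrow> (\<integral>\<^sup>+\<omega>. ennreal ((U' j r \<omega> - X' j r \<omega>)\<^sup>2) \<partial>M) \<le> v"
  shows "(\<integral>\<^sup>+\<omega>. ennreal ((b r (U' i r \<omega>) ((\<Sum>j=1..N. f (U' j r \<omega>) * Z' j r \<omega>) / real N) - b r (X' i r \<omega>) (m 1 r))\<^sup>2) \<partial>M)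
    \<le> ennreal k1 * v + ennreal k2 * rN N r"
proof -
  have [measurable]: "X' j r \<in> borel_measurable M" "Z' j r \<in> borel_measurable M" "U' j r \<in> borel_measurable M" if "j \<in> {1..N}" for j
    using that m' by auto
  have im[measurable]: "X' i r \<in> borel_measurable M" "U' i r \<in> borel_measurable M" using i m' by auto
  let ?d = "\<lambda>j \<omega>. ennreal ((U' j r \<omega> - X' j r \<omega>)\<^sup>2)"
  let ?B = "\<lambda>\<omega>. ennreal \<bar>(\<Sum>j=1..N. f (X' j r \<omega>) * Z' j r \<omega>) / real N - m 1 r\<bar>"
  let ?Q = "\<lambda>\<omega>. ennreal \<bar>(\<Sum>j=1..N. (Z' j r \<omega>)\<^sup>2) / real N - expectation (\<lambda>\<omega>. (Z' 1 r \<omega>)\<^sup>2)\<bar>"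
  define ka kb where "ka = 2 * L\<^sup>2" and "kb = 4 * L\<^sup>2 * Lf\<^sup>2 * (CZ + 1)"
  have k: "0 \<le> ka" "0 \<le> kb" unfolding ka_def kb_def using CZ(1) by auto
  have [measurable]: "?B \<in> borel_measurable M" "?Q \<in> borel_measurable M" by measurable
  have "(\<integral>\<^sup>+\<omega>. ennreal ((b r (U' i r \<omega>) ((\<Sum>j=1..N. f (U' j r \<omega>) * Z' j r \<omega>) / real N) - b r (X' i r \<omega>) (m 1 r))\<^sup>2) \<partial>M)
    \<le> (\<integral>\<^sup>+\<omega>. ennreal ka * ?d i \<omega> + (\<Sum>j=1..N. ennreal (kb / real N) * ?d j \<omega>) + ennreal k2 * (?B \<omega> + ?Q \<omega>) \<partial>M)"
  proof (rule nn_integral_mono)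
    fix \<omega>
    let ?S = "(\<Sum>j=1..N. (U' j r \<omega> - X' j r \<omega>)\<^sup>2)"
    let ?B' = "\<bar>(\<Sum>j=1..N. f (X' j r \<omega>) * Z' j r \<omega>) / real N - m 1 r\<bar>"
    let ?Q' = "\<bar>(\<Sum>j=1..N. (Z' j r \<omega>)\<^sup>2) / real N - expectation (\<lambda>\<omega>. (Z' 1 r \<omega>)\<^sup>2)\<bar>"
    have "(b r (U' i r \<omega>) ((\<Sum>j=1..N. f (U' j r \<omega>) * Z' j r \<omega>) / real N) - b r (X' i r \<omega>) (m 1 r))\<^sup>2
      \<le> ka * (U' i r \<omega> - X' i r \<omega>)\<^sup>2 + kb * (?S / real N) + k2 * (?B' + ?Q')"
      using drift_gap[OF r Z'_square_integrable(2)[OF order_refl r], where x = "\<lambda>j. U' j r \<omega>" and i = i and N = N and z = "\<lambda>j. Z' j r \<omega>" and y = "\<lambda>j. X' j r \<omega>" and \<mu> = "m 1 r"]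
      unfolding ka_def kb_def k2_def by simp
    then have "ennreal ((b r (U' i r \<omega>) ((\<Sum>j=1..N. f (U' j r \<omega>) * Z' j r \<omega>) / real N) - b r (X' i r \<omega>) (m 1 r))\<^sup>2)
      \<le> ennreal (ka * (U' i r \<omega> - X' i r \<omega>)\<^sup>2 + kb * (?S / real N) + k2 * (?B' + ?Q'))" by (rule ennreal_leI)
    also have "\<dots> = ennreal (ka * (U' i r \<omega> - X' i r \<omega>)\<^sup>2) + ennreal (kb * (?S / real N)) + ennreal (k2 * (?B' + ?Q'))"
      using k k2 by (subst ennreal_plus ennreal_plus[symmetric]; (intro add_nonneg_nonneg mult_nonneg_nonneg divide_nonneg_nonneg sum_nonneg)?; simp)+
    also have "ennreal (kb * (?S / real N)) = (\<Sum>j=1..N. ennreal (kb / real N) * ?d j \<omega>)"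
    proof -
      have "kb * (?S / real N) = (\<Sum>j=1..N. kb / real N * (U' j r \<omega> - X' j r \<omega>)\<^sup>2)" by (simp add: sum_distrib_left sum_divide_distrib)
      also have "ennreal \<dots> = (\<Sum>j=1..N. ennreal (kb / real N * (U' j r \<omega> - X' j r \<omega>)\<^sup>2))"
        using k by (intro sum_ennreal[symmetric]) auto
      also have "\<dots> = (\<Sum>j=1..N. ennreal (kb / real N) * ?d j \<omega>)" using k by (intro sum.cong refl ennreal_mult) auto
      finally show ?thesis .
    qed
    also have "ennreal (ka * (U' i r \<omega> - X' i r \<omega>)\<^sup>2) = ennreal ka * ?d i \<omega>" using k by (simp add: ennreal_mult)
    also have "ennreal (k2 * (?B' + ?Q')) = ennreal k2 * (?B \<omega> + ?Q \<omega>)" using k2 by (simp add: ennreal_mult)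
    finally show "ennreal ((b r (U' i r \<omega>) ((\<Sum>j=1..N. f (U' j r \<omega>) * Z' j r \<omega>) / real N) - b r (X' i r \<omega>) (m 1 r))\<^sup>2)
      \<le> ennreal ka * ?d i \<omega> + (\<Sum>j=1..N. ennreal (kb / real N) * ?d j \<omega>) + ennreal k2 * (?B \<omega> + ?Q \<omega>)" .
  qed
  also have "\<dots> = ennreal ka * (\<integral>\<^sup>+\<omega>. ?d i \<omega> \<partial>M) + (\<Sum>j=1..N. ennreal (kb / real N) * (\<integral>\<^sup>+\<omega>. ?d j \<omega> \<partial>M)) + ennreal k2 * rN N r"
  proof -
    have "(\<integral>\<^sup>+\<omega>. (\<Sum>j=1..N. ennreal (kb / real N) * ?d j \<omega>) \<partial>M) = (\<Sum>j=1..N. \<integral>\<^sup>+\<omega>. ennreal (kb / real N) * ?d j \<omega> \<partial>M)"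
      by (rule nn_integral_sum) measurable
    also have "\<dots> = (\<Sum>j=1..N. ennreal (kb / real N) * (\<integral>\<^sup>+\<omega>. ?d j \<omega> \<partial>M))"
      by (intro sum.cong refl nn_integral_cmult) measurable
    finally have s: "(\<integral>\<^sup>+\<omega>. (\<Sum>j=1..N. ennreal (kb / real N) * ?d j \<omega>) \<partial>M) = (\<Sum>j=1..N. ennreal (kb / real N) * (\<integral>\<^sup>+\<omega>. ?d j \<omega> \<partial>M))" .
    have sm: "(\<lambda>\<omega>. \<Sum>j=1..N. ennreal (kb / real N) * ?d j \<omega>) \<in> borel_measurable M" by measurable
    show ?thesis unfolding s[symmetric] rN_def using sm
      by (simp add: nn_integral_add nn_integral_cmult del: sum_ennreal)
  qed
  also have "\<dots> \<le> ennreal ka * v + (\<Sum>j=1..N. ennreal (kb / real N) * v) + ennreal k2 * rN N r"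
    using V i by (intro add_mono mult_left_mono sum_mono order_refl) auto
  also have "(\<Sum>j=1..N. ennreal (kb / real N) * v) = ennreal kb * v"
  proof -
    have "(\<Sum>j=1..N. ennreal (kb / real N) * v) = (\<Sum>j=1..N. ennreal (kb / real N)) * v" by (rule sum_distrib_right[symmetric])
    also have "(\<Sum>j=1..N. ennreal (kb / real N)) = ennreal kb" using N k by (subst sum_ennreal) auto
    finally show ?thesis .
  qed
  also have "ennreal ka * v + ennreal kb * v = ennreal k1 * v"
    unfolding k1_def using k unfolding ka_def kb_def by (simp add: distrib_right)
  finally show ?thesis .
qed

text \<open>Gronwall's inequality for the largest, among the particles, of the expected running
  suprema of the squared errors. The constant is found before \<open>N\<close>, \<open>U\<close> and
  \<open>V\<close>, so the time integral of \<open>rN\<close> alone governs the convergence.\<close>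

lemma particle_estimate:
  "\<exists>C<\<infinity>. \<forall>N\<ge>1. \<forall>U V. particle_solution M F W T \<sigma> x0 h f b N U V \<longrightarrow>
    (SUP i\<in>{1..N}. \<integral>\<^sup>+\<omega>. (SUP t\<in>{0..T}. ennreal (\<bar>U i t \<omega> - X i t \<omega>\<bar>\<^sup>2)) \<partial>M)
      \<le> C * (\<integral>\<^sup>+s\<in>{0..T}. rN N s \<partial>lborel)"
proof -
  \<comment> \<open>\<open>T\<close> stems from the Cauchy-Schwarz inequality in time,
    \<open>k1\<close> from the comparison of the drifts.\<close>
  define w where "w = ennreal (T * k1)"
  have "(\<integral>\<^sup>+s\<in>{0..T}. w \<partial>lborel) < \<infinity>"
    unfolding w_def by (subst nn_integral_cmult) (auto simp: ennreal_mult_less_top emeasure_lborel_Icc_eq)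
  from gronwall_nn[OF borel_measurable_const this T]
  obtain C where C: "C < \<infinity>" and gr: "\<forall>A \<phi>. (\<exists>B<\<infinity>. \<forall>t\<in>{0..T}. \<phi> t \<le> B) \<longrightarrow>
      (\<forall>t\<in>{0..T}. \<phi> t \<le> A + (\<integral>\<^sup>+s\<in>{0..t}. w * \<phi> s \<partial>lborel)) \<longrightarrow> (\<forall>t\<in>{0..T}. \<phi> t \<le> C * A)"
    by blast
  have main: "(SUP i\<in>{1..N}. \<integral>\<^sup>+\<omega>. (SUP t\<in>{0..T}. ennreal (\<bar>U i t \<omega> - X i t \<omega>\<bar>\<^sup>2)) \<partial>M)
      \<le> C * ennreal (T * k2) * (\<integral>\<^sup>+s\<in>{0..T}. rN N s \<partial>lborel)"
    if N: "N \<ge> 1" and P: "particle_solution M F W T \<sigma> x0 h f b N U V" for N U V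
  proof -
    have "\<forall>j\<in>{1..N}. \<exists>Y. (\<forall>\<omega>. continuous_on UNIV (\<lambda>t. Y t \<omega>)) \<and> (\<lambda>(s, \<omega>). Y s \<omega>) \<in> borel_measurable (borel \<Otimes>\<^sub>M M)
     \<and> (AE \<omega> in M. \<forall>t\<in>{0..T}. Y t \<omega> = U j t \<omega>)"
    proof
      fix j assume j: "j \<in> {1..N}"
      then have "j \<ge> 1" by simp
      have "ito_process M F (W j) T x0
          (\<lambda>t \<omega>. b t (U j t \<omega>) ((\<Sum>j=1..N. f (U j t \<omega>) * V j t \<omega>) / real N) + \<sigma> * h t) (\<lambda>t \<omega>. \<sigma>) (U j)"
        using P j unfolding particle_solution_def by blast
      then show "\<exists>Y. (\<forall>\<omega>. continuous_on UNIV (\<lambda>t. Y t \<omega>)) \<and> (\<lambda>(s, \<omega>). Y s \<omega>) \<in> borel_measurable (borel \<Otimes>\<^sub>M M)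
        \<and> (AE \<omega> in M. \<forall>t\<in>{0..T}. Y t \<omega> = U j t \<omega>)"
        by (rule continuous_version[OF \<open>j \<ge> 1\<close>])
    qed
    then obtain U' where U': "\<forall>j\<in>{1..N}. (\<forall>\<omega>. continuous_on UNIV (\<lambda>t. U' j t \<omega>)) \<and> (\<lambda>(s, \<omega>). U' j s \<omega>) \<in> borel_measurable (borel \<Otimes>\<^sub>M M)
     \<and> (AE \<omega> in M. \<forall>t\<in>{0..T}. U' j t \<omega> = U j t \<omega>)" by (rule bchoice[THEN exE])
    have U'c: "continuous_on UNIV (\<lambda>t. U' j t \<omega>)" and U'j: "(\<lambda>(s, \<omega>). U' j s \<omega>) \<in> borel_measurable (borel \<Otimes>\<^sub>M M)"
      and U'e: "AE \<omega> in M. \<forall>t\<in>{0..T}. U' j t \<omega> = U j t \<omega>" if "j \<in> {1..N}" for j \<omega>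
      using U' that by blast+
    have U'M: "U' j t \<in> borel_measurable M" if "j \<in> {1..N}" for j t
      using measurable_compose[OF measurable_Pair1'[of t borel M] U'j[OF that]] by simp
    define \<mu> where "\<mu> r \<omega> = (\<Sum>j=1..N. f (U' j r \<omega>) * Z' j r \<omega>) / real N" for r \<omega>
    define q where "q i r \<omega> = b r (U' i r \<omega>) (\<mu> r \<omega>) - b r (X' i r \<omega>) (m 1 r)" for i r \<omega>
    \<comment> \<open>The supremum over times is inside the expectation from the start. The time
      integral bounding the error at \<open>s\<close> grows with \<open>s\<close>, so its value at
      \<open>t\<close> bounds the whole running supremum.\<close>
    define G where "G i t \<omega> = (SUP s\<in>{0..t}. ennreal ((U' i s \<omega> - X' i s \<omega>)\<^sup>2))" for i t \<omega>
    define v where "v t = (SUP i\<in>{1..N}. \<integral>\<^sup>+\<omega>. G i t \<omega> \<partial>M)" for t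
    have qm: "(\<lambda>(r, \<omega>). indicator {0..T} r * q i r \<omega>) \<in> borel_measurable (borel \<Otimes>\<^sub>M M)" if i: "i \<in> {1..N}" for i
    proof -
      have [measurable]: "(\<lambda>p. U' j (fst p) (snd p)) \<in> borel_measurable (borel \<Otimes>\<^sub>M M)" if "j \<in> {1..N}" for j
        using U'j[OF that] by (simp add: case_prod_beta)
      have [measurable]: "(\<lambda>p. Z' j (fst p) (snd p)) \<in> borel_measurable (borel \<Otimes>\<^sub>M M)" if "j \<in> {1..N}" for j
        using joint_pairs(2)[of j] that by simp
      have [measurable]: "(\<lambda>p. X' i (fst p) (snd p)) \<in> borel_measurable (borel \<Otimes>\<^sub>M M)" using joint_pairs(1)[of i] i by simp
      have [measurable]: "m 1 \<in> borel_measurable borel" by (rule m_measurable) simp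
      have [measurable]: "(\<lambda>p. \<mu> (fst p) (snd p)) \<in> borel_measurable (borel \<Otimes>\<^sub>M M)"
        unfolding \<mu>_def by measurable
      have "(\<lambda>p. indicator {0..T} (fst p) * b (fst p) (U' i (fst p) (snd p)) (\<mu> (fst p) (snd p))
          - indicator {0..T} (fst p) * b (fst p) (X' i (fst p) (snd p)) (m 1 (fst p))) \<in> borel_measurable (borel \<Otimes>\<^sub>M M)"
        using i by (intro borel_measurable_diff drift_measurable) measurable
      then show ?thesis unfolding q_def by (simp add: case_prod_beta right_diff_distrib)
    qed
    have qmr: "(\<lambda>r. indicator {0..T} r * q i r \<omega>) \<in> borel_measurable borel" if "i \<in> {1..N}" "\<omega> \<in> space M" for i \<omega>
      using measurable_compose[OF measurable_Pair2'[OF that(2)] qm[OF that(1)]] by simp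
    have gap: "AE \<omega> in M. \<forall>s\<in>{0..T}. ennreal \<bar>U' i s \<omega> - X' i s \<omega>\<bar> \<le> (\<integral>\<^sup>+r\<in>{0..s}. ennreal \<bar>q i r \<omega>\<bar> \<partial>lborel)"
      if "i \<in> {1..N}" for i
      unfolding q_def \<mu>_def by (rule particle_gap_integral[OF N P U'c U'e that])
    have q2K: "\<bar>q i r \<omega>\<bar> \<le> 2 * K" if "r \<in> {0..T}" for i r \<omega>
      unfolding q_def using bound[OF that, of "U' i r \<omega>" "\<mu> r \<omega>"] bound[OF that, of "X' i r \<omega>" "m 1 r"] by linarith
    have Gle: "AE \<omega> in M. G i t \<omega> \<le> ennreal T * (\<integral>\<^sup>+r\<in>{0..t}. ennreal ((q i r \<omega>)\<^sup>2) \<partial>lborel)"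
      if i: "i \<in> {1..N}" and t: "t \<in> {0..T}" for i t
      using gap[OF i] AE_space
    proof eventually_elim
      case (elim \<omega>)
      show ?case unfolding G_def
      proof (rule SUP_least)
        fix s assume s: "s \<in> {0..t}"
        then have sT: "0 \<le> s" "s \<le> T" "s \<in> {0..T}" using t by auto
        have m: "(\<lambda>r. indicator {0..s} r * q i r \<omega>) \<in> borel_measurable borel"
        proof -
          have "(\<lambda>r. indicator {0..s} r * q i r \<omega>) = (\<lambda>r. indicator {0..s} r * (indicator {0..T} r * q i r \<omega>))"
            using sT by (auto simp: indicator_def)
          then show ?thesis using qmr[OF i elim(2)] by simp
        qed
        have "ennreal ((U' i s \<omega> - X' i s \<omega>)\<^sup>2) \<le> ennreal T * (\<integral>\<^sup>+r\<in>{0..s}. ennreal ((q i r \<omega>)\<^sup>2) \<partial>lborel)"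
          using elim(1) sT by (intro square_integral_bound[OF m]) auto
        also have "\<dots> \<le> ennreal T * (\<integral>\<^sup>+r\<in>{0..t}. ennreal ((q i r \<omega>)\<^sup>2) \<partial>lborel)"
          using s by (intro mult_left_mono nn_integral_mono) (auto simp: indicator_def)
        finally show "ennreal ((U' i s \<omega> - X' i s \<omega>)\<^sup>2) \<le> ennreal T * (\<integral>\<^sup>+r\<in>{0..t}. ennreal ((q i r \<omega>)\<^sup>2) \<partial>lborel)" .
      qed
    qed
    define a where "a i r = (\<integral>\<^sup>+\<omega>. ennreal ((q i r \<omega>)\<^sup>2) \<partial>M)" for i r
    interpret B1: brownian M F "W 1" by (rule br) simp
    have Fub: "(\<integral>\<^sup>+\<omega>. (\<integral>\<^sup>+r\<in>{0..t}. ennreal ((q i r \<omega>)\<^sup>2) \<partial>lborel) \<partial>M) = (\<integral>\<^sup>+r\<in>{0..t}. a i r \<partial>lborel)"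
      "(\<lambda>\<omega>. \<integral>\<^sup>+r\<in>{0..t}. ennreal ((q i r \<omega>)\<^sup>2) \<partial>lborel) \<in> borel_measurable M"
      "(\<lambda>r. a i r * indicator {0..t} r) \<in> borel_measurable borel"
      if i: "i \<in> {1..N}" and t: "t \<in> {0..T}" for i t
      using B1.Fubini_square(1,3,4)[OF qm[OF i], of t "\<lambda>_ _. 0"] t unfolding a_def by simp_all
    have EG: "(\<integral>\<^sup>+\<omega>. G i t \<omega> \<partial>M) \<le> ennreal T * (\<integral>\<^sup>+r\<in>{0..t}. a i r \<partial>lborel)"
      if i: "i \<in> {1..N}" and t: "t \<in> {0..T}" for i t
    proof -
      have "(\<integral>\<^sup>+\<omega>. G i t \<omega> \<partial>M) \<le> (\<integral>\<^sup>+\<omega>. ennreal T * (\<integral>\<^sup>+r\<in>{0..t}. ennreal ((q i r \<omega>)\<^sup>2) \<partial>lborel) \<partial>M)"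
        by (rule nn_integral_mono_AE[OF Gle[OF i t]])
      also have "\<dots> = ennreal T * (\<integral>\<^sup>+r\<in>{0..t}. a i r \<partial>lborel)"
        unfolding Fub(1)[OF i t, symmetric] by (rule nn_integral_cmult[OF Fub(2)[OF i t]])
      finally show ?thesis .
    qed
    have a_le: "a i r \<le> ennreal k1 * v r + ennreal k2 * rN N r" if i: "i \<in> {1..N}" and r: "r \<in> {0..T}" for i r
      unfolding a_def q_def \<mu>_def
    proof (rule particle_gap_expectation[OF N r i U'M])
      fix j assume j: "j \<in> {1..N}"
      have "(\<integral>\<^sup>+\<omega>. ennreal ((U' j r \<omega> - X' j r \<omega>)\<^sup>2) \<partial>M) \<le> (\<integral>\<^sup>+\<omega>. G j r \<omega> \<partial>M)"
        unfolding G_def using r by (intro nn_integral_mono SUP_upper2[of r]) auto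
      also have "\<dots> \<le> v r" unfolding v_def using j by (intro SUP_upper)
      finally show "(\<integral>\<^sup>+\<omega>. ennreal ((U' j r \<omega> - X' j r \<omega>)\<^sup>2) \<partial>M) \<le> v r" .
    qed
    have "v T \<le> C * (ennreal (T * k2) * (\<integral>\<^sup>+s\<in>{0..T}. rN N s \<partial>lborel))"
    proof (rule gr[rule_format])
      show "T \<in> {0..T}" using T by simp
      \<comment> \<open>Boundedness of \<open>b\<close> bounds the drift difference by
        \<open>2 K\<close>, which gives a finite a priori bound common to all particles.\<close>
      show "\<exists>B<\<infinity>. \<forall>t\<in>{0..T}. v t \<le> B"
      proof (intro exI[of _ "ennreal T * (\<integral>\<^sup>+r\<in>{0..T}. ennreal ((2 * K)\<^sup>2) \<partial>lborel)"] conjI ballI)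
        show "ennreal T * (\<integral>\<^sup>+r\<in>{0..T}. ennreal ((2 * K)\<^sup>2) \<partial>lborel) < \<infinity>"
          by (subst nn_integral_cmult) (auto simp: ennreal_mult_less_top emeasure_lborel_Icc_eq)
        fix t assume t: "t \<in> {0..T}"
        show "v t \<le> ennreal T * (\<integral>\<^sup>+r\<in>{0..T}. ennreal ((2 * K)\<^sup>2) \<partial>lborel)"
          unfolding v_def
        proof (rule SUP_least)
          fix i assume i: "i \<in> {1..N}"
          have "a i r \<le> ennreal ((2 * K)\<^sup>2)" if "r \<in> {0..T}" for r
          proof -
            have "a i r \<le> (\<integral>\<^sup>+\<omega>. ennreal ((2 * K)\<^sup>2) \<partial>M)"
              unfolding a_def
            proof (intro nn_integral_mono ennreal_leI)
              fix \<omega>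
              have "\<bar>q i r \<omega>\<bar> \<le> \<bar>2 * K\<bar>" using q2K[OF that, of i \<omega>] by linarith
              then show "(q i r \<omega>)\<^sup>2 \<le> (2 * K)\<^sup>2" by (simp only: abs_le_square_iff)
            qed
            then show ?thesis by (simp add: emeasure_space_1)
          qed
          then have "(\<integral>\<^sup>+r\<in>{0..t}. a i r \<partial>lborel) \<le> (\<integral>\<^sup>+r\<in>{0..T}. ennreal ((2 * K)\<^sup>2) \<partial>lborel)"
            using t by (intro nn_integral_mono) (auto simp: indicator_def)
          then show "(\<integral>\<^sup>+\<omega>. G i t \<omega> \<partial>M) \<le> ennreal T * (\<integral>\<^sup>+r\<in>{0..T}. ennreal ((2 * K)\<^sup>2) \<partial>lborel)"
            using EG[OF i t] by (meson mult_left_mono order_trans zero_le)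
        qed
      qed
      fix t assume t: "t \<in> {0..T}"
      show "v t \<le> ennreal (T * k2) * (\<integral>\<^sup>+s\<in>{0..T}. rN N s \<partial>lborel) + (\<integral>\<^sup>+s\<in>{0..t}. w * v s \<partial>lborel)"
        unfolding v_def[of t]
      proof (rule SUP_least)
        fix i assume i: "i \<in> {1..N}"
        have "(\<integral>\<^sup>+\<omega>. G i t \<omega> \<partial>M) \<le> ennreal T * (\<integral>\<^sup>+r\<in>{0..t}. a i r \<partial>lborel)" by (rule EG[OF i t])
        also have "\<dots> = (\<integral>\<^sup>+r. ennreal T * (a i r * indicator {0..t} r) \<partial>lborel)"
          using Fub(3)[OF i t] by (intro nn_integral_cmult[symmetric]) simp
        also have "\<dots> \<le> (\<integral>\<^sup>+r. w * v r * indicator {0..t} r \<partial>lborel) + (\<integral>\<^sup>+r. ennreal (T * k2) * (rN N r * indicator {0..T} r) \<partial>lborel)"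
        \<comment> \<open>\<open>v\<close> is not known to be measurable in time, so the sum is
          split by the one-sided form of additivity.\<close>
        proof (rule nn_integral_le_add)
          show "(\<lambda>r. ennreal T * (a i r * indicator {0..t} r)) \<in> borel_measurable lborel" using Fub(3)[OF i t] by simp
          show "(\<lambda>r. ennreal (T * k2) * (rN N r * indicator {0..T} r)) \<in> borel_measurable lborel" by measurable
          show "ennreal (T * k2) * (rN N s * indicator {0..T} s) < \<infinity>" for s
            using rN_bound[of s N] by (auto simp: indicator_def ennreal_mult_less_top intro: order_le_less_trans)
          show "AE r in lborel. ennreal T * (a i r * indicator {0..t} r) \<le> w * v r * indicator {0..t} r + ennreal (T * k2) * (rN N r * indicator {0..T} r)"
          proof (rule AE_I2)
            fix r :: real
            show "ennreal T * (a i r * indicator {0..t} r) \<le> w * v r * indicator {0..t} r + ennreal (T * k2) * (rN N r * indicator {0..T} r)"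
            proof (cases "r \<in> {0..t}")
              case True
              then have r: "r \<in> {0..T}" using t by auto
              have "ennreal T * a i r \<le> ennreal T * (ennreal k1 * v r + ennreal k2 * rN N r)"
                using a_le[OF i r] by (rule mult_left_mono) simp
              also have "\<dots> = w * v r + ennreal (T * k2) * rN N r"
                unfolding w_def using T k1 k2 by (simp add: distrib_left ennreal_mult mult.assoc)
              finally show ?thesis using True r by simp
            qed simp
          qed
        qed
        also have "(\<integral>\<^sup>+r. ennreal (T * k2) * (rN N r * indicator {0..T} r) \<partial>lborel) = ennreal (T * k2) * (\<integral>\<^sup>+s\<in>{0..T}. rN N s \<partial>lborel)"
          by (rule nn_integral_cmult) measurable
        finally show "(\<integral>\<^sup>+\<omega>. G i t \<omega> \<partial>M) \<le> ennreal (T * k2) * (\<integral>\<^sup>+s\<in>{0..T}. rN N s \<partial>lborel) + (\<integral>\<^sup>+s\<in>{0..t}. w * v s \<partial>lborel)"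
          by (simp add: add.commute)
      qed
    qed
    moreover have "v T = (SUP i\<in>{1..N}. \<integral>\<^sup>+\<omega>. (SUP t\<in>{0..T}. ennreal (\<bar>U i t \<omega> - X i t \<omega>\<bar>\<^sup>2)) \<partial>M)"
      unfolding v_def
    proof (rule SUP_cong[OF refl])
      fix i assume i: "i \<in> {1..N}"
      then have i1: "i \<ge> 1" by simp
      show "(\<integral>\<^sup>+\<omega>. G i T \<omega> \<partial>M) = (\<integral>\<^sup>+\<omega>. (SUP t\<in>{0..T}. ennreal (\<bar>U i t \<omega> - X i t \<omega>\<bar>\<^sup>2)) \<partial>M)"
      proof (rule nn_integral_cong_AE, use U'e[OF i] X'_eq[OF i1] in eventually_elim)
        case (elim \<omega>)
        then show ?case unfolding G_def by (intro SUP_cong refl) simp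
      qed
    qed
    ultimately show ?thesis by (simp add: mult.assoc)
  qed
  have "C * ennreal (T * k2) < \<infinity>" using C by (simp add: ennreal_mult_less_top)
  then show ?thesis using main by blast
qed

lemma particles_converge:
  assumes "\<And>N. N \<ge> 1 \<Longrightarrow> particle_solution M F W T \<sigma> x0 h f b N (U N) (V N)"
  shows "(\<lambda>N. SUP i\<in>{1..N}. \<integral>\<^sup>+\<omega>. (SUP t\<in>{0..T}. ennreal (\<bar>U N i t \<omega> - X i t \<omega>\<bar>\<^sup>2)) \<partial>M) \<longlonglongrightarrow> 0"
proof -
  obtain C where C: "C < \<infinity>" and le: "\<And>N U V. N \<ge> 1 \<Longrightarrow> particle_solution M F W T \<sigma> x0 h f b N U V \<Longrightarrow>
    (SUP i\<in>{1..N}. \<integral>\<^sup>+\<omega>. (SUP t\<in>{0..T}. ennreal (\<bar>U i t \<omega> - X i t \<omega>\<bar>\<^sup>2)) \<partial>M)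
      \<le> C * (\<integral>\<^sup>+s\<in>{0..T}. rN N s \<partial>lborel)"
    using particle_estimate by blast
  have lim: "(\<lambda>N. C * (\<integral>\<^sup>+s\<in>{0..T}. rN N s \<partial>lborel)) \<longlonglongrightarrow> 0"
    using ennreal_tendsto_cmult[OF _ rN_integral_converges, of C] C by simp
  show ?thesis
  proof (rule tendsto_sandwich[OF _ _ tendsto_const lim])
    show "\<forall>\<^sub>F N in sequentially. (SUP i\<in>{1..N}. \<integral>\<^sup>+\<omega>. (SUP t\<in>{0..T}. ennreal (\<bar>U N i t \<omega> - X i t \<omega>\<bar>\<^sup>2)) \<partial>M)
      \<le> C * (\<integral>\<^sup>+s\<in>{0..T}. rN N s \<partial>lborel)"
      using le assms by (intro eventually_sequentiallyI[of 1]) blast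
  qed simp
qed

end

theorem proposition3p3:
  fixes M :: "'a measure" and F :: "real \<Rightarrow> 'a measure"
    and W X Z :: "nat \<Rightarrow> real \<Rightarrow> 'a \<Rightarrow> real"
    and XN ZN :: "nat \<Rightarrow> nat \<Rightarrow> real \<Rightarrow> 'a \<Rightarrow> real"
    and T \<sigma> x0 :: real and h f :: "real \<Rightarrow> real" and b :: "real \<Rightarrow> real \<Rightarrow> real \<Rightarrow> real"
  assumes "T > 0" and "\<sigma> > 0"
    and "set_borel_measurable lborel {0..T} h"
    and "set_integrable lborel {0..T} (\<lambda>t. (h t)\<^sup>2)"
    and "\<exists>L. L-lipschitz_on UNIV f"
    and "\<And>x m. continuous_on {0..T} (\<lambda>t. b t x m)"
    and "\<exists>L. \<forall>t\<in>{0..T}. \<forall>m. L-lipschitz_on UNIV (\<lambda>x. b t x m)"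
    and "\<exists>L. \<forall>t\<in>{0..T}. \<forall>x. L-lipschitz_on UNIV (\<lambda>m. b t x m)"
    and "\<exists>K. \<forall>t\<in>{0..T}. \<forall>x m. \<bar>b t x m\<bar> \<le> K"
    and "filtered_prob_space M F"
    and "\<And>i. i \<ge> 1 \<Longrightarrow> brownian_motion M F (W i)"
    and "prob_space.indep_vars M (\<lambda>i. \<Pi>\<^sub>M t\<in>{0..}. borel) (\<lambda>i \<omega>. \<lambda>t\<in>{0..}. W i t \<omega>) {1..}"
    and "\<And>i. i \<ge> 1 \<Longrightarrow> mckean_vlasov_solution M F (W i) T \<sigma> x0 h f b (X i) (Z i)"
    and "\<And>N. N \<ge> 1 \<Longrightarrow> particle_solution M F W T \<sigma> x0 h f b N (XN N) (ZN N)"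
  shows "(\<lambda>N. SUP i\<in>{1..N}. \<integral>\<^sup>+\<omega>. (SUP t\<in>{0..T}. ennreal (\<bar>XN N i t \<omega> - X i t \<omega>\<bar>\<^sup>2)) \<partial>M)
           \<longlonglongrightarrow> 0"
proof -
  obtain Lf where Lf: "Lf-lipschitz_on UNIV f" using assms(5) by blast
  obtain Lx where Lx: "\<And>t m. t \<in> {0..T} \<Longrightarrow> Lx-lipschitz_on UNIV (\<lambda>x. b t x m)" using assms(7) by blast
  obtain Lm where Lm: "\<And>t x. t \<in> {0..T} \<Longrightarrow> Lm-lipschitz_on UNIV (\<lambda>m. b t x m)" using assms(8) by blast
  obtain K where K: "\<And>t x m. t \<in> {0..T} \<Longrightarrow> \<bar>b t x m\<bar> \<le> K" using assms(9) by blast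
  have T0: "0 \<in> {0..T}" using assms(1) by simp
  define L where "L = max Lx Lm"
  have L0: "0 \<le> L" using lipschitz_on_nonneg[OF Lx[OF T0]] unfolding L_def by simp
  have mv: "mckean_vlasov T K L b h M F W X Z \<sigma> x0 Lf f"
  proof (intro mckean_vlasov.intro drift.intro l2_function.intro mckean_vlasov_axioms.intro)
    show "0 \<le> T" "0 \<le> T" using assms(1) by auto
    show "0 \<le> L" by (rule L0)
    show "continuous_on {0..T} (\<lambda>t. b t x m)" for x m by (rule assms(6))
    show "\<bar>b t x m - b t y m\<bar> \<le> L * \<bar>x - y\<bar>" if "t \<in> {0..T}" for t x y m
    proof -
      have "\<bar>b t x m - b t y m\<bar> \<le> Lx * \<bar>x - y\<bar>" using lipschitz_onD[OF Lx[OF that], of x y m] by (simp add: dist_real_def)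
      also have "\<dots> \<le> L * \<bar>x - y\<bar>" unfolding L_def by (intro mult_right_mono) auto
      finally show ?thesis .
    qed
    show "\<bar>b t x m - b t x m'\<bar> \<le> L * \<bar>m - m'\<bar>" if "t \<in> {0..T}" for t x m m'
    proof -
      have "\<bar>b t x m - b t x m'\<bar> \<le> Lm * \<bar>m - m'\<bar>" using lipschitz_onD[OF Lm[OF that], of m m' x] by (simp add: dist_real_def)
      also have "\<dots> \<le> L * \<bar>m - m'\<bar>" unfolding L_def by (intro mult_right_mono) auto
      finally show ?thesis .
    qed
    show "\<bar>b t x m\<bar> \<le> K" if "t \<in> {0..T}" for t x m using K[OF that] .
    show "set_borel_measurable lborel {0..T} h" "set_integrable lborel {0..T} (\<lambda>t. (h t)\<^sup>2)" by fact+
    show "0 \<le> Lf" using Lf by (rule lipschitz_on_nonneg)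
    show "\<bar>f x - f y\<bar> \<le> Lf * \<bar>x - y\<bar>" for x y using lipschitz_onD[OF Lf, of x y] by (simp add: dist_real_def)
    show "brownian M F (W i)" if "i \<ge> 1" for i using assms(10) assms(11)[OF that] by (rule brownian.intro)
    show "prob_space.indep_vars M (\<lambda>i. \<Pi>\<^sub>M t\<in>{0..}. borel) (\<lambda>i \<omega>. path (W i) \<omega>) {1..}" by (rule assms(12))
    show "mckean_vlasov_solution M F (W i) T \<sigma> x0 h f b (X i) (Z i)" if "i \<ge> 1" for i by (rule assms(13)[OF that])
  qed
  obtain X' Z' where v: "\<forall>i\<ge>1. (\<forall>\<omega>. continuous_on UNIV (\<lambda>t. X' i t \<omega>)) \<and> (\<forall>\<omega>. continuous_on UNIV (\<lambda>t. Z' i t \<omega>))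
     \<and> (\<lambda>(s, \<omega>). X' i s \<omega>) \<in> borel_measurable (borel \<Otimes>\<^sub>M M) \<and> (\<lambda>(s, \<omega>). Z' i s \<omega>) \<in> borel_measurable (borel \<Otimes>\<^sub>M M)
     \<and> (AE \<omega> in M. \<forall>t\<in>{0..T}. X' i t \<omega> = X i t \<omega>) \<and> (AE \<omega> in M. \<forall>t\<in>{0..T}. Z' i t \<omega> = Z i t \<omega>)"
    using mckean_vlasov.continuous_versions[OF mv] by blast
  have "mckean_vlasov_continuous T K L b h M F W X Z \<sigma> x0 Lf f X' Z'"
    using v by (intro mckean_vlasov_continuous.intro mv mckean_vlasov_continuous_axioms.intro) blast+
  from mckean_vlasov_continuous.particles_converge[OF this assms(14)] show ?thesis .
qed

end
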